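(* (1) Suppose that for each $n$ the unitary matrix $U$ is the DFT matrix $F_{jk}=\frac{1}{\sqrt n}e^{-2\mathrm i\pi(j-1)(k-1)/n}$, $1\le j,k\le n$, or more generally that $|U_{ij}|^2=1/n$ almost surely for every $i,j\in\{1,\dots,n\}$. Then, as $n\to\infty$, $\mathcal Z^{(n)}\to B_0\otimes B_0$ in distribution in $D([0,1]^2)$. (2) Suppose that $U$ is Haar distributed on $\mathbb U(n)$ for each $n$ (with $\beta'=1$), or Haar distributed on $\mathbb O(n)$ for each $n$ (with $\beta'=1/2$). Then, as $n\to\infty$, the finite dimensional marginals of $\mathcal Z^{(n)}$ converge in distribution to those of $$\sqrt{\beta'^{-1}}\,W^{(\infty)}+B_0\otimes B_0,$$ where $B_0\otimes B_0$ and $W^{(\infty)}$ are independent, and moreover $$n^{-1/2}\mathcal Z^{(n)}\longrightarrow 0\quad\text{in probability in } D([0,1]^2).$$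
   Context: For each $n$, $U=(U_{ij})_{1\le i,j\le n}$ is a (possibly random) $n\times n$ unitary matrix. $R_1,\dots,R_n$ and $C_1,\dots,C_n$ are two independent families of independent random variables uniformly distributed on $[0,1]$, and $(R_i,C_j)_{i,j}$ is independent of $U$. Define $$\mathcal Z^{(n)}_{s,t}=\sum_{i,j=1}^n|U_{ij}|^2\left[\mathbf 1_{R_i\le s}-s\right]\left[\mathbf 1_{C_j\le t}-t\right],\qquad \mathcal Z^{(n)}=\left(\mathcal Z^{(n)}_{s,t},\ s,t\in[0,1]\right).$$ $W^{(\infty)}$ (tied-down bivariate Brownian bridge) is the centered Gaussian process with continuous paths on $[0,1]^2$ with covariance $\mathbb E[W^{(\infty)}(s,t)W^{(\infty)}(s',t')]=(s\wedge s'-ss')(t\wedge t'-tt')$. $B_0\otimes B_0$ denotes the process $(s,t)\mapsto B_0(s)B_0'(t)$, where $B_0$ and $B_0'$ are two independent standard Brownian bridges on $[0,1]$ (centered continuous Gaussian processes with covariance $s\wedge s'-ss'$). $D([0,1]^2)$ is the Skorokhod space of functions $[0,1]^2\to\mathbb R$ which at each point are right continuous (with respect to the natural partial order of $[0,1]^2$) and admit limits in all orthants, endowed with the (Bickel–Wichura) Skorokhod topology. *)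

theory Defs
  imports "HOL-Probability.Probability" "Jordan_Normal_Form.Schur_Decomposition"
begin

section \<open>The Skorokhod space on the unit square\<close>

definition unit_square :: "(real \<times> real) set" where
  "unit_square = {0..1} \<times> {0..1}"

text \<open>
  Functions on the unit square are represented by extensional functions. The four orthants at a
  point use the relations \<open><\<close> and \<open>\<ge>\<close> in each coordinate, as in Bickel and Wichura. Limits
  within an empty orthant hold trivially, which is the intended behaviour on the boundary.
\<close>

definition skorokhod_space :: "(real \<times> real \<Rightarrow> real) set" where
  "skorokhod_space = {x \<in> extensional unit_square. \<forall>p \<in> unit_square.
     (x \<longlongrightarrow> x p) (at p within {q \<in> unit_square. fst p \<le> fst q \<and> snd p \<le> snd q}) \<and>
     (\<forall>R \<in> {(<), (\<ge>)}. \<forall>S \<in> {(<), (\<ge>)}.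
        \<exists>l. (x \<longlongrightarrow> l) (at p within {q \<in> unit_square. R (fst q) (fst p) \<and> S (snd q) (snd p)}))}"

definition time_changes :: "(real \<Rightarrow> real) set" where
  "time_changes = {f. strict_mono_on {0..1} f \<and> continuous_on {0..1} f \<and> f 0 = 0 \<and> f 1 = 1}"

text \<open>
  The Bickel--Wichura distance: the infimum, over time changes acting separately on the two
  coordinates, of the larger of the size of the time change and the uniform distance after it.
  The value off the Skorokhod space is irrelevant; \<open>0\<close> is chosen because the locale
  \<^locale>\<open>Metric_space\<close> asks for nonnegativity and symmetry on the whole type.
\<close>

definition skorokhod_dist :: "(real \<times> real \<Rightarrow> real) \<Rightarrow> (real \<times> real \<Rightarrow> real) \<Rightarrow> real" where
  "skorokhod_dist x y =
     (if x \<in> skorokhod_space \<and> y \<in> skorokhod_space then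
        INF (f, g) \<in> time_changes \<times> time_changes.
          max (SUP (s, t) \<in> unit_square. max \<bar>f s - s\<bar> \<bar>g t - t\<bar>)
              (SUP (s, t) \<in> unit_square. \<bar>x (s, t) - y (f s, g t)\<bar>)
      else 0)"

definition skorokhod_topology :: "(real \<times> real \<Rightarrow> real) topology" where
  "skorokhod_topology = Metric_space.mtopology skorokhod_space skorokhod_dist"

text \<open>
  \<^const>\<open>skorokhod_dist\<close> is a metric on \<^const>\<open>skorokhod_space\<close>, so
  \<^const>\<open>skorokhod_topology\<close> is the induced metric topology.
\<close>

lemma skorokhod_space_bounded:
  assumes "x \<in> skorokhod_space"
  obtains K where "\<And>p. p \<in> unit_square \<Longrightarrow> \<bar>x p\<bar> \<le> K"
proof -
  have loc: "\<exists>e>0. \<exists>K. \<forall>q \<in> unit_square \<inter> ball p e. \<bar>x q\<bar> \<le> K" if p: "p \<in> unit_square" for p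
  proof -
    let ?S = "\<lambda>R S. {q \<in> unit_square. R (fst q) (fst p) \<and> S (snd q) (snd p)}"
    have quad: "\<exists>e>0. \<exists>K. \<forall>q \<in> ?S R S. q \<noteq> p \<and> dist q p < e \<longrightarrow> \<bar>x q\<bar> \<le> K"
      if RS: "R \<in> {(<), (\<ge>)}" "S \<in> {(<), (\<ge>)}" for R S :: "real \<Rightarrow> real \<Rightarrow> bool"
    proof -
      have "\<forall>R \<in> {(<), (\<ge>)}. \<forall>S \<in> {(<), (\<ge>)}. \<exists>l. (x \<longlongrightarrow> l) (at p within ?S R S)"
        using assms p unfolding skorokhod_space_def mem_Collect_eq by (elim conjE) (drule (1) bspec, elim conjE)
      then obtain l where l: "(x \<longlongrightarrow> l) (at p within ?S R S)"
        using RS by (meson bspec)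
      then have "\<forall>\<^sub>F q in at p within ?S R S. dist (x q) l < 1"
        by (rule tendstoD) simp
      then obtain e where "e > 0" "\<forall>q \<in> ?S R S. q \<noteq> p \<and> dist q p < e \<longrightarrow> dist (x q) l < 1"
        unfolding eventually_at by blast
      moreover have "dist (x q) l < 1 \<Longrightarrow> \<bar>x q\<bar> \<le> \<bar>l\<bar> + 1" for q
        unfolding dist_real_def by linarith
      ultimately show ?thesis by blast
    qed
    obtain e1 K1 where 1: "e1 > 0" "\<forall>q \<in> ?S (<) (<). q \<noteq> p \<and> dist q p < e1 \<longrightarrow> \<bar>x q\<bar> \<le> K1"
      using quad[of "(<)" "(<)"] by auto
    obtain e2 K2 where 2: "e2 > 0" "\<forall>q \<in> ?S (<) (\<ge>). q \<noteq> p \<and> dist q p < e2 \<longrightarrow> \<bar>x q\<bar> \<le> K2"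
      using quad[of "(<)" "(\<ge>)"] by auto
    obtain e3 K3 where 3: "e3 > 0" "\<forall>q \<in> ?S (\<ge>) (<). q \<noteq> p \<and> dist q p < e3 \<longrightarrow> \<bar>x q\<bar> \<le> K3"
      using quad[of "(\<ge>)" "(<)"] by auto
    obtain e4 K4 where 4: "e4 > 0" "\<forall>q \<in> ?S (\<ge>) (\<ge>). q \<noteq> p \<and> dist q p < e4 \<longrightarrow> \<bar>x q\<bar> \<le> K4"
      using quad[of "(\<ge>)" "(\<ge>)"] by auto
    define e where "e = min (min e1 e2) (min e3 e4)"
    define K where "K = \<bar>x p\<bar> + \<bar>K1\<bar> + \<bar>K2\<bar> + \<bar>K3\<bar> + \<bar>K4\<bar>"
    have "\<bar>x q\<bar> \<le> K" if q: "q \<in> unit_square" "dist q p < e" for q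
    proof (cases "q = p")
      case True then show ?thesis by (simp add: K_def)
    next
      case False
      consider "fst q < fst p" "snd q < snd p" | "fst q < fst p" "snd q \<ge> snd p"
        | "fst q \<ge> fst p" "snd q < snd p" | "fst q \<ge> fst p" "snd q \<ge> snd p"
        by linarith
      then have "\<bar>x q\<bar> \<le> K1 \<or> \<bar>x q\<bar> \<le> K2 \<or> \<bar>x q\<bar> \<le> K3 \<or> \<bar>x q\<bar> \<le> K4"
        using False q 1(2) 2(2) 3(2) 4(2) by cases (simp_all add: e_def del: split_paired_All)
      then show ?thesis unfolding K_def by linarith
    qed
    moreover have "e > 0" using 1 2 3 4 by (simp add: e_def)
    ultimately show ?thesis by (metis Int_iff dist_commute mem_ball)
  qed
  then obtain e K where eK: "\<And>p. p \<in> unit_square \<Longrightarrow> e p > 0"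
    "\<And>p q. p \<in> unit_square \<Longrightarrow> q \<in> unit_square \<inter> ball p (e p) \<Longrightarrow> \<bar>x q\<bar> \<le> K p"
    by metis
  have "compact unit_square" unfolding unit_square_def by (intro compact_Times compact_Icc)
  then obtain T where T: "T \<subseteq> unit_square" "finite T" "unit_square \<subseteq> (\<Union>p\<in>T. ball p (e p))"
    by (rule compactE_image[where C=unit_square and f="\<lambda>p. ball p (e p)"]) (use eK(1) in auto)
  have "\<bar>x q\<bar> \<le> (\<Sum>p\<in>T. \<bar>K p\<bar>)" if q: "q \<in> unit_square" for q
  proof -
    obtain p where p: "p \<in> T" "q \<in> ball p (e p)" using T q by blast
    have "\<bar>x q\<bar> \<le> \<bar>K p\<bar>" using eK(2)[of p q] p q T by fastforce
    also have "\<dots> \<le> (\<Sum>p\<in>T. \<bar>K p\<bar>)" using p T by (intro member_le_sum) auto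
    finally show ?thesis .
  qed
  then show ?thesis using that by blast
qed

lemma time_changes_bij:
  assumes "f \<in> time_changes"
  shows "bij_betw f {0..1} {0..1}"
proof -
  have sm: "strict_mono_on {0..1} f" and c: "continuous_on {0..1} f" and e: "f 0 = 0" "f 1 = 1"
    using assms by (auto simp: time_changes_def)
  have "f ` {0..1} = {0..1}"
  proof
    have "0 \<le> f t \<and> f t \<le> 1" if "t \<in> {0..1}" for t
      using strict_mono_on_leD[OF sm, of 0 t] strict_mono_on_leD[OF sm, of t 1] that e by auto
    then show "f ` {0..1} \<subseteq> {0..1}" by auto
    show "{0..1} \<subseteq> f ` {0..1}"
    proof
      fix y :: real assume "y \<in> {0..1}"
      then obtain t where "0 \<le> t" "t \<le> 1" "f t = y"
        using IVT'[of f 0 y 1] c e by auto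
      then show "y \<in> f ` {0..1}" by force
    qed
  qed
  then show ?thesis using strict_mono_on_imp_inj_on[OF sm] by (simp add: bij_betw_def)
qed

lemma time_changes_mem: "f \<in> time_changes \<Longrightarrow> t \<in> {0..1} \<Longrightarrow> f t \<in> {0..1}"
  using time_changes_bij bij_betwE by blast

lemma time_changes_id: "(\<lambda>t. t) \<in> time_changes"
  by (auto simp: time_changes_def strict_mono_on_def)

lemma time_changes_comp:
  assumes "f \<in> time_changes" "g \<in> time_changes"
  shows "(\<lambda>t. g (f t)) \<in> time_changes"
proof -
  have "continuous_on {0..1} (\<lambda>t. g (f t))"
    by (rule continuous_on_compose2[of "{0..1}" g])
       (use assms time_changes_mem in \<open>auto simp: time_changes_def\<close>)
  moreover have "strict_mono_on {0..1} (\<lambda>t. g (f t))"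
    using assms time_changes_mem[OF assms(1)] by (auto simp: time_changes_def strict_mono_on_def)
  ultimately show ?thesis using assms by (auto simp: time_changes_def)
qed

lemma time_changes_inv:
  assumes f: "f \<in> time_changes"
  shows "\<exists>g\<in>time_changes. \<forall>t\<in>{0..1}. f (g t) = t"
proof -
  define g where "g = the_inv_into {0..1} f"
  have inj: "inj_on f {0..1}" and im: "f ` {0..1} = {0..1}"
    using time_changes_bij[OF f] by (auto simp: bij_betw_def)
  have fg: "f (g t) = t" if "t \<in> {0..1}" for t
    unfolding g_def using f_the_inv_into_f[OF inj] im that by auto
  have gf: "g (f t) = t" if "t \<in> {0..1}" for t
    unfolding g_def using the_inv_into_f_f[OF inj] that by auto
  have gm: "g t \<in> {0..1}" if "t \<in> {0..1}" for t
    unfolding g_def using the_inv_into_into[OF inj, of t "{0..1}"] im that by auto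
  have "continuous_on {0..1} g"
    using continuous_on_inv_into[of "{0..1}" f] f inj im by (auto simp: time_changes_def g_def)
  moreover have "strict_mono_on {0..1} g"
  proof (rule strict_mono_onI)
    fix r s :: real assume rs: "r \<in> {0..1}" "s \<in> {0..1}" "r < s"
    have sm: "strict_mono_on {0..1} f" using f by (simp add: time_changes_def)
    show "g r < g s"
    proof (rule ccontr)
      assume "\<not> g r < g s"
      then have "f (g s) \<le> f (g r)" using strict_mono_on_leD[OF sm, of "g s" "g r"] gm rs by auto
      then show False using fg rs by auto
    qed
  qed
  moreover have "g 0 = 0" "g 1 = 1" using gf[of 0] gf[of 1] f by (auto simp: time_changes_def)
  ultimately have "g \<in> time_changes" by (simp add: time_changes_def)
  then show ?thesis using fg by blast
qed

lemma skorokhod_dist_le: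
  assumes xy: "x \<in> skorokhod_space" "y \<in> skorokhod_space"
    and "f \<in> time_changes" "g \<in> time_changes"
    and "\<And>t. t \<in> {0..1} \<Longrightarrow> \<bar>f t - t\<bar> \<le> r" "\<And>t. t \<in> {0..1} \<Longrightarrow> \<bar>g t - t\<bar> \<le> r"
    and "\<And>s t. s \<in> {0..1} \<Longrightarrow> t \<in> {0..1} \<Longrightarrow> \<bar>x (s, t) - y (f s, g t)\<bar> \<le> r"
  shows "skorokhod_dist x y \<le> r"
proof -
  let ?F = "\<lambda>(f, g). max (SUP (s, t) \<in> unit_square. max \<bar>f s - s\<bar> \<bar>g t - t\<bar>)
            (SUP (s, t) \<in> unit_square. \<bar>x (s, t) - y (f s, g t)\<bar>)"
  have eq: "skorokhod_dist x y = Inf (?F ` (time_changes \<times> time_changes))"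
    using assms(1,2) by (simp add: skorokhod_dist_def)
  have ne: "unit_square \<noteq> {}" by (auto simp: unit_square_def)
  have nn: "0 \<le> ?F (f, g)" if "f \<in> time_changes" "g \<in> time_changes" for f g
  proof -
    have "bdd_above ((\<lambda>(s, t). max \<bar>f s - s\<bar> \<bar>g t - t\<bar>) ` unit_square)"
    proof (rule bdd_aboveI2[where M=1])
      fix p :: "real \<times> real" assume "p \<in> unit_square"
      then show "(case p of (s, t) \<Rightarrow> max \<bar>f s - s\<bar> \<bar>g t - t\<bar>) \<le> 1"
        using time_changes_mem[OF that(1), of "fst p"] time_changes_mem[OF that(2), of "snd p"]
        by (auto simp: unit_square_def split: prod.splits)
    qed
    moreover have "(0, 0) \<in> unit_square" by (auto simp: unit_square_def)
    ultimately have "(case (0, 0) of (s, t) \<Rightarrow> max \<bar>f s - s\<bar> \<bar>g t - t\<bar>)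
        \<le> (SUP (s, t) \<in> unit_square. max \<bar>f s - s\<bar> \<bar>g t - t\<bar>)"
      by (rule cSUP_upper2[OF _ _ order_refl])
    then show ?thesis by auto
  qed
  have "bdd_below (?F ` (time_changes \<times> time_changes))"
    by (rule bdd_belowI2[where m=0]) (use nn in auto)
  then have "skorokhod_dist x y \<le> ?F (f, g)"
    unfolding eq using assms(3,4) by (rule cINF_lower[OF _ SigmaI])
  also have "\<dots> \<le> r"
    using assms ne by (auto intro!: cSUP_least simp: unit_square_def)
  finally show ?thesis .
qed

lemma skorokhod_dist_less:
  assumes "x \<in> skorokhod_space" "y \<in> skorokhod_space" "skorokhod_dist x y < r"
  obtains f g where "f \<in> time_changes" "g \<in> time_changes"
    "\<And>t. t \<in> {0..1} \<Longrightarrow> \<bar>f t - t\<bar> < r" "\<And>t. t \<in> {0..1} \<Longrightarrow> \<bar>g t - t\<bar> < r"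
    "\<And>s t. s \<in> {0..1} \<Longrightarrow> t \<in> {0..1} \<Longrightarrow> \<bar>x (s, t) - y (f s, g t)\<bar> < r"
proof -
  let ?F = "\<lambda>(f, g). max (SUP (s, t) \<in> unit_square. max \<bar>f s - s\<bar> \<bar>g t - t\<bar>)
            (SUP (s, t) \<in> unit_square. \<bar>x (s, t) - y (f s, g t)\<bar>)"
  have eq: "skorokhod_dist x y = Inf (?F ` (time_changes \<times> time_changes))"
    using assms(1,2) by (simp add: skorokhod_dist_def)
  have "?F ` (time_changes \<times> time_changes) \<noteq> {}" using time_changes_id by auto
  then obtain z where "z \<in> ?F ` (time_changes \<times> time_changes)" "z < r"
    using assms(3) cInf_lessD[of "?F ` (time_changes \<times> time_changes)" r] unfolding eq by blast
  then obtain f g where fg: "f \<in> time_changes" "g \<in> time_changes" "?F (f, g) < r" by auto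
  obtain K where K: "\<And>p. p \<in> unit_square \<Longrightarrow> \<bar>x p\<bar> \<le> K" using skorokhod_space_bounded[OF assms(1)] by blast
  obtain L where L: "\<And>p. p \<in> unit_square \<Longrightarrow> \<bar>y p\<bar> \<le> L" using skorokhod_space_bounded[OF assms(2)] by blast
  have m: "f s \<in> {0..1}" "g s \<in> {0..1}" if "s \<in> {0..1}" for s
    using fg time_changes_mem that by auto
  have b1: "bdd_above ((\<lambda>(s, t). max \<bar>f s - s\<bar> \<bar>g t - t\<bar>) ` unit_square)"
  proof (rule bdd_aboveI2[where M=1])
    fix p :: "real \<times> real" assume "p \<in> unit_square"
    then show "(case p of (s, t) \<Rightarrow> max \<bar>f s - s\<bar> \<bar>g t - t\<bar>) \<le> 1"
      using m[of "fst p"] m[of "snd p"] by (auto simp: unit_square_def split: prod.splits)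
  qed
  have b2: "bdd_above ((\<lambda>(s, t). \<bar>x (s, t) - y (f s, g t)\<bar>) ` unit_square)"
  proof (rule bdd_aboveI2[where M="K + L"])
    fix p :: "real \<times> real" assume p: "p \<in> unit_square"
    have "(f (fst p), g (snd p)) \<in> unit_square"
      using m[of "fst p"] m[of "snd p"] p by (auto simp: unit_square_def)
    then show "(case p of (s, t) \<Rightarrow> \<bar>x (s, t) - y (f s, g t)\<bar>) \<le> K + L"
      using K[OF p] L[of "(f (fst p), g (snd p))"] by (auto split: prod.splits)
  qed
  have u1: "max \<bar>f s - s\<bar> \<bar>g t - t\<bar> < r" and u2: "\<bar>x (s, t) - y (f s, g t)\<bar> < r"
    if "s \<in> {0..1}" "t \<in> {0..1}" for s t
    using cSUP_upper[OF _ b1, of "(s, t)"] cSUP_upper[OF _ b2, of "(s, t)"] fg(3) that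
    by (auto simp: unit_square_def)
  show ?thesis
  proof (rule that[of f g])
    show "\<bar>f t - t\<bar> < r" "\<bar>g t - t\<bar> < r" if "t \<in> {0..1}" for t using u1[of t t] that by auto
  qed (use fg u2 in auto)
qed

lemma skorokhod_dist_nonneg:
  assumes "x \<in> skorokhod_space" "y \<in> skorokhod_space"
  shows "0 \<le> skorokhod_dist x y"
proof (rule ccontr)
  assume "\<not> 0 \<le> skorokhod_dist x y"
  then have "skorokhod_dist x y < 0" by simp
  then obtain f :: "real \<Rightarrow> real" where "\<And>t. t \<in> {0..1} \<Longrightarrow> \<bar>f t - t\<bar> < 0"
    using skorokhod_dist_less[OF assms] by metis
  from this[of 0] show False by auto
qed

lemma skorokhod_dist_commute_le:
  assumes "x \<in> skorokhod_space" "y \<in> skorokhod_space"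
  shows "skorokhod_dist y x \<le> skorokhod_dist x y"
proof (rule field_le_epsilon)
  fix e :: real assume "e > 0"
  then have "skorokhod_dist x y < skorokhod_dist x y + e" by simp
  then obtain f g where fg: "f \<in> time_changes" "g \<in> time_changes"
    "\<And>t. t \<in> {0..1} \<Longrightarrow> \<bar>f t - t\<bar> < skorokhod_dist x y + e"
    "\<And>t. t \<in> {0..1} \<Longrightarrow> \<bar>g t - t\<bar> < skorokhod_dist x y + e"
    "\<And>s t. s \<in> {0..1} \<Longrightarrow> t \<in> {0..1} \<Longrightarrow> \<bar>x (s, t) - y (f s, g t)\<bar> < skorokhod_dist x y + e"
    using skorokhod_dist_less[OF assms] by blast
  obtain f' where f': "f' \<in> time_changes" "\<And>t. t \<in> {0..1} \<Longrightarrow> f (f' t) = t"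
    using time_changes_inv[OF fg(1)] by blast
  obtain g' where g': "g' \<in> time_changes" "\<And>t. t \<in> {0..1} \<Longrightarrow> g (g' t) = t"
    using time_changes_inv[OF fg(2)] by blast
  note mf = time_changes_mem[OF f'(1)] and mg = time_changes_mem[OF g'(1)]
  show "skorokhod_dist y x \<le> skorokhod_dist x y + e"
  proof (rule skorokhod_dist_le[OF assms(2,1) f'(1) g'(1)])
    fix t :: real assume t: "t \<in> {0..1}"
    show "\<bar>f' t - t\<bar> \<le> skorokhod_dist x y + e"
      using fg(3)[OF mf[OF t]] unfolding f'(2)[OF t] by linarith
    show "\<bar>g' t - t\<bar> \<le> skorokhod_dist x y + e"
      using fg(4)[OF mg[OF t]] unfolding g'(2)[OF t] by linarith
  next
    fix s t :: real assume st: "s \<in> {0..1}" "t \<in> {0..1}"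
    show "\<bar>y (s, t) - x (f' s, g' t)\<bar> \<le> skorokhod_dist x y + e"
      using fg(5)[OF mf[OF st(1)] mg[OF st(2)]] unfolding f'(2)[OF st(1)] g'(2)[OF st(2)] by linarith
  qed
qed

lemma skorokhod_dist_triangle:
  assumes "x \<in> skorokhod_space" "y \<in> skorokhod_space" "z \<in> skorokhod_space"
  shows "skorokhod_dist x z \<le> skorokhod_dist x y + skorokhod_dist y z"
proof (rule field_le_epsilon)
  fix e :: real assume "e > 0"
  define a b where "a = skorokhod_dist x y + e / 2" and "b = skorokhod_dist y z + e / 2"
  have "skorokhod_dist x y < a" "skorokhod_dist y z < b" using \<open>e > 0\<close> by (auto simp: a_def b_def)
  obtain f g where fg: "f \<in> time_changes" "g \<in> time_changes"
    "\<And>t. t \<in> {0..1} \<Longrightarrow> \<bar>f t - t\<bar> < a" "\<And>t. t \<in> {0..1} \<Longrightarrow> \<bar>g t - t\<bar> < a"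
    "\<And>s t. s \<in> {0..1} \<Longrightarrow> t \<in> {0..1} \<Longrightarrow> \<bar>x (s, t) - y (f s, g t)\<bar> < a"
    using skorokhod_dist_less[OF assms(1,2) \<open>skorokhod_dist x y < a\<close>] by blast
  obtain h k where hk: "h \<in> time_changes" "k \<in> time_changes"
    "\<And>t. t \<in> {0..1} \<Longrightarrow> \<bar>h t - t\<bar> < b" "\<And>t. t \<in> {0..1} \<Longrightarrow> \<bar>k t - t\<bar> < b"
    "\<And>s t. s \<in> {0..1} \<Longrightarrow> t \<in> {0..1} \<Longrightarrow> \<bar>y (s, t) - z (h s, k t)\<bar> < b"
    using skorokhod_dist_less[OF assms(2,3) \<open>skorokhod_dist y z < b\<close>] by blast
  note mf = time_changes_mem[OF fg(1)] and mg = time_changes_mem[OF fg(2)]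
  have "skorokhod_dist x z \<le> a + b"
  proof (rule skorokhod_dist_le[OF assms(1,3) time_changes_comp[OF fg(1) hk(1)] time_changes_comp[OF fg(2) hk(2)]])
    fix t :: real assume t: "t \<in> {0..1}"
    show "\<bar>h (f t) - t\<bar> \<le> a + b" using fg(3)[OF t] hk(3)[OF mf[OF t]] by linarith
    show "\<bar>k (g t) - t\<bar> \<le> a + b" using fg(4)[OF t] hk(4)[OF mg[OF t]] by linarith
  next
    fix s t :: real assume st: "s \<in> {0..1}" "t \<in> {0..1}"
    show "\<bar>x (s, t) - z (h (f s), k (g t))\<bar> \<le> a + b"
      using fg(5)[OF st] hk(5)[OF mf[OF st(1)] mg[OF st(2)]] by linarith
  qed
  then show "skorokhod_dist x z \<le> skorokhod_dist x y + skorokhod_dist y z + e"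
    by (simp add: a_def b_def)
qed

lemma skorokhod_dist_zero:
  assumes x: "x \<in> skorokhod_space" and y: "y \<in> skorokhod_space" and 0: "skorokhod_dist x y = 0"
  shows "x = y"
proof (rule extensionalityI)
  show "x \<in> extensional unit_square" "y \<in> extensional unit_square"
    using x y by (auto simp: skorokhod_space_def)
  fix p assume p: "p \<in> unit_square"
  obtain s t where st: "p = (s, t)" "s \<in> {0..1}" "t \<in> {0..1}" using p by (auto simp: unit_square_def)
  let ?Q = "{q \<in> unit_square. fst p \<le> fst q \<and> snd p \<le> snd q}"
  have near: "\<exists>r>0. \<forall>q \<in> ?Q. dist q p < r \<longrightarrow> \<bar>z q - z p\<bar> < e"
    if "z \<in> skorokhod_space" "e > 0" for z and e :: real
  proof -
    have "(z \<longlongrightarrow> z p) (at p within ?Q)" using that p by (auto simp: skorokhod_space_def)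
    then have "\<forall>\<^sub>F q in at p within ?Q. dist (z q) (z p) < e" using that(2) by (rule tendstoD)
    then obtain r where r: "r > 0" "\<forall>q \<in> ?Q. q \<noteq> p \<and> dist q p < r \<longrightarrow> dist (z q) (z p) < e"
      unfolding eventually_at by blast
    have "\<bar>z q - z p\<bar> < e" if "q \<in> ?Q" "dist q p < r" for q
      using r(2) that \<open>e > 0\<close> by (cases "q = p") (auto simp: dist_real_def simp del: split_paired_All)
    with r(1) show ?thesis by blast
  qed
  have "\<bar>x p - y p\<bar> \<le> e" if "e > 0" for e :: real
  proof -
    have "e / 3 > 0" using that by simp
    then obtain r1 where r1: "r1 > 0" "\<forall>q \<in> ?Q. dist q p < r1 \<longrightarrow> \<bar>x q - x p\<bar> < e / 3"
      using near[OF x] by blast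
    obtain r2 where r2: "r2 > 0" "\<forall>q \<in> ?Q. dist q p < r2 \<longrightarrow> \<bar>y q - y p\<bar> < e / 3"
      using near[OF y \<open>e / 3 > 0\<close>] by blast
    define r where "r = min r1 r2"
    have r: "r > 0" using r1 r2 by (simp add: r_def)
    \<comment> \<open>move strictly to the right, except at the right end of the interval, which is fixed\<close>
    have step: "\<exists>s'. \<exists>d>0. s' \<in> {0..1} \<and> s \<le> s' \<and> s' < s + r / 2 \<and>
        (\<forall>f\<in>time_changes. \<bar>f s' - s'\<bar> < d \<longrightarrow> s \<le> f s' \<and> f s' < s + r / 2)"
      if s: "s \<in> {0..1}" for s :: real
    proof (cases "s = 1")
      case True
      then show ?thesis using r by (intro exI[of _ 1]) (auto simp: time_changes_def)
    next
      case False
      define s' where "s' = min 1 (s + r / 4)"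
      have "s < s'" "s' < s + r / 2" "s' \<in> {0..1}" using False s r by (auto simp: s'_def)
      then show ?thesis
        by (intro exI[of _ s'] exI[of _ "min (s' - s) (s + r / 2 - s')"]) auto
    qed
    obtain s' d where s': "d > 0" "s' \<in> {0..1}" "s \<le> s'" "s' < s + r / 2"
      "\<And>f. f \<in> time_changes \<Longrightarrow> \<bar>f s' - s'\<bar> < d \<Longrightarrow> s \<le> f s' \<and> f s' < s + r / 2"
      using step[OF st(2)] by blast
    obtain t' d' where t': "d' > 0" "t' \<in> {0..1}" "t \<le> t'" "t' < t + r / 2"
      "\<And>f. f \<in> time_changes \<Longrightarrow> \<bar>f t' - t'\<bar> < d' \<Longrightarrow> t \<le> f t' \<and> f t' < t + r / 2"
      using step[OF st(3)] by blast
    define m where "m = min (e / 3) (min d d')"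
    have "skorokhod_dist x y < m" using 0 s' t' \<open>e / 3 > 0\<close> by (simp add: m_def)
    then obtain f g where fg: "f \<in> time_changes" "g \<in> time_changes"
      "\<And>t. t \<in> {0..1} \<Longrightarrow> \<bar>f t - t\<bar> < m" "\<And>t. t \<in> {0..1} \<Longrightarrow> \<bar>g t - t\<bar> < m"
      "\<And>s t. s \<in> {0..1} \<Longrightarrow> t \<in> {0..1} \<Longrightarrow> \<bar>x (s, t) - y (f s, g t)\<bar> < m"
      using skorokhod_dist_less[OF x y] by blast
    have near_p: "dist (a, b) p < r" if "s \<le> a" "a < s + r / 2" "t \<le> b" "b < t + r / 2" for a b
    proof -
      have "dist (a, b) p \<le> dist a s + dist b t"
        unfolding st(1) dist_Pair_Pair by (rule sqrt_sum_squares_le_sum) auto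
      then show ?thesis using that by (auto simp: dist_real_def)
    qed
    have f1: "s \<le> f s'" "f s' < s + r / 2" using s'(5)[OF fg(1)] fg(3)[OF s'(2)] by (auto simp: m_def)
    have g1: "t \<le> g t'" "g t' < t + r / 2" using t'(5)[OF fg(2)] fg(4)[OF t'(2)] by (auto simp: m_def)
    have "(s', t') \<in> ?Q" using s' t' st by (auto simp: unit_square_def)
    then have "\<bar>x (s', t') - x p\<bar> < e / 3"
      using r1(2) near_p[OF s'(3,4) t'(3,4)] by (auto simp: r_def)
    moreover have "(f s', g t') \<in> ?Q"
      using f1 g1 st time_changes_mem[OF fg(1) s'(2)] time_changes_mem[OF fg(2) t'(2)]
      by (auto simp: unit_square_def)
    then have "\<bar>y (f s', g t') - y p\<bar> < e / 3"
      using r2(2) near_p[OF f1 g1] by (auto simp: r_def)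
    moreover have "\<bar>x (s', t') - y (f s', g t')\<bar> < e / 3" using fg(5)[OF s'(2) t'(2)] by (simp add: m_def)
    ultimately show ?thesis by linarith
  qed
  then show "x p = y p" using field_le_epsilon[of "\<bar>x p - y p\<bar>" 0] by auto
qed

lemma Metric_space_skorokhod: "Metric_space skorokhod_space skorokhod_dist"
proof
  fix x y z
  show "0 \<le> skorokhod_dist x y"
    using skorokhod_dist_nonneg[of x y] by (cases "x \<in> skorokhod_space \<and> y \<in> skorokhod_space")
      (auto simp: skorokhod_dist_def)
  show "skorokhod_dist x y = skorokhod_dist y x"
  proof (cases "x \<in> skorokhod_space \<and> y \<in> skorokhod_space")
    case True
    then show ?thesis using skorokhod_dist_commute_le[of x y] skorokhod_dist_commute_le[of y x] by force
  next
    case False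
    then show ?thesis by (simp only: skorokhod_dist_def) auto
  qed
  assume xy: "x \<in> skorokhod_space" "y \<in> skorokhod_space"
  show "skorokhod_dist x y = 0 \<longleftrightarrow> x = y"
  proof
    assume "x = y"
    have "skorokhod_dist x x \<le> 0"
      by (rule skorokhod_dist_le[OF xy(1) xy(1) time_changes_id time_changes_id]) auto
    then show "skorokhod_dist x y = 0" using skorokhod_dist_nonneg[OF xy] \<open>x = y\<close> by auto
  qed (use skorokhod_dist_zero xy in auto)
  assume "z \<in> skorokhod_space"
  then show "skorokhod_dist x z \<le> skorokhod_dist x y + skorokhod_dist y z"
    using skorokhod_dist_triangle xy by blast
qed


section \<open>Modes of convergence\<close>

definition borel_of :: "'x topology \<Rightarrow> 'x measure" where
  "borel_of T = sigma (topspace T) {V. openin T V}"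

text \<open>
  The \<open>n\<close>-th variable \<open>X n\<close> lives on its own probability space \<open>M n\<close>, the limit \<open>Y\<close> on \<open>N\<close>.
\<close>

definition converges_in_distribution ::
    "'x topology \<Rightarrow> (nat \<Rightarrow> 'a measure) \<Rightarrow> (nat \<Rightarrow> 'a \<Rightarrow> 'x) \<Rightarrow> 'b measure \<Rightarrow> ('b \<Rightarrow> 'x) \<Rightarrow> bool" where
  "converges_in_distribution T M X N Y \<longleftrightarrow>
     (\<forall>n. X n \<in> M n \<rightarrow>\<^sub>M borel_of T) \<and> Y \<in> N \<rightarrow>\<^sub>M borel_of T \<and>
     (\<forall>h :: 'x \<Rightarrow> real. continuous_map T euclideanreal h \<and> bounded (h ` topspace T) \<longrightarrow>
        (\<lambda>n. \<integral>\<omega>. h (X n \<omega>) \<partial>M n) \<longlonglongrightarrow> (\<integral>\<omega>. h (Y \<omega>) \<partial>N))"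

definition fdd_converges ::
    "'i set \<Rightarrow> (nat \<Rightarrow> 'a measure) \<Rightarrow> (nat \<Rightarrow> 'a \<Rightarrow> 'i \<Rightarrow> real) \<Rightarrow> 'b measure \<Rightarrow> ('b \<Rightarrow> 'i \<Rightarrow> real) \<Rightarrow> bool" where
  "fdd_converges I M X N Y \<longleftrightarrow>
     (\<forall>J. finite J \<and> J \<subseteq> I \<longrightarrow>
        converges_in_distribution (product_topology (\<lambda>_. euclideanreal) J)
          M (\<lambda>n \<omega>. restrict (X n \<omega>) J) N (\<lambda>\<omega>. restrict (Y \<omega>) J))"

definition skorokhod_converges_in_probability ::
    "(nat \<Rightarrow> 'a measure) \<Rightarrow> (nat \<Rightarrow> 'a \<Rightarrow> real \<times> real \<Rightarrow> real) \<Rightarrow> (real \<times> real \<Rightarrow> real) \<Rightarrow> bool" where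
  "skorokhod_converges_in_probability M X x \<longleftrightarrow>
     x \<in> skorokhod_space \<and>
     (\<forall>n. X n \<in> M n \<rightarrow>\<^sub>M borel_of skorokhod_topology) \<and>
     (\<forall>\<epsilon>>0. (\<lambda>n. measure (M n) {\<omega> \<in> space (M n). \<epsilon> < skorokhod_dist (X n \<omega>) x}) \<longlonglongrightarrow> 0)"


section \<open>Gaussian processes\<close>

text \<open>Possibly degenerate normal laws on the line.\<close>

definition normal_law :: "real measure \<Rightarrow> bool" where
  "normal_law \<mu> \<longleftrightarrow>
     (\<exists>m \<sigma>. 0 < \<sigma> \<and> \<mu> = density lborel (normal_density m \<sigma>)) \<or> (\<exists>m. \<mu> = return borel m)"

definition centered_gaussian_process ::
    "'b measure \<Rightarrow> 'i set \<Rightarrow> ('i \<Rightarrow> 'b \<Rightarrow> real) \<Rightarrow> ('i \<Rightarrow> 'i \<Rightarrow> real) \<Rightarrow> bool" where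
  "centered_gaussian_process N I X K \<longleftrightarrow>
     prob_space N \<and>
     (\<forall>i\<in>I. X i \<in> borel_measurable N) \<and>
     (\<forall>J c. finite J \<and> J \<subseteq> I \<longrightarrow> normal_law (distr N borel (\<lambda>\<omega>. \<Sum>i\<in>J. c i * X i \<omega>))) \<and>
     (\<forall>i\<in>I. (\<integral>\<omega>. X i \<omega> \<partial>N) = 0) \<and>
     (\<forall>i\<in>I. \<forall>j\<in>I. (\<integral>\<omega>. X i \<omega> * X j \<omega> \<partial>N) = K i j)"

definition brownian_bridge :: "'b measure \<Rightarrow> (real \<Rightarrow> 'b \<Rightarrow> real) \<Rightarrow> bool" where
  "brownian_bridge N B \<longleftrightarrow>
     centered_gaussian_process N {0..1} B (\<lambda>s s'. min s s' - s * s') \<and>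
     (\<forall>\<omega>\<in>space N. continuous_on {0..1} (\<lambda>s. B s \<omega>))"

definition tied_down_bridge :: "'b measure \<Rightarrow> (real \<times> real \<Rightarrow> 'b \<Rightarrow> real) \<Rightarrow> bool" where
  "tied_down_bridge N W \<longleftrightarrow>
     centered_gaussian_process N unit_square W
       (\<lambda>(s, t) (s', t'). (min s s' - s * s') * (min t t' - t * t')) \<and>
     (\<forall>\<omega>\<in>space N. continuous_on unit_square (\<lambda>p. W p \<omega>))"

definition indep_processes ::
    "'b measure \<Rightarrow> 'i set \<Rightarrow> ('i \<Rightarrow> 'b \<Rightarrow> real) \<Rightarrow> ('i \<Rightarrow> 'b \<Rightarrow> real) \<Rightarrow> bool" where
  "indep_processes N I X Y \<longleftrightarrow>
     prob_space.indep_var N (PiM I (\<lambda>_. borel)) (\<lambda>\<omega>. \<lambda>i\<in>I. X i \<omega>)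
                            (PiM I (\<lambda>_. borel)) (\<lambda>\<omega>. \<lambda>i\<in>I. Y i \<omega>)"

definition tensor_process :: "(real \<Rightarrow> 'b \<Rightarrow> real) \<Rightarrow> (real \<Rightarrow> 'b \<Rightarrow> real) \<Rightarrow> real \<times> real \<Rightarrow> 'b \<Rightarrow> real" where
  "tensor_process B B' = (\<lambda>(s, t) \<omega>. B s \<omega> * B' t \<omega>)"


section \<open>Random unitary matrices\<close>

text \<open>Matrix indices run from \<open>0\<close> to \<open>n - 1\<close>, so the DFT exponent \<open>(j - 1) (k - 1)\<close> becomes \<open>j k\<close>.\<close>

definition matrix_borel :: "nat \<Rightarrow> complex mat measure" where
  "matrix_borel n = vimage_algebra (carrier_mat n n)
     (\<lambda>A. \<lambda>p\<in>{..<n} \<times> {..<n}. A $$ p) (PiM ({..<n} \<times> {..<n}) (\<lambda>_. borel))"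

definition unitary_group :: "nat \<Rightarrow> complex mat set" where
  "unitary_group n = {A \<in> carrier_mat n n. A * mat_adjoint A = 1\<^sub>m n \<and> mat_adjoint A * A = 1\<^sub>m n}"

definition orthogonal_group :: "nat \<Rightarrow> complex mat set" where
  "orthogonal_group n = map_mat complex_of_real `
     {A \<in> carrier_mat n n. A * transpose_mat A = 1\<^sub>m n \<and> transpose_mat A * A = 1\<^sub>m n}"

text \<open>
  Left invariance characterises the Haar probability measure of a compact group; right
  invariance is a consequence.
\<close>

definition haar_probability :: "nat \<Rightarrow> complex mat set \<Rightarrow> complex mat measure \<Rightarrow> bool" where
  "haar_probability n G \<mu> \<longleftrightarrow>
     prob_space \<mu> \<and> sets \<mu> = sets (restrict_space (matrix_borel n) G) \<and>
     (\<forall>V\<in>G. distr \<mu> \<mu> (\<lambda>A. V * A) = \<mu>)"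

definition haar_distributed :: "nat \<Rightarrow> complex mat set \<Rightarrow> 'a measure \<Rightarrow> ('a \<Rightarrow> complex mat) \<Rightarrow> bool" where
  "haar_distributed n G M U \<longleftrightarrow>
     U \<in> M \<rightarrow>\<^sub>M restrict_space (matrix_borel n) G \<and>
     haar_probability n G (distr M (restrict_space (matrix_borel n) G) U)"

definition dft_matrix :: "nat \<Rightarrow> complex mat" where
  "dft_matrix n = mat n n (\<lambda>(j, k).
     exp (- 2 * \<i> * complex_of_real pi * of_nat j * of_nat k / of_nat n) / complex_of_real (sqrt (real n)))"


section \<open>The double-indexed empirical process\<close>

text \<open>
  \<open>prob_space.indep_var\<close> requires both variables to have values in the same type, so the
  independence of the matrix from the uniform variables is stated for the generated
  \<open>\<sigma>\<close>-algebras.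
\<close>

definition model ::
    "nat \<Rightarrow> 'a measure \<Rightarrow> ('a \<Rightarrow> complex mat) \<Rightarrow> (nat \<Rightarrow> 'a \<Rightarrow> real) \<Rightarrow> (nat \<Rightarrow> 'a \<Rightarrow> real) \<Rightarrow> bool" where
  "model n M U R C \<longleftrightarrow>
     prob_space M \<and>
     U \<in> M \<rightarrow>\<^sub>M restrict_space (matrix_borel n) (unitary_group n) \<and>
     (\<forall>i<n. R i \<in> borel_measurable M \<and> distr M lborel (R i) = uniform_measure lborel {0..1}) \<and>
     (\<forall>j<n. C j \<in> borel_measurable M \<and> distr M lborel (C j) = uniform_measure lborel {0..1}) \<and>
     prob_space.indep_vars M (\<lambda>_. borel) R {..<n} \<and>
     prob_space.indep_vars M (\<lambda>_. borel) C {..<n} \<and>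
     indep_processes M {..<n} R C \<and>
     prob_space.indep_set M
       (sets (vimage_algebra (space M) (\<lambda>\<omega>. (\<lambda>i\<in>{..<n}. R i \<omega>, \<lambda>j\<in>{..<n}. C j \<omega>))
          (PiM {..<n} (\<lambda>_. borel) \<Otimes>\<^sub>M PiM {..<n} (\<lambda>_. borel))))
       (sets (vimage_algebra (space M) U (restrict_space (matrix_borel n) (unitary_group n))))"

definition Z_process ::
    "nat \<Rightarrow> ('a \<Rightarrow> complex mat) \<Rightarrow> (nat \<Rightarrow> 'a \<Rightarrow> real) \<Rightarrow> (nat \<Rightarrow> 'a \<Rightarrow> real) \<Rightarrow> 'a \<Rightarrow> real \<times> real \<Rightarrow> real" where
  "Z_process n U R C \<omega> = (\<lambda>(s, t)\<in>unit_square.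
     \<Sum>i<n. \<Sum>j<n. (cmod (U \<omega> $$ (i, j)))\<^sup>2 *
       (indicator {..s} (R i \<omega>) - s) * (indicator {..t} (C j \<omega>) - t))"

end

theory Submission
  imports Defs "HOL-Real_Asymp.Real_Asymp"
begin

text \<open>
  With \<open>ra i t = \<Sum>j. |U i j|^2 (1(C j \<le> t) - t)\<close>, the process is \<open>\<Sum>i. ra i t (1(R i \<le> s) - s)\<close>.
  Given the matrix and the column variables this is a sum of independent centred variables, so its
  characteristic function is close to that of a Gaussian vector whose covariance is
  \<open>\<Sum>i. ra i t ra i t'\<close> times the bridge covariance in \<open>s, s'\<close> (\<open>char_conditional\<close>). Since the squared
  moduli of a unitary matrix are doubly stochastic, \<open>ra i t\<close> splits into the mean of the column
  steps, which is common to all rows, and a deviation. The common part contributes the product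
  of two empirical processes, hence two independent bridges. Everything else depends on the limit \<open>\<gamma>\<close>
  of the quadratic variation of the deviations (\<open>fdd_limit\<close>): it is \<open>0\<close> when all entries have
  the same modulus, and \<open>1\<close> or \<open>2\<close> for Haar unitary or orthogonal matrices, which produces the additional
  tied-down sheet.

  For Haar matrices the quadratic variation \<open>T = \<Sum>i. h i ^ 2\<close> of the diagonal \<open>h\<close> of \<open>U D U*\<close> is computed from
  left invariance alone: rotating two rows by \<open>\<pi> / 4\<close> leaves the law of the matrix unchanged but changes \<open>T\<close>
  by an explicit quadratic expression. Averaging over all pairs of rows gives the mean of \<open>T\<close>, the same
  identity for \<open>T^2\<close> bounds the variance, and fourth moments follow likewise (\<open>diagonal_moments\<close>).

  For the functional statement with flat entries, the process is exactly the product of two empirical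
  processes. A dyadic chaining estimate (\<open>empirical_modulus\<close>) bounds their oscillation below a given
  scale, so paths may be replaced by their values on a finite grid uniformly in \<open>n\<close>.
  For the uniform smallness after division by the square root of \<open>n\<close>, a union bound on a grid is combined
  with the monotonicity of the bivariate distribution function hidden in the process
  (\<open>Z_corner_comparison\<close>, \<open>uniform_bound\<close>).
\<close>

section \<open>Measurability and convergence in distribution\<close>

lemma space_borel_of: "space (borel_of T) = topspace T"
  unfolding borel_of_def by (rule space_measure_of) (auto dest: openin_subset)

lemma openin_sets_borel_of: "openin T V \<Longrightarrow> V \<in> sets (borel_of T)"
  unfolding borel_of_def by (subst sets_measure_of) (auto dest: openin_subset)

lemma measurable_borel_ofI:
  assumes "\<And>w. w \<in> space N \<Longrightarrow> X w \<in> topspace T"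
    and "\<And>V. openin T V \<Longrightarrow> {w \<in> space N. X w \<in> V} \<in> sets N"
  shows "X \<in> N \<rightarrow>\<^sub>M borel_of T"
  unfolding borel_of_def
  by (rule measurable_measure_of)
     (use assms in \<open>auto dest: openin_subset simp: vimage_def Int_def conj_commute\<close>)

lemma continuous_map_measurable_borel_of:
  fixes h :: "'x \<Rightarrow> real"
  assumes "continuous_map T euclideanreal h"
  shows "h \<in> borel_of T \<rightarrow>\<^sub>M borel"
proof (rule borel_measurableI)
  fix S :: "real set" assume "open S"
  then have "openin T {x \<in> topspace T. h x \<in> S}"
    using assms by (simp add: openin_continuous_map_preimage)
  moreover have "h -` S \<inter> space (borel_of T) = {x \<in> topspace T. h x \<in> S}"
    by (auto simp: space_borel_of)
  ultimately show "h -` S \<inter> space (borel_of T) \<in> sets (borel_of T)"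
    using openin_sets_borel_of by metis
qed

lemma (in Metric_space) measurable_limit:
  assumes Xk: "\<And>k. X k \<in> N \<rightarrow>\<^sub>M borel_of mtopology"
    and X: "\<And>w. w \<in> space N \<Longrightarrow> Y w \<in> M"
    and lim: "\<And>w. w \<in> space N \<Longrightarrow> (\<lambda>k. d (X k w) (Y w)) \<longlonglongrightarrow> 0"
  shows "Y \<in> N \<rightarrow>\<^sub>M borel_of mtopology"
proof (rule measurable_borel_ofI)
  show "Y w \<in> topspace mtopology" if "w \<in> space N" for w using X[OF that] by simp
  fix V assume V: "openin mtopology V"
  then have VM: "V \<subseteq> M" using openin_subset by fastforce
  have XM: "X k w \<in> M" if "w \<in> space N" for k w
    using measurable_space[OF Xk that] by (simp add: space_borel_of)
  \<comment> \<open>the union of the small balls contained in \<open>V\<close> is open, which avoids measurability of the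
    shrunken set itself\<close>
  define G where "G m = \<Union> {mball x (1 / Suc m) | x. x \<in> M \<and> mball x (2 / Suc m) \<subseteq> V}" for m
  have Gopen: "openin mtopology (G m)" for m unfolding G_def by (rule openin_Union) auto
  have "{w \<in> space N. Y w \<in> V} = (\<Union>m. \<Union>K. \<Inter>k\<in>{K..}. {w \<in> space N. X k w \<in> G m})" (is "?L = ?R")
  proof safe
    fix w assume w: "w \<in> space N" and "Y w \<in> V"
    then obtain r where r: "r > 0" "mball (Y w) r \<subseteq> V" using V by (auto simp: openin_mtopology)
    obtain m where m: "1 / real (Suc m) < r / 2" using nat_approx_posE[of "r/2"] r by auto
    then have "2 / real (Suc m) \<le> r" by simp
    then have sub: "mball (Y w) (2 / Suc m) \<subseteq> V" using r mball_subset_concentric by blast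
    have "\<forall>\<^sub>F k in sequentially. d (X k w) (Y w) < 1 / Suc m"
      using lim[OF w] by (rule order_tendstoD) simp
    then obtain K where K: "\<And>k. k \<ge> K \<Longrightarrow> d (X k w) (Y w) < 1 / Suc m"
      by (auto simp: eventually_sequentially)
    have "X k w \<in> G m" if "k \<ge> K" for k
      unfolding G_def using sub K[OF that] X[OF w] XM[OF w, of k]
      by (intro UnionI[of "mball (Y w) (1 / Suc m)"]) (auto simp: in_mball commute)
    then show "w \<in> ?R" using w by blast
  next
    fix w m K assume K: "w \<in> (\<Inter>k\<in>{K..}. {w \<in> space N. X k w \<in> G m})"
    then have w: "w \<in> space N" by auto
    show "w \<in> space N" by fact
    have "\<forall>\<^sub>F k in sequentially. d (X k w) (Y w) < 1 / Suc m"
      using lim[OF w] by (rule order_tendstoD) simp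
    then obtain K' where K': "\<And>k. k \<ge> K' \<Longrightarrow> d (X k w) (Y w) < 1 / Suc m"
      by (auto simp: eventually_sequentially)
    define k where "k = max K K'"
    have "X k w \<in> G m" using K by (auto simp: k_def)
    then obtain x where x: "x \<in> M" "mball x (2 / Suc m) \<subseteq> V" "X k w \<in> mball x (1 / Suc m)"
      by (auto simp: G_def)
    have "d x (Y w) \<le> d x (X k w) + d (X k w) (Y w)"
      using x X[OF w] XM[OF w] by (intro triangle) auto
    also have "\<dots> < 1 / Suc m + 1 / Suc m"
      using x(3) K'[of k] by (auto simp: k_def in_mball intro!: add_strict_mono)
    finally have "Y w \<in> mball x (2 / Suc m)" using x X[OF w] by (simp add: in_mball)
    then show "Y w \<in> V" using x by blast
  qed
  also have "\<dots> \<in> sets N"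
  proof -
    have "{w \<in> space N. X k w \<in> G m} \<in> sets N" for k m
      using measurable_sets[OF Xk openin_sets_borel_of[OF Gopen]]
      by (simp add: vimage_def Int_def conj_commute)
    then show ?thesis by (intro sets.countable_UN sets.countable_INT'' countable_INT) auto
  qed
  finally show "?L \<in> sets N" .
qed

text \<open>
  A function of finitely many real variables with values in a metric space is measurable as soon as
  it is the limit of its values at discretised arguments, since each discretisation takes countably many
  values. No regularity of the function at other arguments enters, which suits path-valued maps.
\<close>

lemma (in Metric_space) measurable_of_discretizations:
  fixes \<Phi> :: "('i \<Rightarrow> real) \<Rightarrow> 'a"
  assumes I: "finite I" and X: "\<And>i. i \<in> I \<Longrightarrow> X i \<in> borel_measurable N"
    and \<Phi>: "\<And>x. x \<in> extensional I \<Longrightarrow> \<Phi> x \<in> M"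
    and lim: "\<And>x. x \<in> extensional I \<Longrightarrow> 
      (\<lambda>k. d (\<Phi> (\<lambda>i\<in>I. real_of_int \<lceil>real (Suc k) * x i\<rceil> / real (Suc k))) (\<Phi> x)) \<longlonglongrightarrow> 0"
  shows "(\<lambda>w. \<Phi> (\<lambda>i\<in>I. X i w)) \<in> N \<rightarrow>\<^sub>M borel_of mtopology"
proof (rule measurable_limit)
  show "\<Phi> (\<lambda>i\<in>I. X i w) \<in> M" for w by (rule \<Phi>) auto
  let ?D = "\<lambda>k w. (\<lambda>i\<in>I. \<lceil>real (Suc k) * X i w\<rceil>)"
  let ?\<Phi> = "\<lambda>k v. \<Phi> (\<lambda>i\<in>I. real_of_int (v i) / real (Suc k))"
  have eq: "?\<Phi> k (?D k w) = \<Phi> (\<lambda>i\<in>I. real_of_int \<lceil>real (Suc k) * (\<lambda>i\<in>I. X i w) i\<rceil> / real (Suc k))" for k w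
    by (rule arg_cong[where f=\<Phi>]) auto
  show "(\<lambda>k. d (?\<Phi> k (?D k w)) (\<Phi> (\<lambda>i\<in>I. X i w))) \<longlonglongrightarrow> 0" for w
    unfolding eq by (rule lim) (rule restrict_extensional)
  fix k
  have c: "countable (PiE I (\<lambda>_. UNIV :: int set))" by (rule countable_PiE[OF I]) auto
  show "(\<lambda>w. ?\<Phi> k (?D k w)) \<in> N \<rightarrow>\<^sub>M borel_of mtopology"
  proof (rule measurable_borel_ofI)
    show "?\<Phi> k (?D k w) \<in> topspace mtopology" for w by (simp, rule \<Phi>) auto
    fix V assume "openin mtopology V"
    have "{w \<in> space N. ?\<Phi> k (?D k w) \<in> V} =
       (\<Union>v\<in>{v \<in> PiE I (\<lambda>_. UNIV). ?\<Phi> k v \<in> V}. {w \<in> space N. \<forall>i\<in>I. \<lceil>real (Suc k) * X i w\<rceil> = v i})" (is "?L = ?R")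
    proof safe
      fix w assume "w \<in> space N" "?\<Phi> k (?D k w) \<in> V"
      then show "w \<in> ?R"
        by (intro UN_I[of "?D k w"]) auto
    next
      fix v w assume v: "v \<in> PiE I (\<lambda>_. UNIV :: int set)" "?\<Phi> k v \<in> V"
        and eq: "\<forall>i\<in>I. \<lceil>real (Suc k) * X i w\<rceil> = v i"
      then have "?D k w = v" by (auto simp: PiE_def extensional_def restrict_def fun_eq_iff)
      then show "?\<Phi> k (?D k w) \<in> V" using v by simp
    qed
    also have "\<dots> \<in> sets N"
    proof (rule sets.countable_UN')
      show "countable {v \<in> PiE I (\<lambda>_. UNIV). ?\<Phi> k v \<in> V}" using c by (rule countable_subset[rotated]) auto
      have "{w \<in> space N. \<forall>i\<in>I. \<lceil>real (Suc k) * X i w\<rceil> = v i} \<in> sets N" for v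
      proof (rule sets.sets_Collect_finite_All[OF _ I])
        fix i assume "i \<in> I"
        then have [measurable]: "X i \<in> borel_measurable N" by (rule X)
        show "{w \<in> space N. \<lceil>real (Suc k) * X i w\<rceil> = v i} \<in> sets N" by measurable
      qed
      then show "(\<lambda>v. {w \<in> space N. \<forall>i\<in>I. \<lceil>real (Suc k) * X i w\<rceil> = v i}) ` {v \<in> PiE I (\<lambda>_. UNIV). ?\<Phi> k v \<in> V} \<subseteq> sets N"
        by blast
    qed
    finally show "?L \<in> sets N" .
  qed
qed

text \<open>
  An open set of a finite product of lines is a countable union of boxes with rational corners.
\<close>

lemma measurable_borel_of_product:
  assumes J: "finite J" and X: "\<And>p. p \<in> J \<Longrightarrow> (\<lambda>w. X w p) \<in> borel_measurable N"
  shows "(\<lambda>w. restrict (X w) J) \<in> N \<rightarrow>\<^sub>M borel_of (product_topology (\<lambda>_. euclideanreal) J)"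
proof (rule measurable_borel_ofI)
  show "restrict (X w) J \<in> topspace (product_topology (\<lambda>_. euclideanreal) J)" for w by auto
  fix V assume V: "openin (product_topology (\<lambda>_. euclideanreal) J) V"
  define Q where "Q = {(a, b). a \<in> PiE J (\<lambda>_. \<rat> :: real set) \<and> b \<in> PiE J (\<lambda>_. \<rat>) \<and> PiE J (\<lambda>p. {a p<..<b p}) \<subseteq> V}"
  have "countable (PiE J (\<lambda>_. \<rat> :: real set))" using J countable_rat by (rule countable_PiE)
  then have cQ: "countable Q"
    by (intro countable_subset[of Q "PiE J (\<lambda>_. \<rat>) \<times> PiE J (\<lambda>_. \<rat>)"] countable_SIGMA) (auto simp: Q_def)
  have "{w \<in> space N. restrict (X w) J \<in> V} =
      (\<Union>q\<in>Q. {w \<in> space N. \<forall>p\<in>J. fst q p < X w p \<and> X w p < snd q p})" (is "?L = ?R")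
  proof safe
    fix w assume w: "w \<in> space N" "restrict (X w) J \<in> V"
    then obtain U where U: "finite {p \<in> J. U p \<noteq> UNIV}" "\<And>p. p \<in> J \<Longrightarrow> open (U p)"
      "restrict (X w) J \<in> PiE J U" "PiE J U \<subseteq> V"
      using V unfolding openin_product_topology_alt by auto
    have "\<exists>a b. a \<in> \<rat> \<and> b \<in> \<rat> \<and> a < X w p \<and> X w p < b \<and> {a<..<b} \<subseteq> U p" if p: "p \<in> J" for p
    proof -
      have "X w p \<in> U p" using PiE_mem[OF U(3) p] p by simp
      then obtain e where e: "e > 0" "ball (X w p) e \<subseteq> U p" using U(2)[OF p] openE by blast
      obtain a where a: "a \<in> \<rat>" "X w p - e < a" "a < X w p"
        using Rats_dense_in_real[of "X w p - e" "X w p"] e by auto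
      obtain b where b: "b \<in> \<rat>" "X w p < b" "b < X w p + e"
        using Rats_dense_in_real[of "X w p" "X w p + e"] e by auto
      have "{a<..<b} \<subseteq> ball (X w p) e" using a b by (auto simp: dist_real_def)
      then show ?thesis using a b e by blast
    qed
    then obtain a b where ab: "\<And>p. p \<in> J \<Longrightarrow> a p \<in> \<rat> \<and> b p \<in> \<rat> \<and> a p < X w p \<and> X w p < b p \<and> {a p<..<b p} \<subseteq> U p"
      by metis
    have "PiE J (\<lambda>p. {restrict a J p<..<restrict b J p}) \<subseteq> PiE J U"
      by (rule PiE_mono) (use ab in auto)
    then have "(restrict a J, restrict b J) \<in> Q" using ab U(4) unfolding Q_def by auto
    then show "w \<in> ?R" using ab w by (intro UN_I[of "(restrict a J, restrict b J)"]) auto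
  next
    fix w a b assume "(a, b) \<in> Q" and "\<forall>p\<in>J. fst (a, b) p < X w p \<and> X w p < snd (a, b) p"
    then have "restrict (X w) J \<in> PiE J (\<lambda>p. {a p<..<b p})" by (simp add: restrict_PiE_iff)
    then show "restrict (X w) J \<in> V" using \<open>(a, b) \<in> Q\<close> unfolding Q_def by blast
  qed
  also have "\<dots> \<in> sets N"
  proof (rule sets.countable_UN'[OF cQ])
    have "{w \<in> space N. \<forall>p\<in>J. a p < X w p \<and> X w p < b p} \<in> sets N" for a b
    proof (rule sets.sets_Collect_finite_All[OF _ J])
      fix p assume "p \<in> J"
      then have [measurable]: "(\<lambda>w. X w p) \<in> borel_measurable N" by (rule X)
      show "{w \<in> space N. a p < X w p \<and> X w p < b p} \<in> sets N" by measurable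
    qed
    then show "(\<lambda>q. {w \<in> space N. \<forall>p\<in>J. fst q p < X w p \<and> X w p < snd q p}) ` Q \<subseteq> sets N" by auto
  qed
  finally show "?L \<in> sets N" .
qed

lemma (in prob_space) abs_expectation_le:
  fixes h :: "'a \<Rightarrow> real"
  assumes "\<And>w. w \<in> space M \<Longrightarrow> \<bar>h w\<bar> \<le> B" "0 \<le> B"
  shows "\<bar>expectation h\<bar> \<le> B"
proof (cases "integrable M h")
  case True
  have "\<bar>expectation h\<bar> \<le> expectation (\<lambda>w. \<bar>h w\<bar>)" by (rule integral_abs_bound)
  also have "\<dots> \<le> expectation (\<lambda>_. B)" using assms True by (intro integral_mono) auto
  finally show ?thesis by (simp add: prob_space)
qed (simp add: not_integrable_integral_eq assms)

lemma (in prob_space) integrable_of_bounded: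
  fixes h :: "'a \<Rightarrow> 'c::{banach, second_countable_topology}"
  assumes "h \<in> borel_measurable M" "\<And>w. w \<in> space M \<Longrightarrow> norm (h w) \<le> B"
  shows "integrable M h"
  using assms by (intro integrable_const_bound[of _ B]) auto

text \<open>
  A bounded continuous function is the increasing limit of the Lipschitz functions obtained by
  infimal convolution with multiples of the distance; applied to the function and its negative,
  this gives both inequalities for the limit.
\<close>

lemma (in Metric_space) converges_in_distribution_Lipschitz:
  fixes P :: "nat \<Rightarrow> 'c measure" and N :: "'b measure"
  assumes P: "\<And>n. prob_space (P n)" and N: "prob_space N"
    and X: "\<And>n. X n \<in> P n \<rightarrow>\<^sub>M borel_of mtopology" and Y: "Y \<in> N \<rightarrow>\<^sub>M borel_of mtopology"
    and lip: "\<And>h L B. \<lbrakk>\<And>x y. x \<in> M \<Longrightarrow> y \<in> M \<Longrightarrow> \<bar>h x - h y\<bar> \<le> L * d x y; \<And>x. x \<in> M \<Longrightarrow> \<bar>h x\<bar> \<le> B;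
        continuous_map mtopology euclideanreal h; 0 < L; 0 < B\<rbrakk>
      \<Longrightarrow> (\<lambda>n. \<integral>w. h (X n w) \<partial>P n) \<longlonglongrightarrow> (\<integral>w. h (Y w) \<partial>N)"
  shows "converges_in_distribution mtopology P X N Y"
proof -
  have XM: "X n w \<in> M" if "w \<in> space (P n)" for n w
    using measurable_space[OF X that] by (simp add: space_borel_of)
  have YM: "Y w \<in> M" if "w \<in> space N" for w
    using measurable_space[OF Y that] by (simp add: space_borel_of)
  have lower: "\<forall>\<^sub>F n in sequentially. (\<integral>w. h (X n w) \<partial>P n) > (\<integral>w. h (Y w) \<partial>N) - e"
    if hc: "continuous_map mtopology euclideanreal h" and hB: "\<And>x. x \<in> M \<Longrightarrow> \<bar>h x\<bar> \<le> B" and B: "B > 0" and e: "e > 0"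
    for h :: "'a \<Rightarrow> real" and B e :: real
  proof -
    define H where "H m x = (INF y\<in>M. h y + real (Suc m) * d x y)" for m x
    have bdd: "bdd_below ((\<lambda>y. h y + real (Suc m) * d x y) ` M)" for m x
    proof (rule bdd_belowI2[of _ "-B"])
      fix y assume "y \<in> M"
      then show "- B \<le> h y + real (Suc m) * d x y"
        using hB[of y] mult_nonneg_nonneg[of "real (Suc m)" "d x y"] unfolding abs_le_iff
        by (smt (verit) nonneg of_nat_0_le_iff)
    qed
    have Hle: "H m x \<le> h x" if "x \<in> M" for m x
      using cINF_lower[OF bdd that, of m x] that by (simp add: H_def)
    have Hge: "-B \<le> H m x" if "x \<in> M" for m x
      unfolding H_def
    proof (rule cINF_greatest)
      fix y assume "y \<in> M"
      then show "- B \<le> h y + real (Suc m) * d x y"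
        using hB[of y] mult_nonneg_nonneg[of "real (Suc m)" "d x y"] unfolding abs_le_iff
        by (smt (verit) nonneg of_nat_0_le_iff)
    qed (use that in auto)
    have HB: "\<bar>H m x\<bar> \<le> B" if "x \<in> M" for m x
      using Hle[OF that, of m] Hge[OF that, of m] hB[OF that] by (auto simp: abs_le_iff)
    have half: "H m x \<le> H m y + real (Suc m) * d x y" if "x \<in> M" "y \<in> M" for m x y
    proof -
      have "H m x - real (Suc m) * d x y \<le> H m y"
        unfolding H_def[of m y]
      proof (rule cINF_greatest)
        fix z assume z: "z \<in> M"
        have "H m x \<le> h z + real (Suc m) * d x z"
          unfolding H_def by (rule cINF_lower[OF bdd z])
        moreover have "real (Suc m) * d x z \<le> real (Suc m) * (d x y + d y z)"
          by (rule mult_left_mono[OF triangle[OF that z]]) simp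
        ultimately show "H m x - real (Suc m) * d x y \<le> h z + real (Suc m) * d y z"
          by (simp add: distrib_left del: of_nat_Suc)
      qed (use that in auto)
      then show ?thesis by simp
    qed
    have Hlip: "\<bar>H m x - H m y\<bar> \<le> real (Suc m) * d x y" if "x \<in> M" "y \<in> M" for m x y
      using half[OF that, of m] half[OF that(2,1), of m] by (simp add: commute[of y x] abs_le_iff)
    have Hcont: "continuous_map mtopology euclideanreal (H m)" for m
    proof -
      have "Lipschitz_continuous_map (metric (M, d)) (metric (UNIV, dist)) (H m)"
        unfolding Lipschitz_continuous_map_def
        using Hlip[of _ _ m] by (intro conjI exI[of _ "real (Suc m)"])
          (auto simp: mdist_metric mspace_metric Metric_space_axioms Met_TC.Metric_space_axioms dist_real_def simp del: of_nat_Suc)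
      then show ?thesis
        using Lipschitz_continuous_imp_continuous_map[of "metric (M,d)" "metric (UNIV, dist)" "H m"]
        by (simp add: mtopology_of_def mdist_metric mspace_metric Metric_space_axioms Met_TC.Metric_space_axioms)
    qed
    have Hlim: "(\<lambda>m. H m x) \<longlonglongrightarrow> h x" if x: "x \<in> M" for x
    proof (rule LIMSEQ_I)
      fix r :: real assume r: "r > 0"
      have "openin mtopology {y \<in> topspace mtopology. h y \<in> {h x - r/2 <..}}"
        by (rule openin_continuous_map_preimage[OF hc]) simp
      then obtain \<delta> where \<delta>: "\<delta> > 0" "mball x \<delta> \<subseteq> {y \<in> topspace mtopology. h y \<in> {h x - r/2 <..}}"
        using x r unfolding openin_mtopology by auto
      obtain m0 :: nat where m0: "2 * B / \<delta> < real m0" using reals_Archimedean2 by blast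
      have "norm (H m x - h x) < r" if m: "m \<ge> m0" for m
      proof -
        have "h x - r/2 \<le> H m x" unfolding H_def
        proof (rule cINF_greatest)
          fix y assume y: "y \<in> M"
          show "h x - r/2 \<le> h y + real (Suc m) * d x y"
          proof (cases "d x y < \<delta>")
            case True
            then have "h y > h x - r/2" using \<delta> x y by (auto simp: subset_iff in_mball)
            moreover have "0 \<le> real (Suc m) * d x y" by simp
            ultimately show ?thesis by linarith
          next
            case False
            have "2 * B / \<delta> \<le> real (Suc m)" using m0 m by simp
            then have "2 * B \<le> real (Suc m) * \<delta>" using \<delta> by (simp add: field_simps)
            also have "\<dots> \<le> real (Suc m) * d x y" using False by (intro mult_left_mono) auto
            finally show ?thesis using hB[OF x] hB[OF y] r by (auto simp: abs_le_iff)
          qed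
        qed (use x in auto)
        then show ?thesis using Hle[OF x, of m] r by auto
      qed
      then show "\<exists>no. \<forall>n\<ge>no. norm (H n x - h x) < r" by blast
    qed
    have meas: "(\<lambda>w. H m (Y w)) \<in> borel_measurable N" for m
      using measurable_compose[OF Y continuous_map_measurable_borel_of[OF Hcont]] .
    have "(\<lambda>m. \<integral>w. H m (Y w) \<partial>N) \<longlonglongrightarrow> (\<integral>w. h (Y w) \<partial>N)"
    proof (rule integral_dominated_convergence[where w="\<lambda>_. B"])
      show "(\<lambda>w. h (Y w)) \<in> borel_measurable N"
        using measurable_compose[OF Y continuous_map_measurable_borel_of[OF hc]] .
      show "integrable N (\<lambda>_. B)" using N by (simp add: prob_space.finite_measure finite_measure.integrable_const)
    qed (use meas YM Hlim HB in auto)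
    then have "\<forall>\<^sub>F m in sequentially. (\<integral>w. H m (Y w) \<partial>N) > (\<integral>w. h (Y w) \<partial>N) - e/2"
      by (rule order_tendstoD) (use e in auto)
    then obtain m where m: "(\<integral>w. H m (Y w) \<partial>N) > (\<integral>w. h (Y w) \<partial>N) - e/2"
      using eventually_happens by fastforce
    have "(\<lambda>n. \<integral>w. H m (X n w) \<partial>P n) \<longlonglongrightarrow> (\<integral>w. H m (Y w) \<partial>N)"
      by (rule lip[of "H m" "real (Suc m)" B]) (use Hlip HB Hcont B in auto)
    then have "\<forall>\<^sub>F n in sequentially. (\<integral>w. H m (X n w) \<partial>P n) > (\<integral>w. H m (Y w) \<partial>N) - e/2"
      by (rule order_tendstoD) (use e in auto)
    then show ?thesis
    proof eventually_elim
      case (elim n)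
      interpret Pn: prob_space "P n" by (rule P)
      have "(\<integral>w. H m (X n w) \<partial>P n) \<le> (\<integral>w. h (X n w) \<partial>P n)"
      proof (rule integral_mono)
        show "integrable (P n) (\<lambda>w. H m (X n w))"
          using measurable_compose[OF X continuous_map_measurable_borel_of[OF Hcont]] HB XM
          by (intro Pn.integrable_of_bounded[of _ B]) auto
        show "integrable (P n) (\<lambda>w. h (X n w))"
          using measurable_compose[OF X continuous_map_measurable_borel_of[OF hc]] hB XM
          by (intro Pn.integrable_of_bounded[of _ B]) auto
      qed (use Hle XM in auto)
      then show ?case using elim m by linarith
    qed
  qed
  show ?thesis unfolding converges_in_distribution_def
  proof (intro conjI allI impI X Y)
    fix h :: "'a \<Rightarrow> real" assume h: "continuous_map mtopology euclideanreal h \<and> bounded (h ` topspace mtopology)"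
    then obtain B where B: "B > 0" "\<And>x. x \<in> M \<Longrightarrow> \<bar>h x\<bar> \<le> B" by (auto simp: bounded_pos)
    have hm: "continuous_map mtopology euclideanreal (\<lambda>x. - h x)" using h by (simp add: continuous_map_minus)
    show "(\<lambda>n. \<integral>w. h (X n w) \<partial>P n) \<longlonglongrightarrow> (\<integral>w. h (Y w) \<partial>N)"
    proof (rule tendstoI)
      fix e :: real assume e: "e > 0"
      have "\<forall>\<^sub>F n in sequentially. (\<integral>w. h (X n w) \<partial>P n) > (\<integral>w. h (Y w) \<partial>N) - e"
        using lower[of h B e] h B e by auto
      moreover have "\<forall>\<^sub>F n in sequentially. (\<integral>w. - h (X n w) \<partial>P n) > (\<integral>w. - h (Y w) \<partial>N) - e"
        using lower[OF hm, of B e] B e by auto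
      ultimately show "\<forall>\<^sub>F n in sequentially. dist (\<integral>w. h (X n w) \<partial>P n) (\<integral>w. h (Y w) \<partial>N) < e"
        by eventually_elim (auto simp: dist_real_def abs_less_iff)
    qed
  qed
qed

section \<open>Convergence from characteristic functions\<close>

inductive_set trig_polys :: "'i set \<Rightarrow> (('i \<Rightarrow> real) \<Rightarrow> real) set" for J where
  monomial: "(\<lambda>x. a * cos ((\<Sum>p\<in>J. c p * x p) + e)) \<in> trig_polys J"
| add: "f \<in> trig_polys J \<Longrightarrow> g \<in> trig_polys J \<Longrightarrow> (\<lambda>x. f x + g x) \<in> trig_polys J"

lemma trig_polys_monomial_mult:
  assumes "g \<in> trig_polys J"
  shows "(\<lambda>x. a * cos ((\<Sum>p\<in>J. c p * x p) + e) * g x) \<in> trig_polys J"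
  using assms
proof induction
  case (monomial a' c' e')
  have "(\<lambda>x. (a * a' / 2) * cos ((\<Sum>p\<in>J. (c p - c' p) * x p) + (e - e')) +
      (a * a' / 2) * cos ((\<Sum>p\<in>J. (c p + c' p) * x p) + (e + e'))) \<in> trig_polys J" (is "?f \<in> _")
    by (intro trig_polys.intros)
  also have "?f = (\<lambda>x. a * cos ((\<Sum>p\<in>J. c p * x p) + e) * (a' * cos ((\<Sum>p\<in>J. c' p * x p) + e')))"
  proof
    fix x
    let ?A = "(\<Sum>p\<in>J. c p * x p) + e" and ?B = "(\<Sum>p\<in>J. c' p * x p) + e'"
    have "(\<Sum>p\<in>J. (c p - c' p) * x p) + (e - e') = ?A - ?B"
      "(\<Sum>p\<in>J. (c p + c' p) * x p) + (e + e') = ?A + ?B"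
      by (simp_all add: algebra_simps sum.distrib sum_subtractf)
    then have "?f x = (a * a' / 2) * cos (?A - ?B) + (a * a' / 2) * cos (?A + ?B)" by (simp only:)
    also have "\<dots> = (a * a') * ((cos (?A - ?B) + cos (?A + ?B)) / 2)"
      by (simp only: distrib_left add_divide_distrib times_divide_eq_left times_divide_eq_right)
    also have "\<dots> = (a * a') * (cos ?A * cos ?B)" by (simp only: cos_times_cos)
    finally show "?f x = a * cos ?A * (a' * cos ?B)" by simp
  qed
  finally show ?case .
next
  case (add f g)
  then show ?case by (simp add: distrib_left trig_polys.add)
qed

lemma trig_polys_mult:
  assumes "f \<in> trig_polys J" "g \<in> trig_polys J"
  shows "(\<lambda>x. f x * g x) \<in> trig_polys J"
  using assms
proof (induction arbitrary: rule: trig_polys.induct)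
  case (monomial a c e)
  then show ?case by (rule trig_polys_monomial_mult)
next
  case (add f h)
  then show ?case by (simp add: distrib_right trig_polys.add)
qed

lemma trig_polys_const: "(\<lambda>_. a) \<in> trig_polys J"
  using trig_polys.monomial[of a "\<lambda>_. 0" J 0] by simp

lemma trig_polys_sin:
  assumes "finite J" "p \<in> J"
  shows "(\<lambda>x. sin (c * x p)) \<in> trig_polys J"
proof -
  have "(\<Sum>q\<in>J. (if q = p then c else 0) * x q) = c * x p" for x :: "'a \<Rightarrow> real"
    using assms by (simp add: if_distrib[where f="\<lambda>z. z * _"] sum.delta cong: if_cong)
  then show ?thesis
    using trig_polys.monomial[of 1 "\<lambda>q. if q = p then c else 0" J "- (pi / 2)"]
    by (simp add: cos_diff)
qed

lemma trig_polys_approximation: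
  fixes f :: "('i \<Rightarrow> real) \<Rightarrow> real"
  assumes J: "finite J" and f: "continuous_map (product_topology (\<lambda>_. euclideanreal) J) euclideanreal f"
    and B: "\<And>x. x \<in> extensional J \<Longrightarrow> \<bar>f x\<bar> \<le> B" and A: "A > 0" and e: "e > 0"
  obtains g where "g \<in> trig_polys J" "\<And>x. \<bar>g x\<bar> \<le> B + e"
    "\<And>x. (\<And>p. p \<in> J \<Longrightarrow> \<bar>x p\<bar> \<le> A) \<Longrightarrow> \<bar>f (restrict x J) - g x\<bar> \<le> e"
proof -
  \<comment> \<open>number the coordinates, since function spaces over a countable index type are Hausdorff\<close>
  define idx where "idx = to_nat_on J"
  have inj: "inj_on idx J" unfolding idx_def using J by (intro inj_on_to_nat_on countable_finite)
  define S where "S = PiE UNIV (\<lambda>k. if k \<in> idx ` J then {-1..1} else {0 :: real})"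
  have S1: "-1 \<le> w (idx p) \<and> w (idx p) \<le> 1" if "w \<in> S" "p \<in> J" for w p
    using PiE_mem[OF that(1)[unfolded S_def], of "idx p"] that(2) by simp
  have S0: "w k = 0" if "w \<in> S" "k \<notin> idx ` J" for w k
    using PiE_mem[OF that(1)[unfolded S_def], of k] that(2) by simp
  define c where "c = pi / (2 * A)"
  define \<Theta> where "\<Theta> x = (\<lambda>k. if k \<in> idx ` J then sin (c * x (inv_into J idx k)) else 0)" for x :: "'i \<Rightarrow> real"
  define F where "F u = f (\<lambda>p\<in>J. arcsin (u (idx p)) / c)" for u :: "nat \<Rightarrow> real"
  have \<Theta>: "\<Theta> x (idx p) = sin (c * x p)" if "p \<in> J" for x p using that inj by (simp add: \<Theta>_def)
  have \<Theta>S: "\<Theta> x \<in> S" for x by (auto simp: S_def \<Theta>_def)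
  have compact: "compact S"
  proof -
    have "compactin (product_topology (\<lambda>_. euclideanreal) UNIV) S"
      unfolding S_def by (subst compactin_PiE) auto
    then show ?thesis by (simp add: euclidean_product_topology)
  qed
  have Fc: "continuous_on S F"
  proof -
    have "continuous_on S (\<lambda>u. arcsin (u (idx p)) / c)" if "p \<in> J" for p
    proof (intro continuous_intros)
      show "continuous_on S (\<lambda>u. u (idx p))"
        by (rule continuous_on_subset[OF continuous_on_product_coordinates]) auto
      show "\<forall>u\<in>S. - 1 \<le> u (idx p) \<and> u (idx p) \<le> 1"
        using S1[OF _ that] by blast
      show "\<forall>x\<in>S. c \<noteq> 0" using A by (simp add: c_def)
    qed
    then have "continuous_map (top_of_set S) (product_topology (\<lambda>_. euclideanreal) J) (\<lambda>u. \<lambda>p\<in>J. arcsin (u (idx p)) / c)"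
      by (auto simp: continuous_map_componentwise)
    from continuous_map_compose[OF this f] show ?thesis by (simp add: F_def[abs_def] o_def)
  qed
  define R where "R = {G. continuous_on S G \<and> (\<lambda>x. G (\<Theta> x)) \<in> trig_polys J}"
  interpret function_ring_on R S
  proof
    show "compact S" by (rule compact)
    show "\<And>f. f \<in> R \<Longrightarrow> continuous_on S f" by (simp add: R_def)
    show "\<And>f g. f \<in> R \<Longrightarrow> g \<in> R \<Longrightarrow> (\<lambda>x. f x + g x) \<in> R" by (auto simp: R_def intro: continuous_intros trig_polys.add)
    show "\<And>f g. f \<in> R \<Longrightarrow> g \<in> R \<Longrightarrow> (\<lambda>x. f x * g x) \<in> R" by (auto simp: R_def intro: continuous_intros trig_polys_mult)
    show "\<And>c. (\<lambda>_. c) \<in> R" by (auto simp: R_def intro: trig_polys_const)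
    fix u v assume uv: "u \<in> S" "v \<in> S" "u \<noteq> v"
    then obtain k where k: "u k \<noteq> v k" by auto
    have "k \<in> idx ` J" using S0[OF uv(1), of k] S0[OF uv(2), of k] k by metis
    then obtain p where p: "p \<in> J" "k = idx p" by auto
    have "(\<lambda>u. u k) \<in> R"
      using p \<Theta>[OF p(1)] trig_polys_sin[OF J p(1), of c] continuous_on_subset[OF continuous_on_product_coordinates, of S k]
      by (auto simp: R_def)
    then show "\<exists>f\<in>R. f u \<noteq> f v" using k by (intro bexI[of _ "\<lambda>u. u k"])
  qed
  obtain G where G: "G \<in> R" "\<And>u. u \<in> S \<Longrightarrow> \<bar>F u - G u\<bar> < e"
    using Stone_Weierstrass_basic[OF Fc e] by blast
  show ?thesis
  proof
    show "(\<lambda>x. G (\<Theta> x)) \<in> trig_polys J" using G by (simp add: R_def)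
    show "\<bar>G (\<Theta> x)\<bar> \<le> B + e" for x
    proof -
      have "\<bar>F (\<Theta> x)\<bar> \<le> B" unfolding F_def by (rule B) (rule restrict_extensional)
      then show ?thesis using G(2)[OF \<Theta>S, of x] by linarith
    qed
    show "\<bar>f (restrict x J) - G (\<Theta> x)\<bar> \<le> e" if x: "\<And>p. p \<in> J \<Longrightarrow> \<bar>x p\<bar> \<le> A" for x
    proof -
      have "arcsin (\<Theta> x (idx p)) / c = x p" if p: "p \<in> J" for p
      proof -
        have "\<bar>c * x p\<bar> \<le> c * A" using x[OF p] A by (auto simp: c_def abs_mult field_simps)
        also have "\<dots> = pi / 2" using A by (simp add: c_def)
        finally have "arcsin (sin (c * x p)) = c * x p" by (intro arcsin_sin) auto
        then show ?thesis using A \<Theta>[OF p] by (simp add: c_def)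
      qed
      then have "F (\<Theta> x) = f (restrict x J)" unfolding F_def by (intro arg_cong[where f=f]) auto
      then show ?thesis using G(2)[OF \<Theta>S, of x] by simp
    qed
  qed
qed

lemma trig_polys_bounded:
  assumes "g \<in> trig_polys J"
  shows "\<exists>K. \<forall>x. \<bar>g x\<bar> \<le> K"
  using assms
proof induction
  case (monomial a c e)
  have "\<bar>a * cos t\<bar> \<le> \<bar>a\<bar>" for t using abs_cos_le_one[of t] by (simp add: abs_mult mult_left_le)
  then show ?case by blast
next
  case (add f g)
  then obtain K L where "\<And>x. \<bar>f x\<bar> \<le> K" "\<And>x. \<bar>g x\<bar> \<le> L" by auto
  then have "\<bar>f x + g x\<bar> \<le> K + L" for x using abs_triangle_ineq[of "f x" "g x"] by (meson add_mono order_trans)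
  then show ?case by blast
qed

lemma trig_polys_measurable:
  assumes "g \<in> trig_polys J" and X: "\<And>p. p \<in> J \<Longrightarrow> (\<lambda>w. X w p) \<in> borel_measurable N"
  shows "(\<lambda>w. g (X w)) \<in> borel_measurable N"
  using assms(1)
proof induction
  case (monomial a c e)
  have "(\<lambda>w. (\<Sum>p\<in>J. c p * X w p) + e) \<in> borel_measurable N" using X by (intro borel_measurable_add borel_measurable_sum borel_measurable_times) auto
  then show ?case by measurable
qed (rule borel_measurable_add)

text \<open>
  A finite-dimensional continuity theorem without Fourier inversion: folding the space onto
  a torus makes a continuous function periodic, and Stone--Weierstrass approximates it by trigonometric
  polynomials, whose expectations converge. The second moments make the effect of the folding small.
\<close>

lemma expectation_convergence_from_cosines:
  fixes P :: "nat \<Rightarrow> 'a measure" and X :: "nat \<Rightarrow> 'a \<Rightarrow> 'i \<Rightarrow> real" and f :: "('i \<Rightarrow> real) \<Rightarrow> real"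
  assumes P: "\<And>n. prob_space (P n)" and N: "prob_space N" and J: "finite J"
    and X: "\<And>n p. p \<in> J \<Longrightarrow> (\<lambda>w. X n w p) \<in> borel_measurable (P n)"
    and Y: "\<And>p. p \<in> J \<Longrightarrow> (\<lambda>w. Y w p) \<in> borel_measurable N"
    and cosine: "\<And>c e. (\<lambda>n. \<integral>w. cos ((\<Sum>p\<in>J. c p * X n w p) + e) \<partial>P n) \<longlonglongrightarrow> (\<integral>w. cos ((\<Sum>p\<in>J. c p * Y w p) + e) \<partial>N)"
    and X2: "\<And>n p. p \<in> J \<Longrightarrow> integrable (P n) (\<lambda>w. (X n w p)\<^sup>2)"
    and X2K: "\<And>p. p \<in> J \<Longrightarrow> \<forall>\<^sub>F n in sequentially. (\<integral>w. (X n w p)\<^sup>2 \<partial>P n) \<le> K"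
    and Y2: "\<And>p. p \<in> J \<Longrightarrow> integrable N (\<lambda>w. (Y w p)\<^sup>2)"
    and f: "continuous_map (product_topology (\<lambda>_. euclideanreal) J) euclideanreal f"
    and fb: "bounded (f ` topspace (product_topology (\<lambda>_. euclideanreal) J))"
  shows "(\<lambda>n. \<integral>w. f (restrict (X n w) J) \<partial>P n) \<longlonglongrightarrow> (\<integral>w. f (restrict (Y w) J) \<partial>N)"
proof -
  obtain B where B: "B > 0" "\<And>x. x \<in> extensional J \<Longrightarrow> \<bar>f x\<bar> \<le> B"
    using fb by (auto simp: bounded_pos PiE_UNIV_domain PiE_def)
  have trig: "(\<lambda>n. \<integral>w. g (X n w) \<partial>P n) \<longlonglongrightarrow> (\<integral>w. g (Y w) \<partial>N)" if "g \<in> trig_polys J" for g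
    using that
  proof induction
    case (monomial a c e)
    show ?case using tendsto_mult_left[OF cosine, of a c e] by simp
  next
    case (add f g)
    obtain K L where KL: "\<And>x. \<bar>f x\<bar> \<le> K" "\<And>x. \<bar>g x\<bar> \<le> L" using trig_polys_bounded add(1,2) by metis
    have i1: "integrable (P n) (\<lambda>w. f (X n w))" "integrable (P n) (\<lambda>w. g (X n w))" for n
      using KL by (auto intro!: prob_space.integrable_of_bounded[OF P] trig_polys_measurable[OF add(1)] trig_polys_measurable[OF add(2)] X)
    have i2: "integrable N (\<lambda>w. f (Y w))" "integrable N (\<lambda>w. g (Y w))"
      using KL by (auto intro!: prob_space.integrable_of_bounded[OF N] trig_polys_measurable[OF add(1)] trig_polys_measurable[OF add(2)] Y)
    show ?case using tendsto_add[OF add(3,4)] by (simp add: i1 i2)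
  qed
  define K' where "K' = 1 + \<bar>K\<bar> + (\<Sum>p\<in>J. \<integral>w. (Y w p)\<^sup>2 \<partial>N)"
  have nn: "0 \<le> (\<integral>w. (Y w p)\<^sup>2 \<partial>N)" for p by simp
  have K': "K' > 0" "K \<le> K'" "\<And>p. p \<in> J \<Longrightarrow> (\<integral>w. (Y w p)\<^sup>2 \<partial>N) \<le> K'"
  proof -
    have "0 \<le> (\<Sum>p\<in>J. \<integral>w. (Y w p)\<^sup>2 \<partial>N)" by (intro sum_nonneg nn)
    then show "K' > 0" "K \<le> K'" by (auto simp: K'_def)
    show "(\<integral>w. (Y w p)\<^sup>2 \<partial>N) \<le> K'" if "p \<in> J" for p
      using member_le_sum[OF that, of "\<lambda>p. \<integral>w. (Y w p)\<^sup>2 \<partial>N"] J nn by (auto simp: K'_def)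
  qed
  show ?thesis
  proof (rule tendstoI)
    fix r :: real assume r: "r > 0"
    define e where "e = r / 8"
    have e: "e > 0" using r by (simp add: e_def)
    define b where "b = 2 * B + e"
    have b: "b > 0" using B e by (simp add: b_def)
    \<comment> \<open>Chebyshev with \<open>A\<^sup>2\<close> large makes the part outside the box at most \<open>e\<close>\<close>
    define A where "A = sqrt ((card J + 1) * K' * b / e)"
    have A2: "A\<^sup>2 = (card J + 1) * K' * b / e" unfolding A_def using K' b e by (intro real_sqrt_pow2) auto
    have A: "A > 0" unfolding A_def using K' b e by (intro real_sqrt_gt_zero) auto
    obtain g where g: "g \<in> trig_polys J" "\<And>x. \<bar>g x\<bar> \<le> B + e"
      "\<And>x. (\<And>p. p \<in> J \<Longrightarrow> \<bar>x p\<bar> \<le> A) \<Longrightarrow> \<bar>f (restrict x J) - g x\<bar> \<le> e"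
      using trig_polys_approximation[OF J f B(2) A e] by blast
    have close: "\<bar>(\<integral>w. f (restrict (Z w) J) \<partial>Q) - (\<integral>w. g (Z w) \<partial>Q)\<bar> \<le> 2 * e"
      if Q: "prob_space Q" and Z: "\<And>p. p \<in> J \<Longrightarrow> (\<lambda>w. Z w p) \<in> borel_measurable Q"
        and Z2: "\<And>p. p \<in> J \<Longrightarrow> integrable Q (\<lambda>w. (Z w p)\<^sup>2)" "\<And>p. p \<in> J \<Longrightarrow> (\<integral>w. (Z w p)\<^sup>2 \<partial>Q) \<le> K'"
      for Q :: "'z measure" and Z
    proof -
      interpret Q: prob_space Q by (rule Q)
      have f1: "\<bar>f (restrict (Z w) J)\<bar> \<le> B" for w by (rule B(2)) (rule restrict_extensional)
      have i1: "integrable Q (\<lambda>w. f (restrict (Z w) J))"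
        using measurable_compose[OF measurable_borel_of_product[OF J Z] continuous_map_measurable_borel_of[OF f]] f1
        by (intro Q.integrable_of_bounded[of _ B]) auto
      have i2: "integrable Q (\<lambda>w. g (Z w))"
        using trig_polys_measurable[OF g(1) Z] g(2) by (intro Q.integrable_of_bounded[of _ "B + e"]) auto
      have pw: "\<bar>f (restrict (Z w) J) - g (Z w)\<bar> \<le> e + b / A\<^sup>2 * (\<Sum>p\<in>J. (Z w p)\<^sup>2)" for w
      proof (cases "\<forall>p\<in>J. \<bar>Z w p\<bar> \<le> A")
        case True
        moreover have "0 \<le> b / A\<^sup>2 * (\<Sum>p\<in>J. (Z w p)\<^sup>2)" using b by (intro mult_nonneg_nonneg sum_nonneg) auto
        ultimately show ?thesis using g(3)[of "Z w"] by auto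
      next
        case False
        then obtain p where p: "p \<in> J" "A < \<bar>Z w p\<bar>" by auto
        have "A\<^sup>2 \<le> (Z w p)\<^sup>2" using p A by (intro abs_le_square_iff[THEN iffD1]) auto
        also have "\<dots> \<le> (\<Sum>p\<in>J. (Z w p)\<^sup>2)" using p J by (intro member_le_sum) auto
        finally have "b \<le> b / A\<^sup>2 * (\<Sum>p\<in>J. (Z w p)\<^sup>2)" using A b by (simp add: field_simps)
        moreover have "\<bar>f (restrict (Z w) J) - g (Z w)\<bar> \<le> b" using f1[of w] g(2)[of "Z w"] by (simp add: b_def)
        ultimately show ?thesis using e by linarith
      qed
      have "\<bar>(\<integral>w. f (restrict (Z w) J) \<partial>Q) - (\<integral>w. g (Z w) \<partial>Q)\<bar> = \<bar>\<integral>w. f (restrict (Z w) J) - g (Z w) \<partial>Q\<bar>"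
        using i1 i2 by simp
      also have "\<dots> \<le> (\<integral>w. \<bar>f (restrict (Z w) J) - g (Z w)\<bar> \<partial>Q)" by (rule integral_abs_bound)
      also have "\<dots> \<le> (\<integral>w. e + b / A\<^sup>2 * (\<Sum>p\<in>J. (Z w p)\<^sup>2) \<partial>Q)"
        using i1 i2 Z2 pw by (intro integral_mono) (auto intro!: integrable_add integrable_mult_right integrable_sum)
      also have "\<dots> = e + b / A\<^sup>2 * (\<Sum>p\<in>J. \<integral>w. (Z w p)\<^sup>2 \<partial>Q)" using Z2 by (simp add: Q.prob_space)
      also have "\<dots> \<le> e + b / A\<^sup>2 * (\<Sum>p\<in>J. K')"
        using Z2 b by (intro add_left_mono mult_left_mono sum_mono) auto
      also have "\<dots> \<le> e + e"
      proof -
        have "b / A\<^sup>2 = e / ((card J + 1) * K')" unfolding A2 using K' b e by (simp add: divide_simps)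
        then have "b / A\<^sup>2 * (\<Sum>p\<in>J. K') = e * (card J / (card J + 1))" using K' by simp
        also have "\<dots> \<le> e * 1" using e by (intro mult_left_mono) auto
        finally show ?thesis by simp
      qed
      finally show ?thesis by simp
    qed
    have "\<forall>\<^sub>F n in sequentially. \<forall>p\<in>J. (\<integral>w. (X n w p)\<^sup>2 \<partial>P n) \<le> K"
      using X2K by (simp add: eventually_ball_finite_distrib[OF J])
    moreover have "\<forall>\<^sub>F n in sequentially. dist (\<integral>w. g (X n w) \<partial>P n) (\<integral>w. g (Y w) \<partial>N) < e"
      using tendstoD[OF trig[OF g(1)] e] .
    ultimately show "\<forall>\<^sub>F n in sequentially. dist (\<integral>w. f (restrict (X n w) J) \<partial>P n) (\<integral>w. f (restrict (Y w) J) \<partial>N) < r"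
    proof eventually_elim
      case (elim n)
      have "\<bar>(\<integral>w. f (restrict (X n w) J) \<partial>P n) - (\<integral>w. g (X n w) \<partial>P n)\<bar> \<le> 2 * e"
        using elim K' by (intro close P X X2) fastforce+
      moreover have "\<bar>(\<integral>w. f (restrict (Y w) J) \<partial>N) - (\<integral>w. g (Y w) \<partial>N)\<bar> \<le> 2 * e"
        by (intro close N Y Y2 K')
      ultimately show ?case using elim r unfolding dist_real_def e_def by linarith
    qed
  qed
qed

section \<open>Paths with jumps along coordinate lines\<close>

text \<open>
  The jump part of all the paths below: a function that is constant on a one-sided
  neighbourhood on each side of every point, and right continuous.
\<close>

definition locally_step :: "(real \<Rightarrow> 'c) \<Rightarrow> bool" where
  "locally_step u \<longleftrightarrow> (\<forall>s. (\<forall>\<^sub>F s' in at_right s. u s' = u s) \<and> (\<exists>a. \<forall>\<^sub>F s' in at_left s. u s' = a))"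

lemma locally_step_const: "locally_step (\<lambda>_. a)"
  by (auto simp: locally_step_def)

lemma locally_step_floor:
  assumes k: "k > 0"
  shows "locally_step (\<lambda>s. \<lfloor>k * s\<rfloor>)"
  unfolding locally_step_def
proof (intro allI conjI)
  fix s :: real
  have "s < (\<lfloor>k * s\<rfloor> + 1) / k" using k floor_correct[of "k * s"] by (simp add: field_simps)
  then have "\<forall>\<^sub>F s' in at_right s. s' < (\<lfloor>k * s\<rfloor> + 1) / k" by (auto simp: eventually_at_right_field)
  moreover have "\<forall>\<^sub>F s' in at_right s. s' > s" by (rule eventually_at_right_less)
  ultimately show "\<forall>\<^sub>F s' in at_right s. \<lfloor>k * s'\<rfloor> = \<lfloor>k * s\<rfloor>"
  proof eventually_elim
    case (elim s')
    have "k * s < k * s'" using elim k by simp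
    moreover have "k * s' < \<lfloor>k * s\<rfloor> + 1" using elim k by (simp add: field_simps)
    ultimately show ?case using floor_correct[of "k * s"] by (intro floor_unique) linarith+
  qed
  have "(\<lceil>k * s\<rceil> - 1) / k < s" using k ceiling_correct[of "k * s"] by (simp add: field_simps)
  then have "\<forall>\<^sub>F s' in at_left s. (\<lceil>k * s\<rceil> - 1) / k < s'" by (auto simp: eventually_at_left_field)
  moreover have "\<forall>\<^sub>F s' in at_left s. s' < s" unfolding eventually_at_filter by simp
  ultimately have "\<forall>\<^sub>F s' in at_left s. \<lfloor>k * s'\<rfloor> = \<lceil>k * s\<rceil> - 1"
  proof eventually_elim
    case (elim s')
    have "k * s' < k * s" using elim k by simp
    moreover have "\<lceil>k * s\<rceil> - 1 < k * s'" using elim k by (simp add: field_simps)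
    ultimately show ?case using ceiling_correct[of "k * s"] by (intro floor_unique) (simp_all, linarith)
  qed
  then show "\<exists>a. \<forall>\<^sub>F s' in at_left s. \<lfloor>k * s'\<rfloor> = a" by blast
qed

lemma locally_step_below:
  fixes r :: "'i \<Rightarrow> real"
  assumes "finite I"
  shows "locally_step (\<lambda>s. {i \<in> I. r i \<le> s})"
  unfolding locally_step_def
proof (intro allI conjI)
  fix s :: real
  have "\<forall>\<^sub>F s' in at_right s. r i \<le> s' \<longleftrightarrow> r i \<le> s" for i
  proof (cases "r i \<le> s")
    case True
    show ?thesis using eventually_at_right_less[of s] by eventually_elim (use True in auto)
  next
    case False
    then have "\<forall>\<^sub>F s' in at_right s. s' < r i" by (auto simp: eventually_at_right_field intro!: exI[of _ "r i"])
    then show ?thesis by eventually_elim (use False in auto)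
  qed
  then have "\<forall>\<^sub>F s' in at_right s. \<forall>i\<in>I. r i \<le> s' \<longleftrightarrow> r i \<le> s"
    using assms by (simp add: eventually_ball_finite_distrib)
  then show "\<forall>\<^sub>F s' in at_right s. {i \<in> I. r i \<le> s'} = {i \<in> I. r i \<le> s}" by eventually_elim auto
  have lt: "\<forall>\<^sub>F s' in at_left s. s' < s" unfolding eventually_at_filter by simp
  have "\<forall>\<^sub>F s' in at_left s. r i \<le> s' \<longleftrightarrow> r i < s" for i
  proof (cases "r i < s")
    case True
    then have "\<forall>\<^sub>F s' in at_left s. r i < s'" by (auto simp: eventually_at_left_field intro!: exI[of _ "r i"])
    then show ?thesis by eventually_elim (use True in auto)
  next
    case False
    show ?thesis using lt by eventually_elim (use False in auto)
  qed
  then have "\<forall>\<^sub>F s' in at_left s. \<forall>i\<in>I. r i \<le> s' \<longleftrightarrow> r i < s"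
    using assms by (simp add: eventually_ball_finite_distrib)
  then have "\<forall>\<^sub>F s' in at_left s. {i \<in> I. r i \<le> s'} = {i \<in> I. r i < s}" by eventually_elim auto
  then show "\<exists>a. \<forall>\<^sub>F s' in at_left s. {i \<in> I. r i \<le> s'} = a" by blast
qed

lemma locally_step_side:
  assumes u: "locally_step u" and R: "R \<in> {(<), (\<ge>)}"
  shows "\<exists>a \<delta>. \<delta> > 0 \<and> (R s s \<longrightarrow> a = u s) \<and> (\<forall>s'. R s' s \<and> \<bar>s' - s\<bar> < \<delta> \<longrightarrow> u s' = a)"
proof -
  consider "R = (<)" | "R = (\<ge>)" using R by auto
  then show ?thesis
  proof cases
    case 1
    obtain a where "\<forall>\<^sub>F s' in at_left s. u s' = a" using u by (auto simp: locally_step_def)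
    then obtain \<delta> where "\<delta> > 0" "\<forall>x\<in>{..<s}. x \<noteq> s \<and> dist x s < \<delta> \<longrightarrow> u x = a"
      unfolding eventually_at by blast
    then show ?thesis unfolding 1 by (intro exI[of _ a] exI[of _ \<delta>]) (auto simp: dist_real_def)
  next
    case 2
    have "\<forall>\<^sub>F s' in at_right s. u s' = u s" using u by (auto simp: locally_step_def)
    then obtain \<delta> where "\<delta> > 0" "\<forall>x\<in>{s<..}. x \<noteq> s \<and> dist x s < \<delta> \<longrightarrow> u x = u s"
      unfolding eventually_at by blast
    then show ?thesis unfolding 2 by (intro exI[of _ "u s"] exI[of _ \<delta>]) (auto simp: dist_real_def le_less)
  qed
qed

text \<open>
  In each orthant at a point the two step functions are eventually constant, so the path coincides there with a single
  continuous function.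
\<close>

lemma skorokhod_spaceI:
  assumes u: "locally_step u" and v: "locally_step v"
    and G: "\<And>a b. continuous_on unit_square (G a b)"
  shows "restrict (\<lambda>q. G (u (fst q)) (v (snd q)) q) unit_square \<in> skorokhod_space" (is "?x \<in> _")
proof -
  have orthant: "\<exists>l. (?x \<longlongrightarrow> l) (at p within {q \<in> unit_square. R (fst q) (fst p) \<and> S (snd q) (snd p)}) \<and>
      (R (fst p) (fst p) \<and> S (snd p) (snd p) \<longrightarrow> l = ?x p)"
    if p: "p \<in> unit_square" and R: "R \<in> {(<), (\<ge>)}" and S: "S \<in> {(<), (\<ge>)}" for p R S
  proof -
    let ?Q = "{q \<in> unit_square. R (fst q) (fst p) \<and> S (snd q) (snd p)}"
    obtain a \<delta> where a: "\<delta> > 0" "R (fst p) (fst p) \<Longrightarrow> a = u (fst p)"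
      "\<And>s'. R s' (fst p) \<Longrightarrow> \<bar>s' - fst p\<bar> < \<delta> \<Longrightarrow> u s' = a"
      using locally_step_side[OF u R, of "fst p"] by blast
    obtain b \<delta>' where b: "\<delta>' > 0" "S (snd p) (snd p) \<Longrightarrow> b = v (snd p)"
      "\<And>s'. S s' (snd p) \<Longrightarrow> \<bar>s' - snd p\<bar> < \<delta>' \<Longrightarrow> v s' = b"
      using locally_step_side[OF v S, of "snd p"] by blast
    have "\<forall>\<^sub>F q in at p within ?Q. G a b q = ?x q"
      unfolding eventually_at
    proof (intro exI[of _ "min \<delta> \<delta>'"] conjI ballI impI)
      fix q assume q: "q \<in> ?Q" "q \<noteq> p \<and> dist q p < min \<delta> \<delta>'"
      have "\<bar>fst q - fst p\<bar> \<le> dist q p" using dist_fst_le[of q p] by (simp add: dist_real_def)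
      moreover have "\<bar>snd q - snd p\<bar> \<le> dist q p" using dist_snd_le[of q p] by (simp add: dist_real_def)
      ultimately show "G a b q = ?x q" using q a(3)[of "fst q"] b(3)[of "snd q"] by simp
    qed (use a b in auto)
    moreover have "(G a b \<longlongrightarrow> G a b p) (at p within ?Q)"
      using G[of a b] p by (auto simp: continuous_on_def intro: tendsto_within_subset)
    ultimately have "(?x \<longlongrightarrow> G a b p) (at p within ?Q)" by (rule Lim_transform_eventually[rotated])
    then show ?thesis using a(2) b(2) p by (intro exI[of _ "G a b p"]) auto
  qed
  show ?thesis
    unfolding skorokhod_space_def
  proof (intro CollectI conjI ballI)
    fix p assume p: "p \<in> unit_square"
    show "(?x \<longlongrightarrow> ?x p) (at p within {q \<in> unit_square. fst p \<le> fst q \<and> snd p \<le> snd q})"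
      using orthant[OF p, of "(\<ge>)" "(\<ge>)"] by auto
    fix R S :: "real \<Rightarrow> real \<Rightarrow> bool" assume "R \<in> {(<), (\<ge>)}" "S \<in> {(<), (\<ge>)}"
    then show "\<exists>l. (?x \<longlongrightarrow> l) (at p within {q \<in> unit_square. R (fst q) (fst p) \<and> S (snd q) (snd p)})"
      using orthant[OF p] by blast
  qed auto
qed

lemma skorokhod_space_continuous:
  assumes "continuous_on unit_square f"
  shows "restrict f unit_square \<in> skorokhod_space"
  using skorokhod_spaceI[OF locally_step_const locally_step_const, of "\<lambda>_ _. f"] assms by simp

lemma skorokhod_dist_le_uniform:
  assumes "x \<in> skorokhod_space" "y \<in> skorokhod_space" "0 \<le> r" "\<And>p. p \<in> unit_square \<Longrightarrow> \<bar>x p - y p\<bar> \<le> r"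
  shows "skorokhod_dist x y \<le> r"
  by (rule skorokhod_dist_le[OF assms(1,2) time_changes_id time_changes_id])
     (use assms in \<open>auto simp: unit_square_def\<close>)

interpretation skorokhod: Metric_space skorokhod_space skorokhod_dist
  rewrites "Metric_space.mtopology skorokhod_space skorokhod_dist = skorokhod_topology"
  by (rule Metric_space_skorokhod) (simp add: skorokhod_topology_def)

definition bilinear_path :: "nat \<Rightarrow> (nat \<Rightarrow> nat \<Rightarrow> real) \<Rightarrow> (nat \<Rightarrow> real) \<Rightarrow> (nat \<Rightarrow> real) \<Rightarrow> real \<times> real \<Rightarrow> real" where
  "bilinear_path n a r c = (\<lambda>(s, t)\<in>unit_square.
     \<Sum>i<n. \<Sum>j<n. a i j * (indicator {..s} (r i) - s) * (indicator {..t} (c j) - t))"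

lemma bilinear_path_apply:
  assumes "s \<in> {0..1}" "t \<in> {0..1}"
  shows "bilinear_path n a r c (s, t) = (\<Sum>i<n. \<Sum>j<n. a i j * (indicator {..s} (r i) - s) * (indicator {..t} (c j) - t))"
  using assms by (simp add: bilinear_path_def unit_square_def)

lemma bilinear_path_in_skorokhod: "bilinear_path n a r c \<in> skorokhod_space"
proof -
  define G where "G A B = (\<lambda>q. \<Sum>i<n. \<Sum>j<n. a i j * ((if i \<in> A then 1 else 0) - fst q) * ((if j \<in> B then 1 else 0) - snd q))"
    for A B :: "nat set"
  have "bilinear_path n a r c =
      restrict (\<lambda>q. G {i \<in> {..<n}. r i \<le> fst q} {j \<in> {..<n}. c j \<le> snd q} q) unit_square"
    unfolding bilinear_path_def G_def
    by (intro restrict_ext) (auto simp: split_beta indicator_def intro!: sum.cong)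
  also have "\<dots> \<in> skorokhod_space"
    by (rule skorokhod_spaceI[OF locally_step_below locally_step_below]) (auto simp: G_def intro!: continuous_intros)
  finally show ?thesis .
qed

text \<open>
  Finitely many interior points can be moved slightly by a time change built from disjoint tent functions.
\<close>

lemma time_change_moving_points:
  fixes A :: "real set"
  assumes A: "finite A" "A \<subseteq> {0<..<1}"
  obtains \<eta> where "\<eta> > 0" "\<And>\<psi> \<epsilon> :: real. (\<And>\<rho>. \<rho> \<in> A \<Longrightarrow> \<bar>\<psi> \<rho> - \<rho>\<bar> \<le> \<epsilon>) \<Longrightarrow> card A * \<epsilon> < \<eta> \<Longrightarrow>
      \<exists>f\<in>time_changes. (\<forall>\<rho>\<in>A. f \<rho> = \<psi> \<rho>) \<and> (\<forall>s. \<bar>f s - s\<bar> \<le> card A * \<epsilon>)"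
proof -
  have "\<exists>\<eta>>0. \<forall>x\<in>A \<union> {0, 1}. x \<noteq> a \<longrightarrow> \<eta> \<le> dist a x" for a
    using A by (intro finite_set_avoid) auto
  then obtain h where h: "\<And>a. h a > 0" "\<And>a x. x \<in> A \<union> {0, 1} \<Longrightarrow> x \<noteq> a \<Longrightarrow> h a \<le> dist a x" by metis
  define \<eta> where "\<eta> = Min (insert 1 (h ` A))"
  have \<eta>0: "\<eta> > 0" unfolding \<eta>_def using A h by (subst Min_gr_iff) auto
  have \<eta>: "\<eta> \<le> \<bar>\<rho> - x\<bar>" if "\<rho> \<in> A" "x \<in> A \<union> {0, 1}" "x \<noteq> \<rho>" for \<rho> x
  proof -
    have "\<eta> \<le> h \<rho>" unfolding \<eta>_def using A that by (intro Min_le) auto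
    then show ?thesis using h(2)[OF that(2,3)] by (simp add: dist_real_def)
  qed
  define tent where "tent \<rho> s = max 0 (1 - \<bar>s - \<rho>\<bar> / \<eta>)" for \<rho> s :: real
  have tent_self: "tent \<rho> \<rho> = 1" for \<rho> by (simp add: tent_def)
  have tent_other: "tent \<rho> x = 0" if "\<rho> \<in> A" "x \<in> A \<union> {0, 1}" "x \<noteq> \<rho>" for \<rho> x
    using \<eta>[OF that] \<eta>0 by (simp add: tent_def field_simps abs_minus_commute)
  have tent_lip: "\<bar>tent \<rho> s - tent \<rho> s'\<bar> \<le> \<bar>s - s'\<bar> / \<eta>" for \<rho> s s'
  proof -
    have "\<bar>tent \<rho> s - tent \<rho> s'\<bar> \<le> \<bar>\<bar>s - \<rho>\<bar> / \<eta> - \<bar>s' - \<rho>\<bar> / \<eta>\<bar>" unfolding tent_def by linarith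
    also have "\<dots> = \<bar>\<bar>s - \<rho>\<bar> - \<bar>s' - \<rho>\<bar>\<bar> / \<eta>" using \<eta>0 by (simp add: diff_divide_distrib[symmetric])
    also have "\<dots> \<le> \<bar>s - s'\<bar> / \<eta>" using \<eta>0 by (intro divide_right_mono) linarith+
    finally show ?thesis .
  qed
  have tent01: "0 \<le> tent \<rho> s" "tent \<rho> s \<le> 1" for \<rho> s using \<eta>0 by (auto simp: tent_def)
  show ?thesis
  proof (rule that[OF \<eta>0])
    fix \<psi> and \<epsilon> :: real assume \<psi>: "\<And>\<rho>. \<rho> \<in> A \<Longrightarrow> \<bar>\<psi> \<rho> - \<rho>\<bar> \<le> \<epsilon>" and small: "card A * \<epsilon> < \<eta>"
    define f where "f s = s + (\<Sum>\<rho>\<in>A. (\<psi> \<rho> - \<rho>) * tent \<rho> s)" for s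
    have f_A: "f \<rho> = \<psi> \<rho>" if \<rho>: "\<rho> \<in> A" for \<rho>
    proof -
      have "(\<Sum>\<rho>'\<in>A. (\<psi> \<rho>' - \<rho>') * tent \<rho>' \<rho>) = (\<Sum>\<rho>'\<in>A. if \<rho>' = \<rho> then \<psi> \<rho> - \<rho> else 0)"
        using \<rho> by (intro sum.cong) (auto simp: tent_self tent_other)
      then show ?thesis using \<rho> A by (simp add: f_def)
    qed
    have f01: "f x = x" if "x \<in> {0, 1}" for x
    proof -
      have "tent \<rho> x = 0" if "\<rho> \<in> A" for \<rho>
        using that \<open>x \<in> {0,1}\<close> A by (intro tent_other) auto
      then show ?thesis by (simp add: f_def)
    qed
    have near: "\<bar>f s - s\<bar> \<le> card A * \<epsilon>" for s
    proof -
      have "\<bar>f s - s\<bar> \<le> (\<Sum>\<rho>\<in>A. \<bar>(\<psi> \<rho> - \<rho>) * tent \<rho> s\<bar>)" unfolding f_def by simp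
      also have "\<dots> \<le> (\<Sum>\<rho>\<in>A. \<epsilon> * 1)"
        unfolding abs_mult using \<psi> tent01 by (intro sum_mono mult_mono) (auto intro: order_trans[OF abs_ge_zero])
      finally show ?thesis by simp
    qed
    have mono: "f s < f s'" if "s < s'" for s s'
    proof -
      have "\<bar>\<Sum>\<rho>\<in>A. (\<psi> \<rho> - \<rho>) * (tent \<rho> s' - tent \<rho> s)\<bar> \<le> (\<Sum>\<rho>\<in>A. \<bar>(\<psi> \<rho> - \<rho>) * (tent \<rho> s' - tent \<rho> s)\<bar>)"
        by (rule sum_abs)
      also have "\<dots> \<le> (\<Sum>\<rho>\<in>A. \<epsilon> * (\<bar>s' - s\<bar> / \<eta>))"
        unfolding abs_mult using \<psi> tent_lip by (intro sum_mono mult_mono) (auto intro: order_trans[OF abs_ge_zero])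
      also have "\<dots> = (card A * \<epsilon>) * ((s' - s) / \<eta>)" using that by simp
      also have "\<dots> < \<eta> * ((s' - s) / \<eta>)" using small that \<eta>0 by (intro mult_strict_right_mono) auto
      also have "\<dots> = s' - s" using \<eta>0 by simp
      finally have "\<bar>\<Sum>\<rho>\<in>A. (\<psi> \<rho> - \<rho>) * (tent \<rho> s' - tent \<rho> s)\<bar> < s' - s" .
      moreover have "f s' - f s = (s' - s) + (\<Sum>\<rho>\<in>A. (\<psi> \<rho> - \<rho>) * (tent \<rho> s' - tent \<rho> s))"
        by (simp add: f_def algebra_simps sum_subtractf)
      ultimately show ?thesis by linarith
    qed
    have "continuous_on {0..1} f" unfolding f_def tent_def using \<eta>0 by (intro continuous_intros) auto
    then have "f \<in> time_changes" using mono f01 by (auto simp: time_changes_def strict_mono_on_def)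
    then show "\<exists>f\<in>time_changes. (\<forall>\<rho>\<in>A. f \<rho> = \<psi> \<rho>) \<and> (\<forall>s. \<bar>f s - s\<bar> \<le> card A * \<epsilon>)"
      using f_A near by blast
  qed
qed

lemma ceiling_discretization_near: "\<bar>real_of_int \<lceil>real (Suc k) * x\<rceil> / real (Suc k) - x\<bar> \<le> 1 / real (Suc k)"
proof -
  define m where "m = real (Suc k)"
  have m: "m > 0" by (simp add: m_def)
  have "real_of_int \<lceil>m * x\<rceil> / m - x = (real_of_int \<lceil>m * x\<rceil> - m * x) / m" using m by (simp add: field_simps)
  moreover have "\<bar>real_of_int \<lceil>m * x\<rceil> - m * x\<bar> \<le> 1" by linarith
  ultimately have "\<bar>real_of_int \<lceil>m * x\<rceil> / m - x\<bar> \<le> 1 / m" using m by (simp add: abs_divide divide_right_mono)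
  then show ?thesis unfolding m_def .
qed

text \<open>rounding up keeps 0 and 1 fixed and never moves a point across them\<close>

lemma time_change_discretization:
  fixes r :: "nat \<Rightarrow> real" and n :: nat
  defines "\<psi> \<equiv> \<lambda>k x. real_of_int \<lceil>real (Suc k) * x\<rceil> / real (Suc k)"
  shows "\<forall>\<^sub>F k in sequentially. \<exists>f\<in>time_changes. (\<forall>s. \<bar>f s - s\<bar> \<le> n / real (Suc k)) \<and>
     (\<forall>i<n. \<forall>s\<in>{0..1}. r i \<le> s \<longleftrightarrow> \<psi> k (r i) \<le> f s)"
proof -
  define A where "A = r ` {..<n} \<inter> {0<..<1}"
  have A: "finite A" "A \<subseteq> {0<..<1}" by (auto simp: A_def)
  have "card A \<le> card (r ` {..<n})" unfolding A_def by (intro card_mono) auto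
  also have "\<dots> \<le> n" using card_image_le[of "{..<n}" r] by simp
  finally have cardA: "card A \<le> n" .
  obtain \<eta> where \<eta>: "\<eta> > 0" "\<And>\<psi> \<epsilon> :: real. (\<And>\<rho>. \<rho> \<in> A \<Longrightarrow> \<bar>\<psi> \<rho> - \<rho>\<bar> \<le> \<epsilon>) \<Longrightarrow> card A * \<epsilon> < \<eta> \<Longrightarrow>
      \<exists>f\<in>time_changes. (\<forall>\<rho>\<in>A. f \<rho> = \<psi> \<rho>) \<and> (\<forall>s. \<bar>f s - s\<bar> \<le> card A * \<epsilon>)"
    using time_change_moving_points[OF A] by metis
  have "(\<lambda>k. real (card A) * (1 / real (Suc k))) \<longlonglongrightarrow> real (card A) * 0"
    using LIMSEQ_inverse_real_of_nat by (intro tendsto_mult_left) (simp add: inverse_eq_divide)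
  then have "\<forall>\<^sub>F k in sequentially. card A * (1 / real (Suc k)) < \<eta>"
    by (rule order_tendstoD) (use \<eta> in auto)
  then show ?thesis
  proof eventually_elim
    case (elim k)
    have "\<exists>f\<in>time_changes. (\<forall>\<rho>\<in>A. f \<rho> = \<psi> k \<rho>) \<and> (\<forall>s. \<bar>f s - s\<bar> \<le> card A * (1 / real (Suc k)))"
    proof (rule \<eta>(2)[OF _ elim])
      show "\<bar>\<psi> k \<rho> - \<rho>\<bar> \<le> 1 / real (Suc k)" for \<rho> unfolding \<psi>_def by (rule ceiling_discretization_near)
    qed
    then obtain f where f: "f \<in> time_changes" "\<And>\<rho>. \<rho> \<in> A \<Longrightarrow> f \<rho> = \<psi> k \<rho>" "\<And>s. \<bar>f s - s\<bar> \<le> card A * (1 / real (Suc k))"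
      by (elim bexE conjE) simp
    have "card A * (1 / real (Suc k)) \<le> n / real (Suc k)" using cardA by (simp add: divide_right_mono)
    then have near: "\<bar>f s - s\<bar> \<le> n / real (Suc k)" for s using f(3)[of s] by linarith
    have sm: "strict_mono_on {0..1} f" using f(1) by (simp add: time_changes_def)
    have "r i \<le> s \<longleftrightarrow> \<psi> k (r i) \<le> f s" if i: "i < n" and s: "s \<in> {0..1}" for i s
    proof -
      have fs: "0 \<le> f s" "f s \<le> 1" using time_changes_mem[OF f(1) s] by auto
      have up: "x \<le> \<psi> k x" for x unfolding \<psi>_def
        using ceiling_correct[of "real (Suc k) * x"] by (simp add: field_simps del: of_nat_Suc)
      have "r i \<in> A" if "0 < r i" "r i < 1" using i that unfolding A_def by simp
      then consider "r i \<le> 0" | "r i \<in> A" | "r i = 1" | "r i > 1" by linarith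
      then show ?thesis
      proof cases
        case 1
        then have "real (Suc k) * r i \<le> 0" by (intro mult_nonneg_nonpos) auto
        then have "\<lceil>real (Suc k) * r i\<rceil> \<le> 0" unfolding ceiling_le_zero .
        then have "\<psi> k (r i) \<le> 0" unfolding \<psi>_def by (intro divide_nonpos_pos) (simp_all del: of_nat_Suc ceiling_le_zero)
        then have "\<psi> k (r i) \<le> f s" using fs by linarith
        then show ?thesis using 1 s by auto
      next
        case 2
        then have "r i \<in> {0..1}" using A by auto
        then have "f (r i) \<le> f s \<longleftrightarrow> r i \<le> s" using sm s by (intro strict_mono_on_less_eq)
        then show ?thesis unfolding f(2)[OF 2] by blast
      next
        case 3
        have "\<psi> k 1 = 1" unfolding \<psi>_def by (simp del: of_nat_Suc)
        moreover have "f 1 = 1" using f(1) unfolding time_changes_def by blast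
        moreover have "f 1 \<le> f s \<longleftrightarrow> 1 \<le> s" using sm s by (intro strict_mono_on_less_eq) auto
        ultimately show ?thesis unfolding 3 by simp
      next
        case 4
        have "\<not> r i \<le> s" "\<not> \<psi> k (r i) \<le> f s" using up[of "r i"] s fs 4 by (simp, linarith)
        then show ?thesis by blast
      qed
    qed
    then show ?case using f(1) near by (intro bexI[of _ f] conjI allI impI ballI) auto
  qed
qed

lemma abs_indicator_diff_le_one: "\<bar>indicator A x - s\<bar> \<le> 1" if "s \<in> {0..1}" for s :: real
  using that by (cases "x \<in> A") auto

lemma triple_product_diff:
  fixes a a' x x' y y' :: real
  assumes "\<bar>x\<bar> \<le> 1" "\<bar>x'\<bar> \<le> 1" "\<bar>y\<bar> \<le> 1" "\<bar>y'\<bar> \<le> 1" "\<bar>a - a'\<bar> \<le> e" "\<bar>a\<bar> \<le> K" "\<bar>x - x'\<bar> \<le> d" "\<bar>y - y'\<bar> \<le> d"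
  shows "\<bar>a * x * y - a' * x' * y'\<bar> \<le> e + K * (2 * d)"
proof -
  have m: "\<bar>p * (q * r)\<bar> \<le> P * (Q * R)" if "\<bar>p\<bar> \<le> P" "\<bar>q\<bar> \<le> Q" "\<bar>r\<bar> \<le> R" for p q r P Q R :: real
    using that unfolding abs_mult by (intro mult_mono) (auto intro: order_trans[OF abs_ge_zero])
  have 1: "\<bar>a * ((x - x') * y)\<bar> \<le> K * (d * 1)" by (rule m) (rule assms)+
  have 2: "\<bar>a * (x' * (y - y'))\<bar> \<le> K * (1 * d)" by (rule m) (rule assms)+
  have 3: "\<bar>(a - a') * (x' * y')\<bar> \<le> e * (1 * 1)" by (rule m) (rule assms)+
  have "a * x * y - a' * x' * y' = a * ((x - x') * y) + a * (x' * (y - y')) + (a - a') * (x' * y')"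
    by (simp add: algebra_simps)
  also have "\<bar>\<dots>\<bar> \<le> K * (d * 1) + K * (1 * d) + e * (1 * 1)"
    by (intro order_trans[OF abs_triangle_ineq] add_mono 1 2 3)
  finally show ?thesis by simp
qed

lemma bilinear_path_perturbation:
  assumes s: "s \<in> {0..1}" "s' \<in> {0..1}" and t: "t \<in> {0..1}" "t' \<in> {0..1}"
    and r: "\<And>i. i < n \<Longrightarrow> r i \<le> s \<longleftrightarrow> r' i \<le> s'" and c: "\<And>j. j < n \<Longrightarrow> c j \<le> t \<longleftrightarrow> c' j \<le> t'"
    and a: "\<And>i j. i < n \<Longrightarrow> j < n \<Longrightarrow> \<bar>a i j - a' i j\<bar> \<le> e" "\<And>i j. i < n \<Longrightarrow> j < n \<Longrightarrow> \<bar>a i j\<bar> \<le> K"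
    and d: "\<bar>s' - s\<bar> \<le> d" "\<bar>t' - t\<bar> \<le> d"
  shows "\<bar>bilinear_path n a r c (s, t) - bilinear_path n a' r' c' (s', t')\<bar> \<le> real n * (real n * (e + K * (2 * d)))"
proof -
  have T: "\<bar>a i j * (indicator {..s} (r i) - s) * (indicator {..t} (c j) - t) -
      a' i j * (indicator {..s'} (r' i) - s') * (indicator {..t'} (c' j) - t')\<bar> \<le> e + K * (2 * d)"
    if ij: "i < n" "j < n" for i j
  proof (rule triple_product_diff)
    have "indicator {..s} (r i) = (indicator {..s'} (r' i) :: real)"
      unfolding indicator_def atMost_iff r[OF ij(1)] ..
    then show "\<bar>(indicator {..s} (r i) - s) - (indicator {..s'} (r' i) - s')\<bar> \<le> d" using d by simp
    have "indicator {..t} (c j) = (indicator {..t'} (c' j) :: real)"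
      unfolding indicator_def atMost_iff c[OF ij(2)] ..
    then show "\<bar>(indicator {..t} (c j) - t) - (indicator {..t'} (c' j) - t')\<bar> \<le> d" using d by simp
  qed (rule abs_indicator_diff_le_one s t a ij)+
  have "\<bar>bilinear_path n a r c (s, t) - bilinear_path n a' r' c' (s', t')\<bar> \<le> (\<Sum>i<n. \<Sum>j<n. e + K * (2 * d))"
    unfolding bilinear_path_apply[OF s(1) t(1)] bilinear_path_apply[OF s(2) t(2)] sum_subtractf[symmetric]
    by (rule order_trans[OF sum_abs], rule sum_mono, rule order_trans[OF sum_abs], rule sum_mono, rule T) auto
  then show ?thesis by simp
qed

text \<open>
  Rounding the data up to a grid moves the jumps by little, and a time change undoes the
  movement, so the discretised paths converge in the Skorokhod distance. Uniform convergence fails here.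
\<close>

lemma bilinear_path_measurable:
  assumes a: "\<And>i j. i < n \<Longrightarrow> j < n \<Longrightarrow> a i j \<in> borel_measurable M"
    and r: "\<And>i. i < n \<Longrightarrow> r i \<in> borel_measurable M" and c: "\<And>i. i < n \<Longrightarrow> c i \<in> borel_measurable M"
  shows "(\<lambda>w. bilinear_path n (\<lambda>i j. a i j w) (\<lambda>i. r i w) (\<lambda>j. c j w)) \<in> M \<rightarrow>\<^sub>M borel_of skorokhod_topology"
proof -
  \<comment> \<open>all the data in one finite index set\<close>
  define I :: "(nat + nat + nat \<times> nat) set" where "I = {..<n} <+> {..<n} <+> {..<n} \<times> {..<n}"
  define X where "X = (\<lambda>q. case q of Inl i \<Rightarrow> r i | Inr (Inl j) \<Rightarrow> c j | Inr (Inr (i, j)) \<Rightarrow> a i j)"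
  define \<Phi> where "\<Phi> x = bilinear_path n (\<lambda>i j. x (Inr (Inr (i, j)))) (\<lambda>i. x (Inl i)) (\<lambda>j. x (Inr (Inl j)))" for x
  have cong: "bilinear_path n a r c = bilinear_path n a' r' c'"
    if "\<And>i j. i < n \<Longrightarrow> j < n \<Longrightarrow> a i j = a' i j" "\<And>i. i < n \<Longrightarrow> r i = r' i" "\<And>i. i < n \<Longrightarrow> c i = c' i" for a r c a' r' c'
    unfolding bilinear_path_def using that by (intro restrict_ext) (auto intro!: sum.cong)
  have "(\<lambda>w. \<Phi> (\<lambda>i\<in>I. X i w)) \<in> M \<rightarrow>\<^sub>M borel_of skorokhod_topology"
  proof (rule skorokhod.measurable_of_discretizations)
    show "finite I" by (simp add: I_def)
    show "X i \<in> borel_measurable M" if "i \<in> I" for i using that a r c by (auto simp: I_def X_def)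
    show "\<Phi> x \<in> skorokhod_space" for x unfolding \<Phi>_def by (rule bilinear_path_in_skorokhod)
    fix x :: "nat + nat + nat \<times> nat \<Rightarrow> real"
    define \<psi> where "\<psi> k x = real_of_int \<lceil>real (Suc k) * x\<rceil> / real (Suc k)" for k x
    define K where "K = (\<Sum>i<n. \<Sum>j<n. \<bar>x (Inr (Inr (i, j)))\<bar>)"
    have K: "\<bar>x (Inr (Inr (i, j)))\<bar> \<le> K" if "i < n" "j < n" for i j
    proof -
      have "\<bar>x (Inr (Inr (i, j)))\<bar> \<le> (\<Sum>j<n. \<bar>x (Inr (Inr (i, j)))\<bar>)" using that by (intro member_le_sum) auto
      also have "\<dots> \<le> K" unfolding K_def
        using that by (intro member_le_sum[of i _ "\<lambda>i. \<Sum>j<n. \<bar>x (Inr (Inr (i, j)))\<bar>"]) (auto intro: sum_nonneg)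
      finally show ?thesis .
    qed
    define L where "L = real n + real n * (real n * (1 + K * (2 * n)))"
    have K0: "0 \<le> K" unfolding K_def by (intro sum_nonneg) auto
    show "(\<lambda>k. skorokhod_dist (\<Phi> (\<lambda>i\<in>I. real_of_int \<lceil>real (Suc k) * x i\<rceil> / real (Suc k))) (\<Phi> x)) \<longlonglongrightarrow> 0"
    proof (rule tendsto_sandwich[OF always_eventually _ tendsto_const])
      show "\<forall>k. 0 \<le> skorokhod_dist (\<Phi> (\<lambda>i\<in>I. real_of_int \<lceil>real (Suc k) * x i\<rceil> / real (Suc k))) (\<Phi> x)" by simp
      have "(\<lambda>k. L * (1 / real (Suc k))) \<longlonglongrightarrow> L * 0"
        using LIMSEQ_inverse_real_of_nat by (intro tendsto_mult_left) (simp add: inverse_eq_divide)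
      then show "(\<lambda>k. L * (1 / real (Suc k))) \<longlonglongrightarrow> 0" by simp
      show "\<forall>\<^sub>F k in sequentially. skorokhod_dist (\<Phi> (\<lambda>i\<in>I. real_of_int \<lceil>real (Suc k) * x i\<rceil> / real (Suc k))) (\<Phi> x) \<le> L * (1 / real (Suc k))"
        using time_change_discretization[of n "\<lambda>i. x (Inl i)"] time_change_discretization[of n "\<lambda>i. x (Inr (Inl i))"]
      proof eventually_elim
        case (elim k)
        define e where "e = 1 / real (Suc k)"
        have e: "0 \<le> e" by (simp add: e_def)
        have eq: "\<Phi> (\<lambda>i\<in>I. real_of_int \<lceil>real (Suc k) * x i\<rceil> / real (Suc k)) =
           bilinear_path n (\<lambda>i j. \<psi> k (x (Inr (Inr (i, j))))) (\<lambda>i. \<psi> k (x (Inl i))) (\<lambda>j. \<psi> k (x (Inr (Inl j))))"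
          unfolding \<Phi>_def \<psi>_def by (rule cong) (auto simp: I_def)
        have ne: "real n / real (Suc k) = n * e" by (simp add: e_def)
        obtain f where f: "f \<in> time_changes" "\<And>s. \<bar>f s - s\<bar> \<le> n * e"
           "\<And>i s. i < n \<Longrightarrow> s \<in> {0..1} \<Longrightarrow> x (Inl i) \<le> s \<longleftrightarrow> \<psi> k (x (Inl i)) \<le> f s"
          using elim(1)[folded \<psi>_def, unfolded ne] by blast
        obtain g where g: "g \<in> time_changes" "\<And>s. \<bar>g s - s\<bar> \<le> n * e"
           "\<And>i s. i < n \<Longrightarrow> s \<in> {0..1} \<Longrightarrow> x (Inr (Inl i)) \<le> s \<longleftrightarrow> \<psi> k (x (Inr (Inl i))) \<le> g s"
          using elim(2)[folded \<psi>_def, unfolded ne] by blast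
        have L1: "n * e \<le> L * e" using e K0 by (intro mult_right_mono) (auto simp: L_def)
        have "skorokhod_dist (\<Phi> x) (\<Phi> (\<lambda>i\<in>I. real_of_int \<lceil>real (Suc k) * x i\<rceil> / real (Suc k))) \<le> L * e"
          unfolding eq
        proof (rule skorokhod_dist_le[OF _ _ f(1) g(1)])
          show "\<Phi> x \<in> skorokhod_space" unfolding \<Phi>_def by (rule bilinear_path_in_skorokhod)
          show "\<bar>f t - t\<bar> \<le> L * e" for t using f(2)[of t] L1 by linarith
          show "\<bar>g t - t\<bar> \<le> L * e" for t using g(2)[of t] L1 by linarith
          fix s t :: real assume st: "s \<in> {0..1}" "t \<in> {0..1}"
          note fs = time_changes_mem[OF f(1) st(1)] and gt = time_changes_mem[OF g(1) st(2)]
          have "\<bar>\<Phi> x (s, t) - bilinear_path n (\<lambda>i j. \<psi> k (x (Inr (Inr (i, j))))) (\<lambda>i. \<psi> k (x (Inl i))) (\<lambda>j. \<psi> k (x (Inr (Inl j)))) (f s, g t)\<bar>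
              \<le> real n * (real n * (e + K * (2 * (n * e))))"
            unfolding \<Phi>_def
          proof (rule bilinear_path_perturbation)
            show "\<bar>x (Inr (Inr (i, j))) - \<psi> k (x (Inr (Inr (i, j))))\<bar> \<le> e" for i j
              using ceiling_discretization_near[of k "x (Inr (Inr (i, j)))"] unfolding \<psi>_def e_def by linarith
          qed (rule st fs gt f(2,3) g(2,3) K st; assumption?)+
          also have "\<dots> = real n * (real n * (1 + K * (2 * n))) * e"
            by (simp only: distrib_left distrib_right mult.assoc mult_1_left)
          also have "\<dots> \<le> L * e" using e by (intro mult_right_mono) (simp_all add: L_def)
          finally show "\<bar>\<Phi> x (s, t) - bilinear_path n (\<lambda>i j. \<psi> k (x (Inr (Inr (i, j))))) (\<lambda>i. \<psi> k (x (Inl i))) (\<lambda>j. \<psi> k (x (Inr (Inl j)))) (f s, g t)\<bar> \<le> L * e" .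
        qed (rule bilinear_path_in_skorokhod)
        then show ?case by (simp add: e_def skorokhod.commute)
      qed
    qed
  qed
  moreover have "\<Phi> (\<lambda>i\<in>I. X i w) = bilinear_path n (\<lambda>i j. a i j w) (\<lambda>i. r i w) (\<lambda>j. c j w)" for w
    unfolding \<Phi>_def by (rule cong) (auto simp: I_def X_def)
  ultimately show ?thesis by simp
qed

section \<open>Sums of independent bounded variables\<close>

lemma (in prob_space) indep_bounded_mult:
  fixes X Y :: "'a \<Rightarrow> real" and f g :: "real \<Rightarrow> real"
  assumes ind: "indep_var borel X borel Y" and [measurable]: "f \<in> borel_measurable borel" "g \<in> borel_measurable borel"
    and f: "\<And>w. w \<in> space M \<Longrightarrow> \<bar>f (X w)\<bar> \<le> A" and g: "\<And>w. w \<in> space M \<Longrightarrow> \<bar>g (Y w)\<bar> \<le> B"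
  shows "expectation (\<lambda>w. f (X w) * g (Y w)) = expectation (\<lambda>w. f (X w)) * expectation (\<lambda>w. g (Y w))"
proof -
  have [measurable]: "X \<in> borel_measurable M" "Y \<in> borel_measurable M"
    using ind by (auto dest: indep_var_rv1 indep_var_rv2)
  have "indep_var borel (f \<circ> X) borel (g \<circ> Y)" by (rule indep_var_compose[OF ind]) auto
  moreover have "integrable M (f \<circ> X)" using f by (intro integrable_of_bounded[of _ A]) auto
  moreover have "integrable M (g \<circ> Y)" using g by (intro integrable_of_bounded[of _ B]) auto
  ultimately have "expectation (\<lambda>w. (f \<circ> X) w * (g \<circ> Y) w) = expectation (f \<circ> X) * expectation (g \<circ> Y)"
    by (intro indep_var_lebesgue_integral)
  then show ?thesis by (simp add: o_def)
qed

text \<open>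
  Expanding the fourth power one summand at a time, independence and centring remove all odd terms.
\<close>

lemma (in prob_space) indep_sum_moments:
  fixes X :: "'i \<Rightarrow> 'a \<Rightarrow> real"
  assumes "finite I" "indep_vars (\<lambda>_. borel) X I"
    and "\<And>i w. i \<in> I \<Longrightarrow> w \<in> space M \<Longrightarrow> \<bar>X i w\<bar> \<le> B i"
    and "\<And>i. i \<in> I \<Longrightarrow> expectation (X i) = 0"
    and "\<And>i. i \<in> I \<Longrightarrow> expectation (\<lambda>w. X i w ^ 2) \<le> v i"
    and "\<And>i. i \<in> I \<Longrightarrow> expectation (\<lambda>w. X i w ^ 4) \<le> q i"
  shows "expectation (\<lambda>w. \<Sum>i\<in>I. X i w) = 0 \<and>
    expectation (\<lambda>w. (\<Sum>i\<in>I. X i w) ^ 2) \<le> (\<Sum>i\<in>I. v i) \<and>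
    expectation (\<lambda>w. (\<Sum>i\<in>I. X i w) ^ 4) \<le> 3 * (\<Sum>i\<in>I. v i)\<^sup>2 + (\<Sum>i\<in>I. q i)"
  using assms
proof (induction I rule: finite_induct)
  case (insert i I)
  let ?S = "\<lambda>w. \<Sum>i\<in>I. X i w" and ?V = "\<Sum>i\<in>I. v i" and ?Q = "\<Sum>i\<in>I. q i" and ?B = "\<Sum>i\<in>I. B i"
  have IH: "expectation ?S = 0" "expectation (\<lambda>w. ?S w ^ 2) \<le> ?V" "expectation (\<lambda>w. ?S w ^ 4) \<le> 3 * ?V\<^sup>2 + ?Q"
    using insert.IH[OF indep_vars_subset[OF insert.prems(1)]] insert.prems by blast+
  have ind: "indep_var borel (X i) borel ?S" using insert.hyps insert.prems by (intro indep_vars_sum) auto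
  have [measurable]: "X i \<in> borel_measurable M" "?S \<in> borel_measurable M"
    using ind by (auto dest: indep_var_rv1 indep_var_rv2)
  have bX: "\<bar>X i w\<bar> \<le> B i" if "w \<in> space M" for w using insert.prems that by auto
  have bS: "\<bar>?S w\<bar> \<le> ?B" if "w \<in> space M" for w
    using insert.prems that by (intro order_trans[OF sum_abs] sum_mono) auto
  have bXp: "\<bar>X i w ^ k\<bar> \<le> B i ^ k" if "w \<in> space M" for w k
    unfolding power_abs using bX[OF that] by (intro power_mono) auto
  have bSp: "\<bar>?S w ^ k\<bar> \<le> ?B ^ k" if "w \<in> space M" for w k
    unfolding power_abs using bS[OF that] by (intro power_mono) auto
  have mult: "expectation (\<lambda>w. X i w ^ k * ?S w ^ l) = expectation (\<lambda>w. X i w ^ k) * expectation (\<lambda>w. ?S w ^ l)" for k l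
    by (rule indep_bounded_mult[OF ind, of "\<lambda>x. x ^ k" "\<lambda>x. x ^ l" "B i ^ k" "?B ^ l"]) (auto intro: bXp bSp)
  have int: "integrable M (\<lambda>w. X i w ^ k * ?S w ^ l)" for k l
  proof (rule integrable_of_bounded[of _ "B i ^ k * ?B ^ l"])
    fix w assume w: "w \<in> space M"
    show "norm (X i w ^ k * ?S w ^ l) \<le> B i ^ k * ?B ^ l"
      unfolding real_norm_def abs_mult using bXp[OF w, of k] bSp[OF w, of l]
      by (intro mult_mono) auto
  qed simp
  have intX: "integrable M (\<lambda>w. X i w ^ k)" for k using int[of k 0] by simp
  have intS: "integrable M (\<lambda>w. ?S w ^ l)" for l using int[of 0 l] by simp
  have sumI: "(\<Sum>j\<in>insert i I. X j w) = X i w + ?S w" for w using insert.hyps by simp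
  have X0: "expectation (X i) = 0" and X2: "expectation (\<lambda>w. X i w ^ 2) \<le> v i"
    and X4: "expectation (\<lambda>w. X i w ^ 4) \<le> q i" using insert.prems by auto
  have v0: "0 \<le> v i" using X2 by (intro order_trans[OF _ X2]) auto
  have S0: "0 \<le> expectation (\<lambda>w. ?S w ^ 2)" by simp
  have "expectation (\<lambda>w. X i w + ?S w) = 0"
    using intX[of 1] intS[of 1] X0 IH(1) by simp
  moreover have "expectation (\<lambda>w. (X i w + ?S w) ^ 2) \<le> v i + ?V"
  proof -
    have "expectation (\<lambda>w. (X i w + ?S w) ^ 2) =
        expectation (\<lambda>w. X i w ^ 2 + 2 * (X i w ^ 1 * ?S w ^ 1) + ?S w ^ 2)"
      by (simp add: power2_eq_square algebra_simps)
    also have "\<dots> = expectation (\<lambda>w. X i w ^ 2) + 2 * expectation (\<lambda>w. X i w ^ 1 * ?S w ^ 1) + expectation (\<lambda>w. ?S w ^ 2)"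
      using intX[of 2] intS[of 2] int[of 1 1] by simp
    also have "\<dots> \<le> v i + 2 * 0 + ?V" unfolding mult using X0 X2 IH by simp
    finally show ?thesis by simp
  qed
  moreover have "expectation (\<lambda>w. (X i w + ?S w) ^ 4) \<le> 3 * (v i + ?V)\<^sup>2 + (q i + ?Q)"
  proof -
    have "expectation (\<lambda>w. (X i w + ?S w) ^ 4) =
        expectation (\<lambda>w. X i w ^ 4 + 4 * (X i w ^ 3 * ?S w ^ 1) + 6 * (X i w ^ 2 * ?S w ^ 2) + 4 * (X i w ^ 1 * ?S w ^ 3) + ?S w ^ 4)"
      by (intro Bochner_Integration.integral_cong) (auto simp: power4_eq_xxxx power2_eq_square power3_eq_cube algebra_simps)
    also have "\<dots> = expectation (\<lambda>w. X i w ^ 4) + 4 * expectation (\<lambda>w. X i w ^ 3 * ?S w ^ 1) +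
       6 * expectation (\<lambda>w. X i w ^ 2 * ?S w ^ 2) + 4 * expectation (\<lambda>w. X i w ^ 1 * ?S w ^ 3) + expectation (\<lambda>w. ?S w ^ 4)"
      using intX[of 4] intS[of 4] int[of 3 1] int[of 2 2] int[of 1 3] by simp
    also have "\<dots> = expectation (\<lambda>w. X i w ^ 4) + 6 * (expectation (\<lambda>w. X i w ^ 2) * expectation (\<lambda>w. ?S w ^ 2)) + expectation (\<lambda>w. ?S w ^ 4)"
      unfolding mult using X0 IH(1) by simp
    also have "\<dots> \<le> q i + 6 * (v i * ?V) + (3 * ?V\<^sup>2 + ?Q)"
      using X2 X4 IH v0 S0 by (intro add_mono mult_left_mono mult_mono) auto
    also have "\<dots> \<le> 3 * (v i + ?V)\<^sup>2 + (q i + ?Q)"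
      using zero_le_power2[of "v i"] by (simp add: power2_eq_square algebra_simps)
    finally show ?thesis .
  qed
  ultimately show ?case unfolding sumI using insert.hyps by (simp add: algebra_simps)
qed (simp add: prob_space)

text \<open>
  Lindeberg's replacement argument for characteristic functions: each factor is compared with the
  Gaussian factor of the same variance.
\<close>

lemma (in prob_space) indep_sum_char_approx:
  fixes X :: "'i \<Rightarrow> 'a \<Rightarrow> real"
  assumes I: "finite I" and ind: "indep_vars (\<lambda>_. borel) X I"
    and B: "\<And>i w. i \<in> I \<Longrightarrow> w \<in> space M \<Longrightarrow> \<bar>X i w\<bar> \<le> B i"
    and mean: "\<And>i. i \<in> I \<Longrightarrow> expectation (X i) = 0"
    and var: "\<And>i. i \<in> I \<Longrightarrow> expectation (\<lambda>w. X i w ^ 2) = v i"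
  shows "cmod (expectation (\<lambda>w. iexp (\<Sum>i\<in>I. X i w)) - exp (- (\<Sum>i\<in>I. v i) / 2)) \<le> (\<Sum>i\<in>I. B i ^ 3 + B i ^ 4)"
proof -
  have meas: "X i \<in> borel_measurable M" if "i \<in> I" for i using ind that by (auto simp: indep_vars_def)
  have B0: "0 \<le> B i" if "i \<in> I" for i
  proof -
    obtain w where "w \<in> space M" using not_empty by blast
    from B[OF that this] show ?thesis by linarith
  qed
  have v0: "0 \<le> v i" if "i \<in> I" for i unfolding var[OF that, symmetric] by simp
  have vB: "v i \<le> B i ^ 2" if "i \<in> I" for i
  proof -
    have "X i w ^ 2 \<le> B i ^ 2" if "w \<in> space M" for w
      using power_mono[OF B[OF \<open>i \<in> I\<close> that] abs_ge_zero, of 2] by simp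
    then have "\<bar>expectation (\<lambda>w. X i w ^ 2)\<bar> \<le> B i ^ 2" by (intro abs_expectation_le) auto
    then show ?thesis using var[OF that] by simp
  qed
  have "expectation (\<lambda>w. iexp (\<Sum>i\<in>I. X i w)) = char (distr M borel (\<lambda>w. \<Sum>i\<in>I. X i w)) 1"
    unfolding char_def using meas by (subst integral_distr) auto
  also have "\<dots> = (\<Prod>i\<in>I. char (distr M borel (X i)) 1)" by (rule char_distr_sum[OF ind])
  finally have lhs: "expectation (\<lambda>w. iexp (\<Sum>i\<in>I. X i w)) = (\<Prod>i\<in>I. char (distr M borel (X i)) 1)" .
  have rhs: "complex_of_real (exp (- (\<Sum>i\<in>I. v i) / 2)) = (\<Prod>i\<in>I. complex_of_real (exp (- v i / 2)))"
    using I by (simp add: exp_sum[symmetric] sum_negf sum_divide_distrib of_real_prod[symmetric] del: of_real_prod)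
  have "cmod ((\<Prod>i\<in>I. char (distr M borel (X i)) 1) - (\<Prod>i\<in>I. complex_of_real (exp (- v i / 2))))
      \<le> (\<Sum>i\<in>I. cmod (char (distr M borel (X i)) 1 - complex_of_real (exp (- v i / 2))))"
  proof (rule norm_prod_diff)
    fix i assume i: "i \<in> I"
    interpret D: real_distribution "distr M borel (X i)" by (rule real_distribution_distr[OF meas[OF i]])
    show "cmod (char (distr M borel (X i)) 1) \<le> 1" by (rule D.cmod_char_le_1)
    show "cmod (complex_of_real (exp (- v i / 2))) \<le> 1" using v0[OF i] by simp
  qed
  also have "\<dots> \<le> (\<Sum>i\<in>I. B i ^ 3 + B i ^ 4)"
  proof (rule sum_mono)
    fix i assume i: "i \<in> I"
    have [measurable]: "X i \<in> borel_measurable M" by (rule meas[OF i])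
    have i1: "integrable M (X i)" using B[OF i] by (intro integrable_of_bounded[of _ "B i"]) auto
    have b2: "X i w ^ 2 \<le> B i ^ 2" if "w \<in> space M" for w
      using power_mono[OF B[OF i that] abs_ge_zero, of 2] by simp
    have i2: "integrable M (\<lambda>w. X i w ^ 2)" using b2 by (intro integrable_of_bounded[of _ "B i ^ 2"]) auto
    have "cmod (char (distr M borel (X i)) 1 - (1 - 1^2 * v i / 2)) \<le>
        (1^2 / 6) * expectation (\<lambda>w. min (6 * X i w ^ 2) (\<bar>1\<bar> * \<bar>X i w\<bar> ^ 3))"
      by (rule char_approx3'[OF _ i1 i2 mean[OF i]]) (auto simp: mean[OF i] var[OF i])
    also have "\<dots> \<le> (1 / 6) * B i ^ 3"
    proof -
      have "\<bar>min (6 * X i w ^ 2) (\<bar>1\<bar> * \<bar>X i w\<bar> ^ 3)\<bar> \<le> B i ^ 3" if "w \<in> space M" for w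
      proof -
        have "\<bar>X i w\<bar> ^ 3 \<le> B i ^ 3" using B[OF i that] by (intro power_mono) auto
        then show ?thesis by (auto simp: min_def)
      qed
      then have "\<bar>expectation (\<lambda>w. min (6 * X i w ^ 2) (\<bar>1\<bar> * \<bar>X i w\<bar> ^ 3))\<bar> \<le> B i ^ 3"
        using B0[OF i] by (intro abs_expectation_le) auto
      then show ?thesis by simp
    qed
    finally have 1: "cmod (char (distr M borel (X i)) 1 - (1 - v i / 2)) \<le> (1 / 6) * B i ^ 3" by simp
    have 2: "\<bar>(1 - v i / 2) - exp (- v i / 2)\<bar> \<le> (v i) ^ 2"
    proof -
      define y where "y = v i / 2"
      have y: "0 \<le> y" using v0[OF i] by (simp add: y_def)
      have l: "1 - y \<le> exp (- y)" using exp_ge_add_one_self[of "- y"] by simp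
      have "(1 + y) * exp (- y) \<le> 1"
        using exp_ge_add_one_self[of y] y by (simp add: exp_minus divide_simps)
      also have "1 \<le> 1 + y ^ 3" using y by simp
      also have "1 + y ^ 3 = (1 + y) * (1 - y + y ^ 2)" by (simp add: algebra_simps power2_eq_square power3_eq_cube)
      finally have "exp (- y) \<le> 1 - y + y ^ 2" using y by simp
      moreover have "y ^ 2 \<le> (v i) ^ 2" using v0[OF i] by (intro power_mono) (auto simp: y_def)
      ultimately show ?thesis using l by (simp add: y_def)
    qed
    have "(v i) ^ 2 \<le> (B i ^ 2) ^ 2" using vB[OF i] v0[OF i] by (intro power_mono)
    then have 3: "(v i) ^ 2 \<le> B i ^ 4" by (simp add: power_mult[symmetric])
    have "cmod (char (distr M borel (X i)) 1 - complex_of_real (exp (- v i / 2))) \<le>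
        cmod (char (distr M borel (X i)) 1 - (1 - v i / 2)) + cmod (complex_of_real ((1 - v i / 2) - exp (- v i / 2)))"
      by (rule order_trans[OF _ norm_triangle_ineq]) simp
    also have "\<dots> \<le> (1 / 6) * B i ^ 3 + B i ^ 4" using 1 2 3 unfolding norm_of_real by linarith
    also have "\<dots> \<le> B i ^ 3 + B i ^ 4" using B0[OF i] by simp
    finally show "cmod (char (distr M borel (X i)) 1 - complex_of_real (exp (- v i / 2))) \<le> B i ^ 3 + B i ^ 4" .
  qed
  finally show ?thesis unfolding lhs rhs .
qed

section \<open>Samples of uniform variables\<close>

definition centred_step :: "real \<Rightarrow> real \<Rightarrow> real" where
  "centred_step s r = indicator {..s} r - s"

definition bridge_cov :: "real \<Rightarrow> real \<Rightarrow> real" where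
  "bridge_cov s s' = min s s' - s * s'"

lemma centred_step_measurable [measurable]: "centred_step s \<in> borel_measurable borel"
  unfolding centred_step_def[abs_def] by measurable

lemma abs_centred_step_le: "s \<in> {0..1} \<Longrightarrow> \<bar>centred_step s r\<bar> \<le> 1"
  unfolding centred_step_def by (rule abs_indicator_diff_le_one)

locale uniform_sample = prob_space M for M :: "'a measure" +
  fixes n :: nat and R :: "nat \<Rightarrow> 'a \<Rightarrow> real"
  assumes R_measurable: "\<And>i. i < n \<Longrightarrow> R i \<in> borel_measurable M"
    and R_uniform: "\<And>i. i < n \<Longrightarrow> distr M lborel (R i) = uniform_measure lborel {0..1}"
    and R_indep: "indep_vars (\<lambda>_. borel) R {..<n}"
begin

lemma expectation_indicator:
  assumes i: "i < n" and s: "s \<in> {0..1}"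
  shows "expectation (\<lambda>w. indicator {..s} (R i w)) = s"
proof -
  have [measurable]: "R i \<in> borel_measurable M" by (rule R_measurable[OF i])
  have "expectation (\<lambda>w. indicator {..s} (R i w)) = (\<integral>x. (indicator {..s} x :: real) \<partial>distr M lborel (R i))"
    using integral_distr[of "R i" M lborel "indicator {..s} :: real \<Rightarrow> real"] by simp
  also have "\<dots> = measure (distr M lborel (R i)) {..s}" by simp
  also have "\<dots> = measure lborel ({0..1} \<inter> {..s}) / measure lborel {0..1::real}"
    unfolding R_uniform[OF i] by (rule measure_uniform_measure) auto
  also have "{0..1} \<inter> {..s} = {0..s}" using s by auto
  finally show ?thesis using s by simp
qed

lemma step_integrable:
  assumes "i < n" "s \<in> {0..1}"
  shows "integrable M (\<lambda>w. centred_step s (R i w))" "integrable M (\<lambda>w. indicator {..s} (R i w) :: real)"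
  using abs_centred_step_le[OF assms(2)] R_measurable[OF assms(1)]
  by (auto intro!: integrable_of_bounded[of _ 1] split: split_indicator)

lemma expectation_centred_step:
  assumes "i < n" "s \<in> {0..1}"
  shows "expectation (\<lambda>w. centred_step s (R i w)) = 0"
  using expectation_indicator[OF assms] step_integrable(2)[OF assms] by (simp add: centred_step_def prob_space)

lemma expectation_centred_step_mult:
  assumes i: "i < n" and s: "s \<in> {0..1}" and s': "s' \<in> {0..1}"
  shows "expectation (\<lambda>w. centred_step s (R i w) * centred_step s' (R i w)) = bridge_cov s s'"
proof -
  have m: "min s s' \<in> {0..1}" using s s' by auto
  have "expectation (\<lambda>w. centred_step s (R i w) * centred_step s' (R i w)) =
     expectation (\<lambda>w. indicator {..min s s'} (R i w) - s' * indicator {..s} (R i w) - s * indicator {..s'} (R i w) + s * s')"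
    by (intro Bochner_Integration.integral_cong) (auto simp: centred_step_def algebra_simps split: split_indicator)
  also have "\<dots> = min s s' - s' * s - s * s' + s * s'"
    using step_integrable(2)[OF i s] step_integrable(2)[OF i s'] step_integrable(2)[OF i m]
    by (simp add: expectation_indicator[OF i s] expectation_indicator[OF i s'] expectation_indicator[OF i m] prob_space)
  finally show ?thesis by (simp add: bridge_cov_def)
qed

lemma indep_transform:
  assumes "\<And>i. i < n \<Longrightarrow> f i \<in> borel_measurable borel"
  shows "indep_vars (\<lambda>_. borel) (\<lambda>i w. f i (R i w)) {..<n}"
  by (rule indep_vars_compose2[OF R_indep]) (use assms in auto)

lemma weighted_sum_moments:
  assumes s: "s \<in> {0..1}"
  shows "expectation (\<lambda>w. (\<Sum>i<n. a i * centred_step s (R i w)) ^ 2) \<le> (\<Sum>i<n. a i ^ 2)"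
    and "expectation (\<lambda>w. (\<Sum>i<n. a i * centred_step s (R i w)) ^ 4) \<le> 4 * (\<Sum>i<n. a i ^ 2)\<^sup>2"
proof -
  have b: "\<bar>a i * centred_step s r\<bar> \<le> \<bar>a i\<bar>" for i r
    using abs_centred_step_le[OF s, of r] by (simp add: abs_mult mult_left_le)
  have m: "expectation (\<lambda>w. (a i * centred_step s (R i w)) ^ k) \<le> a i ^ k" if "i < n" "even k" for i k
  proof -
    have "\<bar>(a i * centred_step s (R i w)) ^ k\<bar> \<le> \<bar>a i\<bar> ^ k" for w
      unfolding power_abs using b by (intro power_mono) auto
    then have "\<bar>expectation (\<lambda>w. (a i * centred_step s (R i w)) ^ k)\<bar> \<le> \<bar>a i\<bar> ^ k"
      by (intro abs_expectation_le) auto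
    then show ?thesis using that by (simp add: power_even_abs)
  qed
  have *: "expectation (\<lambda>w. \<Sum>i<n. a i * centred_step s (R i w)) = 0 \<and>
    expectation (\<lambda>w. (\<Sum>i<n. a i * centred_step s (R i w)) ^ 2) \<le> (\<Sum>i<n. a i ^ 2) \<and>
    expectation (\<lambda>w. (\<Sum>i<n. a i * centred_step s (R i w)) ^ 4) \<le> 3 * (\<Sum>i<n. a i ^ 2)\<^sup>2 + (\<Sum>i<n. a i ^ 4)"
  proof (rule indep_sum_moments)
    show "indep_vars (\<lambda>_. borel) (\<lambda>i w. a i * centred_step s (R i w)) {..<n}"
      by (rule indep_transform) measurable
  qed (use b m expectation_centred_step[OF _ s] in auto)
  then show "expectation (\<lambda>w. (\<Sum>i<n. a i * centred_step s (R i w)) ^ 2) \<le> (\<Sum>i<n. a i ^ 2)" by blast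
  have "(\<Sum>i<n. a i ^ 4) \<le> (\<Sum>i<n. a i ^ 2 * (\<Sum>j<n. a j ^ 2))"
  proof (rule sum_mono)
    fix i assume "i \<in> {..<n}"
    then have "a i ^ 2 \<le> (\<Sum>j<n. a j ^ 2)" by (intro member_le_sum) auto
    then have "a i ^ 2 * a i ^ 2 \<le> a i ^ 2 * (\<Sum>j<n. a j ^ 2)" by (intro mult_left_mono) auto
    then show "a i ^ 4 \<le> a i ^ 2 * (\<Sum>j<n. a j ^ 2)" by (simp add: power_add[symmetric])
  qed
  also have "\<dots> = (\<Sum>i<n. a i ^ 2)\<^sup>2" by (simp add: sum_distrib_right power2_eq_square)
  finally show "expectation (\<lambda>w. (\<Sum>i<n. a i * centred_step s (R i w)) ^ 4) \<le> 4 * (\<Sum>i<n. a i ^ 2)\<^sup>2"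
    using * by linarith
qed

text \<open>
  The bound of Bernstein type needed for chaining: a step over an interval of length \<open>t - s\<close> has second and fourth
  moments at most \<open>t - s\<close>.
\<close>

lemma increment_fourth_moment:
  assumes s: "s \<in> {0..1}" and t: "t \<in> {0..1}" and st: "s \<le> t"
  shows "expectation (\<lambda>w. (\<Sum>i<n. centred_step t (R i w) - centred_step s (R i w)) ^ 4)
    \<le> 3 * (real n * (t - s))\<^sup>2 + real n * (t - s)"
proof -
  let ?X = "\<lambda>i w. centred_step t (R i w) - centred_step s (R i w)"
  have b: "\<bar>?X i w\<bar> \<le> 1" for i w using s t st by (auto simp: centred_step_def split: split_indicator)
  have v: "expectation (\<lambda>w. ?X i w ^ 2) \<le> t - s" if i: "i < n" for i
  proof -
    have "expectation (\<lambda>w. ?X i w ^ 2) = expectation (\<lambda>w. (1 - 2 * (t - s)) * (indicator {..t} (R i w) - indicator {..s} (R i w)) + (t - s)\<^sup>2)"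
      using st by (intro Bochner_Integration.integral_cong) (auto simp: centred_step_def power2_eq_square algebra_simps split: split_indicator)
    also have "\<dots> = (1 - 2 * (t - s)) * (t - s) + (t - s)\<^sup>2"
      using step_integrable(2)[OF i s] step_integrable(2)[OF i t] by (simp add: expectation_indicator[OF i s] expectation_indicator[OF i t] prob_space)
    also have "\<dots> = (t - s) - (t - s)\<^sup>2" by (simp add: power2_eq_square algebra_simps)
    also have "\<dots> \<le> t - s" by simp
    finally show ?thesis .
  qed
  have q: "expectation (\<lambda>w. ?X i w ^ 4) \<le> t - s" if i: "i < n" for i
  proof -
    have [measurable]: "R i \<in> borel_measurable M" by (rule R_measurable[OF i])
    have b2: "?X i w ^ 2 \<le> 1" for w using b[of i w] by (simp add: abs_square_le_1)
    have "?X i w ^ 4 \<le> ?X i w ^ 2" for w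
      using mult_left_mono[OF b2, of "?X i w ^ 2" w] by (simp add: power_add[symmetric])
    then have "expectation (\<lambda>w. ?X i w ^ 4) \<le> expectation (\<lambda>w. ?X i w ^ 2)"
      using b2 power_le_one[OF abs_ge_zero b, of _ _ 4] by (intro integral_mono integrable_of_bounded[of _ 1]) (auto simp: power_abs)
    then show ?thesis using v[OF i] by linarith
  qed
  have m: "expectation (?X i) = 0" if i: "i < n" for i
    using step_integrable(1)[OF i s] step_integrable(1)[OF i t] by (simp add: expectation_centred_step[OF i s] expectation_centred_step[OF i t])
  have "expectation (\<lambda>w. \<Sum>i<n. ?X i w) = 0 \<and> expectation (\<lambda>w. (\<Sum>i<n. ?X i w) ^ 2) \<le> (\<Sum>i<n. t - s) \<and>
    expectation (\<lambda>w. (\<Sum>i<n. ?X i w) ^ 4) \<le> 3 * (\<Sum>i<n. t - s)\<^sup>2 + (\<Sum>i<n. t - s)"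
  proof (rule indep_sum_moments)
    show "indep_vars (\<lambda>_. borel) ?X {..<n}" by (rule indep_transform) measurable
  qed (use b v q m in auto)
  then show ?thesis by simp
qed

lemma char_approx:
  fixes c s :: "'p \<Rightarrow> real" and g :: "nat \<Rightarrow> 'p \<Rightarrow> real"
  assumes J: "finite J" and s: "\<And>p. p \<in> J \<Longrightarrow> s p \<in> {0..1}"
  defines "G \<equiv> \<lambda>i. \<Sum>p\<in>J. \<bar>g i p\<bar>"
  shows "cmod (expectation (\<lambda>w. iexp (\<Sum>i<n. \<Sum>p\<in>J. g i p * centred_step (s p) (R i w)))
      - exp (- (\<Sum>i<n. \<Sum>p\<in>J. \<Sum>q\<in>J. g i p * g i q * bridge_cov (s p) (s q)) / 2)) \<le> (\<Sum>i<n. G i ^ 3 + G i ^ 4)"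
proof (rule indep_sum_char_approx)
  show "indep_vars (\<lambda>_. borel) (\<lambda>i w. \<Sum>p\<in>J. g i p * centred_step (s p) (R i w)) {..<n}"
    by (rule indep_transform) measurable
  show "\<bar>\<Sum>p\<in>J. g i p * centred_step (s p) (R i w)\<bar> \<le> G i" for i w
    unfolding G_def using abs_centred_step_le[OF s]
    by (intro order_trans[OF sum_abs] sum_mono) (auto simp: abs_mult intro: mult_left_le)
  show "expectation (\<lambda>w. \<Sum>p\<in>J. g i p * centred_step (s p) (R i w)) = 0" if "i \<in> {..<n}" for i
    using that s by (subst Bochner_Integration.integral_sum) (auto simp: expectation_centred_step step_integrable)
  show "expectation (\<lambda>w. (\<Sum>p\<in>J. g i p * centred_step (s p) (R i w)) ^ 2) =
      (\<Sum>p\<in>J. \<Sum>q\<in>J. g i p * g i q * bridge_cov (s p) (s q))" if i: "i \<in> {..<n}" for i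
  proof -
    have int: "integrable M (\<lambda>w. centred_step (s p) (R i w) * centred_step (s q) (R i w))" if "p \<in> J" "q \<in> J" for p q
    proof (rule integrable_of_bounded[of _ "1 * 1"])
      have [measurable]: "R i \<in> borel_measurable M" using i by (auto intro: R_measurable)
      show "(\<lambda>w. centred_step (s p) (R i w) * centred_step (s q) (R i w)) \<in> borel_measurable M" by measurable
      show "norm (centred_step (s p) (R i w) * centred_step (s q) (R i w)) \<le> 1 * 1" for w
        unfolding real_norm_def abs_mult by (intro mult_mono abs_centred_step_le s that) auto
    qed
    have "(\<lambda>w. (\<Sum>p\<in>J. g i p * centred_step (s p) (R i w)) ^ 2) =
      (\<lambda>w. \<Sum>p\<in>J. \<Sum>q\<in>J. g i p * g i q * (centred_step (s p) (R i w) * centred_step (s q) (R i w)))"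
      by (intro ext) (simp add: power2_eq_square sum_product ac_simps)
    then show ?thesis using i s int
      by (simp add: Bochner_Integration.integral_sum expectation_centred_step_mult)
  qed
qed simp

end

section \<open>Decoupling\<close>

lemma (in prob_space) distr_Pair_indep:
  assumes X: "X \<in> M \<rightarrow>\<^sub>M S" and Y: "Y \<in> M \<rightarrow>\<^sub>M T"
    and ind: "indep_set (sets (vimage_algebra (space M) X S)) (sets (vimage_algebra (space M) Y T))"
  shows "distr M (S \<Otimes>\<^sub>M T) (\<lambda>w. (X w, Y w)) = distr M S X \<Otimes>\<^sub>M distr M T Y"
proof (rule sym, rule pair_measure_eqI)
  interpret DX: prob_space "distr M S X" by (rule prob_space_distr[OF X])
  interpret DY: prob_space "distr M T Y" by (rule prob_space_distr[OF Y])
  show "sigma_finite_measure (distr M S X)" "sigma_finite_measure (distr M T Y)" by unfold_locales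
  show "sets (distr M S X \<Otimes>\<^sub>M distr M T Y) = sets (distr M (S \<Otimes>\<^sub>M T) (\<lambda>w. (X w, Y w)))"
    by (simp cong: sets_pair_measure_cong)
  fix A B assume "A \<in> sets (distr M S X)" "B \<in> sets (distr M T Y)"
  then have AB: "A \<in> sets S" "B \<in> sets T" by auto
  have "prob ((X -` A \<inter> space M) \<inter> (Y -` B \<inter> space M)) = prob (X -` A \<inter> space M) * prob (Y -` B \<inter> space M)"
    by (rule indep_setD[OF ind]) (auto intro: in_vimage_algebra AB)
  moreover have "(\<lambda>w. (X w, Y w)) -` (A \<times> B) \<inter> space M = (X -` A \<inter> space M) \<inter> (Y -` B \<inter> space M)" by auto
  ultimately show "emeasure (distr M S X) A * emeasure (distr M T Y) B = emeasure (distr M (S \<Otimes>\<^sub>M T) (\<lambda>w. (X w, Y w))) (A \<times> B)"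
    using X Y AB by (simp add: emeasure_distr emeasure_eq_measure ennreal_mult[symmetric])
qed

lemma (in prob_space) decouple:
  fixes F :: "'x \<Rightarrow> 'y \<Rightarrow> 'b :: {banach, second_countable_topology}"
  assumes X: "X \<in> M \<rightarrow>\<^sub>M S" and Y: "Y \<in> M \<rightarrow>\<^sub>M T"
    and prod: "distr M (S \<Otimes>\<^sub>M T) (\<lambda>w. (X w, Y w)) = distr M S X \<Otimes>\<^sub>M distr M T Y"
    and F: "case_prod F \<in> borel_measurable (S \<Otimes>\<^sub>M T)"
    and B: "\<And>x y. x \<in> space S \<Longrightarrow> y \<in> space T \<Longrightarrow> norm (F x y) \<le> B"
  shows "expectation (\<lambda>w. F (X w) (Y w)) = expectation (\<lambda>w'. expectation (\<lambda>w. F (X w) (Y w')))"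
    and "expectation (\<lambda>w. F (X w) (Y w)) = expectation (\<lambda>w. expectation (\<lambda>w'. F (X w) (Y w')))"
proof -
  interpret DX: prob_space "distr M S X" by (rule prob_space_distr[OF X])
  interpret DY: prob_space "distr M T Y" by (rule prob_space_distr[OF Y])
  interpret P: pair_prob_space "distr M S X" "distr M T Y" by unfold_locales
  have Fm: "case_prod F \<in> borel_measurable (distr M S X \<Otimes>\<^sub>M distr M T Y)" using F by simp
  have Fi: "integrable (distr M S X \<Otimes>\<^sub>M distr M T Y) (case_prod F)"
    using Fm B by (intro P.integrable_of_bounded[of _ B]) (auto simp: space_pair_measure)
  have XY: "(\<lambda>w. (X w, Y w)) \<in> M \<rightarrow>\<^sub>M S \<Otimes>\<^sub>M T" using X Y by simp
  have lhs: "expectation (\<lambda>w. F (X w) (Y w)) = integral\<^sup>L (distr M S X \<Otimes>\<^sub>M distr M T Y) (case_prod F)"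
    unfolding prod[symmetric] using integral_distr[OF XY F] by simp
  have s1: "(\<lambda>y. \<integral>x. F x y \<partial>distr M S X) \<in> borel_measurable T"
  proof -
    have "(\<lambda>(y, x). F x y) \<in> borel_measurable (T \<Otimes>\<^sub>M distr M S X)"
      using measurable_pair_swap[OF F] by simp
    then show ?thesis using DX.borel_measurable_lebesgue_integral[of "\<lambda>y x. F x y" T] by simp
  qed
  have s2: "(\<lambda>x. \<integral>y. F x y \<partial>distr M T Y) \<in> borel_measurable S"
  proof -
    have "(\<lambda>(x, y). F x y) \<in> borel_measurable (S \<Otimes>\<^sub>M distr M T Y)" using F by simp
    then show ?thesis using DY.borel_measurable_lebesgue_integral[of F S] by simp
  qed
  have "expectation (\<lambda>w. F (X w) (Y w)) = (\<integral>y. (\<integral>x. F x y \<partial>distr M S X) \<partial>distr M T Y)"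
    unfolding lhs using P.integral_snd[of F] Fi by simp
  also have "\<dots> = expectation (\<lambda>w'. \<integral>x. F x (Y w') \<partial>distr M S X)" by (rule integral_distr[OF Y s1])
  also have "\<dots> = expectation (\<lambda>w'. expectation (\<lambda>w. F (X w) (Y w')))"
    using measurable_space[OF Y] measurable_compose_Pair1[OF _ measurable_pair_swap[OF F]]
    by (intro Bochner_Integration.integral_cong integral_distr[OF X]) auto
  finally show "expectation (\<lambda>w. F (X w) (Y w)) = expectation (\<lambda>w'. expectation (\<lambda>w. F (X w) (Y w')))" .
  have "expectation (\<lambda>w. F (X w) (Y w)) = (\<integral>x. (\<integral>y. F x y \<partial>distr M T Y) \<partial>distr M S X)"
    unfolding lhs using P.integral_fst[of F] Fi by simp
  also have "\<dots> = expectation (\<lambda>w. \<integral>y. F (X w) y \<partial>distr M T Y)" by (rule integral_distr[OF X s2])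
  also have "\<dots> = expectation (\<lambda>w. expectation (\<lambda>w'. F (X w) (Y w')))"
    using measurable_space[OF X] measurable_compose_Pair1[OF _ F]
    by (intro Bochner_Integration.integral_cong integral_distr[OF Y]) auto
  finally show "expectation (\<lambda>w. F (X w) (Y w)) = expectation (\<lambda>w. expectation (\<lambda>w'. F (X w) (Y w')))" .
qed

section \<open>Unitary and orthogonal matrices\<close>

lemma mat_adjoint_index:
  assumes "A \<in> carrier_mat n n" "i < n" "j < n"
  shows "mat_adjoint A $$ (i, j) = cnj (A $$ (j, i))"
  using assms unfolding mat_adjoint_def by (simp add: mat_of_rows_def conjugate_complex_def)

lemma mat_adjoint_carrier: "A \<in> carrier_mat n n \<Longrightarrow> mat_adjoint A \<in> carrier_mat n n"
  unfolding mat_adjoint_def by (simp add: mat_of_rows_def)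

lemma mat_mult_index:
  fixes A B :: "'a :: semiring_0 mat"
  assumes "A \<in> carrier_mat n n" "B \<in> carrier_mat n n" "i < n" "j < n"
  shows "(A * B) $$ (i, j) = (\<Sum>l<n. A $$ (i, l) * B $$ (l, j))"
  using assms by (simp add: scalar_prod_def atLeast0LessThan)

lemma mat_eq_entries_iff:
  assumes "A \<in> carrier_mat n n" "B \<in> carrier_mat n n"
  shows "A = B \<longleftrightarrow> (\<forall>i<n. \<forall>k<n. A $$ (i, k) = B $$ (i, k))"
  using assms by (auto intro: eq_matI)

lemma sum_rotate: "(\<Sum>j\<in>A. \<Sum>b\<in>B. \<Sum>c\<in>C. f j b c) = (\<Sum>b\<in>B. \<Sum>c\<in>C. \<Sum>j\<in>A. f j b c)"
  by (rule trans[OF sum.swap]) (intro sum.cong refl sum.swap)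

lemma unitary_group_iff:
  "A \<in> unitary_group n \<longleftrightarrow> A \<in> carrier_mat n n \<and>
     (\<forall>i<n. \<forall>k<n. (\<Sum>j<n. A $$ (i, j) * cnj (A $$ (k, j))) = (if i = k then 1 else 0))"
proof (cases "A \<in> carrier_mat n n")
  case A: True
  note A' = mat_adjoint_carrier[OF A]
  have "A * mat_adjoint A = 1\<^sub>m n \<longleftrightarrow> (\<forall>i<n. \<forall>k<n. (A * mat_adjoint A) $$ (i, k) = 1\<^sub>m n $$ (i, k))"
    by (rule mat_eq_entries_iff[OF mult_carrier_mat[OF A A'] one_carrier_mat])
  also have "\<dots> \<longleftrightarrow> (\<forall>i<n. \<forall>k<n. (\<Sum>j<n. A $$ (i, j) * cnj (A $$ (k, j))) = (if i = k then 1 else 0))"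
    using mat_mult_index[OF A A'] mat_adjoint_index[OF A] by simp
  finally show ?thesis
    using A mat_mult_left_right_inverse[OF A A'] unfolding unitary_group_def by blast
qed (simp add: unitary_group_def)

lemma unitary_group_columns:
  assumes A: "A \<in> unitary_group n" and jl: "j < n" "l < n"
  shows "(\<Sum>i<n. cnj (A $$ (i, j)) * A $$ (i, l)) = (if j = l then 1 else 0)"
proof -
  have c: "A \<in> carrier_mat n n" and 1: "mat_adjoint A * A = 1\<^sub>m n" using A by (auto simp: unitary_group_def)
  have "(mat_adjoint A * A) $$ (j, l) = (\<Sum>i<n. cnj (A $$ (i, j)) * A $$ (i, l))"
    using mat_mult_index[OF mat_adjoint_carrier[OF c] c jl] mat_adjoint_index[OF c] jl by simp
  then show ?thesis unfolding 1 using jl by simp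
qed

lemma unitary_group_mult:
  assumes V: "V \<in> unitary_group n" and A: "A \<in> unitary_group n"
  shows "V * A \<in> unitary_group n"
proof -
  have c: "V \<in> carrier_mat n n" "A \<in> carrier_mat n n" using V A by (auto simp: unitary_group_def)
  have "(\<Sum>j<n. (V * A) $$ (i, j) * cnj ((V * A) $$ (k, j))) = (if i = k then 1 else 0)" if ik: "i < n" "k < n" for i k
  proof -
    have "(\<Sum>j<n. (V * A) $$ (i, j) * cnj ((V * A) $$ (k, j))) =
        (\<Sum>j<n. \<Sum>b<n. \<Sum>c<n. V $$ (i, b) * cnj (V $$ (k, c)) * (A $$ (b, j) * cnj (A $$ (c, j))))"
      using ik by (intro sum.cong) (simp_all add: mat_mult_index[OF c] sum_product ac_simps)
    also have "\<dots> = (\<Sum>b<n. \<Sum>c<n. V $$ (i, b) * cnj (V $$ (k, c)) * (\<Sum>j<n. A $$ (b, j) * cnj (A $$ (c, j))))"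
      unfolding sum_distrib_left by (rule sum_rotate)
    also have "\<dots> = (\<Sum>b<n. \<Sum>c<n. if b = c then V $$ (i, b) * cnj (V $$ (k, c)) else 0)"
      using A by (intro sum.cong) (auto simp: unitary_group_iff)
    also have "\<dots> = (\<Sum>b<n. V $$ (i, b) * cnj (V $$ (k, b)))" by (simp add: sum.delta)
    finally show ?thesis using V ik by (simp add: unitary_group_iff)
  qed
  then show ?thesis using c by (simp add: unitary_group_iff)
qed

lemma orthogonal_group_iff:
  "A \<in> orthogonal_group n \<longleftrightarrow> A \<in> unitary_group n \<and> (\<forall>i<n. \<forall>j<n. Im (A $$ (i, j)) = 0)"
proof
  assume "A \<in> orthogonal_group n"
  then obtain B where B: "B \<in> carrier_mat n n" "B * transpose_mat B = 1\<^sub>m n" "A = map_mat complex_of_real B"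
    unfolding orthogonal_group_def by auto
  have "(\<Sum>j<n. A $$ (i, j) * cnj (A $$ (k, j))) = (if i = k then 1 else 0)" if ik: "i < n" "k < n" for i k
  proof -
    have "(B * transpose_mat B) $$ (i, k) = (\<Sum>j<n. B $$ (i, j) * B $$ (k, j))"
      using mat_mult_index[OF B(1), of "transpose_mat B" i k] B ik by simp
    then have "(\<Sum>j<n. B $$ (i, j) * B $$ (k, j)) = (if i = k then 1 else 0)" unfolding B(2) using ik by simp
    then have "complex_of_real (\<Sum>j<n. B $$ (i, j) * B $$ (k, j)) = (if i = k then 1 else 0)" by simp
    then show ?thesis using B ik by simp
  qed
  then show "A \<in> unitary_group n \<and> (\<forall>i<n. \<forall>j<n. Im (A $$ (i, j)) = 0)"
    using B by (simp add: unitary_group_iff)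
next
  assume A: "A \<in> unitary_group n \<and> (\<forall>i<n. \<forall>j<n. Im (A $$ (i, j)) = 0)"
  then have c: "A \<in> carrier_mat n n" by (auto simp: unitary_group_def)
  define B where "B = map_mat Re A"
  have Bc: "B \<in> carrier_mat n n" "transpose_mat B \<in> carrier_mat n n" using c by (auto simp: B_def)
  have AB: "A = map_mat complex_of_real B" using A c by (auto simp: B_def complex_eq_iff intro!: eq_matI)
  have "(B * transpose_mat B) $$ (i, k) = 1\<^sub>m n $$ (i, k)" if ik: "i < n" "k < n" for i k
  proof -
    have "complex_of_real ((B * transpose_mat B) $$ (i, k)) = (\<Sum>j<n. A $$ (i, j) * cnj (A $$ (k, j)))"
      using mat_mult_index[OF Bc ik] Bc ik by (simp add: AB)
    also have "\<dots> = (if i = k then 1 else 0)" using A ik by (simp add: unitary_group_iff)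
    also have "\<dots> = complex_of_real (1\<^sub>m n $$ (i, k))" using ik by simp
    finally show ?thesis unfolding of_real_eq_iff .
  qed
  then have "B * transpose_mat B = 1\<^sub>m n" using Bc by (intro eq_matI) auto
  then show "A \<in> orthogonal_group n"
    using mat_mult_left_right_inverse[OF Bc] Bc AB unfolding orthogonal_group_def by blast
qed

lemma orthogonal_group_mult:
  assumes V: "V \<in> orthogonal_group n" and A: "A \<in> orthogonal_group n"
  shows "V * A \<in> orthogonal_group n"
proof -
  have c: "V \<in> carrier_mat n n" "A \<in> carrier_mat n n" using V A by (auto simp: orthogonal_group_iff unitary_group_def)
  show ?thesis using V A unitary_group_mult[of V n A] by (auto simp: orthogonal_group_iff mat_mult_index[OF c])
qed

section \<open>Rotations of two rows\<close>

definition row_rotation :: "nat \<Rightarrow> nat \<Rightarrow> nat \<Rightarrow> complex \<Rightarrow> complex mat" where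
  "row_rotation n i k z = mat n n (\<lambda>(a, b).
     if a = i then (of_bool (b = i) + z * of_bool (b = k)) / complex_of_real (sqrt 2)
     else if a = k then (of_bool (b = i) - z * of_bool (b = k)) / complex_of_real (sqrt 2)
     else of_bool (a = b))"

lemma row_rotation_sum:
  assumes "i < n" "k < n" "a < n"
  shows "(\<Sum>b<n. row_rotation n i k z $$ (a, b) * f b) =
    (if a = i then (f i + z * f k) / complex_of_real (sqrt 2)
     else if a = k then (f i - z * f k) / complex_of_real (sqrt 2) else f a)"
proof -
  have d: "(\<Sum>b<n. of_bool (b = l) * f b) = f l" "(\<Sum>b<n. of_bool (l = b) * f b) = f l" if "l < n" for l
    using that by (auto simp: of_bool_def if_distrib[where f="\<lambda>x. x * _"] sum.delta sum.delta' cong: if_cong)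
  consider "a = i" | "a = k" "a \<noteq> i" | "a \<noteq> i" "a \<noteq> k" by blast
  then show ?thesis
  proof cases
    case 1
    then have "(\<Sum>b<n. row_rotation n i k z $$ (a, b) * f b) =
        (\<Sum>b<n. (of_bool (b = i) * f b + z * (of_bool (b = k) * f b)) / complex_of_real (sqrt 2))"
      using assms by (intro sum.cong) (simp_all add: row_rotation_def distrib_right)
    then show ?thesis using 1 d assms
      by (simp add: sum_divide_distrib[symmetric] sum.distrib sum_distrib_left[symmetric] del: of_bool_eq)
  next
    case 2
    then have "(\<Sum>b<n. row_rotation n i k z $$ (a, b) * f b) =
        (\<Sum>b<n. (of_bool (b = i) * f b - z * (of_bool (b = k) * f b)) / complex_of_real (sqrt 2))"
      using assms by (intro sum.cong) (simp_all add: row_rotation_def left_diff_distrib)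
    then show ?thesis using 2 d assms
      by (simp add: sum_divide_distrib[symmetric] sum_subtractf sum_distrib_left[symmetric] del: of_bool_eq)
  next
    case 3
    then have "(\<Sum>b<n. row_rotation n i k z $$ (a, b) * f b) = (\<Sum>b<n. of_bool (a = b) * f b)"
      using assms by (intro sum.cong) (simp_all add: row_rotation_def)
    then show ?thesis using 3 d assms by simp
  qed
qed

lemma row_rotation_unitary:
  assumes ik: "i < n" "k < n" "i \<noteq> k" and z: "cmod z = 1"
  shows "row_rotation n i k z \<in> unitary_group n"
proof -
  have zz: "z * cnj z = 1" using complex_norm_square[of z] z by simp
  have s2: "complex_of_real (sqrt 2) * complex_of_real (sqrt 2) = 2" by (simp flip: of_real_mult)
  have "(\<Sum>j<n. row_rotation n i k z $$ (a, j) * cnj (row_rotation n i k z $$ (c, j))) = (if a = c then 1 else 0)"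
    if "a < n" "c < n" for a c
    unfolding row_rotation_sum[OF ik(1,2) that(1)] using that ik zz
    by (auto simp: row_rotation_def s2 algebra_simps)
  then show ?thesis by (simp add: unitary_group_iff row_rotation_def)
qed

lemma row_rotation_orthogonal:
  assumes ik: "i < n" "k < n" "i \<noteq> k"
  shows "row_rotation n i k 1 \<in> orthogonal_group n"
  using row_rotation_unitary[OF ik, of 1] by (auto simp: orthogonal_group_iff row_rotation_def)

section \<open>Diagonal entries of a conjugated diagonal matrix\<close>

definition conj_entry :: "nat \<Rightarrow> (nat \<Rightarrow> real) \<Rightarrow> complex mat \<Rightarrow> nat \<Rightarrow> nat \<Rightarrow> complex" where
  "conj_entry n y A i k = (\<Sum>j<n. A $$ (i, j) * cnj (A $$ (k, j)) * complex_of_real (y j))"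

definition conj_diag :: "nat \<Rightarrow> (nat \<Rightarrow> real) \<Rightarrow> complex mat \<Rightarrow> nat \<Rightarrow> real" where
  "conj_diag n y A i = (\<Sum>j<n. (cmod (A $$ (i, j)))\<^sup>2 * y j)"

lemma conj_entry_diag: "conj_entry n y A i i = complex_of_real (conj_diag n y A i)"
  unfolding conj_entry_def conj_diag_def by (simp only: of_real_sum of_real_mult complex_norm_square)

lemma conj_entry_swap: "cmod (conj_entry n y A k i) = cmod (conj_entry n y A i k)"
proof -
  have "conj_entry n y A k i = cnj (conj_entry n y A i k)"
    unfolding conj_entry_def by (simp add: ac_simps)
  then show ?thesis by simp
qed

lemma conj_diag_rotation:
  fixes y :: "nat \<Rightarrow> real"
  assumes A: "A \<in> carrier_mat n n" and ik: "i < n" "k < n" "i \<noteq> k" and z: "cmod z = 1" and a: "a < n"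
  defines "x \<equiv> Re (cnj z * conj_entry n y A i k)" and "m \<equiv> (conj_diag n y A i + conj_diag n y A k) / 2"
  shows "conj_diag n y (row_rotation n i k z * A) a = (if a = i then m + x else if a = k then m - x else conj_diag n y A a)"
proof -
  have Vc: "row_rotation n i k z \<in> carrier_mat n n" by (simp add: row_rotation_def)
  have e: "(row_rotation n i k z * A) $$ (a, j) = (if a = i then (A $$ (i, j) + z * A $$ (k, j)) / complex_of_real (sqrt 2)
     else if a = k then (A $$ (i, j) - z * A $$ (k, j)) / complex_of_real (sqrt 2) else A $$ (a, j))" if "j < n" for j
    unfolding mat_mult_index[OF Vc A a that] by (rule row_rotation_sum[OF ik(1,2) a])
  have x: "x = (\<Sum>j<n. Re (A $$ (i, j) * cnj (z * A $$ (k, j))) * y j)"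
    unfolding x_def conj_entry_def sum_distrib_left Re_sum
    by (intro sum.cong refl) (simp add: algebra_simps del: Re_sum)
  have m: "m = (\<Sum>j<n. ((cmod (A $$ (i, j)))\<^sup>2 + (cmod (A $$ (k, j)))\<^sup>2) / 2 * y j)"
    unfolding m_def conj_diag_def by (simp only: sum.distrib[symmetric] sum_divide_distrib distrib_right[symmetric] times_divide_eq_left)
  have half: "(cmod (w / complex_of_real (sqrt 2)))\<^sup>2 = (cmod w)\<^sup>2 / 2" for w
    by (simp add: norm_divide power_divide)
  have "(cmod (p + q))\<^sup>2 = (cmod p)\<^sup>2 + (cmod q)\<^sup>2 + 2 * Re (p * cnj q)"
    "(cmod (p - q))\<^sup>2 = (cmod p)\<^sup>2 + (cmod q)\<^sup>2 - 2 * Re (p * cnj q)" for p q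
    unfolding cmod_power2 by (simp_all add: power2_eq_square algebra_simps)
  then have sq: "(cmod ((p + q) / complex_of_real (sqrt 2)))\<^sup>2 = ((cmod p)\<^sup>2 + (cmod q)\<^sup>2) / 2 + Re (p * cnj q)"
    "(cmod ((p - q) / complex_of_real (sqrt 2)))\<^sup>2 = ((cmod p)\<^sup>2 + (cmod q)\<^sup>2) / 2 - Re (p * cnj q)" for p q
    unfolding half by simp_all
  have zq: "cmod (z * q) = cmod q" for q using z by (simp add: norm_mult)
  have e1: "(row_rotation n i k z * A) $$ (a, j) = (A $$ (i, j) + z * A $$ (k, j)) / complex_of_real (sqrt 2)"
    if "a = i" "j < n" for j using that by (subst e) auto
  have e2: "(row_rotation n i k z * A) $$ (a, j) = (A $$ (i, j) - z * A $$ (k, j)) / complex_of_real (sqrt 2)"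
    if "a = k" "a \<noteq> i" "j < n" for j using that by (subst e) auto
  consider "a = i" | "a = k" "a \<noteq> i" | "a \<noteq> i" "a \<noteq> k" by blast
  then show ?thesis
  proof cases
    case 1
    have "conj_diag n y (row_rotation n i k z * A) a =
      (\<Sum>j<n. (((cmod (A $$ (i, j)))\<^sup>2 + (cmod (A $$ (k, j)))\<^sup>2) / 2 + Re (A $$ (i, j) * cnj (z * A $$ (k, j)))) * y j)"
      unfolding conj_diag_def by (intro sum.cong refl) (simp only: e1[OF 1] sq zq lessThan_iff)
    also have "\<dots> = m + x" unfolding x m by (simp only: sum.distrib[symmetric] distrib_right[symmetric])
    finally show ?thesis using 1 by simp
  next
    case 2
    have "conj_diag n y (row_rotation n i k z * A) a =
      (\<Sum>j<n. (((cmod (A $$ (i, j)))\<^sup>2 + (cmod (A $$ (k, j)))\<^sup>2) / 2 - Re (A $$ (i, j) * cnj (z * A $$ (k, j)))) * y j)"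
      unfolding conj_diag_def by (intro sum.cong refl) (simp only: e2[OF 2] sq zq lessThan_iff)
    also have "\<dots> = m - x" unfolding x m by (simp only: sum_subtractf[symmetric] left_diff_distrib[symmetric])
    finally show ?thesis using 2 by simp
  next
    case 3
    then show ?thesis unfolding conj_diag_def by (simp add: e)
  qed
qed

text \<open>
  The diagonal entries of \<open>A A* = 1\<close>; with the next lemma, squared moduli are doubly stochastic.
\<close>

lemma unitary_row_sum:
  assumes A: "A \<in> unitary_group n" and i: "i < n"
  shows "(\<Sum>j<n. (cmod (A $$ (i, j)))\<^sup>2) = 1"
proof -
  have "complex_of_real (\<Sum>j<n. (cmod (A $$ (i, j)))\<^sup>2) = (\<Sum>j<n. A $$ (i, j) * cnj (A $$ (i, j)))"
    by (simp only: of_real_sum complex_norm_square)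
  also have "\<dots> = complex_of_real 1" using A i by (simp add: unitary_group_iff)
  finally show ?thesis unfolding of_real_eq_iff .
qed

lemma unitary_column_sum:
  assumes A: "A \<in> unitary_group n" and j: "j < n"
  shows "(\<Sum>i<n. (cmod (A $$ (i, j)))\<^sup>2) = 1"
proof -
  have "complex_of_real (\<Sum>i<n. (cmod (A $$ (i, j)))\<^sup>2) = (\<Sum>i<n. cnj (A $$ (i, j)) * A $$ (i, j))"
    unfolding of_real_sum by (intro sum.cong refl) (simp only: complex_norm_square mult.commute)
  also have "\<dots> = complex_of_real 1" using unitary_group_columns[OF A j j] by simp
  finally show ?thesis unfolding of_real_eq_iff .
qed

lemma conj_diag_sum:
  assumes A: "A \<in> unitary_group n"
  shows "(\<Sum>i<n. conj_diag n y A i) = (\<Sum>j<n. y j)"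
proof -
  have "(\<Sum>i<n. conj_diag n y A i) = (\<Sum>j<n. (\<Sum>i<n. (cmod (A $$ (i, j)))\<^sup>2) * y j)"
    unfolding conj_diag_def sum_distrib_right by (rule sum.swap)
  also have "\<dots> = (\<Sum>j<n. y j)" by (intro sum.cong refl) (simp add: unitary_column_sum[OF A])
  finally show ?thesis .
qed

lemma conj_entry_row_norm:
  assumes A: "A \<in> unitary_group n"
  shows "(\<Sum>k<n. (cmod (conj_entry n y A i k))\<^sup>2) = (\<Sum>j<n. (cmod (A $$ (i, j)))\<^sup>2 * (y j)\<^sup>2)"
proof -
  have "complex_of_real (\<Sum>k<n. (cmod (conj_entry n y A i k))\<^sup>2) = (\<Sum>k<n. conj_entry n y A i k * cnj (conj_entry n y A i k))"
    by (simp only: of_real_sum complex_norm_square)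
  also have "\<dots> = (\<Sum>k<n. \<Sum>j<n. \<Sum>l<n. A $$ (i, j) * cnj (A $$ (i, l)) * complex_of_real (y j * y l) * (cnj (A $$ (k, j)) * A $$ (k, l)))"
    unfolding conj_entry_def cnj_sum sum_product by (intro sum.cong refl) (simp add: ac_simps)
  also have "\<dots> = (\<Sum>j<n. \<Sum>l<n. A $$ (i, j) * cnj (A $$ (i, l)) * complex_of_real (y j * y l) * (\<Sum>k<n. cnj (A $$ (k, j)) * A $$ (k, l)))"
    unfolding sum_distrib_left by (rule sum_rotate)
  also have "\<dots> = (\<Sum>j<n. \<Sum>l<n. if j = l then A $$ (i, j) * cnj (A $$ (i, l)) * complex_of_real (y j * y l) else 0)"
    using unitary_group_columns[OF A] by (intro sum.cong) auto
  also have "\<dots> = complex_of_real (\<Sum>j<n. (cmod (A $$ (i, j)))\<^sup>2 * (y j)\<^sup>2)"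
    unfolding of_real_sum by (intro sum.cong refl) (simp add: complex_norm_square[symmetric] power2_eq_square[of "complex_of_real (y _)"])
  finally show ?thesis unfolding of_real_eq_iff .
qed

lemma sum_pairwise_square_diff:
  fixes h :: "nat \<Rightarrow> real"
  shows "(\<Sum>i<n. \<Sum>k<n. (h i - h k)\<^sup>2) = 2 * real n * (\<Sum>i<n. (h i)\<^sup>2) - 2 * (\<Sum>i<n. h i)\<^sup>2"
proof -
  have "(\<Sum>i<n. \<Sum>k<n. (h i - h k)\<^sup>2) = (\<Sum>i<n. \<Sum>k<n. (h i)\<^sup>2 + (h k)\<^sup>2 - 2 * (h i * h k))"
    by (simp only: power2_diff mult.assoc)
  also have "\<dots> = real n * (\<Sum>i<n. (h i)\<^sup>2) + real n * (\<Sum>i<n. (h i)\<^sup>2) - 2 * (\<Sum>i<n. \<Sum>k<n. h i * h k)"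
    by (simp add: sum.distrib sum_subtractf sum_distrib_left[symmetric])
  also have "(\<Sum>i<n. \<Sum>k<n. h i * h k) = (\<Sum>i<n. h i)\<^sup>2" by (simp add: power2_eq_square sum_product)
  finally show ?thesis by simp
qed

section \<open>Haar measure\<close>

lemma matrix_entry_measurable:
  assumes "i < n" "j < n"
  shows "(\<lambda>A. A $$ (i, j)) \<in> borel_measurable (matrix_borel n)"
proof -
  have "(\<lambda>A. \<lambda>p\<in>{..<n} \<times> {..<n}. A $$ p) \<in> matrix_borel n \<rightarrow>\<^sub>M PiM ({..<n} \<times> {..<n}) (\<lambda>_. borel :: complex measure)"
    unfolding matrix_borel_def by (rule measurable_vimage_algebra1) (auto simp: space_PiM)
  from measurable_compose[OF this measurable_component_singleton[of "(i, j)"]] assms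
  show ?thesis by simp
qed

lemma space_matrix_borel: "space (matrix_borel n) = carrier_mat n n"
  by (simp add: matrix_borel_def)

lemma measurable_matrix_borelI:
  assumes "\<And>x. x \<in> space N \<Longrightarrow> f x \<in> carrier_mat n n"
    and "\<And>i j. i < n \<Longrightarrow> j < n \<Longrightarrow> (\<lambda>x. f x $$ (i, j)) \<in> borel_measurable N"
  shows "f \<in> N \<rightarrow>\<^sub>M matrix_borel n"
  unfolding matrix_borel_def
proof (rule measurable_vimage_algebra2)
  show "f \<in> space N \<rightarrow> carrier_mat n n" using assms by auto
  show "(\<lambda>x. \<lambda>p\<in>{..<n} \<times> {..<n}. f x $$ p) \<in> N \<rightarrow>\<^sub>M PiM ({..<n} \<times> {..<n}) (\<lambda>_. borel)"
    using assms(2) by (intro measurable_restrict) auto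
qed

text \<open>\<open>Z\<close> is \<open>{1, \<i>}\<close> in the unitary and \<open>{1}\<close> in the orthogonal case.\<close>

locale haar_moments = prob_space \<mu> for \<mu> :: "complex mat measure" +
  fixes n :: nat and G :: "complex mat set" and Z :: "complex set"
  assumes haar: "haar_probability n G \<mu>"
    and G_unitary: "G \<subseteq> unitary_group n"
    and G_mult: "\<And>V A. V \<in> G \<Longrightarrow> A \<in> G \<Longrightarrow> V * A \<in> G"
    and Z: "finite Z" "1 \<in> Z" "\<And>z. z \<in> Z \<Longrightarrow> cmod z = 1"
    and rotation_G: "\<And>i k z. i < n \<Longrightarrow> k < n \<Longrightarrow> i \<noteq> k \<Longrightarrow> z \<in> Z \<Longrightarrow> row_rotation n i k z \<in> G"
    and entry_Z: "\<And>A y i k. A \<in> G \<Longrightarrow> i < n \<Longrightarrow> k < n \<Longrightarrow>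
       (\<Sum>z\<in>Z. (Re (cnj z * conj_entry n y A i k))\<^sup>2) = (cmod (conj_entry n y A i k))\<^sup>2"
begin

lemma sets_mu: "sets \<mu> = sets (restrict_space (matrix_borel n) G)"
  using haar by (simp add: haar_probability_def)

lemma G_carrier: "G \<subseteq> carrier_mat n n"
  using G_unitary by (auto simp: unitary_group_def)

lemma space_mu: "space \<mu> = G"
  using sets_eq_imp_space_eq[OF sets_mu] G_carrier by (auto simp: space_restrict_space space_matrix_borel)

lemma entry_measurable [measurable]:
  assumes "i < n" "j < n"
  shows "(\<lambda>A. A $$ (i, j)) \<in> borel_measurable \<mu>"
  unfolding measurable_cong_sets[OF sets_mu refl]
  by (rule measurable_restrict_space1) (rule matrix_entry_measurable[OF assms])

lemma conj_diag_measurable: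
  assumes "i < n"
  shows "(\<lambda>A. conj_diag n y A i) \<in> borel_measurable \<mu>"
  unfolding conj_diag_def using entry_measurable[OF assms]
  by (intro borel_measurable_sum borel_measurable_times borel_measurable_power) (auto intro!: borel_measurable_norm)

lemma mult_measurable:
  assumes V: "V \<in> G"
  shows "(\<lambda>A. V * A) \<in> \<mu> \<rightarrow>\<^sub>M \<mu>"
  unfolding measurable_cong_sets[OF refl sets_mu]
proof (rule measurable_restrict_space2)
  show "(\<lambda>A. V * A) \<in> space \<mu> \<rightarrow> G" using G_mult[OF V] by (auto simp: space_mu)
  have Vc: "V \<in> carrier_mat n n" using V G_carrier by blast
  show "(\<lambda>A. V * A) \<in> \<mu> \<rightarrow>\<^sub>M matrix_borel n"
  proof (rule measurable_matrix_borelI)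
    show "V * A \<in> carrier_mat n n" if "A \<in> space \<mu>" for A using that Vc G_carrier by (auto simp: space_mu)
    fix i j assume ij: "i < n" "j < n"
    have "(\<lambda>A. \<Sum>l<n. V $$ (i, l) * A $$ (l, j)) \<in> borel_measurable \<mu>"
      using entry_measurable[OF _ ij(2)] by (intro borel_measurable_sum borel_measurable_times) auto
    then show "(\<lambda>A. (V * A) $$ (i, j)) \<in> borel_measurable \<mu>"
      by (rule measurable_cong[THEN iffD1, rotated])
         (use mat_mult_index[OF Vc _ ij] G_carrier in \<open>auto simp: space_mu\<close>)
  qed
qed

lemma expectation_mult:
  fixes f :: "complex mat \<Rightarrow> real"
  assumes V: "V \<in> G" and f: "f \<in> borel_measurable \<mu>"
  shows "expectation (\<lambda>A. f (V * A)) = expectation f"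
proof -
  have "expectation f = integral\<^sup>L (distr \<mu> \<mu> (\<lambda>A. V * A)) f"
    using haar V by (simp add: haar_probability_def)
  also have "\<dots> = expectation (\<lambda>A. f (V * A))" by (rule integral_distr[OF mult_measurable[OF V] f])
  finally show ?thesis by simp
qed

context
  fixes y :: "nat \<Rightarrow> real" and K :: real
  assumes y0: "(\<Sum>j<n. y j) = 0" and yK: "\<And>j. j < n \<Longrightarrow> \<bar>y j\<bar> \<le> K" and K: "0 \<le> K"
begin

abbreviation h where "h \<equiv> conj_diag n y"
abbreviation H where "H \<equiv> conj_entry n y"
definition T2 where "T2 A = (\<Sum>i<n. (h A i)\<^sup>2)"
definition T4 where "T4 A = (\<Sum>i<n. (h A i) ^ 4)"
definition S2 where "S2 = (\<Sum>j<n. (y j)\<^sup>2)"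
definition xr where "xr z A i k = Re (cnj z * H A i k)"
definition md where "md A i k = (h A i + h A k) / 2"
definition dd where "dd A i k = (h A i - h A k) / 2"
definition b where "b = real (card Z)"

lemma b1: "1 \<le> b"
proof -
  have "card Z \<noteq> 0" using Z by auto
  then show ?thesis unfolding b_def by linarith
qed

lemma row_H: "A \<in> G \<Longrightarrow> i < n \<Longrightarrow> (\<Sum>k<n. (cmod (H A i k))\<^sup>2) \<le> K\<^sup>2"
proof -
  assume A: "A \<in> G" and i: "i < n"
  have Au: "A \<in> unitary_group n" using A G_unitary by blast
  have "(\<Sum>k<n. (cmod (H A i k))\<^sup>2) = (\<Sum>j<n. (cmod (A $$ (i, j)))\<^sup>2 * (y j)\<^sup>2)" by (rule conj_entry_row_norm[OF Au])
  also have "\<dots> \<le> (\<Sum>j<n. (cmod (A $$ (i, j)))\<^sup>2 * K\<^sup>2)"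
    using yK by (intro sum_mono mult_left_mono power2_le_iff_abs_le[THEN iffD2]) (auto simp: K)
  also have "\<dots> = K\<^sup>2" using unitary_row_sum[OF Au i] by (simp add: sum_distrib_right[symmetric])
  finally show ?thesis .
qed

lemma total_H: "A \<in> G \<Longrightarrow> (\<Sum>i<n. \<Sum>k<n. (cmod (H A i k))\<^sup>2) = S2"
proof -
  assume A: "A \<in> G"
  have Au: "A \<in> unitary_group n" using A G_unitary by blast
  have "(\<Sum>i<n. \<Sum>k<n. (cmod (H A i k))\<^sup>2) = (\<Sum>i<n. \<Sum>j<n. (cmod (A $$ (i, j)))\<^sup>2 * (y j)\<^sup>2)"
    by (simp add: conj_entry_row_norm[OF Au])
  also have "\<dots> = (\<Sum>j<n. (\<Sum>i<n. (cmod (A $$ (i, j)))\<^sup>2) * (y j)\<^sup>2)"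
    unfolding sum_distrib_right by (rule sum.swap)
  also have "\<dots> = S2" unfolding S2_def by (intro sum.cong refl) (simp add: unitary_column_sum[OF Au])
  finally show ?thesis .
qed

lemma h_bound: "A \<in> G \<Longrightarrow> i < n \<Longrightarrow> \<bar>h A i\<bar> \<le> K"
proof -
  assume A: "A \<in> G" and i: "i < n"
  have "(h A i)\<^sup>2 = (cmod (H A i i))\<^sup>2" by (simp add: conj_entry_diag)
  also have "\<dots> \<le> (\<Sum>k<n. (cmod (H A i k))\<^sup>2)" using i by (intro member_le_sum) auto
  also have "\<dots> \<le> K\<^sup>2" by (rule row_H[OF A i])
  finally show ?thesis using K by (simp add: power2_le_iff_abs_le)
qed

lemma h_sum: "A \<in> G \<Longrightarrow> (\<Sum>i<n. h A i) = 0"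
  using conj_diag_sum[of A n y] G_unitary y0 by auto

lemma h_measurable [measurable]: "i < n \<Longrightarrow> (\<lambda>A. h A i) \<in> borel_measurable \<mu>"
  by (rule conj_diag_measurable)

lemma T2_measurable [measurable]: "T2 \<in> borel_measurable \<mu>" and T4_measurable [measurable]: "T4 \<in> borel_measurable \<mu>"
  unfolding T2_def[abs_def] T4_def[abs_def] by (auto intro!: borel_measurable_sum borel_measurable_power)

lemma xr_measurable [measurable]:
  assumes "i < n" "k < n" shows "(\<lambda>A. xr z A i k) \<in> borel_measurable \<mu>"
proof -
  have "(\<lambda>A. H A i k) \<in> borel_measurable \<mu>" unfolding conj_entry_def
    using assms by (intro borel_measurable_sum borel_measurable_times borel_measurable_const entry_measurable
      measurable_compose[OF entry_measurable borel_measurable_continuous_onI[OF continuous_on_cnj[OF continuous_on_id]]]) auto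
  then show ?thesis unfolding xr_def by measurable
qed

lemma rotate:
  fixes \<Phi> :: "(nat \<Rightarrow> real) \<Rightarrow> real"
  assumes ik: "i < n" "k < n" "i \<noteq> k" and z: "z \<in> Z"
    and \<Phi>: "(\<lambda>A. \<Phi> (\<lambda>a\<in>{..<n}. h A a)) \<in> borel_measurable \<mu>"
  shows "expectation (\<lambda>A. \<Phi> (\<lambda>a\<in>{..<n}. if a = i then md A i k + xr z A i k else if a = k then md A i k - xr z A i k else h A a))
      = expectation (\<lambda>A. \<Phi> (\<lambda>a\<in>{..<n}. h A a))"
proof -
  have "expectation (\<lambda>A. \<Phi> (\<lambda>a\<in>{..<n}. h A a)) = expectation (\<lambda>A. \<Phi> (\<lambda>a\<in>{..<n}. h (row_rotation n i k z * A) a))"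
    using expectation_mult[OF rotation_G[OF ik z] \<Phi>] by simp
  also have "\<dots> = expectation (\<lambda>A. \<Phi> (\<lambda>a\<in>{..<n}. if a = i then md A i k + xr z A i k else if a = k then md A i k - xr z A i k else h A a))"
  proof (intro Bochner_Integration.integral_cong refl arg_cong[where f=\<Phi>] restrict_ext)
    fix A a assume "A \<in> space \<mu>" "a \<in> {..<n}"
    then show "h (row_rotation n i k z * A) a = (if a = i then md A i k + xr z A i k else if a = k then md A i k - xr z A i k else h A a)"
      using conj_diag_rotation[OF _ ik Z(3)[OF z], of A a y] G_carrier by (auto simp: space_mu md_def xr_def)
  qed
  finally show ?thesis by simp
qed

lemma xr_bound:
  assumes "A \<in> G" "i < n" "k < n" "z \<in> Z"
  shows "\<bar>xr z A i k\<bar> \<le> K" and "(xr z A i k)\<^sup>2 \<le> (cmod (H A i k))\<^sup>2"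
proof -
  have "(xr z A i k)\<^sup>2 \<le> (\<Sum>z\<in>Z. (xr z A i k)\<^sup>2)" using assms Z by (intro member_le_sum) auto
  also have "\<dots> = (cmod (H A i k))\<^sup>2" unfolding xr_def using assms by (intro entry_Z)
  finally show 1: "(xr z A i k)\<^sup>2 \<le> (cmod (H A i k))\<^sup>2" .
  also have "\<dots> \<le> (\<Sum>k<n. (cmod (H A i k))\<^sup>2)" using assms by (intro member_le_sum) auto
  also have "\<dots> \<le> K\<^sup>2" using assms by (intro row_H)
  finally show "\<bar>xr z A i k\<bar> \<le> K" using K by (simp add: power2_le_iff_abs_le)
qed

lemma sum_change:
  fixes F :: "real \<Rightarrow> real"
  assumes "i < n" "k < n" "i \<noteq> k"
  shows "(\<Sum>a<n. F (if a = i then p else if a = k then q else v a)) = (\<Sum>a<n. F (v a)) - F (v i) - F (v k) + F p + F q"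
proof -
  have split: "(\<Sum>a<n. g a) = g i + g k + (\<Sum>a\<in>{..<n} - {i} - {k}. g a)" for g :: "nat \<Rightarrow> real"
    using assms sum.remove[of "{..<n}" i g] sum.remove[of "{..<n} - {i}" k g] by simp
  have "(\<Sum>a\<in>{..<n} - {i} - {k}. F (if a = i then p else if a = k then q else v a)) = (\<Sum>a\<in>{..<n} - {i} - {k}. F (v a))"
    by (intro sum.cong) auto
  then show ?thesis unfolding split using assms by simp
qed

lemma dd_bound: "A \<in> G \<Longrightarrow> i < n \<Longrightarrow> k < n \<Longrightarrow> \<bar>dd A i k\<bar> \<le> K"
  and md_bound: "A \<in> G \<Longrightarrow> i < n \<Longrightarrow> k < n \<Longrightarrow> \<bar>md A i k\<bar> \<le> K"
  using h_bound[of A i] h_bound[of A k] unfolding dd_def md_def by (auto simp: abs_le_iff)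

lemma dd_measurable [measurable]: "i < n \<Longrightarrow> k < n \<Longrightarrow> (\<lambda>A. dd A i k) \<in> borel_measurable \<mu>"
  and md_measurable [measurable]: "i < n \<Longrightarrow> k < n \<Longrightarrow> (\<lambda>A. md A i k) \<in> borel_measurable \<mu>"
  unfolding dd_def md_def by measurable

lemma T2_nonneg: "0 \<le> T2 A" and T4_nonneg: "0 \<le> T4 A"
  unfolding T2_def T4_def by (auto intro: sum_nonneg)

lemma T2_bound: "A \<in> G \<Longrightarrow> \<bar>T2 A\<bar> \<le> real n * K\<^sup>2"
proof -
  assume A: "A \<in> G"
  have "T2 A \<le> (\<Sum>i<n. K\<^sup>2)" unfolding T2_def using h_bound[OF A] K
    by (intro sum_mono power2_le_iff_abs_le[THEN iffD2]) auto
  then show ?thesis using T2_nonneg[of A] by simp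
qed

lemma T4_bound: "A \<in> G \<Longrightarrow> \<bar>T4 A\<bar> \<le> real n * K ^ 4"
proof -
  assume A: "A \<in> G"
  have "h A i ^ 4 \<le> K ^ 4" if "i < n" for i
    using power_mono[OF h_bound[OF A that] abs_ge_zero, of 4] by simp
  then have "T4 A \<le> (\<Sum>i<n. K ^ 4)" unfolding T4_def by (intro sum_mono) auto
  then show ?thesis using T4_nonneg[of A] by simp
qed

lemma rotate_T2:
  assumes ik: "i < n" "k < n" "i \<noteq> k" and z: "z \<in> Z"
  shows "expectation (\<lambda>A. (T2 A + (2 * (xr z A i k)\<^sup>2 - 2 * (dd A i k)\<^sup>2)) ^ r) = expectation (\<lambda>A. T2 A ^ r)"
proof -
  let ?\<Phi> = "\<lambda>v. (\<Sum>a<n. (v a)\<^sup>2) ^ r :: real"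
  have "expectation (\<lambda>A. ?\<Phi> (\<lambda>a\<in>{..<n}. if a = i then md A i k + xr z A i k else if a = k then md A i k - xr z A i k else h A a))
      = expectation (\<lambda>A. ?\<Phi> (\<lambda>a\<in>{..<n}. h A a))"
  proof (rule rotate[OF ik z])
    have "(\<lambda>A. T2 A ^ r) \<in> borel_measurable \<mu>" by measurable
    then show "(\<lambda>A. ?\<Phi> (\<lambda>a\<in>{..<n}. h A a)) \<in> borel_measurable \<mu>" unfolding T2_def by (simp cong: sum.cong)
  qed
  moreover have "(\<Sum>a<n. ((\<lambda>a\<in>{..<n}. if a = i then md A i k + xr z A i k else if a = k then md A i k - xr z A i k else h A a) a)\<^sup>2)
      = T2 A + (2 * (xr z A i k)\<^sup>2 - 2 * (dd A i k)\<^sup>2)" for A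
  proof -
    have "(\<Sum>a<n. ((\<lambda>a\<in>{..<n}. if a = i then md A i k + xr z A i k else if a = k then md A i k - xr z A i k else h A a) a)\<^sup>2)
       = (\<Sum>a<n. (if a = i then md A i k + xr z A i k else if a = k then md A i k - xr z A i k else h A a)\<^sup>2)"
      by (intro sum.cong) auto
    also have "\<dots> = T2 A - (h A i)\<^sup>2 - (h A k)\<^sup>2 + (md A i k + xr z A i k)\<^sup>2 + (md A i k - xr z A i k)\<^sup>2"
      unfolding T2_def by (rule sum_change[OF ik])
    finally show ?thesis unfolding md_def dd_def by (simp add: power2_eq_square field_simps)
  qed
  moreover have "(\<Sum>a<n. ((\<lambda>a\<in>{..<n}. h A a) a)\<^sup>2) = T2 A" for A unfolding T2_def by (intro sum.cong) auto
  ultimately show ?thesis by simp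
qed

text \<open>
  The rotation exchanges half the difference of two diagonal entries with the off-diagonal entry
  and keeps their half sum, so these moments agree.
\<close>

lemma rotate_fourth:
  assumes ik: "i < n" "k < n" "i \<noteq> k" and z: "z \<in> Z"
  shows "expectation (\<lambda>A. (xr z A i k) ^ 4) = expectation (\<lambda>A. (dd A i k) ^ 4)"
    and "expectation (\<lambda>A. (md A i k)\<^sup>2 * (xr z A i k)\<^sup>2) = expectation (\<lambda>A. (md A i k)\<^sup>2 * (dd A i k)\<^sup>2)"
proof -
  have "expectation (\<lambda>A. (((md A i k + xr z A i k) - (md A i k - xr z A i k)) / 2) ^ 4) = expectation (\<lambda>A. ((h A i - h A k) / 2) ^ 4)"
    using rotate[OF ik z, of "\<lambda>v. ((v i - v k) / 2) ^ 4"] ik by simp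
  then show "expectation (\<lambda>A. (xr z A i k) ^ 4) = expectation (\<lambda>A. (dd A i k) ^ 4)" unfolding dd_def by simp
  have "expectation (\<lambda>A. (((md A i k + xr z A i k) + (md A i k - xr z A i k)) / 2)\<^sup>2 * (((md A i k + xr z A i k) - (md A i k - xr z A i k)) / 2)\<^sup>2)
     = expectation (\<lambda>A. ((h A i + h A k) / 2)\<^sup>2 * ((h A i - h A k) / 2)\<^sup>2)"
    using rotate[OF ik z, of "\<lambda>v. ((v i + v k) / 2)\<^sup>2 * ((v i - v k) / 2)\<^sup>2"] ik by simp
  then show "expectation (\<lambda>A. (md A i k)\<^sup>2 * (xr z A i k)\<^sup>2) = expectation (\<lambda>A. (md A i k)\<^sup>2 * (dd A i k)\<^sup>2)"
    unfolding dd_def md_def by simp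
qed

lemma sum_dd: "A \<in> G \<Longrightarrow> (\<Sum>i<n. \<Sum>k<n. (dd A i k)\<^sup>2) = real n * T2 A / 2"
proof -
  assume A: "A \<in> G"
  have "(\<Sum>i<n. \<Sum>k<n. (dd A i k)\<^sup>2) = (\<Sum>i<n. \<Sum>k<n. (h A i - h A k)\<^sup>2) / 4"
    unfolding dd_def by (simp add: power_divide sum_divide_distrib)
  then show ?thesis unfolding sum_pairwise_square_diff h_sum[OF A] T2_def by simp
qed

lemma sum_off_diagonal:
  fixes g :: "nat \<Rightarrow> nat \<Rightarrow> real"
  shows "(\<Sum>i<n. \<Sum>k\<in>{..<n} - {i}. g i k) = (\<Sum>i<n. \<Sum>k<n. g i k) - (\<Sum>i<n. g i i)"
  by (simp add: sum_diff1 sum_subtractf)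

text \<open>
  Summing the effect of all rotations on \<open>T2\<close>: the off-diagonal entries together with the diagonal have the
  Hilbert--Schmidt norm of the diagonal matrix, and the differences of the diagonal entries
  give back a multiple of \<open>T2\<close> because their sum vanishes.
\<close>

lemma drift:
  assumes A: "A \<in> G"
  shows "(\<Sum>i<n. \<Sum>k\<in>{..<n} - {i}. \<Sum>z\<in>Z. 2 * (xr z A i k)\<^sup>2 - 2 * (dd A i k)\<^sup>2) = 2 * S2 - (b * n + 2) * T2 A"
proof -
  have z: "(\<Sum>z\<in>Z. 2 * (xr z A i k)\<^sup>2 - 2 * (dd A i k)\<^sup>2) = 2 * (cmod (H A i k))\<^sup>2 - 2 * b * (dd A i k)\<^sup>2" if "i < n" "k < n" for i k
  proof -
    have "(\<Sum>z\<in>Z. 2 * (xr z A i k)\<^sup>2 - 2 * (dd A i k)\<^sup>2) = 2 * (\<Sum>z\<in>Z. (xr z A i k)\<^sup>2) - 2 * b * (dd A i k)\<^sup>2"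
      by (simp add: sum_subtractf sum_distrib_left b_def)
    then show ?thesis using entry_Z[OF A that, of y] unfolding xr_def by simp
  qed
  have "(\<Sum>i<n. \<Sum>k\<in>{..<n} - {i}. \<Sum>z\<in>Z. 2 * (xr z A i k)\<^sup>2 - 2 * (dd A i k)\<^sup>2) =
     (\<Sum>i<n. \<Sum>k\<in>{..<n} - {i}. 2 * (cmod (H A i k))\<^sup>2 - 2 * b * (dd A i k)\<^sup>2)"
    by (intro sum.cong refl z) auto
  also have "\<dots> = (\<Sum>i<n. \<Sum>k<n. 2 * (cmod (H A i k))\<^sup>2 - 2 * b * (dd A i k)\<^sup>2) - (\<Sum>i<n. 2 * (cmod (H A i i))\<^sup>2 - 2 * b * (dd A i i)\<^sup>2)"
    by (rule sum_off_diagonal)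
  also have "(\<Sum>i<n. 2 * (cmod (H A i i))\<^sup>2 - 2 * b * (dd A i i)\<^sup>2) = 2 * T2 A"
    unfolding conj_entry_diag T2_def by (simp add: dd_def sum_distrib_left)
  also have "(\<Sum>i<n. \<Sum>k<n. 2 * (cmod (H A i k))\<^sup>2 - 2 * b * (dd A i k)\<^sup>2) = 2 * (\<Sum>i<n. \<Sum>k<n. (cmod (H A i k))\<^sup>2) - 2 * b * (\<Sum>i<n. \<Sum>k<n. (dd A i k)\<^sup>2)"
    by (simp only: sum_subtractf sum_distrib_left)
  also have "\<dots> - 2 * T2 A = 2 * S2 - (b * n + 2) * T2 A"
    unfolding total_H[OF A] sum_dd[OF A] by (simp add: algebra_simps)
  finally show ?thesis .
qed

abbreviation Q where "Q z A i k \<equiv> 2 * (xr z A i k)\<^sup>2 - 2 * (dd A i k)\<^sup>2"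

lemma Q_bound: "A \<in> G \<Longrightarrow> i < n \<Longrightarrow> k < n \<Longrightarrow> z \<in> Z \<Longrightarrow> \<bar>Q z A i k\<bar> \<le> 2 * K\<^sup>2"
proof -
  assume a: "A \<in> G" "i < n" "k < n" "z \<in> Z"
  have "(xr z A i k)\<^sup>2 \<le> K\<^sup>2" "(dd A i k)\<^sup>2 \<le> K\<^sup>2"
    using xr_bound(1)[OF a] dd_bound[OF a(1-3)] K by (simp_all add: power2_le_iff_abs_le)
  moreover have "0 \<le> (xr z A i k)\<^sup>2" "0 \<le> (dd A i k)\<^sup>2" by simp_all
  ultimately show ?thesis by linarith
qed

lemma intG:
  fixes f :: "complex mat \<Rightarrow> real"
  assumes "f \<in> borel_measurable \<mu>" "\<And>A. A \<in> G \<Longrightarrow> \<bar>f A\<bar> \<le> C"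
  shows "integrable \<mu> f"
  using assms by (intro integrable_of_bounded[of _ C]) (auto simp: space_mu)

lemma int_T2_power: "integrable \<mu> (\<lambda>A. T2 A ^ r)"
proof (rule intG[of _ "(real n * K\<^sup>2) ^ r"])
  show "\<bar>T2 A ^ r\<bar> \<le> (real n * K\<^sup>2) ^ r" if "A \<in> G" for A
    unfolding power_abs by (intro power_mono T2_bound that) auto
qed measurable

lemma int_T2: "integrable \<mu> T2" using int_T2_power[of 1] by simp

lemma int_T4: "integrable \<mu> T4" by (rule intG[OF T4_measurable T4_bound])

lemma int_Q: "i < n \<Longrightarrow> k < n \<Longrightarrow> z \<in> Z \<Longrightarrow> integrable \<mu> (\<lambda>A. Q z A i k)"
  by (rule intG[of _ "2 * K\<^sup>2"]) (auto intro: Q_bound)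

lemma int_Q2: "i < n \<Longrightarrow> k < n \<Longrightarrow> z \<in> Z \<Longrightarrow> integrable \<mu> (\<lambda>A. (Q z A i k)\<^sup>2)"
proof (rule intG[of _ "(2 * K\<^sup>2)\<^sup>2"])
  assume ik: "i < n" "k < n" "z \<in> Z"
  show "(\<lambda>A. (Q z A i k)\<^sup>2) \<in> borel_measurable \<mu>" using ik by measurable
  show "\<bar>(Q z A i k)\<^sup>2\<bar> \<le> (2 * K\<^sup>2)\<^sup>2" if "A \<in> G" for A
    using power_mono[OF Q_bound[OF that ik] abs_ge_zero, of 2] by simp
qed

lemma int_T2Q: "i < n \<Longrightarrow> k < n \<Longrightarrow> z \<in> Z \<Longrightarrow> integrable \<mu> (\<lambda>A. T2 A * Q z A i k)"
proof (rule intG[of _ "(real n * K\<^sup>2) * (2 * K\<^sup>2)"])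
  assume ik: "i < n" "k < n" "z \<in> Z"
  show "(\<lambda>A. T2 A * Q z A i k) \<in> borel_measurable \<mu>" using ik by measurable
  show "\<bar>T2 A * Q z A i k\<bar> \<le> (real n * K\<^sup>2) * (2 * K\<^sup>2)" if "A \<in> G" for A
    unfolding abs_mult by (intro mult_mono T2_bound Q_bound that ik) auto
qed

lemma E_Q: "i < n \<Longrightarrow> k < n \<Longrightarrow> i \<noteq> k \<Longrightarrow> z \<in> Z \<Longrightarrow> expectation (\<lambda>A. Q z A i k) = 0"
  using rotate_T2[of i k z 1] int_T2 int_Q[of i k z]
  by (simp add: Bochner_Integration.integral_add[OF int_T2 int_Q] del: Bochner_Integration.integral_diff)

lemma E_Q2:
  assumes ik: "i < n" "k < n" "i \<noteq> k" "z \<in> Z"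
  shows "expectation (\<lambda>A. (Q z A i k)\<^sup>2) = - 2 * expectation (\<lambda>A. T2 A * Q z A i k)"
proof -
  have lin: "expectation (\<lambda>A. f A + (2 * g A + q A)) = expectation f + (2 * expectation g + expectation q)"
    if "integrable \<mu> f" "integrable \<mu> g" "integrable \<mu> q" for f g q :: "complex mat \<Rightarrow> real"
    using that by simp
  have "expectation (\<lambda>A. T2 A ^ 2) = expectation (\<lambda>A. (T2 A + Q z A i k) ^ 2)" using rotate_T2[OF ik, of 2] by simp
  also have "\<dots> = expectation (\<lambda>A. T2 A ^ 2 + (2 * (T2 A * Q z A i k) + (Q z A i k)\<^sup>2))"
    by (intro Bochner_Integration.integral_cong refl) (simp add: power2_sum)
  also have "\<dots> = expectation (\<lambda>A. T2 A ^ 2) + (2 * expectation (\<lambda>A. T2 A * Q z A i k) + expectation (\<lambda>A. (Q z A i k)\<^sup>2))"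
    by (rule lin[OF int_T2_power int_T2Q[OF ik(1,2,4)] int_Q2[OF ik(1,2,4)]])
  finally show ?thesis by simp
qed

lemma expectation_sum3:
  fixes f :: "nat \<Rightarrow> nat \<Rightarrow> complex \<Rightarrow> complex mat \<Rightarrow> real"
  assumes f: "\<And>i k z. i < n \<Longrightarrow> k < n \<Longrightarrow> z \<in> Z \<Longrightarrow> integrable \<mu> (f i k z)"
  shows "expectation (\<lambda>A. \<Sum>i<n. \<Sum>k\<in>{..<n} - {i}. \<Sum>z\<in>Z. f i k z A) = (\<Sum>i<n. \<Sum>k\<in>{..<n} - {i}. \<Sum>z\<in>Z. expectation (f i k z))"
proof -
  have "expectation (\<lambda>A. \<Sum>i<n. \<Sum>k\<in>{..<n} - {i}. \<Sum>z\<in>Z. f i k z A) = (\<Sum>i<n. expectation (\<lambda>A. \<Sum>k\<in>{..<n} - {i}. \<Sum>z\<in>Z. f i k z A))"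
    by (auto intro!: Bochner_Integration.integral_sum integrable_sum f)
  also have "\<dots> = (\<Sum>i<n. \<Sum>k\<in>{..<n} - {i}. expectation (\<lambda>A. \<Sum>z\<in>Z. f i k z A))"
    by (auto intro!: sum.cong Bochner_Integration.integral_sum integrable_sum f)
  also have "\<dots> = (\<Sum>i<n. \<Sum>k\<in>{..<n} - {i}. \<Sum>z\<in>Z. expectation (f i k z))"
    by (auto intro!: sum.cong Bochner_Integration.integral_sum f)
  finally show ?thesis .
qed

lemma expectation_sum2:
  fixes f :: "nat \<Rightarrow> nat \<Rightarrow> complex mat \<Rightarrow> real"
  assumes f: "\<And>i k. i < n \<Longrightarrow> k < n \<Longrightarrow> integrable \<mu> (f i k)"
  shows "expectation (\<lambda>A. \<Sum>i<n. \<Sum>k\<in>{..<n} - {i}. f i k A) = (\<Sum>i<n. \<Sum>k\<in>{..<n} - {i}. expectation (f i k))"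
proof -
  have "expectation (\<lambda>A. \<Sum>i<n. \<Sum>k\<in>{..<n} - {i}. f i k A) = (\<Sum>i<n. expectation (\<lambda>A. \<Sum>k\<in>{..<n} - {i}. f i k A))"
    by (auto intro!: Bochner_Integration.integral_sum integrable_sum f)
  also have "\<dots> = (\<Sum>i<n. \<Sum>k\<in>{..<n} - {i}. expectation (f i k))"
    by (auto intro!: sum.cong Bochner_Integration.integral_sum f)
  finally show ?thesis .
qed

lemma E_T2: "(b * n + 2) * expectation T2 = 2 * S2"
proof -
  have "0 = (\<Sum>i<n. \<Sum>k\<in>{..<n} - {i}. \<Sum>z\<in>Z. expectation (\<lambda>A. Q z A i k))"
    using E_Q by (intro sum.neutral[symmetric] ballI) auto
  also have "\<dots> = expectation (\<lambda>A. \<Sum>i<n. \<Sum>k\<in>{..<n} - {i}. \<Sum>z\<in>Z. Q z A i k)"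
    by (rule expectation_sum3[symmetric]) (rule int_Q)
  also have "\<dots> = expectation (\<lambda>A. 2 * S2 - (b * n + 2) * T2 A)"
    by (intro Bochner_Integration.integral_cong refl drift) (simp add: space_mu)
  also have "\<dots> = 2 * S2 - (b * n + 2) * expectation T2" using int_T2 by (simp add: prob_space)
  finally show ?thesis by simp
qed

lemma fourth_power_average: "((p - q) / 2) ^ 4 \<le> (p ^ 4 + q ^ 4) / 2" for p q :: real
proof -
  have av: "((u + v) / 2)\<^sup>2 \<le> (u\<^sup>2 + v\<^sup>2) / 2" for u v :: real
    using zero_le_power2[of "u - v"] by (simp add: power2_eq_square field_simps)
  have "((p - q) / 2) ^ 4 = (((p + (- q)) / 2)\<^sup>2)\<^sup>2" by simp
  also have "\<dots> \<le> ((p\<^sup>2 + (- q)\<^sup>2) / 2)\<^sup>2" by (rule power_mono[OF av]) simp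
  also have "\<dots> \<le> ((p\<^sup>2)\<^sup>2 + ((- q)\<^sup>2)\<^sup>2) / 2" by (rule av)
  also have "\<dots> = (p ^ 4 + q ^ 4) / 2" by simp
  finally show ?thesis .
qed

lemma int_h4: "i < n \<Longrightarrow> integrable \<mu> (\<lambda>A. h A i ^ 4)"
proof (rule intG[of _ "K ^ 4"])
  assume i: "i < n"
  show "\<bar>h A i ^ 4\<bar> \<le> K ^ 4" if "A \<in> G" for A unfolding power_abs by (intro power_mono h_bound that i) auto
qed measurable

lemma E_Q2_le:
  assumes ik: "i < n" "k < n" "i \<noteq> k" "z \<in> Z"
  shows "expectation (\<lambda>A. (Q z A i k)\<^sup>2) \<le> 4 * (expectation (\<lambda>A. h A i ^ 4) + expectation (\<lambda>A. h A k ^ 4))"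
proof -
  have ix: "integrable \<mu> (\<lambda>A. (xr z A i k) ^ 4)"
  proof (rule intG[of _ "K ^ 4"])
    show "\<bar>(xr z A i k) ^ 4\<bar> \<le> K ^ 4" if "A \<in> G" for A unfolding power_abs using ik by (intro power_mono xr_bound that) auto
  qed (use ik in measurable)
  have id: "integrable \<mu> (\<lambda>A. (dd A i k) ^ 4)"
  proof (rule intG[of _ "K ^ 4"])
    show "\<bar>(dd A i k) ^ 4\<bar> \<le> K ^ 4" if "A \<in> G" for A unfolding power_abs using ik by (intro power_mono dd_bound that) auto
  qed (use ik in measurable)
  have p: "(2 * u - 2 * v)\<^sup>2 \<le> 4 * (u\<^sup>2 + v\<^sup>2)" if "0 \<le> u" "0 \<le> v" for u v :: real
  proof -
    have "4 * (u\<^sup>2 + v\<^sup>2) - (2 * u - 2 * v)\<^sup>2 = 8 * (u * v)" by (simp add: power2_eq_square algebra_simps)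
    then show ?thesis using mult_nonneg_nonneg[OF that] by linarith
  qed
  have "(Q z A i k)\<^sup>2 \<le> 4 * ((xr z A i k) ^ 4 + (dd A i k) ^ 4)" for A
    using p[of "(xr z A i k)\<^sup>2" "(dd A i k)\<^sup>2"] by simp
  then have "expectation (\<lambda>A. (Q z A i k)\<^sup>2) \<le> expectation (\<lambda>A. 4 * ((xr z A i k) ^ 4 + (dd A i k) ^ 4))"
    using int_Q2[OF ik(1,2,4)] ix id by (intro integral_mono) auto
  also have "\<dots> = 8 * expectation (\<lambda>A. (dd A i k) ^ 4)"
    using ix id by (simp add: rotate_fourth(1)[OF ik])
  finally have 8: "expectation (\<lambda>A. (Q z A i k)\<^sup>2) \<le> 8 * expectation (\<lambda>A. (dd A i k) ^ 4)" .
  have "expectation (\<lambda>A. (dd A i k) ^ 4) \<le> expectation (\<lambda>A. (h A i ^ 4 + h A k ^ 4) / 2)"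
    using id int_h4 ik fourth_power_average unfolding dd_def by (intro integral_mono) auto
  also have "\<dots> = (expectation (\<lambda>A. h A i ^ 4) + expectation (\<lambda>A. h A k ^ 4)) / 2"
    using int_h4 ik by simp
  finally show ?thesis using 8 by linarith
qed

lemma E_T4: "expectation T4 = (\<Sum>i<n. expectation (\<lambda>A. h A i ^ 4))"
  unfolding T4_def[abs_def] using int_h4 by (subst Bochner_Integration.integral_sum) auto

lemma variance_T2_le: "expectation (\<lambda>A. (T2 A - expectation T2)\<^sup>2) \<le> 4 * expectation T4"
proof -
  have "(\<Sum>i<n. \<Sum>k\<in>{..<n} - {i}. \<Sum>z\<in>Z. expectation (\<lambda>A. (Q z A i k)\<^sup>2)) =
      (\<Sum>i<n. \<Sum>k\<in>{..<n} - {i}. \<Sum>z\<in>Z. - 2 * expectation (\<lambda>A. T2 A * Q z A i k))"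
    using E_Q2 by (intro sum.cong refl) auto
  also have "\<dots> = - 2 * (\<Sum>i<n. \<Sum>k\<in>{..<n} - {i}. \<Sum>z\<in>Z. expectation (\<lambda>A. T2 A * Q z A i k))"
    by (simp only: sum_distrib_left)
  also have "(\<Sum>i<n. \<Sum>k\<in>{..<n} - {i}. \<Sum>z\<in>Z. expectation (\<lambda>A. T2 A * Q z A i k)) =
      expectation (\<lambda>A. \<Sum>i<n. \<Sum>k\<in>{..<n} - {i}. \<Sum>z\<in>Z. T2 A * Q z A i k)"
    by (rule expectation_sum3[symmetric]) (rule int_T2Q)
  also have "expectation (\<lambda>A. \<Sum>i<n. \<Sum>k\<in>{..<n} - {i}. \<Sum>z\<in>Z. T2 A * Q z A i k) = expectation (\<lambda>A. 2 * S2 * T2 A - (b * n + 2) * T2 A ^ 2)"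
  proof (intro Bochner_Integration.integral_cong refl)
    fix A assume "A \<in> space \<mu>"
    then have "(\<Sum>i<n. \<Sum>k\<in>{..<n} - {i}. \<Sum>z\<in>Z. T2 A * Q z A i k) = T2 A * (2 * S2 - (b * n + 2) * T2 A)"
      by (simp only: sum_distrib_left[symmetric] drift space_mu)
    then show "(\<Sum>i<n. \<Sum>k\<in>{..<n} - {i}. \<Sum>z\<in>Z. T2 A * Q z A i k) = 2 * S2 * T2 A - (b * n + 2) * T2 A ^ 2"
      by (simp add: power2_eq_square algebra_simps)
  qed
  also have "\<dots> = 2 * S2 * expectation T2 - (b * n + 2) * expectation (\<lambda>A. T2 A ^ 2)"
    using int_T2 int_T2_power[of 2] by simp
  also have "\<dots> = - (b * n + 2) * (expectation (\<lambda>A. T2 A ^ 2) - (expectation T2)\<^sup>2)"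
    unfolding E_T2[symmetric] by (simp add: power2_eq_square algebra_simps)
  finally have S: "(\<Sum>i<n. \<Sum>k\<in>{..<n} - {i}. \<Sum>z\<in>Z. expectation (\<lambda>A. (Q z A i k)\<^sup>2)) =
      - 2 * (- (b * n + 2) * (expectation (\<lambda>A. T2 A ^ 2) - (expectation T2)\<^sup>2))" .
  have flip: "S = - 2 * (- c * D) \<Longrightarrow> 2 * c * D = S" for S c D :: real by simp
  note 1 = flip[OF S]
  have nn: "0 \<le> expectation (\<lambda>A. h A i ^ 4)" for i by simp
  have "(\<Sum>i<n. \<Sum>k\<in>{..<n} - {i}. \<Sum>z\<in>Z. expectation (\<lambda>A. (Q z A i k)\<^sup>2))
     \<le> (\<Sum>i<n. \<Sum>k\<in>{..<n} - {i}. \<Sum>z\<in>Z. 4 * (expectation (\<lambda>A. h A i ^ 4) + expectation (\<lambda>A. h A k ^ 4)))"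
    using E_Q2_le by (intro sum_mono) auto
  also have "\<dots> \<le> (\<Sum>i<n. \<Sum>k<n. \<Sum>z\<in>Z. 4 * (expectation (\<lambda>A. h A i ^ 4) + expectation (\<lambda>A. h A k ^ 4)))"
    using nn by (intro sum_mono sum_mono2 sum_nonneg mult_nonneg_nonneg add_nonneg_nonneg) auto
  also have "\<dots> = 8 * b * n * expectation T4"
    unfolding E_T4 by (simp add: sum.distrib sum_distrib_left[symmetric] b_def algebra_simps)
  finally have 2: "2 * (b * n + 2) * (expectation (\<lambda>A. T2 A ^ 2) - (expectation T2)\<^sup>2) \<le> 8 * b * n * expectation T4"
    unfolding 1 .
  have T40: "0 \<le> expectation T4" by (intro Bochner_Integration.integral_nonneg T4_nonneg)
  have "8 * b * n * expectation T4 \<le> (2 * (b * n + 2)) * (4 * expectation T4)" using T40 by (simp add: algebra_simps)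
  then have "(2 * (b * n + 2)) * (expectation (\<lambda>A. T2 A ^ 2) - (expectation T2)\<^sup>2) \<le> (2 * (b * n + 2)) * (4 * expectation T4)"
    using 2 by linarith
  moreover have "0 < 2 * (b * n + 2)" using b1 by (simp add: add_nonneg_pos)
  ultimately have "expectation (\<lambda>A. T2 A ^ 2) - (expectation T2)\<^sup>2 \<le> 4 * expectation T4" by (rule mult_left_le_imp_le)
  then show ?thesis using variance_eq[OF int_T2 int_T2_power[of 2]] by simp
qed

lemma T4_le: "n * expectation T4 \<le> expectation (\<lambda>A. T2 A ^ 2) + 8 * K\<^sup>2 * expectation T2"
proof -
  have sq: "(\<lambda>A. f A ^ 2 * g A ^ 2) \<in> borel_measurable \<mu>" if "f \<in> borel_measurable \<mu>" "g \<in> borel_measurable \<mu>" for f g :: "complex mat \<Rightarrow> real"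
    using that by measurable
  have int2: "integrable \<mu> (\<lambda>A. f A ^ 2 * g A ^ 2)"
    if "f \<in> borel_measurable \<mu>" "g \<in> borel_measurable \<mu>" "\<And>A. A \<in> G \<Longrightarrow> \<bar>f A\<bar> \<le> K" "\<And>A. A \<in> G \<Longrightarrow> \<bar>g A\<bar> \<le> K" for f g
  proof (rule intG[OF sq[OF that(1,2)], of "K ^ 2 * K ^ 2"])
    show "\<bar>f A ^ 2 * g A ^ 2\<bar> \<le> K ^ 2 * K ^ 2" if "A \<in> G" for A
      unfolding abs_mult power_abs using \<open>A \<in> G\<close> \<open>\<And>A. A \<in> G \<Longrightarrow> \<bar>f A\<bar> \<le> K\<close> \<open>\<And>A. A \<in> G \<Longrightarrow> \<bar>g A\<bar> \<le> K\<close>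
      by (intro mult_mono power_mono) auto
  qed
  have imd: "integrable \<mu> (\<lambda>A. (md A i k)\<^sup>2 * (dd A i k)\<^sup>2)" if "i < n" "k < n" for i k
    using that by (intro int2 md_measurable dd_measurable md_bound dd_bound)
  have imx: "integrable \<mu> (\<lambda>A. (md A i k)\<^sup>2 * (xr 1 A i k)\<^sup>2)" if "i < n" "k < n" for i k
    using that Z by (intro int2 md_measurable xr_measurable md_bound xr_bound)
  have pw: "(h A i ^ 2 - h A k ^ 2)\<^sup>2 = 16 * ((md A i k)\<^sup>2 * (dd A i k)\<^sup>2)" for A i k
  proof -
    have "h A i ^ 2 - h A k ^ 2 = 4 * (md A i k * dd A i k)" unfolding md_def dd_def by (simp add: power2_eq_square field_simps)
    then show ?thesis by (simp add: power_mult_distrib)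
  qed
  have id: "2 * n * T4 A - 2 * (T2 A)\<^sup>2 = 16 * (\<Sum>i<n. \<Sum>k\<in>{..<n} - {i}. (md A i k)\<^sup>2 * (dd A i k)\<^sup>2)" for A
  proof -
    have "2 * n * T4 A - 2 * (T2 A)\<^sup>2 = (\<Sum>i<n. \<Sum>k<n. (h A i ^ 2 - h A k ^ 2)\<^sup>2)"
      unfolding T2_def T4_def sum_pairwise_square_diff by simp
    also have "\<dots> = (\<Sum>i<n. \<Sum>k\<in>{..<n} - {i}. (h A i ^ 2 - h A k ^ 2)\<^sup>2)" unfolding sum_off_diagonal by simp
    finally show ?thesis unfolding pw by (simp only: sum_distrib_left)
  qed
  have "expectation (\<lambda>A. \<Sum>i<n. \<Sum>k\<in>{..<n} - {i}. (md A i k)\<^sup>2 * (dd A i k)\<^sup>2) =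
      (\<Sum>i<n. \<Sum>k\<in>{..<n} - {i}. expectation (\<lambda>A. (md A i k)\<^sup>2 * (dd A i k)\<^sup>2))"
    by (rule expectation_sum2) (rule imd)
  also have "\<dots> = (\<Sum>i<n. \<Sum>k\<in>{..<n} - {i}. expectation (\<lambda>A. (md A i k)\<^sup>2 * (xr 1 A i k)\<^sup>2))"
    using rotate_fourth(2)[OF _ _ _ Z(2)] by (intro sum.cong refl) auto
  also have "\<dots> = expectation (\<lambda>A. \<Sum>i<n. \<Sum>k\<in>{..<n} - {i}. (md A i k)\<^sup>2 * (xr 1 A i k)\<^sup>2)"
    by (rule expectation_sum2[symmetric]) (rule imx)
  finally have swap: "expectation (\<lambda>A. \<Sum>i<n. \<Sum>k\<in>{..<n} - {i}. (md A i k)\<^sup>2 * (dd A i k)\<^sup>2) =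
      expectation (\<lambda>A. \<Sum>i<n. \<Sum>k\<in>{..<n} - {i}. (md A i k)\<^sup>2 * (xr 1 A i k)\<^sup>2)" .
  have "2 * n * expectation T4 - 2 * expectation (\<lambda>A. T2 A ^ 2) = expectation (\<lambda>A. 2 * n * T4 A - 2 * (T2 A)\<^sup>2)"
    using int_T4 int_T2_power[of 2] by simp
  also have "\<dots> = 16 * expectation (\<lambda>A. \<Sum>i<n. \<Sum>k\<in>{..<n} - {i}. (md A i k)\<^sup>2 * (xr 1 A i k)\<^sup>2)"
    unfolding id swap[symmetric] by simp
  also have "\<dots> \<le> 16 * expectation (\<lambda>A. K\<^sup>2 * T2 A)"
  proof (intro mult_left_mono integral_mono)
    show "integrable \<mu> (\<lambda>A. \<Sum>i<n. \<Sum>k\<in>{..<n} - {i}. (md A i k)\<^sup>2 * (xr 1 A i k)\<^sup>2)"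
      by (auto intro!: Bochner_Integration.integrable_sum imx)
    show "integrable \<mu> (\<lambda>A. K\<^sup>2 * T2 A)" using int_T2 by simp
    fix A assume "A \<in> space \<mu>"
    then have A: "A \<in> G" by (simp add: space_mu)
    have md2: "(md A i k)\<^sup>2 \<le> ((h A i)\<^sup>2 + (h A k)\<^sup>2) / 2" for i k
      unfolding md_def using zero_le_power2[of "h A i - h A k"] by (simp add: power2_eq_square field_simps)
    have "(\<Sum>i<n. \<Sum>k\<in>{..<n} - {i}. (md A i k)\<^sup>2 * (xr 1 A i k)\<^sup>2) \<le> (\<Sum>i<n. \<Sum>k<n. (md A i k)\<^sup>2 * (xr 1 A i k)\<^sup>2)"
      by (intro sum_mono sum_mono2) auto
    also have "\<dots> \<le> (\<Sum>i<n. \<Sum>k<n. ((h A i)\<^sup>2 + (h A k)\<^sup>2) / 2 * (cmod (H A i k))\<^sup>2)"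
      using md2 xr_bound(2)[OF A _ _ Z(2)] by (intro sum_mono mult_mono) auto
    also have "\<dots> = ((\<Sum>i<n. \<Sum>k<n. (h A i)\<^sup>2 * (cmod (H A i k))\<^sup>2) + (\<Sum>i<n. \<Sum>k<n. (h A k)\<^sup>2 * (cmod (H A i k))\<^sup>2)) / 2"
      by (simp add: sum.distrib[symmetric] sum_divide_distrib distrib_right[symmetric])
    also have "(\<Sum>i<n. \<Sum>k<n. (h A k)\<^sup>2 * (cmod (H A i k))\<^sup>2) = (\<Sum>i<n. \<Sum>k<n. (h A i)\<^sup>2 * (cmod (H A i k))\<^sup>2)"
      by (subst sum.swap) (simp add: conj_entry_swap)
    finally have "(\<Sum>i<n. \<Sum>k\<in>{..<n} - {i}. (md A i k)\<^sup>2 * (xr 1 A i k)\<^sup>2) \<le> (\<Sum>i<n. \<Sum>k<n. (h A i)\<^sup>2 * (cmod (H A i k))\<^sup>2)"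
      by simp
    also have "\<dots> \<le> (\<Sum>i<n. (h A i)\<^sup>2 * K\<^sup>2)"
      unfolding sum_distrib_left[symmetric] using row_H[OF A] by (intro sum_mono mult_left_mono) auto
    also have "\<dots> = K\<^sup>2 * T2 A" unfolding T2_def sum_distrib_right[symmetric] by (rule mult.commute)
    finally show "(\<Sum>i<n. \<Sum>k\<in>{..<n} - {i}. (md A i k)\<^sup>2 * (xr 1 A i k)\<^sup>2) \<le> K\<^sup>2 * T2 A" .
  qed simp
  also have "\<dots> = 16 * (K\<^sup>2 * expectation T2)" by simp
  finally show ?thesis by linarith
qed

lemma S2_le: "S2 \<le> n * K\<^sup>2"
proof -
  have "S2 \<le> (\<Sum>j<n. K\<^sup>2)" unfolding S2_def using yK K by (intro sum_mono power2_le_iff_abs_le[THEN iffD2]) auto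
  then show ?thesis by simp
qed

lemma E_T2_le: "expectation T2 \<le> 2 * K\<^sup>2"
proof -
  have T20: "0 \<le> expectation T2" by (intro Bochner_Integration.integral_nonneg T2_nonneg)
  show ?thesis
  proof (cases "n = 0")
    case True
    have "T2 = (\<lambda>_. 0)" unfolding T2_def[abs_def] using True by simp
    then have "expectation T2 = 0" by simp
    then show ?thesis by simp
  next
    case False
    have "n * expectation T2 \<le> (b * n + 2) * expectation T2"
      using mult_right_mono[OF b1, of "real n"] T20 by (intro mult_right_mono) auto
    also have "\<dots> \<le> n * (2 * K\<^sup>2)" using E_T2 S2_le by simp
    finally show ?thesis using False by simp
  qed
qed

text \<open>
  As the law is invariant, the expectation of the drift vanishes, which determines the mean of \<open>T2\<close>. The same identity
  for \<open>T2^2\<close> bounds the variance by fourth moments, and the fourth moments are bounded through \<open>rotate_fourth\<close>.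
\<close>

theorem diagonal_moments:
  assumes n: "n \<ge> 8"
  shows "expectation (\<lambda>A. T2 A ^ 2) \<le> 24 * K ^ 4"
    and "expectation T4 \<le> 40 * K ^ 4 / n"
    and "expectation (\<lambda>A. (T2 A - 2 * S2 / (b * n + 2))\<^sup>2) \<le> 160 * K ^ 4 / n"
proof -
  let ?e1 = "expectation T2" and ?e2 = "expectation (\<lambda>A. T2 A ^ 2)" and ?e4 = "expectation T4"
  have T20: "0 \<le> ?e1" by (intro Bochner_Integration.integral_nonneg T2_nonneg)
  have v: "?e2 - ?e1\<^sup>2 \<le> 4 * ?e4"
    using variance_T2_le variance_eq[OF int_T2 int_T2_power[of 2]] by simp
  have "?e1\<^sup>2 \<le> (2 * K\<^sup>2)\<^sup>2" using E_T2_le T20 by (intro power_mono)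
  then have s: "?e1\<^sup>2 \<le> 4 * K ^ 4" by (simp add: power_mult_distrib)
  have "8 * K\<^sup>2 * ?e1 \<le> 8 * K\<^sup>2 * (2 * K\<^sup>2)" using E_T2_le by (intro mult_left_mono) auto
  also have "8 * K\<^sup>2 * (2 * K\<^sup>2) = 16 * K ^ 4" by (simp add: power2_eq_square power4_eq_xxxx)
  finally have t: "n * ?e4 \<le> ?e2 + 16 * K ^ 4" using T4_le by linarith
  have K40: "0 \<le> K ^ 4" by simp
  have "0 \<le> ?e4" by (intro Bochner_Integration.integral_nonneg T4_nonneg)
  then have "8 * ?e4 \<le> n * ?e4" using n by (intro mult_right_mono) auto
  then show e2: "?e2 \<le> 24 * K ^ 4" using v s t K40 by linarith
  have "n * ?e4 \<le> 40 * K ^ 4" using e2 t by linarith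
  then show e4: "?e4 \<le> 40 * K ^ 4 / n" using n by (simp add: field_simps)
  have "b * n + 2 > 0" using b1 by (intro add_nonneg_pos mult_nonneg_nonneg) auto
  then have "?e1 = 2 * S2 / (b * n + 2)" using E_T2 by (simp add: field_simps)
  then show "expectation (\<lambda>A. (T2 A - 2 * S2 / (b * n + 2))\<^sup>2) \<le> 160 * K ^ 4 / n"
    using variance_T2_le e4 by simp
qed

end

end

lemma haar_moments_unitary:
  assumes "haar_probability n (unitary_group n) \<mu>"
  shows "haar_moments \<mu> n (unitary_group n) {1, \<i>}"
proof -
  interpret prob_space \<mu> using assms by (simp add: haar_probability_def)
  show ?thesis
  proof
    show "row_rotation n i k z \<in> unitary_group n" if "i < n" "k < n" "i \<noteq> k" "z \<in> {1, \<i>}" for i k z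
      using that by (intro row_rotation_unitary) auto
    show "(\<Sum>z\<in>{1, \<i>}. (Re (cnj z * conj_entry n y A i k))\<^sup>2) = (cmod (conj_entry n y A i k))\<^sup>2" for A y i k
      by (simp add: cmod_power2)
  qed (use assms unitary_group_mult in auto)
qed

lemma haar_moments_orthogonal:
  assumes "haar_probability n (orthogonal_group n) \<mu>"
  shows "haar_moments \<mu> n (orthogonal_group n) {1}"
proof -
  interpret prob_space \<mu> using assms by (simp add: haar_probability_def)
  show ?thesis
  proof
    show "row_rotation n i k z \<in> orthogonal_group n" if "i < n" "k < n" "i \<noteq> k" "z \<in> {1}" for i k z
      using that row_rotation_orthogonal by auto
    show "(\<Sum>z\<in>{1}. (Re (cnj z * conj_entry n y A i k))\<^sup>2) = (cmod (conj_entry n y A i k))\<^sup>2"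
      if "A \<in> orthogonal_group n" "i < n" "k < n" for A y i k
    proof -
      have "Im (conj_entry n y A i k) = 0" using that unfolding conj_entry_def orthogonal_group_iff by simp
      then show ?thesis by (simp add: cmod_power2)
    qed
  qed (use assms orthogonal_group_mult orthogonal_group_iff in auto)
qed

section \<open>Gaussian processes\<close>

lemma (in prob_space) normal_law_facts:
  assumes X [measurable]: "X \<in> borel_measurable M" and law: "normal_law (distr M borel X)"
  shows "integrable M X" "integrable M (\<lambda>w. (X w)\<^sup>2)"
    and "expectation X = 0 \<Longrightarrow> expectation (\<lambda>w. iexp (X w)) = exp (- expectation (\<lambda>w. (X w)\<^sup>2) / 2)"
proof -
  have "integrable M X \<and> integrable M (\<lambda>w. (X w)\<^sup>2) \<and>
    (expectation X = 0 \<longrightarrow> expectation (\<lambda>w. iexp (X w)) = exp (- expectation (\<lambda>w. (X w)\<^sup>2) / 2))"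
    using law unfolding normal_law_def
  proof (elim disjE exE conjE)
    fix m \<sigma> :: real assume \<sigma>: "0 < \<sigma>" and d: "distr M borel X = density lborel (normal_density m \<sigma>)"
    have "distr M lborel X = distr M borel X" by (rule distr_cong) auto
    then have D: "distributed M lborel X (normal_density m \<sigma>)" using d by (auto simp: distributed_def)
    define Y where "Y w = (X w - m) / \<sigma>" for w
    have DY: "distributed M lborel Y std_normal_density"
      unfolding Y_def using D normal_standard_normal_convert[OF \<sigma>] by blast
    have XY: "X w = \<sigma> * Y w + m" for w using \<sigma> by (simp add: Y_def)
    have Ym [measurable]: "Y \<in> borel_measurable M" unfolding Y_def by measurable
    have Yk: "integrable M (\<lambda>w. Y w ^ k)" for k
      using distributed_integrable[OF DY, of "\<lambda>x. x ^ k"] integrable_std_normal_moment[of k] by simp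
    have i1: "integrable M X" unfolding XY[abs_def] using Yk[of 1] by simp
    have "(X w)\<^sup>2 = \<sigma>\<^sup>2 * Y w ^ 2 + (2 * \<sigma> * m) * Y w ^ 1 + m\<^sup>2" for w by (simp add: XY power2_eq_square algebra_simps)
    then have i2: "integrable M (\<lambda>w. (X w)\<^sup>2)" using Yk[of 1] Yk[of 2] by simp
    have "expectation (\<lambda>w. iexp (X w)) = exp (- expectation (\<lambda>w. (X w)\<^sup>2) / 2)" if 0: "expectation X = 0"
    proof -
      have m: "m = 0" using normal_distributed_expectation[OF \<sigma> D] 0 by simp
      have v: "expectation (\<lambda>w. (X w)\<^sup>2) = \<sigma>\<^sup>2" using normal_distributed_variance[OF \<sigma> D] 0 by simp
      have dY: "distr M borel Y = std_normal_distribution"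
      proof -
        have "distr M borel Y = distr M lborel Y" by (rule distr_cong) auto
        then show ?thesis using DY by (auto simp: distributed_def)
      qed
      have "expectation (\<lambda>w. iexp (X w)) = expectation (\<lambda>w. iexp (\<sigma> * Y w))" by (simp add: XY m)
      also have "\<dots> = (CLINT x|distr M borel Y. iexp (\<sigma> * x))" by (subst integral_distr) auto
      also have "\<dots> = char std_normal_distribution \<sigma>" unfolding dY char_def ..
      also have "\<dots> = exp (- (\<sigma>\<^sup>2) / 2)" by (simp add: char_std_normal_distribution exp_of_real[symmetric])
      finally show ?thesis using v by simp
    qed
    then show ?thesis using i1 i2 by blast
  next
    fix m assume d: "distr M borel X = return borel m"
    have "AE x in distr M borel X. x = m" unfolding d by (subst AE_return) auto
    then have ae: "AE w in M. X w = m" by (subst (asm) AE_distr_iff) auto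
    have i1: "integrable M X" by (rule integrable_cong_AE[THEN iffD2, of _ _ "\<lambda>_. m"]) (use ae in auto)
    have i2: "integrable M (\<lambda>w. (X w)\<^sup>2)"
      by (rule integrable_cong_AE[THEN iffD2, of _ _ "\<lambda>_. m\<^sup>2"]) (use ae in auto)
    have e: "expectation X = m" "expectation (\<lambda>w. (X w)\<^sup>2) = m\<^sup>2" 
    proof -
      have "expectation X = expectation (\<lambda>_. m)" by (rule integral_cong_AE) (use ae in auto)
      then show "expectation X = m" by (simp add: prob_space)
      have "expectation (\<lambda>w. (X w)\<^sup>2) = expectation (\<lambda>_. m\<^sup>2)" by (rule integral_cong_AE) (use ae in auto)
      then show "expectation (\<lambda>w. (X w)\<^sup>2) = m\<^sup>2" by (simp add: prob_space)
    qed
    have "expectation (\<lambda>w. iexp (X w)) = expectation (\<lambda>_. iexp m)" by (rule integral_cong_AE) (use ae in auto)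
    then have "expectation (\<lambda>w. iexp (X w)) = iexp m" by (simp add: prob_space)
    then show ?thesis using i1 i2 e by simp
  qed
  then show "integrable M X" "integrable M (\<lambda>w. (X w)\<^sup>2)"
    "expectation X = 0 \<Longrightarrow> expectation (\<lambda>w. iexp (X w)) = exp (- expectation (\<lambda>w. (X w)\<^sup>2) / 2)"
    by blast+
qed

lemma integrable_mult_of_squares:
  fixes X Y :: "'a \<Rightarrow> real"
  assumes [measurable]: "X \<in> borel_measurable M" "Y \<in> borel_measurable M"
    and i: "integrable M (\<lambda>w. (X w)\<^sup>2)" "integrable M (\<lambda>w. (Y w)\<^sup>2)"
  shows "integrable M (\<lambda>w. X w * Y w)"
proof (rule Bochner_Integration.integrable_bound[OF Bochner_Integration.integrable_add[OF i]])
  have "\<bar>x * y\<bar> \<le> x\<^sup>2 + y\<^sup>2" for x y :: real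
  proof -
    have "2 * (\<bar>x\<bar> * \<bar>y\<bar>) \<le> x\<^sup>2 + y\<^sup>2" using zero_le_power2[of "\<bar>x\<bar> - \<bar>y\<bar>"] by (simp add: power2_diff)
    moreover have "0 \<le> \<bar>x\<bar> * \<bar>y\<bar>" by simp
    ultimately show ?thesis unfolding abs_mult by linarith
  qed
  then show "AE w in M. norm (X w * Y w) \<le> norm ((X w)\<^sup>2 + (Y w)\<^sup>2)" by simp
qed measurable

locale gaussian_family =
  fixes N :: "'b measure" and I :: "'i set" and X :: "'i \<Rightarrow> 'b \<Rightarrow> real" and K :: "'i \<Rightarrow> 'i \<Rightarrow> real"
  assumes gaussian: "centered_gaussian_process N I X K"
begin

sublocale prob_space N using gaussian by (simp add: centered_gaussian_process_def)

lemma X_measurable: "i \<in> I \<Longrightarrow> X i \<in> borel_measurable N"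
  using gaussian by (auto simp: centered_gaussian_process_def)

lemma X_integrable: "i \<in> I \<Longrightarrow> integrable N (X i)" and X2_integrable: "i \<in> I \<Longrightarrow> integrable N (\<lambda>w. (X i w)\<^sup>2)"
proof -
  assume i: "i \<in> I"
  have "normal_law (distr N borel (\<lambda>w. \<Sum>j\<in>{i}. 1 * X j w))"
    using gaussian i unfolding centered_gaussian_process_def by (elim conjE allE[of _ "{i}"] allE[of _ "\<lambda>_. 1"]) auto
  then have "normal_law (distr N borel (X i))" by simp
  from normal_law_facts(1,2)[OF X_measurable[OF i] this]
  show "integrable N (X i)" "integrable N (\<lambda>w. (X i w)\<^sup>2)" by auto
qed

text \<open>the index map \<open>f\<close> need not be injective\<close>

lemma linear_combination:
  fixes f :: "'p \<Rightarrow> 'i" and d :: "'p \<Rightarrow> real"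
  assumes J: "finite J" and f: "\<And>p. p \<in> J \<Longrightarrow> f p \<in> I"
  defines "V \<equiv> (\<Sum>p\<in>J. \<Sum>q\<in>J. d p * d q * K (f p) (f q))"
  shows "expectation (\<lambda>w. iexp (\<Sum>p\<in>J. d p * X (f p) w)) = exp (- V / 2)" and "0 \<le> V"
proof -
  define L where "L w = (\<Sum>p\<in>J. d p * X (f p) w)" for w
  have Lm: "L \<in> borel_measurable N" unfolding L_def using X_measurable f by (intro borel_measurable_sum borel_measurable_times) auto
  have "L w = (\<Sum>i\<in>f ` J. (\<Sum>p\<in>{p \<in> J. f p = i}. d p) * X i w)" for w
    unfolding L_def by (subst sum.image_gen[OF J, of _ f]) (auto intro!: sum.cong simp: sum_distrib_right)
  moreover have "normal_law (distr N borel (\<lambda>w. \<Sum>i\<in>f ` J. (\<Sum>p\<in>{p \<in> J. f p = i}. d p) * X i w))"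
    using gaussian f J unfolding centered_gaussian_process_def
    by (elim conjE allE[of _ "f ` J"] allE[of _ "\<lambda>i. \<Sum>p\<in>{p \<in> J. f p = i}. d p"]) auto
  ultimately have law: "normal_law (distr N borel L)" by (simp add: L_def[abs_def])
  have E1: "expectation (X i) = 0" if "i \<in> I" for i using gaussian that by (auto simp: centered_gaussian_process_def)
  have E2: "expectation (\<lambda>w. X i w * X j w) = K i j" if "i \<in> I" "j \<in> I" for i j
    using gaussian that by (auto simp: centered_gaussian_process_def)
  have mean: "expectation L = 0"
    unfolding L_def using X_integrable f E1 by (subst Bochner_Integration.integral_sum) auto
  have int: "integrable N (\<lambda>w. d p * d q * (X (f p) w * X (f q) w))" if "p \<in> J" "q \<in> J" for p q
    using that f by (intro Bochner_Integration.integrable_mult_right integrable_mult_of_squares X_measurable X2_integrable) auto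
  have sq: "(L w)\<^sup>2 = (\<Sum>p\<in>J. \<Sum>q\<in>J. d p * d q * (X (f p) w * X (f q) w))" for w
    unfolding L_def power2_eq_square sum_product by (simp add: ac_simps)
  have "expectation (\<lambda>w. \<Sum>p\<in>J. \<Sum>q\<in>J. d p * d q * (X (f p) w * X (f q) w)) =
      (\<Sum>p\<in>J. expectation (\<lambda>w. \<Sum>q\<in>J. d p * d q * (X (f p) w * X (f q) w)))"
    by (auto intro!: Bochner_Integration.integral_sum Bochner_Integration.integrable_sum int)
  also have "\<dots> = (\<Sum>p\<in>J. \<Sum>q\<in>J. expectation (\<lambda>w. d p * d q * (X (f p) w * X (f q) w)))"
    by (rule sum.cong[OF refl], rule Bochner_Integration.integral_sum, rule int)
  also have "\<dots> = V" unfolding V_def using f by (auto intro!: sum.cong simp: E2)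
  finally have var: "expectation (\<lambda>w. (L w)\<^sup>2) = V" unfolding sq .
  show "expectation (\<lambda>w. iexp (\<Sum>p\<in>J. d p * X (f p) w)) = exp (- V / 2)"
    using normal_law_facts(3)[OF Lm law mean] unfolding var unfolding L_def .
  show "0 \<le> V" unfolding var[symmetric] by simp
qed

end

section \<open>Limit processes\<close>

lemma (in prob_space) decouple_indep_processes:
  fixes F :: "('i \<Rightarrow> real) \<Rightarrow> ('i \<Rightarrow> real) \<Rightarrow> 'c :: {banach, second_countable_topology}"
  assumes ind: "indep_processes M I X Y"
    and F: "case_prod F \<in> borel_measurable (PiM I (\<lambda>_. borel) \<Otimes>\<^sub>M PiM I (\<lambda>_. borel))"
    and B: "\<And>x y. norm (F x y) \<le> B"
  shows "expectation (\<lambda>w. F (\<lambda>i\<in>I. X i w) (\<lambda>i\<in>I. Y i w)) =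
    expectation (\<lambda>w'. expectation (\<lambda>w. F (\<lambda>i\<in>I. X i w) (\<lambda>i\<in>I. Y i w')))"
proof (rule decouple(1)[where S="PiM I (\<lambda>_. borel)" and T="PiM I (\<lambda>_. borel)" and B=B])
  show "(\<lambda>w. \<lambda>i\<in>I. X i w) \<in> M \<rightarrow>\<^sub>M PiM I (\<lambda>_. borel)" "(\<lambda>w. \<lambda>i\<in>I. Y i w) \<in> M \<rightarrow>\<^sub>M PiM I (\<lambda>_. borel)"
    using ind unfolding indep_processes_def by (auto dest: indep_var_rv1 indep_var_rv2)
  show "distr M (PiM I (\<lambda>_. borel) \<Otimes>\<^sub>M PiM I (\<lambda>_. borel)) (\<lambda>w. (\<lambda>i\<in>I. X i w, \<lambda>i\<in>I. Y i w)) =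
    distr M (PiM I (\<lambda>_. borel)) (\<lambda>w. \<lambda>i\<in>I. X i w) \<Otimes>\<^sub>M distr M (PiM I (\<lambda>_. borel)) (\<lambda>w. \<lambda>i\<in>I. Y i w)"
    using ind unfolding indep_processes_def indep_var_distribution_eq by simp
qed (use F B in auto)

lemma iexp_measurable [measurable]: "(\<lambda>x. iexp x) \<in> borel_measurable (borel :: real measure)"
  by (intro borel_measurable_continuous_onI continuous_intros)

lemma bridge_family: "brownian_bridge N B \<Longrightarrow> gaussian_family N {0..1} B bridge_cov"
  by (simp add: brownian_bridge_def gaussian_family_def bridge_cov_def[abs_def])

lemma tied_family: "tied_down_bridge N W \<Longrightarrow>
    gaussian_family N unit_square W (\<lambda>p q. bridge_cov (fst p) (fst q) * bridge_cov (snd p) (snd q))"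
  by (simp add: tied_down_bridge_def gaussian_family_def bridge_cov_def split_beta')

text \<open>
  Conditionally on the second bridge the product process is Gaussian. The \<open>max 0\<close> changes nothing, the quadratic form being
  nonnegative; it makes the integrand bounded as a function of arbitrary reals.
\<close>

lemma tensor_char:
  assumes B: "brownian_bridge N B" and B': "brownian_bridge N B'" and ind: "indep_processes N {0..1} B B'"
    and J: "finite J" "J \<subseteq> unit_square"
  shows "(\<integral>w. iexp (\<Sum>p\<in>J. c p * tensor_process B B' p w) \<partial>N) =
    (\<integral>w. complex_of_real (exp (- max 0 (\<Sum>p\<in>J. \<Sum>q\<in>J. c p * c q * bridge_cov (fst p) (fst q) * (B' (snd p) w * B' (snd q) w)) / 2)) \<partial>N)"
proof -
  interpret B: gaussian_family N "{0..1}" B bridge_cov by (rule bridge_family[OF B])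
  have fs: "fst p \<in> {0..1}" "snd p \<in> {0..1}" if "p \<in> J" for p using that J by (auto simp: unit_square_def)
  let ?F = "\<lambda>x y. iexp (\<Sum>p\<in>J. c p * (x (fst p) * y (snd p)))"
  have "(\<integral>w. iexp (\<Sum>p\<in>J. c p * tensor_process B B' p w) \<partial>N) = (\<integral>w. ?F (\<lambda>s\<in>{0..1}. B s w) (\<lambda>s\<in>{0..1}. B' s w) \<partial>N)"
    using fs by (intro Bochner_Integration.integral_cong refl arg_cong[where f=iexp] sum.cong) (auto simp: tensor_process_def split_beta)
  also have "\<dots> = (\<integral>w'. (\<integral>w. ?F (\<lambda>s\<in>{0..1}. B s w) (\<lambda>s\<in>{0..1}. B' s w') \<partial>N) \<partial>N)"
  proof (rule B.decouple_indep_processes[OF ind, of ?F 1])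
    have [measurable]: "(\<lambda>x. fst x (fst p)) \<in> borel_measurable (PiM {0..1} (\<lambda>_. borel :: real measure) \<Otimes>\<^sub>M PiM {0..1} (\<lambda>_. borel :: real measure))"
      "(\<lambda>x. snd x (snd p)) \<in> borel_measurable (PiM {0..1} (\<lambda>_. borel :: real measure) \<Otimes>\<^sub>M PiM {0..1} (\<lambda>_. borel :: real measure))" if "p \<in> J" for p
      using fs[OF that] by (auto intro: measurable_compose[OF measurable_fst measurable_component_singleton] measurable_compose[OF measurable_snd measurable_component_singleton])
    have "(\<lambda>x. \<Sum>p\<in>J. c p * (fst x (fst p) * snd x (snd p))) \<in> borel_measurable (PiM {0..1} (\<lambda>_. borel :: real measure) \<Otimes>\<^sub>M PiM {0..1} (\<lambda>_. borel :: real measure))"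
      by measurable
    from measurable_compose[OF this iexp_measurable]
    show "case_prod ?F \<in> borel_measurable (PiM {0..1} (\<lambda>_. borel) \<Otimes>\<^sub>M PiM {0..1} (\<lambda>_. borel))"
      by (simp add: split_beta')
  qed simp
  also have "\<dots> = (\<integral>w'. complex_of_real (exp (- max 0 (\<Sum>p\<in>J. \<Sum>q\<in>J. c p * c q * bridge_cov (fst p) (fst q) * (B' (snd p) w' * B' (snd q) w')) / 2)) \<partial>N)"
  proof (rule Bochner_Integration.integral_cong[OF refl])
    fix w'
    let ?d = "\<lambda>p. c p * B' (snd p) w'"
    have "(\<integral>w. ?F (\<lambda>s\<in>{0..1}. B s w) (\<lambda>s\<in>{0..1}. B' s w') \<partial>N) = (\<integral>w. iexp (\<Sum>p\<in>J. ?d p * B (fst p) w) \<partial>N)"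
      using fs by (intro Bochner_Integration.integral_cong refl arg_cong[where f=iexp] sum.cong) auto
    also have "\<dots> = complex_of_real (exp (- (\<Sum>p\<in>J. \<Sum>q\<in>J. ?d p * ?d q * bridge_cov (fst p) (fst q)) / 2))"
      using fs by (intro B.linear_combination J) auto
    also have "(\<Sum>p\<in>J. \<Sum>q\<in>J. ?d p * ?d q * bridge_cov (fst p) (fst q)) =
        max 0 (\<Sum>p\<in>J. \<Sum>q\<in>J. ?d p * ?d q * bridge_cov (fst p) (fst q))"
      using B.linear_combination(2)[OF J(1), of fst ?d] fs by simp
    also have "(\<Sum>p\<in>J. \<Sum>q\<in>J. ?d p * ?d q * bridge_cov (fst p) (fst q)) =
       (\<Sum>p\<in>J. \<Sum>q\<in>J. c p * c q * bridge_cov (fst p) (fst q) * (B' (snd p) w' * B' (snd q) w'))"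
      by (simp only: ac_simps)
    finally show "(\<integral>w. ?F (\<lambda>s\<in>{0..1}. B s w) (\<lambda>s\<in>{0..1}. B' s w') \<partial>N) =
        complex_of_real (exp (- max 0 (\<Sum>p\<in>J. \<Sum>q\<in>J. c p * c q * bridge_cov (fst p) (fst q) * (B' (snd p) w' * B' (snd q) w')) / 2))" .
  qed
  finally show ?thesis .
qed

lemma tensor_measurable:
  assumes "brownian_bridge N B" "brownian_bridge N B'" "p \<in> unit_square"
  shows "tensor_process B B' p \<in> borel_measurable N"
  using gaussian_family.X_measurable[OF bridge_family[OF assms(1)], of "fst p"]
    gaussian_family.X_measurable[OF bridge_family[OF assms(2)], of "snd p"] assms(3)
  by (auto simp: tensor_process_def split_beta unit_square_def)

lemma tensor_square_integrable:
  assumes B: "brownian_bridge N B" and B': "brownian_bridge N B'" and ind: "indep_processes N {0..1} B B'"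
    and p: "p \<in> unit_square"
  shows "integrable N (\<lambda>w. (tensor_process B B' p w)\<^sup>2)"
proof -
  interpret B: gaussian_family N "{0..1}" B bridge_cov by (rule bridge_family[OF B])
  interpret B': gaussian_family N "{0..1}" B' bridge_cov by (rule bridge_family[OF B'])
  have fs: "fst p \<in> {0..1}" "snd p \<in> {0..1}" using p by (auto simp: unit_square_def)
  have "B.indep_var borel ((\<lambda>x. (x (fst p))\<^sup>2) \<circ> (\<lambda>w. \<lambda>s\<in>{0..1}. B s w)) borel ((\<lambda>x. (x (snd p))\<^sup>2) \<circ> (\<lambda>w. \<lambda>s\<in>{0..1}. B' s w))"
  proof (rule B.indep_var_compose)
    show "B.indep_var (PiM {0..1} (\<lambda>_. borel)) (\<lambda>w. \<lambda>s\<in>{0..1}. B s w) (PiM {0..1} (\<lambda>_. borel)) (\<lambda>w. \<lambda>s\<in>{0..1}. B' s w)"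
      using ind by (simp add: indep_processes_def)
  qed (use fs in \<open>auto intro!: borel_measurable_power measurable_component_singleton\<close>)
  then have "B.indep_var borel (\<lambda>w. (B (fst p) w)\<^sup>2) borel (\<lambda>w. (B' (snd p) w)\<^sup>2)"
    using fs by (simp add: o_def)
  from B.indep_var_integrable[OF this B.X2_integrable[OF fs(1)] B'.X2_integrable[OF fs(2)]]
  show ?thesis by (simp add: tensor_process_def split_beta power_mult_distrib)
qed

lemma tensor_plus_tied_char:
  assumes BB: "brownian_bridge N B" "brownian_bridge N B'" "indep_processes N {0..1} B B'"
    and W: "tied_down_bridge N W" and ind: "indep_processes N unit_square (tensor_process B B') W"
    and J: "finite J" "J \<subseteq> unit_square" and g: "0 \<le> \<gamma>"
  shows "(\<integral>w. iexp (\<Sum>p\<in>J. c p * (sqrt \<gamma> * W p w + tensor_process B B' p w)) \<partial>N) =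
    (\<integral>w. complex_of_real (exp (- (\<gamma> * (\<Sum>p\<in>J. \<Sum>q\<in>J. c p * c q * bridge_cov (fst p) (fst q) * bridge_cov (snd p) (snd q)) +
       max 0 (\<Sum>p\<in>J. \<Sum>q\<in>J. c p * c q * bridge_cov (fst p) (fst q) * (B' (snd p) w * B' (snd q) w))) / 2)) \<partial>N)"
proof -
  interpret W: gaussian_family N unit_square W "\<lambda>p q. bridge_cov (fst p) (fst q) * bridge_cov (snd p) (snd q)"
    by (rule tied_family[OF W])
  let ?T = "tensor_process B B'"
  let ?\<kappa> = "\<Sum>p\<in>J. \<Sum>q\<in>J. c p * c q * bridge_cov (fst p) (fst q) * bridge_cov (snd p) (snd q)"
  let ?Q = "\<lambda>w. \<Sum>p\<in>J. \<Sum>q\<in>J. c p * c q * bridge_cov (fst p) (fst q) * (B' (snd p) w * B' (snd q) w)"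
  let ?F = "\<lambda>x y. iexp (\<Sum>p\<in>J. c p * (sqrt \<gamma> * y p + x p))"
  have "(\<integral>w. iexp (\<Sum>p\<in>J. c p * (sqrt \<gamma> * W p w + ?T p w)) \<partial>N) = (\<integral>w. ?F (\<lambda>p\<in>unit_square. ?T p w) (\<lambda>p\<in>unit_square. W p w) \<partial>N)"
    using J by (intro Bochner_Integration.integral_cong refl arg_cong[where f=iexp] sum.cong) auto
  also have "\<dots> = (\<integral>w'. (\<integral>w. ?F (\<lambda>p\<in>unit_square. ?T p w) (\<lambda>p\<in>unit_square. W p w') \<partial>N) \<partial>N)"
  proof (rule W.decouple_indep_processes[OF ind, of ?F 1])
    have [measurable]: "(\<lambda>x. fst x p) \<in> borel_measurable (PiM unit_square (\<lambda>_. borel :: real measure) \<Otimes>\<^sub>M PiM unit_square (\<lambda>_. borel :: real measure))"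
      "(\<lambda>x. snd x p) \<in> borel_measurable (PiM unit_square (\<lambda>_. borel :: real measure) \<Otimes>\<^sub>M PiM unit_square (\<lambda>_. borel :: real measure))" if "p \<in> J" for p
      using J that by (auto intro: measurable_compose[OF measurable_fst measurable_component_singleton] measurable_compose[OF measurable_snd measurable_component_singleton])
    have "(\<lambda>x. \<Sum>p\<in>J. c p * (sqrt \<gamma> * snd x p + fst x p)) \<in> borel_measurable (PiM unit_square (\<lambda>_. borel :: real measure) \<Otimes>\<^sub>M PiM unit_square (\<lambda>_. borel :: real measure))"
      by measurable
    from measurable_compose[OF this iexp_measurable]
    show "case_prod ?F \<in> borel_measurable (PiM unit_square (\<lambda>_. borel) \<Otimes>\<^sub>M PiM unit_square (\<lambda>_. borel))"
      by (simp add: split_beta')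
  qed simp
  also have "\<dots> = (\<integral>w'. iexp (\<Sum>p\<in>J. (c p * sqrt \<gamma>) * W p w') * (\<integral>w. iexp (\<Sum>p\<in>J. c p * ?T p w) \<partial>N) \<partial>N)"
  proof (rule Bochner_Integration.integral_cong[OF refl])
    fix w'
    have "?F (\<lambda>p\<in>unit_square. ?T p w) (\<lambda>p\<in>unit_square. W p w') = iexp (\<Sum>p\<in>J. (c p * sqrt \<gamma>) * W p w') * iexp (\<Sum>p\<in>J. c p * ?T p w)" for w
    proof -
      have "(\<Sum>p\<in>J. c p * (sqrt \<gamma> * (\<lambda>p\<in>unit_square. W p w') p + (\<lambda>p\<in>unit_square. ?T p w) p)) =
        (\<Sum>p\<in>J. (c p * sqrt \<gamma>) * W p w') + (\<Sum>p\<in>J. c p * ?T p w)"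
        unfolding sum.distrib[symmetric] using J by (intro sum.cong) (auto simp: algebra_simps)
      then show ?thesis by (simp only: of_real_add distrib_left exp_add)
    qed
    then show "(\<integral>w. ?F (\<lambda>p\<in>unit_square. ?T p w) (\<lambda>p\<in>unit_square. W p w') \<partial>N) =
        iexp (\<Sum>p\<in>J. (c p * sqrt \<gamma>) * W p w') * (\<integral>w. iexp (\<Sum>p\<in>J. c p * ?T p w) \<partial>N)"
      by (simp only: integral_mult_right_zero)
  qed
  also have "\<dots> = (\<integral>w'. iexp (\<Sum>p\<in>J. (c p * sqrt \<gamma>) * W p w') \<partial>N) * (\<integral>w. iexp (\<Sum>p\<in>J. c p * ?T p w) \<partial>N)"
    by (simp only: integral_mult_left_zero)
  also have "(\<integral>w'. iexp (\<Sum>p\<in>J. (c p * sqrt \<gamma>) * W p w') \<partial>N) = complex_of_real (exp (- (\<gamma> * ?\<kappa>) / 2))"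
  proof -
    have "(\<Sum>p\<in>J. \<Sum>q\<in>J. (c p * sqrt \<gamma>) * (c q * sqrt \<gamma>) * (bridge_cov (fst p) (fst q) * bridge_cov (snd p) (snd q))) = \<gamma> * ?\<kappa>"
      unfolding sum_distrib_left using g by (intro sum.cong refl) (simp add: algebra_simps flip: real_sqrt_mult power2_eq_square)
    then show ?thesis using W.linear_combination(1)[OF J(1), of "\<lambda>p. p" "\<lambda>p. c p * sqrt \<gamma>"] J by auto
  qed
  also have "(\<integral>w. iexp (\<Sum>p\<in>J. c p * ?T p w) \<partial>N) = (\<integral>w. complex_of_real (exp (- max 0 (?Q w) / 2)) \<partial>N)"
    by (rule tensor_char[OF BB J])
  also have "complex_of_real (exp (- (\<gamma> * ?\<kappa>) / 2)) * \<dots> = (\<integral>w. complex_of_real (exp (- (\<gamma> * ?\<kappa>) / 2)) * complex_of_real (exp (- max 0 (?Q w) / 2)) \<partial>N)"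
    by (simp only: integral_mult_right_zero)
  also have "\<dots> = (\<integral>w. complex_of_real (exp (- (\<gamma> * ?\<kappa> + max 0 (?Q w)) / 2)) \<partial>N)"
    by (intro Bochner_Integration.integral_cong refl) (simp only: of_real_mult[symmetric] exp_add[symmetric] add_divide_distrib[symmetric] minus_add_distrib add_uminus_conv_diff)
  finally show ?thesis .
qed

section \<open>The model\<close>

definition row_average :: "nat \<Rightarrow> complex mat \<Rightarrow> (nat \<Rightarrow> real) \<Rightarrow> nat \<Rightarrow> real \<Rightarrow> real" where
  "row_average n u c i t = (\<Sum>j<n. (cmod (u $$ (i, j)))\<^sup>2 * centred_step t (c j))"

definition sample_mean :: "nat \<Rightarrow> (nat \<Rightarrow> real) \<Rightarrow> real \<Rightarrow> real" where
  "sample_mean n c t = (\<Sum>j<n. centred_step t (c j)) / real n"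

definition row_deviation :: "nat \<Rightarrow> complex mat \<Rightarrow> (nat \<Rightarrow> real) \<Rightarrow> nat \<Rightarrow> real \<Rightarrow> real" where
  "row_deviation n u c i t = conj_diag n (\<lambda>j. centred_step t (c j) - sample_mean n c t) u i"

lemma row_average_split:
  assumes "u \<in> unitary_group n" "i < n"
  shows "row_average n u c i t = row_deviation n u c i t + sample_mean n c t"
proof -
  have "row_deviation n u c i t = row_average n u c i t - (\<Sum>j<n. (cmod (u $$ (i, j)))\<^sup>2) * sample_mean n c t"
    unfolding row_deviation_def conj_diag_def row_average_def right_diff_distrib sum_subtractf sum_distrib_right ..
  then show ?thesis using unitary_row_sum[OF assms] by simp
qed

lemma abs_row_average_le:
  assumes "u \<in> unitary_group n" "i < n" "t \<in> {0..1}"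
  shows "\<bar>row_average n u c i t\<bar> \<le> 1"
proof -
  have "\<bar>row_average n u c i t\<bar> \<le> (\<Sum>j<n. (cmod (u $$ (i, j)))\<^sup>2)"
    unfolding row_average_def using abs_centred_step_le[OF assms(3)]
    by (intro order_trans[OF sum_abs] sum_mono) (auto simp: abs_mult intro: mult_left_le)
  then show ?thesis using unitary_row_sum[OF assms(1,2)] by simp
qed

lemma abs_sample_mean_le:
  assumes "t \<in> {0..1}"
  shows "\<bar>sample_mean n c t\<bar> \<le> 1"
proof -
  have "\<bar>\<Sum>j<n. centred_step t (c j)\<bar> \<le> (\<Sum>j<n. 1)"
    using abs_centred_step_le[OF assms] by (intro order_trans[OF sum_abs] sum_mono) auto
  then show ?thesis unfolding sample_mean_def by (auto simp: abs_divide divide_simps)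
qed

lemma abs_row_deviation_le:
  assumes "u \<in> unitary_group n" "i < n" "t \<in> {0..1}"
  shows "\<bar>row_deviation n u c i t\<bar> \<le> 2"
  using row_average_split[OF assms(1,2), of c t] abs_row_average_le[OF assms, of c] abs_sample_mean_le[OF assms(3), of n c]
  by linarith

lemma Z_process_eq:
  assumes "(s, t) \<in> unit_square"
  shows "Z_process n U R C w (s, t) = (\<Sum>i<n. row_average n (U w) (\<lambda>j. C j w) i t * centred_step s (R i w))"
proof -
  have "Z_process n U R C w (s, t) = (\<Sum>i<n. \<Sum>j<n. (cmod (U w $$ (i, j)))\<^sup>2 * centred_step t (C j w) * centred_step s (R i w))"
    using assms unfolding Z_process_def centred_step_def by (simp add: ac_simps)
  then show ?thesis unfolding row_average_def sum_distrib_right .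
qed

lemma Z_process_bilinear_path:
  "Z_process n U R C w = bilinear_path n (\<lambda>i j. (cmod (U w $$ (i, j)))\<^sup>2) (\<lambda>i. R i w) (\<lambda>j. C j w)"
  unfolding Z_process_def bilinear_path_def ..

locale sample_model =
  fixes n :: nat and M :: "'a measure" and U :: "'a \<Rightarrow> complex mat" and R C :: "nat \<Rightarrow> 'a \<Rightarrow> real"
  assumes model: "model n M U R C"
begin

sublocale prob_space M using model by (simp add: model_def)

sublocale R: uniform_sample M n R
  using model by unfold_locales (auto simp: model_def)

sublocale C: uniform_sample M n C
  using model by unfold_locales (auto simp: model_def)

abbreviation "PB \<equiv> PiM {..<n} (\<lambda>_. borel :: real measure)"
abbreviation "UB \<equiv> restrict_space (matrix_borel n) (unitary_group n)"

lemma U_measurable: "U \<in> M \<rightarrow>\<^sub>M UB" using model by (simp add: model_def)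

lemma space_UB: "space UB = unitary_group n"
  by (auto simp: space_restrict_space space_matrix_borel unitary_group_def)

lemma U_unitary: "w \<in> space M \<Longrightarrow> U w \<in> unitary_group n"
  using measurable_space[OF U_measurable] by (simp add: space_UB)

lemma UB_entry_measurable: "i < n \<Longrightarrow> j < n \<Longrightarrow> (\<lambda>u. u $$ (i, j)) \<in> borel_measurable UB"
  by (intro measurable_restrict_space1 matrix_entry_measurable)

lemma U_entry_measurable: "i < n \<Longrightarrow> j < n \<Longrightarrow> (\<lambda>w. U w $$ (i, j)) \<in> borel_measurable M"
  by (rule measurable_compose[OF U_measurable UB_entry_measurable])

definition "Rv w = (\<lambda>i\<in>{..<n}. R i w)"
definition "Cv w = (\<lambda>i\<in>{..<n}. C i w)"

lemma Rv_measurable: "Rv \<in> M \<rightarrow>\<^sub>M PB" and Cv_measurable: "Cv \<in> M \<rightarrow>\<^sub>M PB"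
  unfolding Rv_def[abs_def] Cv_def[abs_def] by (auto intro!: measurable_restrict R.R_measurable C.R_measurable)

lemma distr_R_C: "distr M (PB \<Otimes>\<^sub>M PB) (\<lambda>w. (Rv w, Cv w)) = distr M PB Rv \<Otimes>\<^sub>M distr M PB Cv"
  using model unfolding model_def indep_processes_def indep_var_distribution_eq Rv_def Cv_def by simp

lemma indep_RC_U: "indep_set (sets (vimage_algebra (space M) (\<lambda>w. (Rv w, Cv w)) (PB \<Otimes>\<^sub>M PB))) (sets (vimage_algebra (space M) U UB))"
  using model unfolding model_def Rv_def Cv_def by blast

lemma RC_measurable: "(\<lambda>w. (Rv w, Cv w)) \<in> M \<rightarrow>\<^sub>M PB \<Otimes>\<^sub>M PB"
  using Rv_measurable Cv_measurable by simp

lemma distr_RC_U: "distr M ((PB \<Otimes>\<^sub>M PB) \<Otimes>\<^sub>M UB) (\<lambda>w. ((Rv w, Cv w), U w)) = distr M (PB \<Otimes>\<^sub>M PB) (\<lambda>w. (Rv w, Cv w)) \<Otimes>\<^sub>M distr M UB U"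
  by (rule distr_Pair_indep[OF RC_measurable U_measurable indep_RC_U])

lemma distr_C_U: "distr M (PB \<Otimes>\<^sub>M UB) (\<lambda>w. (Cv w, U w)) = distr M PB Cv \<Otimes>\<^sub>M distr M UB U"
proof (rule distr_Pair_indep[OF Cv_measurable U_measurable])
  have "sets (vimage_algebra (space M) Cv PB) \<subseteq> sets (vimage_algebra (space M) (\<lambda>w. (Rv w, Cv w)) (PB \<Otimes>\<^sub>M PB))"
  proof
    fix A assume "A \<in> sets (vimage_algebra (space M) Cv PB)"
    then obtain B where B: "B \<in> sets PB" "A = Cv -` B \<inter> space M"
      using measurable_space[OF Cv_measurable] by (auto simp: sets_vimage_algebra2)
    have "A = (\<lambda>w. (Rv w, Cv w)) -` (space PB \<times> B) \<inter> space M"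
      using B measurable_space[OF Rv_measurable] by auto
    also have "\<dots> \<in> sets (vimage_algebra (space M) (\<lambda>w. (Rv w, Cv w)) (PB \<Otimes>\<^sub>M PB))"
      using B by (intro in_vimage_algebra) auto
    finally show "A \<in> sets (vimage_algebra (space M) (\<lambda>w. (Rv w, Cv w)) (PB \<Otimes>\<^sub>M PB))" .
  qed
  then show "indep_set (sets (vimage_algebra (space M) Cv PB)) (sets (vimage_algebra (space M) U UB))"
    using indep_RC_U unfolding indep_sets2_eq by blast
qed

lemma decouple_C_U:
  fixes G :: "(nat \<Rightarrow> real) \<Rightarrow> complex mat \<Rightarrow> 'c :: {banach, second_countable_topology}"
  assumes G: "case_prod G \<in> borel_measurable (PB \<Otimes>\<^sub>M UB)" and B: "\<And>c u. u \<in> unitary_group n \<Longrightarrow> norm (G c u) \<le> B"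
  shows "expectation (\<lambda>w. G (Cv w) (U w)) = expectation (\<lambda>w. expectation (\<lambda>w'. G (Cv w) (U w')))"
    and "expectation (\<lambda>w. G (Cv w) (U w)) = expectation (\<lambda>w'. expectation (\<lambda>w. G (Cv w) (U w')))"
  using decouple[OF Cv_measurable U_measurable distr_C_U G, of B] B by (auto simp: space_UB)

lemma decouple_R:
  fixes F :: "(nat \<Rightarrow> real) \<Rightarrow> (nat \<Rightarrow> real) \<Rightarrow> complex mat \<Rightarrow> 'c :: {banach, second_countable_topology}"
  assumes F: "(\<lambda>((r, c), u). F r c u) \<in> borel_measurable ((PB \<Otimes>\<^sub>M PB) \<Otimes>\<^sub>M UB)"
    and B: "\<And>r c u. u \<in> unitary_group n \<Longrightarrow> norm (F r c u) \<le> B"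
  shows "expectation (\<lambda>w. F (Rv w) (Cv w) (U w)) = expectation (\<lambda>w'. expectation (\<lambda>w. F (Rv w) (Cv w') (U w')))"
proof -
  let ?F = "\<lambda>x u. F (fst x) (snd x) u"
  have F': "case_prod ?F \<in> borel_measurable ((PB \<Otimes>\<^sub>M PB) \<Otimes>\<^sub>M UB)" using F by (simp add: split_beta')
  have "expectation (\<lambda>w. F (Rv w) (Cv w) (U w)) = expectation (\<lambda>w'. expectation (\<lambda>w. F (Rv w) (Cv w) (U w')))"
    using decouple(1)[OF RC_measurable U_measurable distr_RC_U F', of B] B by (simp add: space_UB)
  also have "\<dots> = expectation (\<lambda>w''. expectation (\<lambda>w'. expectation (\<lambda>w. F (Rv w) (Cv w') (U w''))))"
  proof (rule Bochner_Integration.integral_cong[OF refl])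
    fix w'' assume w: "w'' \<in> space M"
    have "U w'' \<in> space UB" using U_unitary[OF w] by (simp add: space_UB)
    then have "(\<lambda>x. ?F x (U w'')) \<in> borel_measurable (PB \<Otimes>\<^sub>M PB)"
      using measurable_compose[OF measurable_Pair2' F'] by simp
    then have "(\<lambda>(r, c). F r c (U w'')) \<in> borel_measurable (PB \<Otimes>\<^sub>M PB)" by (simp add: split_beta')
    from decouple(1)[OF Rv_measurable Cv_measurable distr_R_C this, of B] B U_unitary[OF w]
    show "expectation (\<lambda>w. F (Rv w) (Cv w) (U w'')) = expectation (\<lambda>w'. expectation (\<lambda>w. F (Rv w) (Cv w') (U w'')))" by blast
  qed
  also have "\<dots> = expectation (\<lambda>w'. expectation (\<lambda>w. F (Rv w) (Cv w') (U w')))"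
  proof (rule decouple_C_U(2)[symmetric])
    have "(\<lambda>x. ((Rv (snd x), fst (fst x)), snd (fst x))) \<in> (PB \<Otimes>\<^sub>M UB) \<Otimes>\<^sub>M M \<rightarrow>\<^sub>M (PB \<Otimes>\<^sub>M PB) \<Otimes>\<^sub>M UB"
      by (intro measurable_Pair measurable_compose[OF measurable_snd Rv_measurable]) measurable
    from measurable_compose[OF this F]
    have "(\<lambda>(x, w). F (Rv w) (fst x) (snd x)) \<in> borel_measurable ((PB \<Otimes>\<^sub>M UB) \<Otimes>\<^sub>M M)" by (simp add: split_beta')
    from borel_measurable_lebesgue_integral[OF this]
    show "(\<lambda>(c, u). expectation (\<lambda>w. F (Rv w) c u)) \<in> borel_measurable (PB \<Otimes>\<^sub>M UB)" by (simp add: split_beta')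
    fix c u assume u: "u \<in> unitary_group n"
    then have u': "u \<in> space UB" by (simp add: space_UB)
    have 1: "norm (expectation (\<lambda>w. F (Rv w) c u)) \<le> expectation (\<lambda>w. norm (F (Rv w) c u))" by (rule integral_norm_bound)
    have 2: "\<bar>expectation (\<lambda>w. norm (F (Rv w) c u))\<bar> \<le> B"
      using B[OF u] order_trans[OF norm_ge_zero B[OF u]] by (intro abs_expectation_le) auto
    from 1 2 show "norm (expectation (\<lambda>w. F (Rv w) c u)) \<le> B" by linarith
  qed
  finally show ?thesis .
qed

lemma row_average_measurable:
  assumes "i < n" shows "(\<lambda>x. row_average n (snd x) (fst x) i t) \<in> borel_measurable (PB \<Otimes>\<^sub>M UB)"
  unfolding row_average_def
proof (intro borel_measurable_sum borel_measurable_times)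
  fix j assume j: "j \<in> {..<n}"
  show "(\<lambda>x. (cmod (snd x $$ (i, j)))\<^sup>2) \<in> borel_measurable (PB \<Otimes>\<^sub>M UB)"
  proof -
    have [measurable]: "(\<lambda>x. snd x $$ (i, j)) \<in> borel_measurable (PB \<Otimes>\<^sub>M UB)"
      using j assms by (intro measurable_compose[OF measurable_snd UB_entry_measurable]) auto
    show ?thesis by measurable
  qed
  show "(\<lambda>x. centred_step t (fst x j)) \<in> borel_measurable (PB \<Otimes>\<^sub>M UB)"
    by (rule measurable_compose[OF _ centred_step_measurable])
       (rule measurable_compose[OF measurable_fst measurable_component_singleton[OF j]])
qed

lemma sample_mean_measurable: "(\<lambda>c. sample_mean n c t) \<in> borel_measurable PB"
  unfolding sample_mean_def
  by (intro borel_measurable_divide borel_measurable_sum borel_measurable_const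
      measurable_compose[OF _ centred_step_measurable] measurable_component_singleton) auto

lemma CvU_measurable: "(\<lambda>w. (Cv w, U w)) \<in> M \<rightarrow>\<^sub>M PB \<Otimes>\<^sub>M UB"
  using Cv_measurable U_measurable by simp

lemma Cv_eq: "row_average n u (Cv w) i t = row_average n u (\<lambda>j. C j w) i t" "sample_mean n (Cv w) t = sample_mean n (\<lambda>j. C j w) t"
  "row_deviation n u (Cv w) i t = row_deviation n u (\<lambda>j. C j w) i t"
proof -
  show m: "sample_mean n (Cv w) t = sample_mean n (\<lambda>j. C j w) t" unfolding sample_mean_def Cv_def by simp
  show "row_average n u (Cv w) i t = row_average n u (\<lambda>j. C j w) i t" unfolding row_average_def Cv_def by simp
  show "row_deviation n u (Cv w) i t = row_deviation n u (\<lambda>j. C j w) i t"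
    unfolding row_deviation_def conj_diag_def m by (simp add: Cv_def)
qed

abbreviation "ra i t w \<equiv> row_average n (U w) (\<lambda>j. C j w) i t"
abbreviation "sm t w \<equiv> sample_mean n (\<lambda>j. C j w) t"
abbreviation "rd i t w \<equiv> row_deviation n (U w) (\<lambda>j. C j w) i t"

lemma ra_measurable [measurable]: "i < n \<Longrightarrow> ra i t \<in> borel_measurable M"
  using measurable_compose[OF CvU_measurable row_average_measurable, of i t] by (simp add: Cv_eq)

lemma sm_measurable [measurable]: "sm t \<in> borel_measurable M"
  using measurable_compose[OF Cv_measurable sample_mean_measurable, of t] by (simp add: Cv_eq)

lemma rd_measurable [measurable]: "i < n \<Longrightarrow> rd i t \<in> borel_measurable M"
proof -
  assume i: "i < n"
  have "(\<lambda>w. ra i t w - sm t w) \<in> borel_measurable M" using i by measurable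
  then show ?thesis
    by (rule measurable_cong[THEN iffD1, rotated]) (simp add: row_average_split[OF U_unitary i])
qed

lemma Z_skorokhod_measurable:
  "(\<lambda>w. \<lambda>p\<in>unit_square. k * Z_process n U R C w p) \<in> M \<rightarrow>\<^sub>M borel_of skorokhod_topology"
proof -
  have "(\<lambda>p\<in>unit_square. k * Z_process n U R C w p) =
     bilinear_path n (\<lambda>i j. k * (cmod (U w $$ (i, j)))\<^sup>2) (\<lambda>i. R i w) (\<lambda>j. C j w)" for w
    unfolding Z_process_def bilinear_path_def
    by (intro restrict_ext) (auto simp: sum_distrib_left mult.assoc)
  moreover have "(\<lambda>w. bilinear_path n (\<lambda>i j. k * (cmod (U w $$ (i, j)))\<^sup>2) (\<lambda>i. R i w) (\<lambda>j. C j w)) \<in> M \<rightarrow>\<^sub>M borel_of skorokhod_topology"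
  proof (rule bilinear_path_measurable)
    fix i j assume ij: "i < n" "j < n"
    have [measurable]: "(\<lambda>w. U w $$ (i, j)) \<in> borel_measurable M" by (rule U_entry_measurable[OF ij])
    show "(\<lambda>w. k * (cmod (U w $$ (i, j)))\<^sup>2) \<in> borel_measurable M" by measurable
  qed (simp_all add: R.R_measurable C.R_measurable)
  ultimately show ?thesis by simp
qed

lemma Z_eval_measurable:
  assumes "p \<in> unit_square"
  shows "(\<lambda>w. Z_process n U R C w p) \<in> borel_measurable M"
proof -
  obtain s t where p: "p = (s, t)" by (cases p)
  have "(\<lambda>w. \<Sum>i<n. ra i t w * centred_step s (R i w)) \<in> borel_measurable M"
    using R.R_measurable by (intro borel_measurable_sum borel_measurable_times measurable_compose[OF _ centred_step_measurable]) auto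
  then show ?thesis using assms unfolding p by (simp add: Z_process_eq)
qed

definition "cond_var J c w = (\<Sum>i<n. \<Sum>p\<in>J. \<Sum>q\<in>J. (c p * ra i (snd p) w) * (c q * ra i (snd q) w) * bridge_cov (fst p) (fst q))"

definition "abs_weight J c i w = (\<Sum>p\<in>J. \<bar>c p * ra i (snd p) w\<bar>)"

lemma cond_var_measurable [measurable]: "cond_var J c \<in> borel_measurable M"
  unfolding cond_var_def[abs_def] by measurable

lemma abs_weight_measurable [measurable]: "i < n \<Longrightarrow> abs_weight J c i \<in> borel_measurable M"
  unfolding abs_weight_def[abs_def] by measurable

lemma abs_weight_le:
  assumes "J \<subseteq> unit_square" "i < n" "w \<in> space M"
  shows "0 \<le> abs_weight J c i w" "abs_weight J c i w \<le> (\<Sum>p\<in>J. \<bar>c p\<bar>)"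
proof -
  show "0 \<le> abs_weight J c i w" unfolding abs_weight_def by (intro sum_nonneg) auto
  have "snd p \<in> {0..1}" if "p \<in> J" for p using that assms(1) by (auto simp: unit_square_def)
  then show "abs_weight J c i w \<le> (\<Sum>p\<in>J. \<bar>c p\<bar>)"
    unfolding abs_weight_def using abs_row_average_le[OF U_unitary[OF assms(3)] assms(2)]
    by (intro sum_mono) (auto simp: abs_mult intro: mult_left_le)
qed

lemma psd_bridge:
  fixes a :: "real \<times> real \<Rightarrow> real"
  assumes n0: "0 < n" and J: "finite J" "J \<subseteq> unit_square"
  shows "0 \<le> (\<Sum>p\<in>J. \<Sum>q\<in>J. a p * a q * bridge_cov (fst p) (fst q))"
proof -
  have fs: "fst p \<in> {0..1}" if "p \<in> J" for p using that J by (auto simp: unit_square_def)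
  have [measurable]: "R 0 \<in> borel_measurable M" using R.R_measurable n0 by simp
  have int: "integrable M (\<lambda>w. a p * a q * (centred_step (fst p) (R 0 w) * centred_step (fst q) (R 0 w)))" if "p \<in> J" "q \<in> J" for p q
  proof (intro Bochner_Integration.integrable_mult_right integrable_of_bounded[of _ "1 * 1"])
    show "norm (centred_step (fst p) (R 0 w) * centred_step (fst q) (R 0 w)) \<le> 1 * 1" for w
      unfolding real_norm_def abs_mult by (intro mult_mono abs_centred_step_le fs that) auto
  qed measurable
  have "0 \<le> expectation (\<lambda>w. (\<Sum>p\<in>J. a p * centred_step (fst p) (R 0 w))\<^sup>2)" by simp
  also have "\<dots> = expectation (\<lambda>w. \<Sum>p\<in>J. \<Sum>q\<in>J. a p * a q * (centred_step (fst p) (R 0 w) * centred_step (fst q) (R 0 w)))"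
    unfolding power2_eq_square sum_product by (simp only: ac_simps)
  also have "\<dots> = (\<Sum>p\<in>J. expectation (\<lambda>w. \<Sum>q\<in>J. a p * a q * (centred_step (fst p) (R 0 w) * centred_step (fst q) (R 0 w))))"
    by (auto intro!: Bochner_Integration.integral_sum Bochner_Integration.integrable_sum int)
  also have "\<dots> = (\<Sum>p\<in>J. \<Sum>q\<in>J. expectation (\<lambda>w. a p * a q * (centred_step (fst p) (R 0 w) * centred_step (fst q) (R 0 w))))"
    by (rule sum.cong[OF refl], rule Bochner_Integration.integral_sum, rule int)
  also have "\<dots> = (\<Sum>p\<in>J. \<Sum>q\<in>J. a p * a q * bridge_cov (fst p) (fst q))"
    using R.expectation_centred_step_mult[OF n0 fs fs] by (intro sum.cong refl) simp
  finally show ?thesis .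
qed

lemma cond_var_nonneg:
  assumes J: "finite J" "J \<subseteq> unit_square" 
  shows "0 \<le> cond_var J c w"
proof -
  show ?thesis unfolding cond_var_def
  proof (rule sum_nonneg)
    fix i assume "i \<in> {..<n}"
    then have "0 < n" by simp
    then show "0 \<le> (\<Sum>p\<in>J. \<Sum>q\<in>J. (c p * ra i (snd p) w) * (c q * ra i (snd q) w) * bridge_cov (fst p) (fst q))"
      by (rule psd_bridge[OF _ J])
  qed
qed

text \<open>
  Conditionally on the matrix and the columns, the process is a weighted sum of the independent steps of the rows.
\<close>

theorem char_conditional:
  assumes J: "finite J" "J \<subseteq> unit_square"
  shows "cmod (expectation (\<lambda>w. iexp (\<Sum>p\<in>J. c p * Z_process n U R C w p)) - complex_of_real (expectation (\<lambda>w. exp (- cond_var J c w / 2))))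
     \<le> expectation (\<lambda>w. \<Sum>i<n. abs_weight J c i w ^ 3 + abs_weight J c i w ^ 4)"
proof -
  have fs: "fst p \<in> {0..1}" "snd p \<in> {0..1}" if "p \<in> J" for p using that J by (auto simp: unit_square_def)
  let ?F = "\<lambda>r v u. iexp (\<Sum>i<n. \<Sum>p\<in>J. (c p * row_average n u v i (snd p)) * centred_step (fst p) (r i))"
  let ?I = "\<lambda>w'. expectation (\<lambda>w. iexp (\<Sum>i<n. \<Sum>p\<in>J. (c p * ra i (snd p) w') * centred_step (fst p) (R i w)))"
  have "expectation (\<lambda>w. iexp (\<Sum>p\<in>J. c p * Z_process n U R C w p)) = expectation (\<lambda>w. ?F (Rv w) (Cv w) (U w))"
  proof (intro Bochner_Integration.integral_cong refl arg_cong[where f=iexp])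
    fix w
    have "(\<Sum>p\<in>J. c p * Z_process n U R C w p) = (\<Sum>p\<in>J. \<Sum>i<n. (c p * ra i (snd p) w) * centred_step (fst p) (R i w))"
    proof (intro sum.cong refl)
      fix p assume "p \<in> J"
      then have "(fst p, snd p) \<in> unit_square" using J by auto
      from Z_process_eq[OF this, of n U R C w]
      show "c p * Z_process n U R C w p = (\<Sum>i<n. (c p * ra i (snd p) w) * centred_step (fst p) (R i w))"
        by (simp add: sum_distrib_left mult.assoc)
    qed
    also have "\<dots> = (\<Sum>i<n. \<Sum>p\<in>J. (c p * ra i (snd p) w) * centred_step (fst p) (R i w))" by (rule sum.swap)
    also have "\<dots> = (\<Sum>i<n. \<Sum>p\<in>J. (c p * row_average n (U w) (Cv w) i (snd p)) * centred_step (fst p) (Rv w i))"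
      unfolding Cv_eq by (intro sum.cong refl) (simp add: Rv_def)
    finally show "(\<Sum>p\<in>J. c p * Z_process n U R C w p) = (\<Sum>i<n. \<Sum>p\<in>J. (c p * row_average n (U w) (Cv w) i (snd p)) * centred_step (fst p) (Rv w i))" .
  qed
  also have "\<dots> = expectation (\<lambda>w'. expectation (\<lambda>w. ?F (Rv w) (Cv w') (U w')))"
  proof (rule decouple_R[where B=1])
    have 1: "(\<lambda>x. row_average n (snd x) (snd (fst x)) i t) \<in> borel_measurable ((PB \<Otimes>\<^sub>M PB) \<Otimes>\<^sub>M UB)" if "i < n" for i t
    proof -
      have "(\<lambda>x. (snd (fst x), snd x)) \<in> (PB \<Otimes>\<^sub>M PB) \<Otimes>\<^sub>M UB \<rightarrow>\<^sub>M PB \<Otimes>\<^sub>M UB" by measurable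
      from measurable_compose[OF this row_average_measurable[OF that]] show ?thesis by simp
    qed
    have 2: "(\<lambda>x. centred_step s (fst (fst x) i)) \<in> borel_measurable ((PB \<Otimes>\<^sub>M PB) \<Otimes>\<^sub>M UB)" if "i < n" for i s
      by (rule measurable_compose[OF _ centred_step_measurable], rule measurable_compose[OF measurable_fst],
          rule measurable_compose[OF measurable_fst], rule measurable_component_singleton) (use that in simp)
    have "(\<lambda>x. \<Sum>i<n. \<Sum>p\<in>J. (c p * row_average n (snd x) (snd (fst x)) i (snd p)) * centred_step (fst p) (fst (fst x) i)) \<in> borel_measurable ((PB \<Otimes>\<^sub>M PB) \<Otimes>\<^sub>M UB)"
      by (intro borel_measurable_sum borel_measurable_times borel_measurable_const 1 2) auto
    from measurable_compose[OF this iexp_measurable]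
    show "(\<lambda>((r, v), u). ?F r v u) \<in> borel_measurable ((PB \<Otimes>\<^sub>M PB) \<Otimes>\<^sub>M UB)" by (simp add: split_beta')
  qed simp
  also have "\<dots> = expectation ?I"
    by (intro Bochner_Integration.integral_cong refl arg_cong[where f=iexp] sum.cong) (simp add: Cv_eq Rv_def)
  finally have lhs: "expectation (\<lambda>w. iexp (\<Sum>p\<in>J. c p * Z_process n U R C w p)) = expectation ?I" .
  have I_measurable: "?I \<in> borel_measurable M"
  proof (rule borel_measurable_lebesgue_integral)
    have "(\<lambda>x. \<Sum>i<n. \<Sum>p\<in>J. (c p * ra i (snd p) (fst x)) * centred_step (fst p) (R i (snd x))) \<in> borel_measurable (M \<Otimes>\<^sub>M M)"
      by (intro borel_measurable_sum borel_measurable_times borel_measurable_const measurable_compose[OF measurable_fst ra_measurable]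
          measurable_compose[OF _ centred_step_measurable] measurable_compose[OF measurable_snd R.R_measurable]) auto
    from measurable_compose[OF this iexp_measurable]
    show "(\<lambda>(w', w). iexp (\<Sum>i<n. \<Sum>p\<in>J. (c p * ra i (snd p) w') * centred_step (fst p) (R i w))) \<in> borel_measurable (M \<Otimes>\<^sub>M M)"
      by (simp add: split_beta')
  qed
  have I_bound: "cmod (?I w') \<le> 1" for w'
  proof -
    have "cmod (?I w') \<le> expectation (\<lambda>w. cmod (iexp (\<Sum>i<n. \<Sum>p\<in>J. (c p * ra i (snd p) w') * centred_step (fst p) (R i w))))"
      by (rule integral_norm_bound)
    then show ?thesis by (simp add: prob_space)
  qed
  have I_int: "integrable M ?I" using I_measurable I_bound by (intro integrable_of_bounded[of _ 1]) auto
  have V_int: "integrable M (\<lambda>w. complex_of_real (exp (- cond_var J c w / 2)))"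
    using cond_var_nonneg[OF J] by (intro integrable_of_bounded[of _ 1]) auto
  define S where "S = (\<Sum>p\<in>J. \<bar>c p\<bar>)"
  have W_int: "integrable M (\<lambda>w. \<Sum>i<n. abs_weight J c i w ^ 3 + abs_weight J c i w ^ 4)"
  proof (rule integrable_of_bounded[of _ "\<Sum>i<n. S ^ 3 + S ^ 4"])
    show "norm (\<Sum>i<n. abs_weight J c i w ^ 3 + abs_weight J c i w ^ 4) \<le> (\<Sum>i<n. S ^ 3 + S ^ 4)" if "w \<in> space M" for w
      unfolding real_norm_def
    proof (intro order_trans[OF sum_abs] sum_mono)
      fix i assume "i \<in> {..<n}"
      then have w: "0 \<le> abs_weight J c i w" "abs_weight J c i w \<le> S" using abs_weight_le[OF J(2) _ that] by (auto simp: S_def)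
      then show "\<bar>abs_weight J c i w ^ 3 + abs_weight J c i w ^ 4\<bar> \<le> S ^ 3 + S ^ 4"
        by (auto intro!: add_mono power_mono)
    qed
  qed measurable
  have "expectation (\<lambda>w. iexp (\<Sum>p\<in>J. c p * Z_process n U R C w p)) - complex_of_real (expectation (\<lambda>w. exp (- cond_var J c w / 2)))
      = expectation (\<lambda>w. ?I w - complex_of_real (exp (- cond_var J c w / 2)))"
    unfolding lhs using I_int V_int by (simp add: integral_complex_of_real[symmetric] del: integral_complex_of_real)
  also have "cmod \<dots> \<le> expectation (\<lambda>w. cmod (?I w - complex_of_real (exp (- cond_var J c w / 2))))"
    by (rule integral_norm_bound)
  also have "\<dots> \<le> expectation (\<lambda>w. \<Sum>i<n. abs_weight J c i w ^ 3 + abs_weight J c i w ^ 4)"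
  proof (rule integral_mono)
    show "integrable M (\<lambda>w. cmod (?I w - complex_of_real (exp (- cond_var J c w / 2))))" using I_int V_int by auto
    show "cmod (?I w' - complex_of_real (exp (- cond_var J c w' / 2))) \<le> (\<Sum>i<n. abs_weight J c i w' ^ 3 + abs_weight J c i w' ^ 4)" for w'
      using R.char_approx[OF J(1), of fst "\<lambda>i p. c p * ra i (snd p) w'"] fs unfolding cond_var_def abs_weight_def by auto
  qed (rule W_int)
  finally show ?thesis .
qed

end

section \<open>Finite-dimensional limits\<close>

lemma expectation_convergence_from_characters:
  fixes P :: "nat \<Rightarrow> 'a measure" and X :: "nat \<Rightarrow> 'a \<Rightarrow> 'i \<Rightarrow> real" and f :: "('i \<Rightarrow> real) \<Rightarrow> real"
  assumes P: "\<And>n. prob_space (P n)" and N: "prob_space N" and J: "finite J"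
    and X: "\<And>n p. p \<in> J \<Longrightarrow> (\<lambda>w. X n w p) \<in> borel_measurable (P n)"
    and Y: "\<And>p. p \<in> J \<Longrightarrow> (\<lambda>w. Y w p) \<in> borel_measurable N"
    and char: "\<And>c. (\<lambda>n. \<integral>w. iexp (\<Sum>p\<in>J. c p * X n w p) \<partial>P n) \<longlonglongrightarrow> (\<integral>w. iexp (\<Sum>p\<in>J. c p * Y w p) \<partial>N)"
    and X2: "\<And>n p. p \<in> J \<Longrightarrow> integrable (P n) (\<lambda>w. (X n w p)\<^sup>2)"
    and X2K: "\<And>p. p \<in> J \<Longrightarrow> \<forall>\<^sub>F n in sequentially. (\<integral>w. (X n w p)\<^sup>2 \<partial>P n) \<le> K"
    and Y2: "\<And>p. p \<in> J \<Longrightarrow> integrable N (\<lambda>w. (Y w p)\<^sup>2)"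
    and f: "continuous_map (product_topology (\<lambda>_. euclideanreal) J) euclideanreal f"
    and fb: "bounded (f ` topspace (product_topology (\<lambda>_. euclideanreal) J))"
  shows "(\<lambda>n. \<integral>w. f (restrict (X n w) J) \<partial>P n) \<longlonglongrightarrow> (\<integral>w. f (restrict (Y w) J) \<partial>N)"
proof (rule expectation_convergence_from_cosines[OF P N J X Y _ X2 X2K Y2 f fb])
  fix c e
  have cos_eq: "(\<integral>w. cos ((\<Sum>p\<in>J. c p * Z w p) + e) \<partial>Q) = Re (iexp e * (\<integral>w. iexp (\<Sum>p\<in>J. c p * Z w p) \<partial>Q))"
    if Q: "prob_space Q" and Z: "\<And>p. p \<in> J \<Longrightarrow> (\<lambda>w. Z w p) \<in> borel_measurable Q" for Q :: "'z measure" and Z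
  proof -
    interpret Q: prob_space Q by (rule Q)
    have "(\<lambda>w. \<Sum>p\<in>J. c p * Z w p) \<in> borel_measurable Q" using Z by (intro borel_measurable_sum borel_measurable_times) auto
    from measurable_compose[OF this iexp_measurable]
    have int: "integrable Q (\<lambda>w. iexp (\<Sum>p\<in>J. c p * Z w p))" by (intro Q.integrable_of_bounded[of _ 1]) auto
    have "(\<integral>w. cos ((\<Sum>p\<in>J. c p * Z w p) + e) \<partial>Q) = (\<integral>w. Re (iexp e * iexp (\<Sum>p\<in>J. c p * Z w p)) \<partial>Q)"
    proof (rule Bochner_Integration.integral_cong[OF refl])
      fix w
      have "iexp e * iexp (\<Sum>p\<in>J. c p * Z w p) = iexp ((\<Sum>p\<in>J. c p * Z w p) + e)"
        by (simp only: exp_add[symmetric] distrib_left[symmetric] of_real_add[symmetric] add.commute)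
      then show "cos ((\<Sum>p\<in>J. c p * Z w p) + e) = Re (iexp e * iexp (\<Sum>p\<in>J. c p * Z w p))"
        by (simp only: cis_conv_exp[symmetric] cis.sel)
    qed
    also have "\<dots> = Re (\<integral>w. iexp e * iexp (\<Sum>p\<in>J. c p * Z w p) \<partial>Q)"
      by (rule integral_Re) (intro integrable_mult_right int)
    finally show ?thesis by (simp only: integral_mult_right_zero)
  qed
  show "(\<lambda>n. \<integral>w. cos ((\<Sum>p\<in>J. c p * X n w p) + e) \<partial>P n) \<longlonglongrightarrow> (\<integral>w. cos ((\<Sum>p\<in>J. c p * Y w p) + e) \<partial>N)"
  proof -
    have 1: "(\<integral>w. cos ((\<Sum>p\<in>J. c p * X n w p) + e) \<partial>P n) = Re (iexp e * (\<integral>w. iexp (\<Sum>p\<in>J. c p * X n w p) \<partial>P n))" for n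
      by (rule cos_eq[OF P X])
    have 2: "(\<integral>w. cos ((\<Sum>p\<in>J. c p * Y w p) + e) \<partial>N) = Re (iexp e * (\<integral>w. iexp (\<Sum>p\<in>J. c p * Y w p) \<partial>N))"
      by (rule cos_eq[OF N Y])
    show ?thesis unfolding 1 2 by (intro tendsto_Re tendsto_mult_left char)
  qed
qed

context uniform_sample
begin

definition empirical :: "real \<Rightarrow> 'a \<Rightarrow> real" where
  "empirical t w = (\<Sum>j<n. centred_step t (R j w)) / sqrt n"

lemma empirical_measurable [measurable]: "empirical t \<in> borel_measurable M"
  unfolding empirical_def[abs_def] using R_measurable
  by (intro borel_measurable_divide borel_measurable_sum measurable_compose[OF _ centred_step_measurable]) auto

lemma abs_empirical_le: "t \<in> {0..1} \<Longrightarrow> \<bar>empirical t w\<bar> \<le> sqrt n"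
proof -
  assume t: "t \<in> {0..1}"
  have "\<bar>\<Sum>j<n. centred_step t (R j w)\<bar> \<le> (\<Sum>j<n. 1)"
    using abs_centred_step_le[OF t] by (intro order_trans[OF sum_abs] sum_mono) auto
  then have "\<bar>empirical t w\<bar> \<le> n / sqrt n" unfolding empirical_def by (simp add: abs_divide divide_right_mono)
  then show ?thesis by (simp add: real_div_sqrt)
qed

lemma empirical_square_integrable: "t \<in> {0..1} \<Longrightarrow> integrable M (\<lambda>w. (empirical t w)\<^sup>2)"
  using power_mono[OF abs_empirical_le abs_ge_zero, of t _ 2] by (intro integrable_of_bounded[of _ "(sqrt n)\<^sup>2"]) auto

lemma empirical_moments:
  assumes t: "t \<in> {0..1}"
  shows "expectation (\<lambda>w. (empirical t w)\<^sup>2) \<le> 1" and "expectation (\<lambda>w. (empirical t w) ^ 4) \<le> 4"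
proof -
  have eq: "empirical t w = (\<Sum>j<n. (1 / sqrt n) * centred_step t (R j w))" for w
    unfolding empirical_def by (simp add: sum_divide_distrib)
  have w: "(\<Sum>j<n. (1 / sqrt n)\<^sup>2) \<le> 1" by (simp add: power_divide)
  show "expectation (\<lambda>w. (empirical t w)\<^sup>2) \<le> 1"
    using weighted_sum_moments(1)[OF t, of "\<lambda>_. 1 / sqrt n"] w unfolding eq by linarith
  have "(\<Sum>j<n. (1 / sqrt n)\<^sup>2)\<^sup>2 \<le> 1" using w by (intro power_le_one sum_nonneg) auto
  then show "expectation (\<lambda>w. (empirical t w) ^ 4) \<le> 4"
    using weighted_sum_moments(2)[OF t, of "\<lambda>_. 1 / sqrt n"] unfolding eq by linarith
qed

lemma empirical_char_approx:
  fixes d :: "real \<Rightarrow> real"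
  assumes T: "finite T" "T \<subseteq> {0..1}" and n: "0 < n"
  defines "D \<equiv> (\<Sum>t\<in>T. \<bar>d t\<bar>)"
  shows "cmod (expectation (\<lambda>w. iexp (\<Sum>t\<in>T. d t * empirical t w)) - exp (- (\<Sum>t\<in>T. \<Sum>t'\<in>T. d t * d t' * bridge_cov t t') / 2))
    \<le> D ^ 3 * (1 / sqrt n) + D ^ 4 * (1 / n)"
proof -
  have "(\<Sum>i<n. \<Sum>t\<in>T. (d t / sqrt n) * centred_step t (R i w)) = (\<Sum>t\<in>T. d t * empirical t w)" for w
    unfolding empirical_def by (subst sum.swap) (simp add: sum_distrib_left sum_divide_distrib)
  moreover have "(\<Sum>i<n. \<Sum>t\<in>T. \<Sum>t'\<in>T. (d t / sqrt n) * (d t' / sqrt n) * bridge_cov t t') = (\<Sum>t\<in>T. \<Sum>t'\<in>T. d t * d t' * bridge_cov t t')"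
  proof -
    have "(d t / sqrt n) * (d t' / sqrt n) * bridge_cov t t' = (d t * d t' * bridge_cov t t') / n" for t t'
      by (simp add: field_simps)
    then have "(\<Sum>i<n. \<Sum>t\<in>T. \<Sum>t'\<in>T. (d t / sqrt n) * (d t' / sqrt n) * bridge_cov t t') = (\<Sum>i<n. (\<Sum>t\<in>T. \<Sum>t'\<in>T. d t * d t' * bridge_cov t t') / n)"
      by (simp only: sum_divide_distrib)
    then show ?thesis using n by simp
  qed
  moreover have "(\<Sum>t\<in>T. \<bar>d t / sqrt n\<bar>) = D / sqrt n" unfolding D_def by (simp add: sum_divide_distrib)
  moreover have "(\<Sum>i<n. (D / sqrt n) ^ 3 + (D / sqrt n) ^ 4) = D ^ 3 * (1 / sqrt n) + D ^ 4 * (1 / n)"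
  proof -
    have s: "sqrt n * sqrt n = n" "sqrt n > 0" using n by auto
    have "n * (D / sqrt n) ^ 3 = (sqrt n * sqrt n) * (D / sqrt n) ^ 3" unfolding s(1) ..
    also have "\<dots> = D ^ 3 * (1 / sqrt n)" using s(2) by (simp only: power3_eq_cube) (simp add: field_simps)
    finally have 1: "n * (D / sqrt n) ^ 3 = D ^ 3 * (1 / sqrt n)" .
    have "(D / sqrt n) ^ 4 = D ^ 4 / n ^ 2" unfolding power_divide
      using s by (simp add: power4_eq_xxxx power2_eq_square mult.assoc)
    then have 2: "n * (D / sqrt n) ^ 4 = D ^ 4 * (1 / n)" using n by (simp add: power2_eq_square)
    show ?thesis using 1 2 by (simp add: distrib_left)
  qed
  ultimately show ?thesis
    using char_approx[OF T(1), of "\<lambda>t. t" "\<lambda>i t. d t / sqrt n"] T(2) by (auto simp: subset_iff)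
qed

end

lemma empirical_fdd:
  fixes M :: "nat \<Rightarrow> 'a measure" and R :: "nat \<Rightarrow> nat \<Rightarrow> 'a \<Rightarrow> real" and f :: "(real \<Rightarrow> real) \<Rightarrow> real"
  assumes S: "\<And>n. uniform_sample (M n) n (R n)" and B: "brownian_bridge N B"
    and T: "finite T" "T \<subseteq> {0..1}"
    and f: "continuous_map (product_topology (\<lambda>_. euclideanreal) T) euclideanreal f"
    and fb: "bounded (f ` topspace (product_topology (\<lambda>_. euclideanreal) T))"
  shows "(\<lambda>n. \<integral>w. f (\<lambda>t\<in>T. uniform_sample.empirical n (R n) t w) \<partial>M n) \<longlonglongrightarrow> (\<integral>w. f (\<lambda>t\<in>T. B t w) \<partial>N)"
proof -
  interpret B: gaussian_family N "{0..1}" B bridge_cov by (rule bridge_family[OF B])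
  have "(\<lambda>n. \<integral>w. f (restrict (\<lambda>t. uniform_sample.empirical n (R n) t w) T) \<partial>M n) \<longlonglongrightarrow> (\<integral>w. f (restrict (\<lambda>t. B t w) T) \<partial>N)"
  proof (rule expectation_convergence_from_characters[where K=1])
    show "prob_space (M n)" for n using S[of n] by (simp add: uniform_sample_def)
    show "prob_space N" by unfold_locales
    show "uniform_sample.empirical n (R n) t \<in> borel_measurable (M n)" for n t by (rule uniform_sample.empirical_measurable[OF S])
    show "B t \<in> borel_measurable N" if "t \<in> T" for t using B.X_measurable T that by auto
    show "integrable (M n) (\<lambda>w. (uniform_sample.empirical n (R n) t w)\<^sup>2)" if "t \<in> T" for n t
      using T that by (intro uniform_sample.empirical_square_integrable[OF S]) auto
    show "\<forall>\<^sub>F n in sequentially. (\<integral>w. (uniform_sample.empirical n (R n) t w)\<^sup>2 \<partial>M n) \<le> 1" if "t \<in> T" for t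
      using T that by (intro always_eventually allI uniform_sample.empirical_moments(1)[OF S]) auto
    show "integrable N (\<lambda>w. (B t w)\<^sup>2)" if "t \<in> T" for t using B.X2_integrable T that by auto
    fix d :: "real \<Rightarrow> real"
    define D where "D = (\<Sum>t\<in>T. \<bar>d t\<bar>)"
    let ?lim = "complex_of_real (exp (- (\<Sum>t\<in>T. \<Sum>t'\<in>T. d t * d t' * bridge_cov t t') / 2))"
    have lim: "(\<integral>w. iexp (\<Sum>t\<in>T. d t * B t w) \<partial>N) = ?lim"
      using T by (intro B.linear_combination(1)) auto
    have "(\<lambda>n. (\<integral>w. iexp (\<Sum>t\<in>T. d t * uniform_sample.empirical n (R n) t w) \<partial>M n) - ?lim) \<longlonglongrightarrow> 0"
    proof (rule Lim_null_comparison)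
      show "\<forall>\<^sub>F n in sequentially. norm ((\<integral>w. iexp (\<Sum>t\<in>T. d t * uniform_sample.empirical n (R n) t w) \<partial>M n) - ?lim) \<le> D ^ 3 * (1 / sqrt n) + D ^ 4 * (1 / n)"
        using eventually_gt_at_top[of 0]
        by eventually_elim (use uniform_sample.empirical_char_approx[OF S T, of _ d] in \<open>simp add: D_def\<close>)
      show "(\<lambda>n. D ^ 3 * (1 / sqrt (real n)) + D ^ 4 * (1 / real n)) \<longlonglongrightarrow> 0"
        by real_asymp
    qed
    then show "(\<lambda>n. \<integral>w. iexp (\<Sum>t\<in>T. d t * uniform_sample.empirical n (R n) t w) \<partial>M n) \<longlonglongrightarrow> (\<integral>w. iexp (\<Sum>t\<in>T. d t * B t w) \<partial>N)"
      unfolding lim by (rule LIM_zero_cancel)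
  qed (use T f fb in auto)
  then show ?thesis by simp
qed

context sample_model
begin

lemma sm_empirical: "0 < n \<Longrightarrow> C.empirical t w = sqrt n * sm t w"
  unfolding C.empirical_def sample_mean_def using real_div_sqrt[of n] by (simp add: field_simps)

lemma int_sum_bounded:
  fixes f :: "nat \<Rightarrow> 'a \<Rightarrow> real"
  assumes "\<And>i. i < n \<Longrightarrow> f i \<in> borel_measurable M" "\<And>i w. i < n \<Longrightarrow> w \<in> space M \<Longrightarrow> \<bar>f i w\<bar> \<le> B"
  shows "integrable M (\<lambda>w. \<Sum>i<n. f i w)"
  using assms by (intro Bochner_Integration.integrable_sum integrable_of_bounded[of _ B]) auto

lemma int_rd_power: "t \<in> {0..1} \<Longrightarrow> integrable M (\<lambda>w. \<Sum>i<n. rd i t w ^ k)"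
proof (rule int_sum_bounded[of _ "2 ^ k"])
  assume t: "t \<in> {0..1}"
  show "\<bar>rd i t w ^ k\<bar> \<le> 2 ^ k" if "i < n" "w \<in> space M" for i w
    unfolding power_abs by (intro power_mono abs_row_deviation_le U_unitary that t) auto
qed measurable

lemma int_ra_power: "t \<in> {0..1} \<Longrightarrow> integrable M (\<lambda>w. \<Sum>i<n. ra i t w ^ k)"
proof (rule int_sum_bounded[of _ "1 ^ k"])
  assume t: "t \<in> {0..1}"
  show "\<bar>ra i t w ^ k\<bar> \<le> 1 ^ k" if "i < n" "w \<in> space M" for i w
    unfolding power_abs by (intro power_mono abs_row_average_le U_unitary that t) auto
qed measurable

lemma rd_sum: 
  assumes "0 < n" "w \<in> space M" shows "(\<Sum>i<n. rd i t w) = 0"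
  unfolding row_deviation_def conj_diag_sum[OF U_unitary[OF assms(2)]]
  using assms(1) by (simp add: sum_subtractf sample_mean_def)

lemma ra_product_sum:
  assumes n: "0 < n" and w: "w \<in> space M"
  shows "(\<Sum>i<n. ra i t w * ra i t' w) = (\<Sum>i<n. rd i t w * rd i t' w) + C.empirical t w * C.empirical t' w"
proof -
  have "(\<Sum>i<n. ra i t w * ra i t' w) = (\<Sum>i<n. rd i t w * rd i t' w + (rd i t w * sm t' w + rd i t' w * sm t w + sm t w * sm t' w))"
    using row_average_split[OF U_unitary[OF w]] by (intro sum.cong refl) (simp add: algebra_simps)
  also have "\<dots> = (\<Sum>i<n. rd i t w * rd i t' w) + ((\<Sum>i<n. rd i t w) * sm t' w + (\<Sum>i<n. rd i t' w) * sm t w + n * (sm t w * sm t' w))"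
    by (simp only: sum.distrib sum_distrib_right[symmetric] sum_constant card_lessThan)
  also have "n * (sm t w * sm t' w) = C.empirical t w * C.empirical t' w"
    unfolding sm_empirical[OF n] using n by (simp add: real_sqrt_mult_self flip: mult.assoc)
  finally show ?thesis unfolding rd_sum[OF n w] by simp
qed

lemma expectation_ra2:
  assumes n: "0 < n" and t: "t \<in> {0..1}"
  shows "expectation (\<lambda>w. \<Sum>i<n. (ra i t w)\<^sup>2) \<le> expectation (\<lambda>w. \<Sum>i<n. (rd i t w)\<^sup>2) + 1"
proof -
  have "expectation (\<lambda>w. \<Sum>i<n. (ra i t w)\<^sup>2) = expectation (\<lambda>w. (\<Sum>i<n. (rd i t w)\<^sup>2) + (C.empirical t w)\<^sup>2)"
    using ra_product_sum[OF n, of _ t t] by (intro Bochner_Integration.integral_cong refl) (simp add: power2_eq_square)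
  also have "\<dots> = expectation (\<lambda>w. \<Sum>i<n. (rd i t w)\<^sup>2) + expectation (\<lambda>w. (C.empirical t w)\<^sup>2)"
    using int_rd_power[OF t, of 2] C.empirical_square_integrable[OF t] by simp
  finally show ?thesis using C.empirical_moments(1)[OF t] by linarith
qed

lemma fourth_power_add: "(x + y) ^ 4 \<le> 8 * (x ^ 4 + y ^ 4)" for x y :: real
proof -
  have av: "(u + v)\<^sup>2 \<le> 2 * (u\<^sup>2 + v\<^sup>2)" for u v :: real
    using zero_le_power2[of "u - v"] by (simp add: power2_eq_square algebra_simps)
  have "((x + y)\<^sup>2)\<^sup>2 \<le> (2 * (x\<^sup>2 + y\<^sup>2))\<^sup>2" by (rule power_mono[OF av]) simp
  also have "\<dots> = 4 * (x\<^sup>2 + y\<^sup>2)\<^sup>2" unfolding power_mult_distrib by simp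
  also have "\<dots> \<le> 4 * (2 * ((x\<^sup>2)\<^sup>2 + (y\<^sup>2)\<^sup>2))" by (intro mult_left_mono av) simp
  finally show ?thesis by simp
qed

lemma expectation_ra4:
  assumes n: "0 < n" and t: "t \<in> {0..1}"
  shows "expectation (\<lambda>w. \<Sum>i<n. ra i t w ^ 4) \<le> 8 * expectation (\<lambda>w. \<Sum>i<n. rd i t w ^ 4) + 32 / n"
proof -
  have e4: "integrable M (\<lambda>w. C.empirical t w ^ 4)"
    using power_mono[OF C.abs_empirical_le[OF t] abs_ge_zero, of _ 4] by (intro integrable_of_bounded[of _ "(sqrt n) ^ 4"]) auto
  have "expectation (\<lambda>w. \<Sum>i<n. ra i t w ^ 4) \<le> expectation (\<lambda>w. 8 * (\<Sum>i<n. rd i t w ^ 4) + 8 / n * C.empirical t w ^ 4)"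
  proof (rule integral_mono)
    show "integrable M (\<lambda>w. \<Sum>i<n. ra i t w ^ 4)" by (rule int_ra_power[OF t])
    show "integrable M (\<lambda>w. 8 * (\<Sum>i<n. rd i t w ^ 4) + 8 / n * C.empirical t w ^ 4)"
      using int_rd_power[OF t, of 4] e4 by (intro Bochner_Integration.integrable_add integrable_mult_right)
    fix w assume w: "w \<in> space M"
    have "(\<Sum>i<n. ra i t w ^ 4) \<le> (\<Sum>i<n. 8 * (rd i t w ^ 4 + sm t w ^ 4))"
      using row_average_split[OF U_unitary[OF w]] fourth_power_add by (intro sum_mono) simp
    also have "\<dots> = 8 * (\<Sum>i<n. rd i t w ^ 4) + 8 * (n * sm t w ^ 4)"
      by (simp only: sum_distrib_left[symmetric] sum.distrib sum_constant card_lessThan distrib_left)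
    also have "n * sm t w ^ 4 = C.empirical t w ^ 4 / n"
    proof -
      have "(sqrt n) ^ 4 = n * n" using real_sqrt_mult_self[of n] by (simp add: power4_eq_xxxx mult.assoc)
      then show ?thesis unfolding sm_empirical[OF n] power_mult_distrib using n by simp
    qed
    finally show "(\<Sum>i<n. ra i t w ^ 4) \<le> 8 * (\<Sum>i<n. rd i t w ^ 4) + 8 / n * C.empirical t w ^ 4" by simp
  qed
  also have "\<dots> = 8 * expectation (\<lambda>w. \<Sum>i<n. rd i t w ^ 4) + 8 / n * expectation (\<lambda>w. C.empirical t w ^ 4)"
    using int_rd_power[OF t, of 4] e4 by simp
  also have "8 / n * expectation (\<lambda>w. C.empirical t w ^ 4) \<le> 8 / n * 4"
    by (intro mult_left_mono C.empirical_moments(2) t) simp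
  finally show ?thesis by simp
qed

lemma abs_weight_powers:
  fixes c :: "real \<times> real \<Rightarrow> real"
  assumes J: "finite J" "J \<subseteq> unit_square"
  shows "expectation (\<lambda>w. \<Sum>i<n. abs_weight J c i w ^ 2) \<le> (\<Sum>p\<in>J. (card J * (c p)\<^sup>2) * expectation (\<lambda>w. \<Sum>i<n. (ra i (snd p) w)\<^sup>2))"
    and "expectation (\<lambda>w. \<Sum>i<n. abs_weight J c i w ^ 4) \<le> (\<Sum>p\<in>J. (real (card J) ^ 3 * (c p) ^ 4) * expectation (\<lambda>w. \<Sum>i<n. ra i (snd p) w ^ 4))"
proof -
  have fs: "snd p \<in> {0..1}" if "p \<in> J" for p using that J by (auto simp: unit_square_def)
  have iw: "integrable M (\<lambda>w. \<Sum>i<n. abs_weight J c i w ^ k)" for k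
  proof (rule int_sum_bounded[of _ "(\<Sum>p\<in>J. \<bar>c p\<bar>) ^ k"])
    show "\<bar>abs_weight J c i w ^ k\<bar> \<le> (\<Sum>p\<in>J. \<bar>c p\<bar>) ^ k" if "i < n" "w \<in> space M" for i w
      unfolding power_abs using abs_weight_le[OF J(2) that, of c] by (intro power_mono) auto
  qed measurable
  have ir: "integrable M (\<lambda>w. \<Sum>p\<in>J. a p * (\<Sum>i<n. ra i (snd p) w ^ k))" for a k
    by (intro Bochner_Integration.integrable_sum integrable_mult_right int_ra_power fs)
  have Er: "expectation (\<lambda>w. \<Sum>p\<in>J. a p * (\<Sum>i<n. ra i (snd p) w ^ k)) = (\<Sum>p\<in>J. a p * expectation (\<lambda>w. \<Sum>i<n. ra i (snd p) w ^ k))" for a k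
    by (simp only: Bochner_Integration.integral_sum[OF integrable_mult_right[OF int_ra_power[OF fs]]] integral_mult_right_zero)
  have sq: "(\<Sum>p\<in>J. x p)\<^sup>2 \<le> card J * (\<Sum>p\<in>J. (x p)\<^sup>2)" for x :: "real \<times> real \<Rightarrow> real"
    using sum_squared_le_sum_of_squares[of x J] by (simp add: mult.commute)
  have w2: "abs_weight J c i w ^ 2 \<le> (\<Sum>p\<in>J. (card J * (c p)\<^sup>2) * (ra i (snd p) w)\<^sup>2)" for i w
    using sq[of "\<lambda>p. \<bar>c p * ra i (snd p) w\<bar>"] unfolding abs_weight_def sum_distrib_left
    by (simp add: power_mult_distrib mult.assoc)
  have w4: "abs_weight J c i w ^ 4 \<le> (\<Sum>p\<in>J. (real (card J) ^ 3 * (c p) ^ 4) * ra i (snd p) w ^ 4)" for i w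
  proof -
    have "(abs_weight J c i w ^ 2)\<^sup>2 \<le> (\<Sum>p\<in>J. (card J * (c p)\<^sup>2) * (ra i (snd p) w)\<^sup>2)\<^sup>2"
      by (rule power_mono[OF w2]) simp
    also have "\<dots> \<le> card J * (\<Sum>p\<in>J. ((card J * (c p)\<^sup>2) * (ra i (snd p) w)\<^sup>2)\<^sup>2)" by (rule sq)
    also have "\<dots> = (\<Sum>p\<in>J. (real (card J) ^ 3 * (c p) ^ 4) * ra i (snd p) w ^ 4)"
      unfolding sum_distrib_left by (intro sum.cong refl) (simp add: power_mult_distrib power3_eq_cube power2_eq_square power4_eq_xxxx)
    finally show ?thesis by simp
  qed
  have "expectation (\<lambda>w. \<Sum>i<n. abs_weight J c i w ^ 2) \<le> expectation (\<lambda>w. \<Sum>p\<in>J. (card J * (c p)\<^sup>2) * (\<Sum>i<n. ra i (snd p) w ^ 2))"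
  proof (intro integral_mono iw ir)
    show "(\<Sum>i<n. abs_weight J c i w ^ 2) \<le> (\<Sum>p\<in>J. (card J * (c p)\<^sup>2) * (\<Sum>i<n. ra i (snd p) w ^ 2))" for w
      unfolding sum_distrib_left by (subst sum.swap) (intro sum_mono w2)
  qed
  then show "expectation (\<lambda>w. \<Sum>i<n. abs_weight J c i w ^ 2) \<le> (\<Sum>p\<in>J. (card J * (c p)\<^sup>2) * expectation (\<lambda>w. \<Sum>i<n. (ra i (snd p) w)\<^sup>2))"
    unfolding Er .
  have "expectation (\<lambda>w. \<Sum>i<n. abs_weight J c i w ^ 4) \<le> expectation (\<lambda>w. \<Sum>p\<in>J. (real (card J) ^ 3 * (c p) ^ 4) * (\<Sum>i<n. ra i (snd p) w ^ 4))"
  proof (intro integral_mono iw ir)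
    show "(\<Sum>i<n. abs_weight J c i w ^ 4) \<le> (\<Sum>p\<in>J. (real (card J) ^ 3 * (c p) ^ 4) * (\<Sum>i<n. ra i (snd p) w ^ 4))" for w
      unfolding sum_distrib_left by (subst sum.swap) (intro sum_mono w4)
  qed
  then show "expectation (\<lambda>w. \<Sum>i<n. abs_weight J c i w ^ 4) \<le> (\<Sum>p\<in>J. (real (card J) ^ 3 * (c p) ^ 4) * expectation (\<lambda>w. \<Sum>i<n. ra i (snd p) w ^ 4))"
    unfolding Er .
qed

lemma char_error_le:
  assumes J: "finite J" "J \<subseteq> unit_square" and e: "0 < e"
  shows "expectation (\<lambda>w. \<Sum>i<n. abs_weight J c i w ^ 3 + abs_weight J c i w ^ 4) \<le>
    e * expectation (\<lambda>w. \<Sum>i<n. abs_weight J c i w ^ 2) + (1 / e + 1) * expectation (\<lambda>w. \<Sum>i<n. abs_weight J c i w ^ 4)"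
proof -
  have iw: "integrable M (\<lambda>w. \<Sum>i<n. abs_weight J c i w ^ k)" for k
  proof (rule int_sum_bounded[of _ "(\<Sum>p\<in>J. \<bar>c p\<bar>) ^ k"])
    show "\<bar>abs_weight J c i w ^ k\<bar> \<le> (\<Sum>p\<in>J. \<bar>c p\<bar>) ^ k" if "i < n" "w \<in> space M" for i w
      unfolding power_abs using abs_weight_le[OF J(2) that, of c] by (intro power_mono) auto
  qed measurable
  have cube: "w ^ 3 \<le> e * w ^ 2 + 1 / e * w ^ 4" for w :: real
  proof -
    have "0 \<le> (e * w - w ^ 2)\<^sup>2 + (w ^ 2)\<^sup>2 + (e * w)\<^sup>2" by simp
    also have "\<dots> = 2 * (e\<^sup>2 * w ^ 2 + w ^ 4 - e * w ^ 3)"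
      by (simp add: power2_eq_square power3_eq_cube power4_eq_xxxx algebra_simps)
    finally have "e * w ^ 3 \<le> e\<^sup>2 * w ^ 2 + w ^ 4" by simp
    also have "\<dots> = e * (e * w ^ 2 + 1 / e * w ^ 4)" using e by (simp add: distrib_left power2_eq_square)
    finally show ?thesis using e by simp
  qed
  have "expectation (\<lambda>w. \<Sum>i<n. abs_weight J c i w ^ 3 + abs_weight J c i w ^ 4) \<le>
     expectation (\<lambda>w. e * (\<Sum>i<n. abs_weight J c i w ^ 2) + (1 / e + 1) * (\<Sum>i<n. abs_weight J c i w ^ 4))"
  proof (rule integral_mono)
    show "integrable M (\<lambda>w. \<Sum>i<n. abs_weight J c i w ^ 3 + abs_weight J c i w ^ 4)"
      unfolding sum.distrib by (intro Bochner_Integration.integrable_add iw)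
    show "integrable M (\<lambda>w. e * (\<Sum>i<n. abs_weight J c i w ^ 2) + (1 / e + 1) * (\<Sum>i<n. abs_weight J c i w ^ 4))"
      by (intro Bochner_Integration.integrable_add integrable_mult_right iw)
    show "(\<Sum>i<n. abs_weight J c i w ^ 3 + abs_weight J c i w ^ 4) \<le> e * (\<Sum>i<n. abs_weight J c i w ^ 2) + (1 / e + 1) * (\<Sum>i<n. abs_weight J c i w ^ 4)" for w
      unfolding sum_distrib_left sum.distrib[symmetric] 
    proof (rule sum_mono)
      fix i show "abs_weight J c i w ^ 3 + abs_weight J c i w ^ 4 \<le> e * abs_weight J c i w ^ 2 + (1 / e + 1) * abs_weight J c i w ^ 4"
        using cube[of "abs_weight J c i w"] unfolding distrib_right by simp
    qed
  qed
  also have "\<dots> = e * expectation (\<lambda>w. \<Sum>i<n. abs_weight J c i w ^ 2) + (1 / e + 1) * expectation (\<lambda>w. \<Sum>i<n. abs_weight J c i w ^ 4)"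
    using iw[of 2] iw[of 4] by simp
  finally show ?thesis .
qed

definition "mean_form J c w = (\<Sum>p\<in>J. \<Sum>q\<in>J. c p * c q * bridge_cov (fst p) (fst q) * (C.empirical (snd p) w * C.empirical (snd q) w))"

lemma mean_form_measurable [measurable]: "mean_form J c \<in> borel_measurable M"
  unfolding mean_form_def[abs_def] by measurable

lemma bridge_cov_abs_le: "s \<in> {0..1} \<Longrightarrow> s' \<in> {0..1} \<Longrightarrow> \<bar>bridge_cov s s'\<bar> \<le> 1"
proof -
  assume s: "s \<in> {0..1}" "s' \<in> {0..1}"
  have "0 \<le> s * s'" "s * s' \<le> min s s'" using s mult_left_le[of s' s] mult_left_le_one_le[of s' s] by (auto simp: mult_left_le mult_left_le_one_le)
  then show ?thesis using s unfolding bridge_cov_def by (auto simp: abs_le_iff)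
qed

lemma int_rd_product: "t \<in> {0..1} \<Longrightarrow> t' \<in> {0..1} \<Longrightarrow> integrable M (\<lambda>w. \<Sum>i<n. rd i t w * rd i t' w)"
proof (rule int_sum_bounded[of _ "2 * 2"])
  assume t: "t \<in> {0..1}" "t' \<in> {0..1}"
  show "\<bar>rd i t w * rd i t' w\<bar> \<le> 2 * 2" if "i < n" "w \<in> space M" for i w
    unfolding abs_mult by (intro mult_mono abs_row_deviation_le U_unitary that t) auto
qed measurable

theorem char_error_variance:
  fixes \<gamma> :: real and c :: "real \<times> real \<Rightarrow> real"
  assumes n: "0 < n" and J: "finite J" "J \<subseteq> unit_square"
  defines "\<kappa> \<equiv> \<Sum>p\<in>J. \<Sum>q\<in>J. c p * c q * bridge_cov (fst p) (fst q) * bridge_cov (snd p) (snd q)"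
  assumes \<kappa>: "0 \<le> \<gamma> * \<kappa>"
  shows "\<bar>expectation (\<lambda>w. exp (- cond_var J c w / 2)) - expectation (\<lambda>w. exp (- (\<gamma> * \<kappa> + max 0 (mean_form J c w)) / 2))\<bar> \<le>
    (\<Sum>p\<in>J. \<Sum>q\<in>J. \<bar>c p * c q\<bar> * expectation (\<lambda>w. \<bar>(\<Sum>i<n. rd i (snd p) w * rd i (snd q) w) - \<gamma> * bridge_cov (snd p) (snd q)\<bar>))"
proof -
  have fs: "fst p \<in> {0..1}" "snd p \<in> {0..1}" if "p \<in> J" for p using that J by (auto simp: unit_square_def)
  let ?D = "\<lambda>p q w. \<bar>(\<Sum>i<n. rd i (snd p) w * rd i (snd q) w) - \<gamma> * bridge_cov (snd p) (snd q)\<bar>"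
  have iD: "integrable M (?D p q)" if "p \<in> J" "q \<in> J" for p q
    using int_rd_product[OF fs(2)[OF that(1)] fs(2)[OF that(2)]]
    by (intro Bochner_Integration.integrable_abs Bochner_Integration.integrable_diff) auto
  have lip: "\<bar>exp (- a / 2) - exp (- b / 2)\<bar> \<le> \<bar>a - b\<bar>" if "0 \<le> a" "0 \<le> b" for a b :: real
  proof -
    have *: "exp (- a / 2) - exp (- b / 2) \<le> b - a" if ab: "0 \<le> a" "a \<le> b" for a b :: real
    proof -
      define d where "d = (b - a) / 2"
      have d: "0 \<le> d" "- b / 2 = - a / 2 + (- d)" using ab by (auto simp: d_def field_simps)
      have "exp (- a / 2) - exp (- b / 2) = exp (- a / 2) * (1 - exp (- d))"
        unfolding d(2) exp_add by (simp add: right_diff_distrib)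
      also have "\<dots> \<le> 1 * d"
        using exp_ge_add_one_self[of "- d"] ab d(1) by (intro mult_mono) auto
      finally show ?thesis using ab by (simp add: d_def)
    qed
    show ?thesis
    proof (cases "a \<le> b")
      case True
      then have "exp (- b / 2) \<le> exp (- a / 2)" by simp
      then show ?thesis using *[OF that(1) True] True by linarith
    next
      case False
      then have "exp (- a / 2) \<le> exp (- b / 2)" by simp
      then show ?thesis using *[OF that(2), of a] False by linarith
    qed
  qed
  have pw: "\<bar>exp (- cond_var J c w / 2) - exp (- (\<gamma> * \<kappa> + max 0 (mean_form J c w)) / 2)\<bar> \<le> (\<Sum>p\<in>J. \<Sum>q\<in>J. \<bar>c p * c q\<bar> * ?D p q w)"
    if w: "w \<in> space M" for w
  proof -
    define E where "E = (\<Sum>p\<in>J. \<Sum>q\<in>J. \<bar>c p * c q\<bar> * ?D p q w)"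
    have "cond_var J c w = (\<Sum>p\<in>J. \<Sum>q\<in>J. c p * c q * bridge_cov (fst p) (fst q) * (\<Sum>i<n. ra i (snd p) w * ra i (snd q) w))"
      unfolding cond_var_def sum_distrib_left by (subst sum_rotate) (simp only: ac_simps)
    also have "\<dots> = (\<Sum>p\<in>J. \<Sum>q\<in>J. c p * c q * bridge_cov (fst p) (fst q) * ((\<Sum>i<n. rd i (snd p) w * rd i (snd q) w) - \<gamma> * bridge_cov (snd p) (snd q)))
       + \<gamma> * \<kappa> + mean_form J c w"
      unfolding ra_product_sum[OF n w] \<kappa>_def mean_form_def sum_distrib_left sum.distrib[symmetric]
      by (intro sum.cong refl) (simp add: algebra_simps)
    finally have V: "cond_var J c w - (\<gamma> * \<kappa> + mean_form J c w) = (\<Sum>p\<in>J. \<Sum>q\<in>J. c p * c q * bridge_cov (fst p) (fst q) * ((\<Sum>i<n. rd i (snd p) w * rd i (snd q) w) - \<gamma> * bridge_cov (snd p) (snd q)))"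
      by simp
    have "\<bar>cond_var J c w - (\<gamma> * \<kappa> + mean_form J c w)\<bar> \<le> E"
      unfolding V E_def
    proof (rule order_trans[OF sum_abs], rule sum_mono, rule order_trans[OF sum_abs], rule sum_mono)
      fix p q assume pq: "p \<in> J" "q \<in> J"
      have "\<bar>c p * c q\<bar> * \<bar>bridge_cov (fst p) (fst q)\<bar> \<le> \<bar>c p * c q\<bar> * 1"
        by (intro mult_left_mono bridge_cov_abs_le fs pq) simp
      then show "\<bar>c p * c q * bridge_cov (fst p) (fst q) * ((\<Sum>i<n. rd i (snd p) w * rd i (snd q) w) - \<gamma> * bridge_cov (snd p) (snd q))\<bar> \<le> \<bar>c p * c q\<bar> * ?D p q w"
        unfolding abs_mult[of "c p * c q * bridge_cov (fst p) (fst q)"] abs_mult[of "c p * c q"]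
        by (intro mult_right_mono) auto
    qed
    moreover have "0 \<le> cond_var J c w" by (rule cond_var_nonneg[OF J])
    ultimately have "\<bar>cond_var J c w - (\<gamma> * \<kappa> + max 0 (mean_form J c w))\<bar> \<le> 
       E + (max 0 (mean_form J c w) - mean_form J c w)" by linarith
    moreover have "0 \<le> mean_form J c w"
      using psd_bridge[OF n J, of "\<lambda>p. c p * C.empirical (snd p) w"] unfolding mean_form_def by (simp add: ac_simps)
    ultimately have "\<bar>cond_var J c w - (\<gamma> * \<kappa> + max 0 (mean_form J c w))\<bar> \<le> E" by simp
    then show ?thesis
      using lip[of "cond_var J c w" "\<gamma> * \<kappa> + max 0 (mean_form J c w)"] cond_var_nonneg[OF J, of c w] \<kappa> unfolding E_def by linarith
  qed
  have i1: "integrable M (\<lambda>w. exp (- cond_var J c w / 2))"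
    using cond_var_nonneg[OF J] by (intro integrable_of_bounded[of _ 1]) auto
  have i2: "integrable M (\<lambda>w. exp (- (\<gamma> * \<kappa> + max 0 (mean_form J c w)) / 2))"
    using \<kappa> by (intro integrable_of_bounded[of _ 1]) (auto simp: add_nonneg_nonneg)
  have "\<bar>expectation (\<lambda>w. exp (- cond_var J c w / 2)) - expectation (\<lambda>w. exp (- (\<gamma> * \<kappa> + max 0 (mean_form J c w)) / 2))\<bar> =
     \<bar>expectation (\<lambda>w. exp (- cond_var J c w / 2) - exp (- (\<gamma> * \<kappa> + max 0 (mean_form J c w)) / 2))\<bar>"
    using i1 i2 by simp
  also have "\<dots> \<le> expectation (\<lambda>w. \<bar>exp (- cond_var J c w / 2) - exp (- (\<gamma> * \<kappa> + max 0 (mean_form J c w)) / 2)\<bar>)"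
    by (rule integral_abs_bound)
  also have "\<dots> \<le> expectation (\<lambda>w. \<Sum>p\<in>J. \<Sum>q\<in>J. \<bar>c p * c q\<bar> * ?D p q w)"
  proof (rule integral_mono)
    show "integrable M (\<lambda>w. \<bar>exp (- cond_var J c w / 2) - exp (- (\<gamma> * \<kappa> + max 0 (mean_form J c w)) / 2)\<bar>)"
      using i1 i2 by (intro Bochner_Integration.integrable_abs Bochner_Integration.integrable_diff)
    show "integrable M (\<lambda>w. \<Sum>p\<in>J. \<Sum>q\<in>J. \<bar>c p * c q\<bar> * ?D p q w)"
      by (intro Bochner_Integration.integrable_sum integrable_mult_right iD)
  qed (rule pw)
  also have "\<dots> = (\<Sum>p\<in>J. expectation (\<lambda>w. \<Sum>q\<in>J. \<bar>c p * c q\<bar> * ?D p q w))"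
    by (rule Bochner_Integration.integral_sum, intro Bochner_Integration.integrable_sum integrable_mult_right iD)
  also have "\<dots> = (\<Sum>p\<in>J. \<Sum>q\<in>J. expectation (\<lambda>w. \<bar>c p * c q\<bar> * ?D p q w))"
    by (rule sum.cong[OF refl], rule Bochner_Integration.integral_sum, intro integrable_mult_right iD)
  also have "\<dots> = (\<Sum>p\<in>J. \<Sum>q\<in>J. \<bar>c p * c q\<bar> * expectation (?D p q))" by (simp only: integral_mult_right_zero)
  finally show ?thesis .
qed

end

context sample_model
begin

section \<open>The finite-dimensional limit theorem\<close>

lemma Z_moment_decoupled:
  assumes p: "(s, t) \<in> unit_square"
  shows "expectation (\<lambda>w. Z_process n U R C w (s, t) ^ k) =
    expectation (\<lambda>w'. expectation (\<lambda>w. (\<Sum>i<n. ra i t w' * centred_step s (R i w)) ^ k))"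
proof -
  have st: "s \<in> {0..1}" "t \<in> {0..1}" using p by (auto simp: unit_square_def)
  let ?F = "\<lambda>r v u. (\<Sum>i<n. row_average n u v i t * centred_step s (r i)) ^ k"
  have "expectation (\<lambda>w. Z_process n U R C w (s, t) ^ k) = expectation (\<lambda>w. ?F (Rv w) (Cv w) (U w))"
    unfolding Z_process_eq[OF p] Cv_eq by (simp add: Rv_def)
  also have "\<dots> = expectation (\<lambda>w'. expectation (\<lambda>w. ?F (Rv w) (Cv w') (U w')))"
  proof (rule decouple_R[where B="real n ^ k"])
    have 1: "(\<lambda>x. row_average n (snd x) (snd (fst x)) i t) \<in> borel_measurable ((PB \<Otimes>\<^sub>M PB) \<Otimes>\<^sub>M UB)" if "i < n" for i
    proof -
      have "(\<lambda>x. (snd (fst x), snd x)) \<in> (PB \<Otimes>\<^sub>M PB) \<Otimes>\<^sub>M UB \<rightarrow>\<^sub>M PB \<Otimes>\<^sub>M UB" by measurable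
      from measurable_compose[OF this row_average_measurable[OF that]] show ?thesis by simp
    qed
    have 2: "(\<lambda>x. centred_step s (fst (fst x) i)) \<in> borel_measurable ((PB \<Otimes>\<^sub>M PB) \<Otimes>\<^sub>M UB)" if "i < n" for i
      by (rule measurable_compose[OF _ centred_step_measurable], rule measurable_compose[OF measurable_fst],
          rule measurable_compose[OF measurable_fst], rule measurable_component_singleton) (use that in simp)
    have "(\<lambda>x. (\<Sum>i<n. row_average n (snd x) (snd (fst x)) i t * centred_step s (fst (fst x) i)) ^ k) \<in> borel_measurable ((PB \<Otimes>\<^sub>M PB) \<Otimes>\<^sub>M UB)"
      by (intro borel_measurable_power borel_measurable_sum borel_measurable_times 1 2) auto
    then show "(\<lambda>((r, v), u). ?F r v u) \<in> borel_measurable ((PB \<Otimes>\<^sub>M PB) \<Otimes>\<^sub>M UB)" by (simp add: split_beta')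
    fix r v u assume u: "u \<in> unitary_group n"
    have "\<bar>\<Sum>i<n. row_average n u v i t * centred_step s (r i)\<bar> \<le> (\<Sum>i<n. 1 * 1)"
      by (rule order_trans[OF sum_abs], rule sum_mono, unfold abs_mult, rule mult_mono)
         (use abs_row_average_le[OF u _ st(2)] abs_centred_step_le[OF st(1)] in auto)
    then have "\<bar>\<Sum>i<n. row_average n u v i t * centred_step s (r i)\<bar> \<le> n" by simp
    then show "norm (?F r v u) \<le> real n ^ k" unfolding real_norm_def power_abs by (intro power_mono) auto
  qed
  also have "\<dots> = expectation (\<lambda>w'. expectation (\<lambda>w. (\<Sum>i<n. ra i t w' * centred_step s (R i w)) ^ k))"
    unfolding Cv_eq by (simp add: Rv_def)
  finally show ?thesis .
qed

lemma decoupled_measurable: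
  "(\<lambda>w'. expectation (\<lambda>w. (\<Sum>i<n. ra i t w' * centred_step s (R i w)) ^ k)) \<in> borel_measurable M"
proof (rule borel_measurable_lebesgue_integral)
  have "(\<lambda>x. (\<Sum>i<n. ra i t (fst x) * centred_step s (R i (snd x))) ^ k) \<in> borel_measurable (M \<Otimes>\<^sub>M M)"
    by (intro borel_measurable_power borel_measurable_sum borel_measurable_times measurable_compose[OF measurable_fst ra_measurable]
        measurable_compose[OF _ centred_step_measurable] measurable_compose[OF measurable_snd R.R_measurable]) auto
  then show "(\<lambda>(w', w). (\<Sum>i<n. ra i t w' * centred_step s (R i w)) ^ k) \<in> borel_measurable (M \<Otimes>\<^sub>M M)"
    by (simp add: split_beta')
qed

lemma ra2_le: "t \<in> {0..1} \<Longrightarrow> w \<in> space M \<Longrightarrow> 0 \<le> (\<Sum>i<n. (ra i t w)\<^sup>2) \<and> (\<Sum>i<n. (ra i t w)\<^sup>2) \<le> n"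
proof -
  assume t: "t \<in> {0..1}" and w: "w \<in> space M"
  have "(\<Sum>i<n. (ra i t w)\<^sup>2) \<le> (\<Sum>i<n. 1)"
    using abs_row_average_le[OF U_unitary[OF w] _ t] by (intro sum_mono) (auto simp: abs_square_le_1)
  then show ?thesis by (auto intro: sum_nonneg)
qed

lemma Z_moments:
  assumes p: "(s, t) \<in> unit_square"
  shows "expectation (\<lambda>w. (Z_process n U R C w (s, t))\<^sup>2) \<le> expectation (\<lambda>w. \<Sum>i<n. (ra i t w)\<^sup>2)"
    and "expectation (\<lambda>w. Z_process n U R C w (s, t) ^ 4) \<le> 4 * expectation (\<lambda>w. (\<Sum>i<n. (ra i t w)\<^sup>2)\<^sup>2)"
proof -
  have st: "s \<in> {0..1}" "t \<in> {0..1}" using p by (auto simp: unit_square_def)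
  note m = R.weighted_sum_moments[OF st(1)]
  have i2: "integrable M (\<lambda>w. (\<Sum>i<n. (ra i t w)\<^sup>2) ^ k)" for k
  proof (rule integrable_of_bounded[of _ "real n ^ k"])
    show "norm ((\<Sum>i<n. (ra i t w)\<^sup>2) ^ k) \<le> real n ^ k" if "w \<in> space M" for w
      unfolding real_norm_def power_abs using ra2_le[OF st(2) that] by (intro power_mono) auto
  qed measurable
  have nn: "0 \<le> expectation (\<lambda>w. (\<Sum>i<n. a i * centred_step s (R i w)) ^ k)" if "even k" for a k
    using that by (intro Bochner_Integration.integral_nonneg) (simp add: zero_le_even_power)
  have i3: "integrable M (\<lambda>w'. expectation (\<lambda>w. (\<Sum>i<n. ra i t w' * centred_step s (R i w)) ^ 2))"
  proof (intro integrable_of_bounded[where B="real n"] decoupled_measurable)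
    show "norm (expectation (\<lambda>w. (\<Sum>i<n. ra i t w' * centred_step s (R i w)) ^ 2)) \<le> n" if "w' \<in> space M" for w'
      using m(1)[of "\<lambda>i. ra i t w'"] nn[of 2 "\<lambda>i. ra i t w'"] ra2_le[OF st(2) that] by auto
  qed
  have i4: "integrable M (\<lambda>w'. expectation (\<lambda>w. (\<Sum>i<n. ra i t w' * centred_step s (R i w)) ^ 4))"
  proof (intro integrable_of_bounded[where B="4 * (real n)\<^sup>2"] decoupled_measurable)
    show "norm (expectation (\<lambda>w. (\<Sum>i<n. ra i t w' * centred_step s (R i w)) ^ 4)) \<le> 4 * (real n)\<^sup>2" if "w' \<in> space M" for w'
    proof -
      have "(\<Sum>i<n. (ra i t w')\<^sup>2)\<^sup>2 \<le> (real n)\<^sup>2" using ra2_le[OF st(2) that] by (intro power_mono) auto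
      then show ?thesis using m(2)[of "\<lambda>i. ra i t w'"] nn[of 4 "\<lambda>i. ra i t w'"] unfolding real_norm_def by auto
    qed
  qed
  show "expectation (\<lambda>w. (Z_process n U R C w (s, t))\<^sup>2) \<le> expectation (\<lambda>w. \<Sum>i<n. (ra i t w)\<^sup>2)"
    unfolding Z_moment_decoupled[OF p] using i2[of 1] by (intro integral_mono i3 m(1)) simp
  have "expectation (\<lambda>w. Z_process n U R C w (s, t) ^ 4) \<le> expectation (\<lambda>w. 4 * (\<Sum>i<n. (ra i t w)\<^sup>2)\<^sup>2)"
    unfolding Z_moment_decoupled[OF p] using i2[of 2] by (intro integral_mono i4 m(2)) simp
  then show "expectation (\<lambda>w. Z_process n U R C w (s, t) ^ 4) \<le> 4 * expectation (\<lambda>w. (\<Sum>i<n. (ra i t w)\<^sup>2)\<^sup>2)"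
    by simp
qed

lemma abs_Z_le:
  assumes p: "(s, t) \<in> unit_square" and w: "w \<in> space M"
  shows "\<bar>Z_process n U R C w (s, t)\<bar> \<le> n"
proof -
  have st: "s \<in> {0..1}" "t \<in> {0..1}" using p by (auto simp: unit_square_def)
  have "\<bar>Z_process n U R C w (s, t)\<bar> \<le> (\<Sum>i<n. 1 * 1)"
    unfolding Z_process_eq[OF p]
    by (rule order_trans[OF sum_abs], rule sum_mono, unfold abs_mult, rule mult_mono)
       (use abs_row_average_le[OF U_unitary[OF w] _ st(2)] abs_centred_step_le[OF st(1)] in auto)
  then show ?thesis by simp
qed

lemma Z_power_integrable: "p \<in> unit_square \<Longrightarrow> integrable M (\<lambda>w. Z_process n U R C w p ^ k)"
proof (rule integrable_of_bounded[of _ "real n ^ k"])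
  assume p: "p \<in> unit_square"
  show "(\<lambda>w. Z_process n U R C w p ^ k) \<in> borel_measurable M" using Z_eval_measurable[OF p] by measurable
  show "norm (Z_process n U R C w p ^ k) \<le> real n ^ k" if "w \<in> space M" for w
    unfolding real_norm_def power_abs using abs_Z_le[of "fst p" "snd p" w] p that by (intro power_mono) auto
qed

end

text \<open>
  The conditional variance is the sum of a nearly deterministic form, governed by \<open>\<gamma>\<close>, and a
  quadratic form in the empirical process of the columns, which converges to a bridge. The fourth powers of the
  deviations control the error of the Gaussian approximation.
\<close>

theorem fdd_limit:
  fixes M :: "nat \<Rightarrow> 'a measure" and f :: "(real \<times> real \<Rightarrow> real) \<Rightarrow> real"
  assumes S: "\<And>n. sample_model n (M n) (U n) (R n) (C n)"
    and H1: "\<And>t. t \<in> {0..1} \<Longrightarrow> (\<lambda>n. \<integral>w. (\<Sum>i<n. row_deviation n (U n w) (\<lambda>j. C n j w) i t ^ 4) \<partial>M n) \<longlonglongrightarrow> 0"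
    and H2: "\<And>t t'. t \<in> {0..1} \<Longrightarrow> t' \<in> {0..1} \<Longrightarrow>
       (\<lambda>n. \<integral>w. \<bar>(\<Sum>i<n. row_deviation n (U n w) (\<lambda>j. C n j w) i t * row_deviation n (U n w) (\<lambda>j. C n j w) i t') - \<gamma> * bridge_cov t t'\<bar> \<partial>M n) \<longlonglongrightarrow> 0"
    and B': "brownian_bridge N B'"
    and J: "finite J" "J \<subseteq> unit_square"
    and Ym: "\<And>p. p \<in> J \<Longrightarrow> (\<lambda>w. Y w p) \<in> borel_measurable N"
    and Y2: "\<And>p. p \<in> J \<Longrightarrow> integrable N (\<lambda>w. (Y w p)\<^sup>2)"
    and Yc: "\<And>c. (\<integral>w. iexp (\<Sum>p\<in>J. c p * Y w p) \<partial>N) =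
      (\<integral>w. complex_of_real (exp (- (\<gamma> * (\<Sum>p\<in>J. \<Sum>q\<in>J. c p * c q * bridge_cov (fst p) (fst q) * bridge_cov (snd p) (snd q)) +
        max 0 (\<Sum>p\<in>J. \<Sum>q\<in>J. c p * c q * bridge_cov (fst p) (fst q) * (B' (snd p) w * B' (snd q) w))) / 2)) \<partial>N)"
    and \<kappa>0: "\<And>c. 0 \<le> \<gamma> * (\<Sum>p\<in>J. \<Sum>q\<in>J. c p * c q * bridge_cov (fst p) (fst q) * bridge_cov (snd p) (snd q))"
    and f: "continuous_map (product_topology (\<lambda>_. euclideanreal) J) euclideanreal f"
    and fb: "bounded (f ` topspace (product_topology (\<lambda>_. euclideanreal) J))"
  shows "(\<lambda>n. \<integral>w. f (restrict (Z_process n (U n) (R n) (C n) w) J) \<partial>M n) \<longlonglongrightarrow> (\<integral>w. f (restrict (Y w) J) \<partial>N)"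
proof -
  interpret sm: sample_model n "M n" "U n" "R n" "C n" for n by (rule S)
  interpret B': gaussian_family N "{0..1}" B' bridge_cov by (rule bridge_family[OF B'])
  have fs: "fst p \<in> {0..1}" "snd p \<in> {0..1}" if "p \<in> J" for p using that J by (auto simp: unit_square_def)
  let ?rd = "\<lambda>n i t w. row_deviation n (U n w) (\<lambda>j. C n j w) i t"
  let ?D = "\<lambda>t t' n. \<integral>w. \<bar>(\<Sum>i<n. ?rd n i t w * ?rd n i t' w) - \<gamma> * bridge_cov t t'\<bar> \<partial>M n"
  define L where "L t = \<bar>\<gamma> * bridge_cov t t\<bar> + 2" for t
  have ra2: "\<forall>\<^sub>F n in sequentially. (\<integral>w. (\<Sum>i<n. (row_average n (U n w) (\<lambda>j. C n j w) i t)\<^sup>2) \<partial>M n) \<le> L t" if t: "t \<in> {0..1}" for t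
  proof -
    have "\<forall>\<^sub>F n in sequentially. ?D t t n < 1" using order_tendstoD(2)[OF H2[OF t t], of 1] by simp
    then show ?thesis using eventually_gt_at_top[of 0]
    proof eventually_elim
      case (elim n)
      have "(\<integral>w. (\<Sum>i<n. (?rd n i t w)\<^sup>2) \<partial>M n) - \<gamma> * bridge_cov t t = (\<integral>w. (\<Sum>i<n. ?rd n i t w * ?rd n i t w) - \<gamma> * bridge_cov t t \<partial>M n)"
        using sm.int_rd_product[OF t t, of n] by (simp add: power2_eq_square sm.prob_space)
      also have "\<dots> \<le> ?D t t n"
        using sm.int_rd_product[OF t t, of n] by (intro integral_mono Bochner_Integration.integrable_abs Bochner_Integration.integrable_diff) auto
      finally show ?case using sm.expectation_ra2[OF elim(2) t] elim(1) unfolding L_def by linarith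
    qed
  qed
  have char: "(\<lambda>n. \<integral>w. iexp (\<Sum>p\<in>J. c p * Z_process n (U n) (R n) (C n) w p) \<partial>M n) \<longlonglongrightarrow> (\<integral>w. iexp (\<Sum>p\<in>J. c p * Y w p) \<partial>N)" for c
  proof -
    let ?\<kappa> = "\<Sum>p\<in>J. \<Sum>q\<in>J. c p * c q * bridge_cov (fst p) (fst q) * bridge_cov (snd p) (snd q)"
    let ?err = "\<lambda>n. \<integral>w. (\<Sum>i<n. sm.abs_weight n J c i w ^ 3 + sm.abs_weight n J c i w ^ 4) \<partial>M n"
    let ?\<psi> = "\<lambda>n. \<integral>w. exp (- (\<gamma> * ?\<kappa> + max 0 (sm.mean_form n J c w)) / 2) \<partial>M n"
    let ?\<phi> = "\<lambda>n. \<integral>w. iexp (\<Sum>p\<in>J. c p * Z_process n (U n) (R n) (C n) w p) \<partial>M n"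
    let ?A4 = "\<lambda>n. \<Sum>p\<in>J. (real (card J) ^ 3 * (c p) ^ 4) * (8 * (\<integral>w. (\<Sum>i<n. ?rd n i (snd p) w ^ 4) \<partial>M n) + 32 / real n)"
    define K2 where "K2 = (\<Sum>p\<in>J. (card J * (c p)\<^sup>2) * L (snd p)) + 1"
    have K2: "K2 > 0" unfolding K2_def L_def by (intro add_nonneg_pos sum_nonneg mult_nonneg_nonneg) auto
    have A4: "?A4 \<longlonglongrightarrow> 0"
    proof -
      have "?A4 \<longlonglongrightarrow> (\<Sum>p\<in>J. (real (card J) ^ 3 * (c p) ^ 4) * (8 * 0 + 0))"
        by (intro tendsto_sum tendsto_mult_left tendsto_add lim_const_over_n H1 fs)
      then show ?thesis by simp
    qed
    have w2: "\<forall>\<^sub>F n in sequentially. (\<integral>w. (\<Sum>i<n. sm.abs_weight n J c i w ^ 2) \<partial>M n) \<le> K2"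
    proof -
      have "\<forall>\<^sub>F n in sequentially. \<forall>p\<in>J. (\<integral>w. (\<Sum>i<n. (row_average n (U n w) (\<lambda>j. C n j w) i (snd p))\<^sup>2) \<partial>M n) \<le> L (snd p)"
        using ra2 fs by (simp add: eventually_ball_finite_distrib[OF J(1)])
      then show ?thesis
      proof eventually_elim
        case (elim n)
        have "(\<integral>w. (\<Sum>i<n. sm.abs_weight n J c i w ^ 2) \<partial>M n) \<le> (\<Sum>p\<in>J. (card J * (c p)\<^sup>2) * (\<integral>w. (\<Sum>i<n. (row_average n (U n w) (\<lambda>j. C n j w) i (snd p))\<^sup>2) \<partial>M n))"
          by (rule sm.abs_weight_powers(1)[OF J])
        also have "\<dots> \<le> (\<Sum>p\<in>J. (card J * (c p)\<^sup>2) * L (snd p))" using elim by (intro sum_mono mult_left_mono) auto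
        finally show ?case by (simp add: K2_def)
      qed
    qed
    have w4: "\<forall>\<^sub>F n in sequentially. (\<integral>w. (\<Sum>i<n. sm.abs_weight n J c i w ^ 4) \<partial>M n) \<le> ?A4 n"
      using eventually_gt_at_top[of 0]
    proof eventually_elim
      case (elim n)
      show ?case
        by (rule order_trans[OF sm.abs_weight_powers(2)[OF J]], intro sum_mono mult_left_mono sm.expectation_ra4[OF elim] fs)
           (auto intro: mult_nonneg_nonneg zero_le_even_power)
    qed
    have err: "?err \<longlonglongrightarrow> 0"
    proof (rule tendstoI)
      fix \<epsilon> :: real assume \<epsilon>: "\<epsilon> > 0"
      define e where "e = \<epsilon> / (2 * K2)"
      have e: "e > 0" using \<epsilon> K2 by (simp add: e_def)
      have "(\<lambda>n. (1 / e + 1) * ?A4 n) \<longlonglongrightarrow> (1 / e + 1) * 0" by (intro tendsto_mult_left A4)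
      then have "\<forall>\<^sub>F n in sequentially. (1 / e + 1) * ?A4 n < \<epsilon> / 2" using \<epsilon> by (intro order_tendstoD(2)) auto
      then show "\<forall>\<^sub>F n in sequentially. dist (?err n) 0 < \<epsilon>" using w2 w4
      proof eventually_elim
        case (elim n)
        have "?err n \<le> e * (\<integral>w. (\<Sum>i<n. sm.abs_weight n J c i w ^ 2) \<partial>M n) + (1 / e + 1) * (\<integral>w. (\<Sum>i<n. sm.abs_weight n J c i w ^ 4) \<partial>M n)"
          by (rule sm.char_error_le[OF J e])
        also have "\<dots> \<le> e * K2 + (1 / e + 1) * ?A4 n" using elim e by (intro add_mono mult_left_mono) auto
        also have "e * K2 = \<epsilon> / 2" using K2 by (simp add: e_def)
        finally have "?err n < \<epsilon>" using elim by linarith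
        moreover have "0 \<le> ?err n"
        proof (rule Bochner_Integration.integral_nonneg, rule sum_nonneg)
          fix w i
          have "0 \<le> sm.abs_weight n J c i w" unfolding sm.abs_weight_def by (intro sum_nonneg) auto
          then show "0 \<le> sm.abs_weight n J c i w ^ 3 + sm.abs_weight n J c i w ^ 4" by simp
        qed
        ultimately show ?case by (simp add: dist_real_def)
      qed
    qed
    have var: "(\<lambda>n. \<Sum>p\<in>J. \<Sum>q\<in>J. \<bar>c p * c q\<bar> * ?D (snd p) (snd q) n) \<longlonglongrightarrow> 0"
    proof -
      have "(\<lambda>n. \<Sum>p\<in>J. \<Sum>q\<in>J. \<bar>c p * c q\<bar> * ?D (snd p) (snd q) n) \<longlonglongrightarrow> (\<Sum>p\<in>J. \<Sum>q\<in>J. \<bar>c p * c q\<bar> * 0)"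
        by (intro tendsto_sum tendsto_mult_left H2 fs)
      then show ?thesis by simp
    qed
    have "(\<lambda>n. ?\<phi> n - complex_of_real (?\<psi> n)) \<longlonglongrightarrow> 0"
    proof (rule Lim_null_comparison)
      show "(\<lambda>n. ?err n + (\<Sum>p\<in>J. \<Sum>q\<in>J. \<bar>c p * c q\<bar> * ?D (snd p) (snd q) n)) \<longlonglongrightarrow> 0"
        using tendsto_add[OF err var] by simp
      show "\<forall>\<^sub>F n in sequentially. norm (?\<phi> n - complex_of_real (?\<psi> n)) \<le> ?err n + (\<Sum>p\<in>J. \<Sum>q\<in>J. \<bar>c p * c q\<bar> * ?D (snd p) (snd q) n)"
        using eventually_gt_at_top[of 0]
      proof eventually_elim
        case (elim n)
        let ?v = "\<integral>w. exp (- sm.cond_var n J c w / 2) \<partial>M n"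
        have "norm (?\<phi> n - complex_of_real (?\<psi> n)) \<le> norm (?\<phi> n - complex_of_real ?v) + norm (complex_of_real ?v - complex_of_real (?\<psi> n))"
          by (rule order_trans[OF _ norm_triangle_ineq]) simp
        also have "norm (complex_of_real ?v - complex_of_real (?\<psi> n)) = \<bar>?v - ?\<psi> n\<bar>"
          by (simp only: of_real_diff[symmetric] norm_of_real)
        also have "norm (?\<phi> n - complex_of_real ?v) + \<bar>?v - ?\<psi> n\<bar> \<le> ?err n + (\<Sum>p\<in>J. \<Sum>q\<in>J. \<bar>c p * c q\<bar> * ?D (snd p) (snd q) n)"
          by (intro add_mono sm.char_conditional[OF J] sm.char_error_variance[OF elim J \<kappa>0])
        finally show ?case .
      qed
    qed
    moreover have "(\<lambda>n. complex_of_real (?\<psi> n)) \<longlonglongrightarrow> (\<integral>w. iexp (\<Sum>p\<in>J. c p * Y w p) \<partial>N)"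
    proof -
      let ?h = "\<lambda>x. exp (- (\<gamma> * ?\<kappa> + max 0 (\<Sum>p\<in>J. \<Sum>q\<in>J. c p * c q * bridge_cov (fst p) (fst q) * (x (snd p) * x (snd q)))) / 2)"
      have "(\<lambda>n. \<integral>w. ?h (\<lambda>t\<in>snd ` J. uniform_sample.empirical n (C n) t w) \<partial>M n) \<longlonglongrightarrow> (\<integral>w. ?h (\<lambda>t\<in>snd ` J. B' t w) \<partial>N)"
      proof (rule empirical_fdd[OF sm.C.uniform_sample_axioms B'])
        show "finite (snd ` J)" "snd ` J \<subseteq> {0..1}" using J fs by auto
        have proj: "continuous_map (product_topology (\<lambda>_. euclideanreal) (snd ` J)) euclideanreal (\<lambda>x. x (snd p))" if "p \<in> J" for p
          using that by (intro continuous_map_product_projection) auto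
        have "continuous_map (product_topology (\<lambda>_. euclideanreal) (snd ` J)) euclideanreal
           (\<lambda>x. \<Sum>p\<in>J. \<Sum>q\<in>J. c p * c q * bridge_cov (fst p) (fst q) * (x (snd p) * x (snd q)))"
          by (intro continuous_map_sum continuous_map_real_mult continuous_map_const[THEN iffD2] proj J) auto
        from continuous_map_compose[OF this, of euclideanreal "\<lambda>v. exp (- (\<gamma> * ?\<kappa> + max 0 v) / 2)"]
        show "continuous_map (product_topology (\<lambda>_. euclideanreal) (snd ` J)) euclideanreal ?h"
          unfolding o_def by (rule meta_mp) (unfold continuous_map_iff_continuous2, intro continuous_intros, auto)
        have "\<bar>?h x\<bar> \<le> 1" for x using \<kappa>0[of c] by (simp add: add_nonneg_nonneg)
        then show "bounded (?h ` topspace (product_topology (\<lambda>_. euclideanreal) (snd ` J)))"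
          by (intro boundedI[of _ 1]) auto
      qed
      then have "?\<psi> \<longlonglongrightarrow> (\<integral>w. exp (- (\<gamma> * ?\<kappa> + max 0 (\<Sum>p\<in>J. \<Sum>q\<in>J. c p * c q * bridge_cov (fst p) (fst q) * (B' (snd p) w * B' (snd q) w))) / 2) \<partial>N)"
        unfolding sm.mean_form_def by (simp cong: sum.cong)
      from tendsto_of_real[OF this, where 'a=complex] show ?thesis unfolding Yc integral_complex_of_real .
    qed
    ultimately show ?thesis using tendsto_add by force
  qed
  show ?thesis
  proof (rule expectation_convergence_from_characters[where K="(\<Sum>p\<in>J. L (snd p))"])
    show "prob_space (M n)" for n by (rule sm.prob_space_axioms)
    show "prob_space N" by (rule B'.prob_space_axioms)
    show "(\<lambda>w. Z_process n (U n) (R n) (C n) w p) \<in> borel_measurable (M n)" if "p \<in> J" for n p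
      using J that by (intro sm.Z_eval_measurable) auto
    show "integrable (M n) (\<lambda>w. (Z_process n (U n) (R n) (C n) w p)\<^sup>2)" if "p \<in> J" for n p
      using J that by (intro sm.Z_power_integrable) auto
    show "\<forall>\<^sub>F n in sequentially. (\<integral>w. (Z_process n (U n) (R n) (C n) w p)\<^sup>2 \<partial>M n) \<le> (\<Sum>p\<in>J. L (snd p))" if p: "p \<in> J" for p
      using ra2[OF fs(2)[OF p]]
    proof eventually_elim
      case (elim n)
      have "(fst p, snd p) \<in> unit_square" using p J by auto
      from sm.Z_moments(1)[OF this, of n] elim
      have "(\<integral>w. (Z_process n (U n) (R n) (C n) w p)\<^sup>2 \<partial>M n) \<le> L (snd p)" by simp
      also have "\<dots> \<le> (\<Sum>p\<in>J. L (snd p))" using p J by (intro member_le_sum) (auto simp: L_def)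
      finally show ?case .
    qed
  qed (use J Ym Y2 char f fb in auto)
qed

section \<open>Row deviations of Haar matrices\<close>

lemma (in prob_space) expectation_abs_le_of_square:
  assumes [measurable]: "X \<in> borel_measurable M" and i: "integrable M (\<lambda>w. (X w)\<^sup>2)" and e: "expectation (\<lambda>w. (X w)\<^sup>2) \<le> K / n" and n: "0 < n"
  shows "expectation (\<lambda>w. \<bar>X w\<bar>) \<le> (1 + K) / sqrt n"
proof -
  have s: "sqrt n > 0" using n by simp
  have am: "\<bar>x\<bar> \<le> 1 / sqrt n + sqrt n * x\<^sup>2" for x :: real
  proof (cases "\<bar>x\<bar> \<le> 1 / sqrt n")
    case True
    then show ?thesis using s by (intro add_increasing2) auto
  next
    case False
    then have "1 \<le> sqrt n * \<bar>x\<bar>" using s by (simp add: field_simps)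
    then have "1 * \<bar>x\<bar> \<le> (sqrt n * \<bar>x\<bar>) * \<bar>x\<bar>" by (intro mult_right_mono) auto
    then have "\<bar>x\<bar> \<le> sqrt n * x\<^sup>2" by (simp add: power2_eq_square mult.assoc)
    then show ?thesis using s by (intro add_increasing) auto
  qed
  have "expectation (\<lambda>w. \<bar>X w\<bar>) \<le> expectation (\<lambda>w. 1 / sqrt n + sqrt n * (X w)\<^sup>2)"
  proof (rule integral_mono')
    show "integrable M (\<lambda>w. 1 / sqrt n + sqrt n * (X w)\<^sup>2)" using i by simp
    show "\<bar>X w\<bar> \<le> 1 / sqrt n + sqrt n * (X w)\<^sup>2" for w by (rule am)
    show "0 \<le> 1 / sqrt n + sqrt n * (X w)\<^sup>2" for w by (rule order_trans[OF abs_ge_zero am])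
  qed
  also have "\<dots> = 1 / sqrt n + sqrt n * expectation (\<lambda>w. (X w)\<^sup>2)" using i by (simp add: prob_space)
  also have "\<dots> \<le> 1 / sqrt n + sqrt n * (K / n)" using s e by (intro add_left_mono mult_left_mono) auto
  also have "sqrt n * (K / n) = K / sqrt n" using n s real_div_sqrt[of n] by (simp add: field_simps)
  finally show ?thesis by (simp add: add_divide_distrib)
qed

context sample_model
begin

lemma row_deviation_measurable:
  assumes "i < n" shows "(\<lambda>x. row_deviation n (snd x) (fst x) i t) \<in> borel_measurable (PB \<Otimes>\<^sub>M UB)"
proof -
  have "(\<lambda>x. row_average n (snd x) (fst x) i t - sample_mean n (fst x) t) \<in> borel_measurable (PB \<Otimes>\<^sub>M UB)"
    by (intro borel_measurable_diff row_average_measurable assms measurable_compose[OF measurable_fst sample_mean_measurable])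
  then show ?thesis
    by (rule measurable_cong[THEN iffD1, rotated])
       (use row_average_split[OF _ assms] in \<open>auto simp: space_pair_measure space_UB\<close>)
qed

lemma expectation_C_U_le:
  assumes G: "case_prod G \<in> borel_measurable (PB \<Otimes>\<^sub>M UB)" and B: "\<And>c u. u \<in> unitary_group n \<Longrightarrow> \<bar>G c u\<bar> \<le> B"
    and nn: "\<And>c u. 0 \<le> G c u" and K: "\<And>c. expectation (\<lambda>w. G c (U w)) \<le> K"
  shows "expectation (\<lambda>w. G (Cv w) (U w)) \<le> (K :: real)"
proof -
  have 0: "0 \<le> expectation (\<lambda>w. G c (U w))" for c using nn by (intro Bochner_Integration.integral_nonneg)
  have "\<bar>expectation (\<lambda>w. expectation (\<lambda>w'. G (Cv w) (U w')))\<bar> \<le> K"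
  proof (rule abs_expectation_le)
    show "\<bar>expectation (\<lambda>w'. G (Cv w) (U w'))\<bar> \<le> K" for w
      using 0[of "Cv w"] K[of "Cv w"] by simp
    show "0 \<le> K" by (rule order_trans[OF 0 K])
  qed
  then show ?thesis using decouple_C_U(1)[OF G, of B] B by auto
qed

lemma sum_centred_deviation: "(\<Sum>j<n. centred_step t (c j) - sample_mean n c t) = 0"
  by (cases "n = 0") (simp_all add: sum_subtractf sample_mean_def)

lemma covariance_estimate:
  assumes n: "0 < n" and t: "t \<in> {0..1}" and t': "t' \<in> {0..1}"
  shows "expectation (\<lambda>w. \<bar>(\<Sum>j<n. (centred_step t (C j w) - sm t w) * (centred_step t' (C j w) - sm t' w)) / n - bridge_cov t t'\<bar>) \<le> 5 / sqrt n + 1 / n"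
proof -
  let ?X = "\<lambda>j w. centred_step t (C j w) * centred_step t' (C j w) - bridge_cov t t'"
  have pm: "\<bar>centred_step t r * centred_step t' r\<bar> \<le> 1 * 1" for r
    unfolding abs_mult by (intro mult_mono abs_centred_step_le t t') auto
  have b: "\<bar>?X j w\<bar> \<le> 2" for j w using pm[of "C j w"] bridge_cov_abs_le[OF t t'] by linarith
  have mean: "expectation (?X j) = 0" if j: "j < n" for j
  proof -
    have "integrable M (\<lambda>w. centred_step t (C j w) * centred_step t' (C j w))"
      using pm C.R_measurable[OF j] by (intro integrable_of_bounded[of _ "1 * 1"]) auto
    then show ?thesis using C.expectation_centred_step_mult[OF j t t'] by (simp add: prob_space)
  qed
  have m: "expectation (\<lambda>w. (?X j w) ^ k) \<le> 2 ^ k" for j k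
  proof -
    have "\<bar>(?X j w) ^ k\<bar> \<le> 2 ^ k" for w unfolding power_abs using b by (intro power_mono) auto
    then have "\<bar>expectation (\<lambda>w. (?X j w) ^ k)\<bar> \<le> 2 ^ k" by (intro abs_expectation_le) auto
    then show ?thesis by simp
  qed
  have s2: "expectation (\<lambda>w. (\<Sum>j<n. ?X j w) ^ 2) \<le> (\<Sum>j<n. 2 ^ 2)"
  proof -
    have "expectation (\<lambda>w. \<Sum>j<n. ?X j w) = 0 \<and> expectation (\<lambda>w. (\<Sum>j<n. ?X j w) ^ 2) \<le> (\<Sum>j<n. 2 ^ 2) \<and>
      expectation (\<lambda>w. (\<Sum>j<n. ?X j w) ^ 4) \<le> 3 * (\<Sum>j<n. 2 ^ 2)\<^sup>2 + (\<Sum>j<n. 2 ^ 4)"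
    proof (rule indep_sum_moments)
      show "indep_vars (\<lambda>_. borel) ?X {..<n}" by (rule C.indep_transform) measurable
    qed (use b mean m[of _ 2] m[of _ 4] in auto)
    then show ?thesis by blast
  qed
  let ?A = "\<lambda>w. (\<Sum>j<n. ?X j w) / n"
  have Cm [measurable]: "j < n \<Longrightarrow> C j \<in> borel_measurable M" for j by (rule C.R_measurable)
  have Am: "?A \<in> borel_measurable M" by measurable
  have Ai: "integrable M (\<lambda>w. (?A w)\<^sup>2)"
  proof (rule integrable_of_bounded[of _ "2\<^sup>2"])
    show "(\<lambda>w. (?A w)\<^sup>2) \<in> borel_measurable M" using Am by measurable
    fix w
    have "\<bar>\<Sum>j<n. ?X j w\<bar> \<le> (\<Sum>j<n. 2)" using b by (intro order_trans[OF sum_abs] sum_mono)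
    then have "\<bar>?A w\<bar> \<le> 2" using n by (simp add: abs_divide divide_simps mult.commute)
    then show "norm ((?A w)\<^sup>2) \<le> 2\<^sup>2" unfolding real_norm_def power_abs by (intro power_mono) auto
  qed
  have "expectation (\<lambda>w. (?A w)\<^sup>2) = expectation (\<lambda>w. (\<Sum>j<n. ?X j w)\<^sup>2) / n\<^sup>2" by (simp add: power_divide)
  also have "\<dots> \<le> (\<Sum>j<n. 2 ^ 2) / n\<^sup>2" using s2 by (intro divide_right_mono) auto
  also have "\<dots> = 4 / n" using n by (simp add: power2_eq_square)
  finally have A1: "expectation (\<lambda>w. \<bar>?A w\<bar>) \<le> (1 + 4) / sqrt n"
    by (rule expectation_abs_le_of_square[OF Am Ai]) (use n in simp)
  have A1i: "integrable M (\<lambda>w. \<bar>?A w\<bar>)"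
  proof (rule integrable_of_bounded[of _ 2])
    fix w
    have "\<bar>\<Sum>j<n. ?X j w\<bar> \<le> (\<Sum>j<n. 2)" using b by (intro order_trans[OF sum_abs] sum_mono)
    then show "norm \<bar>?A w\<bar> \<le> 2" using n by (simp add: abs_divide divide_simps mult.commute)
  qed (use Am in measurable)
  let ?E = "\<lambda>w. ((C.empirical t w)\<^sup>2 + (C.empirical t' w)\<^sup>2) / (2 * n)"
  have Ei: "integrable M ?E" using C.empirical_square_integrable[OF t] C.empirical_square_integrable[OF t'] by simp
  have pw: "\<bar>(\<Sum>j<n. (centred_step t (C j w) - sm t w) * (centred_step t' (C j w) - sm t' w)) / n - bridge_cov t t'\<bar> \<le> \<bar>?A w\<bar> + ?E w" for w
  proof -
    have "(\<Sum>j<n. (centred_step t (C j w) - sm t w) * (centred_step t' (C j w) - sm t' w)) =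
       (\<Sum>j<n. centred_step t (C j w) * centred_step t' (C j w)) - (\<Sum>j<n. centred_step t (C j w)) * sm t' w - sm t w * (\<Sum>j<n. centred_step t' (C j w) - sm t' w)"
      by (simp only: sum_distrib_left sum_distrib_right sum_subtractf[symmetric]) (intro sum.cong refl, simp add: algebra_simps)
    also have "\<dots> = (\<Sum>j<n. centred_step t (C j w) * centred_step t' (C j w)) - n * (sm t w * sm t' w)"
      unfolding sum_centred_deviation using n by (simp add: sample_mean_def)
    also have "n * (sm t w * sm t' w) = C.empirical t w * C.empirical t' w"
      unfolding sm_empirical[OF n] using n by (simp add: real_sqrt_mult_self flip: mult.assoc)
    finally have "(\<Sum>j<n. (centred_step t (C j w) - sm t w) * (centred_step t' (C j w) - sm t' w)) / n - bridge_cov t t' =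
      ?A w - C.empirical t w * C.empirical t' w / n"
      using n by (simp add: sum_subtractf diff_divide_distrib)
    moreover have "\<bar>C.empirical t w * C.empirical t' w / n\<bar> \<le> ?E w"
    proof -
      have "2 * (\<bar>C.empirical t w\<bar> * \<bar>C.empirical t' w\<bar>) \<le> (C.empirical t w)\<^sup>2 + (C.empirical t' w)\<^sup>2"
        using zero_le_power2[of "\<bar>C.empirical t w\<bar> - \<bar>C.empirical t' w\<bar>"] by (simp add: power2_diff)
      then show ?thesis using n by (simp add: abs_mult divide_simps)
    qed
    ultimately show ?thesis by linarith
  qed
  have "expectation (\<lambda>w. \<bar>(\<Sum>j<n. (centred_step t (C j w) - sm t w) * (centred_step t' (C j w) - sm t' w)) / n - bridge_cov t t'\<bar>) \<le> expectation (\<lambda>w. \<bar>?A w\<bar> + ?E w)"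
    using A1i Ei pw by (intro integral_mono') auto
  also have "\<dots> = expectation (\<lambda>w. \<bar>?A w\<bar>) + expectation ?E" using A1i Ei by (rule Bochner_Integration.integral_add)
  also have "expectation ?E = (expectation (\<lambda>w. (C.empirical t w)\<^sup>2) + expectation (\<lambda>w. (C.empirical t' w)\<^sup>2)) / (2 * n)"
    using C.empirical_square_integrable[OF t] C.empirical_square_integrable[OF t'] by simp
  also have "expectation (\<lambda>w. \<bar>?A w\<bar>) + \<dots> \<le> (1 + 4) / sqrt n + (1 + 1) / (2 * n)"
    using A1 C.empirical_moments(1)[OF t] C.empirical_moments(1)[OF t'] by (intro add_mono divide_right_mono) auto
  finally show ?thesis by simp
qed

end

locale haar_sample = sample_model n M U R C
  for n :: nat and M :: "'a measure" and U R C +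
  fixes G :: "complex mat set" and Z :: "complex set"
  assumes U_G: "U \<in> M \<rightarrow>\<^sub>M restrict_space (matrix_borel n) G"
    and U_haar: "haar_moments (distr M (restrict_space (matrix_borel n) G) U) n G Z"
    and n8: "8 \<le> n"
begin

sublocale hm: haar_moments "distr M (restrict_space (matrix_borel n) G) U" n G Z
  by (rule U_haar)

lemma expectation_U: "f \<in> borel_measurable (distr M (restrict_space (matrix_borel n) G) U) \<Longrightarrow> hm.expectation f = expectation (\<lambda>w. f (U w) :: real)"
  by (rule integral_distr[OF U_G]) simp

definition "dev t c j = centred_step t (c j) - sample_mean n c t" for c :: "nat \<Rightarrow> real"

lemma abs_dev_le: "t \<in> {0..1} \<Longrightarrow> \<bar>dev t c j\<bar> \<le> 2"
  using abs_centred_step_le[of t "c j"] abs_sample_mean_le[of t n c] unfolding dev_def by linarith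

lemma sum_dev: "(\<Sum>j<n. dev t c j) = 0"
  unfolding dev_def by (rule sum_centred_deviation)

lemma row_deviation_dev: "row_deviation n u c i t = conj_diag n (dev t c) u i"
  unfolding row_deviation_def dev_def[abs_def] ..

lemma haar_rd4:
  assumes t: "t \<in> {0..1}"
  shows "expectation (\<lambda>w. \<Sum>i<n. rd i t w ^ 4) \<le> 640 / n"
proof -
  have "expectation (\<lambda>w. \<Sum>i<n. row_deviation n (U w) (Cv w) i t ^ 4) \<le> 640 / n"
  proof (rule expectation_C_U_le[where B="\<Sum>i<n. 2 ^ 4" and G="\<lambda>c u. \<Sum>i<n. row_deviation n u c i t ^ 4"])
    have "(\<lambda>x. \<Sum>i<n. row_deviation n (snd x) (fst x) i t ^ 4) \<in> borel_measurable (PB \<Otimes>\<^sub>M UB)"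
      by (intro borel_measurable_sum borel_measurable_power row_deviation_measurable) auto
    then show "(\<lambda>(c, u). \<Sum>i<n. row_deviation n u c i t ^ 4) \<in> borel_measurable (PB \<Otimes>\<^sub>M UB)" by (simp add: split_beta')
    show "\<bar>\<Sum>i<n. row_deviation n u c i t ^ 4\<bar> \<le> (\<Sum>i<n. 2 ^ 4)" if "u \<in> unitary_group n" for c u
      by (rule order_trans[OF sum_abs], rule sum_mono, unfold power_abs, rule power_mono)
         (use abs_row_deviation_le[OF that _ t] in auto)
    show "0 \<le> (\<Sum>i<n. row_deviation n u c i t ^ 4)" for c u by (intro sum_nonneg) auto
    fix c
    note d = sum_dev[of t c] abs_dev_le[OF t, of c] zero_le_numeral[of "num.Bit0 num.One"]
    have "hm.expectation (hm.T4 (dev t c)) \<le> 40 * 2 ^ 4 / n"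
      by (rule hm.diagonal_moments(2)[OF d n8])
    then show "expectation (\<lambda>w. \<Sum>i<n. row_deviation n (U w) c i t ^ 4) \<le> 640 / n"
      using expectation_U[OF hm.T4_measurable[OF d]] unfolding hm.T4_def[OF d] row_deviation_dev by simp
  qed
  then show ?thesis unfolding Cv_eq .
qed

lemma haar_rd2_square:
  assumes t: "t \<in> {0..1}"
  shows "expectation (\<lambda>w. (\<Sum>i<n. (rd i t w)\<^sup>2)\<^sup>2) \<le> 384"
proof -
  have "expectation (\<lambda>w. (\<Sum>i<n. (row_deviation n (U w) (Cv w) i t)\<^sup>2)\<^sup>2) \<le> 384"
  proof (rule expectation_C_U_le[where B="(\<Sum>i<n. 2\<^sup>2)\<^sup>2" and G="\<lambda>c u. (\<Sum>i<n. (row_deviation n u c i t)\<^sup>2)\<^sup>2"])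
    have "(\<lambda>x. (\<Sum>i<n. (row_deviation n (snd x) (fst x) i t)\<^sup>2)\<^sup>2) \<in> borel_measurable (PB \<Otimes>\<^sub>M UB)"
      by (intro borel_measurable_sum borel_measurable_power row_deviation_measurable) auto
    then show "(\<lambda>(c, u). (\<Sum>i<n. (row_deviation n u c i t)\<^sup>2)\<^sup>2) \<in> borel_measurable (PB \<Otimes>\<^sub>M UB)" by (simp add: split_beta')
    show "\<bar>(\<Sum>i<n. (row_deviation n u c i t)\<^sup>2)\<^sup>2\<bar> \<le> (\<Sum>i<n. 2\<^sup>2)\<^sup>2" if "u \<in> unitary_group n" for c u
    proof -
      have "(row_deviation n u c i t)\<^sup>2 \<le> 2\<^sup>2" if "i < n" for i
        using power_mono[OF abs_row_deviation_le[OF \<open>u \<in> unitary_group n\<close> that t] abs_ge_zero, of c 2] by simp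
      then have "(\<Sum>i<n. (row_deviation n u c i t)\<^sup>2) \<le> (\<Sum>i<n. 2\<^sup>2)" by (intro sum_mono) auto
      then show ?thesis unfolding abs_power2 by (intro power_mono sum_nonneg) auto
    qed
    fix c
    note d = sum_dev[of t c] abs_dev_le[OF t, of c] zero_le_numeral[of "num.Bit0 num.One"]
    have "hm.expectation (\<lambda>A. hm.T2 (dev t c) A ^ 2) \<le> 24 * 2 ^ 4"
      by (rule hm.diagonal_moments(1)[OF d n8])
    moreover have "(\<lambda>A. hm.T2 (dev t c) A ^ 2) \<in> borel_measurable (distr M (restrict_space (matrix_borel n) G) U)"
      using hm.T2_measurable[OF d] by (intro borel_measurable_power) auto
    ultimately show "expectation (\<lambda>w. (\<Sum>i<n. (row_deviation n (U w) c i t)\<^sup>2)\<^sup>2) \<le> 384"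
      using expectation_U[of "\<lambda>A. hm.T2 (dev t c) A ^ 2"] unfolding hm.T2_def[OF d] row_deviation_dev by simp
  qed simp
  then show ?thesis unfolding Cv_eq .
qed

lemma T2_deviation:
  assumes d: "(\<Sum>j<n. y j) = 0" "\<And>j. j < n \<Longrightarrow> \<bar>y j\<bar> \<le> 4"
  shows "expectation (\<lambda>w. \<bar>(\<Sum>i<n. (conj_diag n y (U w) i)\<^sup>2) - 2 * (\<Sum>j<n. (y j)\<^sup>2) / (card Z * n + 2)\<bar>) \<le> 40961 / sqrt n"
    and "integrable M (\<lambda>w. \<Sum>i<n. (conj_diag n y (U w) i)\<^sup>2)"
proof -
  have D: "hm.T2 y A = (\<Sum>i<n. (conj_diag n y A i)\<^sup>2)" "hm.S2 y = (\<Sum>j<n. (y j)\<^sup>2)" "hm.b = real (card Z)" for A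
    using hm.T2_def[of y 4] hm.S2_def[of y 4] hm.b_def[of y 4] d by auto
  let ?\<tau> = "2 * hm.S2 y / (hm.b * n + 2)"
  have T2m: "hm.T2 y \<in> borel_measurable (distr M (restrict_space (matrix_borel n) G) U)" by (rule hm.T2_measurable[OF d]) auto
  have i2: "integrable (distr M (restrict_space (matrix_borel n) G) U) (\<lambda>A. (hm.T2 y A - ?\<tau>)\<^sup>2)"
    and i1: "integrable (distr M (restrict_space (matrix_borel n) G) U) (hm.T2 y)"
  proof -
    have a: "integrable (distr M (restrict_space (matrix_borel n) G) U) (\<lambda>A. hm.T2 y A ^ r)" for r by (rule hm.int_T2_power[OF d]) auto
    show "integrable (distr M (restrict_space (matrix_borel n) G) U) (hm.T2 y)" using a[of 1] by simp
    have "(hm.T2 y A - ?\<tau>)\<^sup>2 = hm.T2 y A ^ 2 + (-2 * ?\<tau>) * hm.T2 y A ^ 1 + ?\<tau>\<^sup>2" for A by (simp add: power2_diff)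
    then show "integrable (distr M (restrict_space (matrix_borel n) G) U) (\<lambda>A. (hm.T2 y A - ?\<tau>)\<^sup>2)"
      using a[of 1] a[of 2] by (simp only: hm.prob_space Bochner_Integration.integrable_add integrable_mult_right hm.integrable_const)
  qed
  have "hm.expectation (\<lambda>A. (hm.T2 y A - ?\<tau>)\<^sup>2) \<le> 160 * 4 ^ 4 / n"
    by (rule hm.diagonal_moments(3)[OF d _ n8]) auto
  from hm.expectation_abs_le_of_square[OF _ i2 this] T2m n8
  have "hm.expectation (\<lambda>A. \<bar>hm.T2 y A - ?\<tau>\<bar>) \<le> 40961 / sqrt n" by simp
  moreover have "hm.expectation (\<lambda>A. \<bar>hm.T2 y A - ?\<tau>\<bar>) = expectation (\<lambda>w. \<bar>hm.T2 y (U w) - ?\<tau>\<bar>)"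
  proof (rule expectation_U)
    show "(\<lambda>A. \<bar>hm.T2 y A - ?\<tau>\<bar>) \<in> borel_measurable (distr M (restrict_space (matrix_borel n) G) U)"
      by (intro borel_measurable_abs borel_measurable_diff T2m borel_measurable_const)
  qed
  ultimately show "expectation (\<lambda>w. \<bar>(\<Sum>i<n. (conj_diag n y (U w) i)\<^sup>2) - 2 * (\<Sum>j<n. (y j)\<^sup>2) / (card Z * n + 2)\<bar>) \<le> 40961 / sqrt n"
    unfolding D by (simp add: add.commute)
  have "integrable M (\<lambda>w. hm.T2 y (U w))" using i1 T2m U_G by (subst integrable_distr_eq[symmetric]) auto
  then show "integrable M (\<lambda>w. \<Sum>i<n. (conj_diag n y (U w) i)\<^sup>2)" unfolding D .
qed

lemma conj_diag_add: "conj_diag n (\<lambda>j. y j + y' j) u i = conj_diag n y u i + conj_diag n y' u i"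
  and conj_diag_diff: "conj_diag n (\<lambda>j. y j - y' j) u i = conj_diag n y u i - conj_diag n y' u i"
  unfolding conj_diag_def by (simp_all add: distrib_left right_diff_distrib sum.distrib sum_subtractf)

text \<open>
  Polarisation of \<open>T2_deviation\<close>.
\<close>

lemma haar_product_fixed:
  assumes t: "t \<in> {0..1}" and t': "t' \<in> {0..1}"
  shows "expectation (\<lambda>w. \<bar>(\<Sum>i<n. row_deviation n (U w) c i t * row_deviation n (U w) c i t') - 2 * (\<Sum>j<n. dev t c j * dev t' c j) / (card Z * n + 2)\<bar>) \<le> 40961 / sqrt n"
proof -
  let ?p = "\<lambda>j. dev t c j + dev t' c j" and ?m = "\<lambda>j. dev t c j - dev t' c j"
  have p: "(\<Sum>j<n. ?p j) = 0" "\<And>j. j < n \<Longrightarrow> \<bar>?p j\<bar> \<le> 4" and m: "(\<Sum>j<n. ?m j) = 0" "\<And>j. j < n \<Longrightarrow> \<bar>?m j\<bar> \<le> 4"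
    using abs_dev_le[OF t, of c] abs_dev_le[OF t', of c] by (simp_all add: sum.distrib sum_subtractf sum_dev) (smt (verit))+
  let ?P = "\<lambda>w. (\<Sum>i<n. (conj_diag n ?p (U w) i)\<^sup>2) - 2 * (\<Sum>j<n. (?p j)\<^sup>2) / (card Z * n + 2)"
  let ?Q = "\<lambda>w. (\<Sum>i<n. (conj_diag n ?m (U w) i)\<^sup>2) - 2 * (\<Sum>j<n. (?m j)\<^sup>2) / (card Z * n + 2)"
  have pol: "4 * (a * b) = (a + b)\<^sup>2 - (a - b)\<^sup>2" for a b :: real by (simp add: power2_eq_square algebra_simps)
  have id: "4 * ((\<Sum>i<n. row_deviation n (U w) c i t * row_deviation n (U w) c i t') - 2 * (\<Sum>j<n. dev t c j * dev t' c j) / (card Z * n + 2)) = ?P w - ?Q w" for w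
  proof -
    have 1: "4 * (\<Sum>i<n. row_deviation n (U w) c i t * row_deviation n (U w) c i t') = (\<Sum>i<n. (conj_diag n ?p (U w) i)\<^sup>2) - (\<Sum>i<n. (conj_diag n ?m (U w) i)\<^sup>2)"
      unfolding conj_diag_add conj_diag_diff row_deviation_dev sum_subtractf[symmetric] sum_distrib_left pol ..
    have 2: "4 * (\<Sum>j<n. dev t c j * dev t' c j) = (\<Sum>j<n. (?p j)\<^sup>2) - (\<Sum>j<n. (?m j)\<^sup>2)"
      unfolding sum_subtractf[symmetric] sum_distrib_left pol ..
    have "4 * (2 * (\<Sum>j<n. dev t c j * dev t' c j) / (card Z * n + 2)) = 2 * (4 * (\<Sum>j<n. dev t c j * dev t' c j)) / (card Z * n + 2)" by simp
    then show ?thesis unfolding right_diff_distrib[of 4] 1 2 by (simp add: right_diff_distrib diff_divide_distrib)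
  qed
  have "expectation (\<lambda>w. \<bar>(\<Sum>i<n. row_deviation n (U w) c i t * row_deviation n (U w) c i t') - 2 * (\<Sum>j<n. dev t c j * dev t' c j) / (card Z * n + 2)\<bar>)
     \<le> expectation (\<lambda>w. (\<bar>?P w\<bar> + \<bar>?Q w\<bar>) / 2)"
  proof (rule integral_mono')
    show "integrable M (\<lambda>w. (\<bar>?P w\<bar> + \<bar>?Q w\<bar>) / 2)"
      using T2_deviation(2)[OF p] T2_deviation(2)[OF m] by auto
    show "\<bar>(\<Sum>i<n. row_deviation n (U w) c i t * row_deviation n (U w) c i t') - 2 * (\<Sum>j<n. dev t c j * dev t' c j) / (card Z * n + 2)\<bar> \<le> (\<bar>?P w\<bar> + \<bar>?Q w\<bar>) / 2" for w
    proof -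
      have "\<bar>x\<bar> \<le> (\<bar>p\<bar> + \<bar>q\<bar>) / 2" if "4 * x = p - q" for x p q :: real
        using that abs_triangle_ineq4[of p q] abs_mult[of 4 x] by simp
      from this[OF id] show ?thesis .
    qed
  qed auto
  also have "\<dots> = (expectation (\<lambda>w. \<bar>?P w\<bar>) + expectation (\<lambda>w. \<bar>?Q w\<bar>)) / 2"
    using T2_deviation(2)[OF p] T2_deviation(2)[OF m] by simp
  also have "\<dots> \<le> (40961 / sqrt n + 40961 / sqrt n) / 2"
    by (intro divide_right_mono add_mono T2_deviation p m) auto
  finally show ?thesis by simp
qed

theorem haar_product:
  assumes t: "t \<in> {0..1}" and t': "t' \<in> {0..1}"
  shows "expectation (\<lambda>w. \<bar>(\<Sum>i<n. rd i t w * rd i t' w) - 2 / card Z * bridge_cov t t'\<bar>) \<le> 40971 / sqrt n + 6 / n"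
proof -
  define b where "b = real (card Z)"
  have b1: "1 \<le> b" using hm.b1[of "\<lambda>_. 0" 0] hm.b_def[of "\<lambda>_. 0" 0] by (simp add: b_def)
  have n0: "0 < n" using n8 by simp
  let ?cv = "\<lambda>c. \<Sum>j<n. dev t c j * dev t' c j"
  let ?G = "\<lambda>c u. \<bar>(\<Sum>i<n. row_deviation n u c i t * row_deviation n u c i t') - 2 * ?cv c / (b * n + 2)\<bar>"
  have cvb: "\<bar>?cv c\<bar> \<le> 4 * n" for c
  proof -
    have "\<bar>?cv c\<bar> \<le> (\<Sum>j<n. 2 * 2)"
      by (rule order_trans[OF sum_abs], rule sum_mono, unfold abs_mult, rule mult_mono[OF abs_dev_le[OF t] abs_dev_le[OF t']]) auto
    then show ?thesis by simp
  qed
  have cvm: "?cv \<in> borel_measurable PB"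
    unfolding dev_def by (intro borel_measurable_sum borel_measurable_times borel_measurable_diff sample_mean_measurable measurable_compose[OF _ centred_step_measurable] measurable_component_singleton) auto
  have Gm: "(\<lambda>x. ?G (fst x) (snd x)) \<in> borel_measurable (PB \<Otimes>\<^sub>M UB)"
    by (intro borel_measurable_abs borel_measurable_diff borel_measurable_sum borel_measurable_times borel_measurable_divide borel_measurable_const row_deviation_measurable
        measurable_compose[OF measurable_fst cvm]) auto
  have "expectation (\<lambda>w. ?G (Cv w) (U w)) \<le> 40961 / sqrt n"
  proof (rule expectation_C_U_le[where B="4 * n + 8 * n"])
    show "case_prod ?G \<in> borel_measurable (PB \<Otimes>\<^sub>M UB)" using Gm by (simp add: split_beta')
    show "\<bar>?G c u\<bar> \<le> 4 * n + 8 * n" if "u \<in> unitary_group n" for c u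
    proof -
      have "\<bar>\<Sum>i<n. row_deviation n u c i t * row_deviation n u c i t'\<bar> \<le> (\<Sum>i<n. 2 * 2)"
        by (rule order_trans[OF sum_abs], rule sum_mono, unfold abs_mult, rule mult_mono) (use abs_row_deviation_le[OF that _ t] abs_row_deviation_le[OF that _ t'] in auto)
      moreover have "\<bar>2 * ?cv c / (b * n + 2)\<bar> \<le> 8 * n"
      proof -
        have "1 \<le> b * n + 2" using b1 by (simp add: add_increasing)
        then have "\<bar>2 * ?cv c\<bar> / (b * n + 2) \<le> \<bar>2 * ?cv c\<bar> / 1" by (intro divide_left_mono) auto
        moreover have "\<bar>2 * ?cv c / (b * n + 2)\<bar> = \<bar>2 * ?cv c\<bar> / (b * n + 2)" using \<open>1 \<le> b * n + 2\<close> unfolding abs_divide by simp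
        moreover have "\<bar>2 * ?cv c\<bar> / 1 \<le> 8 * n" using cvb[of c] by (simp add: abs_mult)
        ultimately show ?thesis by linarith
      qed
      ultimately show ?thesis unfolding abs_abs by (intro order_trans[OF abs_triangle_ineq4] add_mono) auto
    qed
    show "expectation (\<lambda>w. ?G c (U w)) \<le> 40961 / sqrt n" for c
      using haar_product_fixed[OF t t', of c] unfolding b_def by (simp add: add.commute)
  qed simp
  then have 1: "expectation (\<lambda>w. ?G (\<lambda>j. C j w) (U w)) \<le> 40961 / sqrt n"
  proof -
    have "?cv (Cv w) = ?cv (\<lambda>j. C j w)" for w unfolding dev_def Cv_eq by (simp add: Cv_def)
    then show ?thesis using \<open>expectation (\<lambda>w. ?G (Cv w) (U w)) \<le> 40961 / sqrt n\<close> unfolding Cv_eq by simp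
  qed
  define H where "H w = \<bar>?cv (\<lambda>j. C j w) / n - bridge_cov t t'\<bar>" for w
  have 2: "expectation H \<le> 5 / sqrt n + 1 / n"
    using covariance_estimate[OF n0 t t'] unfolding dev_def H_def .
  have cvC: "(\<lambda>w. ?cv (\<lambda>j. C j w)) \<in> borel_measurable M"
  proof -
    have "(\<lambda>w. ?cv (Cv w)) \<in> borel_measurable M" by (rule measurable_compose[OF Cv_measurable cvm])
    moreover have "?cv (Cv w) = ?cv (\<lambda>j. C j w)" for w unfolding dev_def Cv_eq by (simp add: Cv_def)
    ultimately show ?thesis by simp
  qed
  have cvi: "integrable M (\<lambda>w. ?cv (\<lambda>j. C j w))"
    using cvC cvb by (intro integrable_of_bounded[of _ "4 * real n"]) (simp_all only: real_norm_def of_nat_mult of_nat_numeral)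
  have Gi: "integrable M (\<lambda>w. ?G (\<lambda>j. C j w) (U w))"
    using int_rd_product[OF t t'] cvi by (intro Bochner_Integration.integrable_abs Bochner_Integration.integrable_diff integrable_divide integrable_mult_right)
  have Hi: "integrable M H" unfolding H_def[abs_def] using cvi by (intro Bochner_Integration.integrable_abs Bochner_Integration.integrable_diff integrable_divide integrable_const)
  have pw: "\<bar>(\<Sum>i<n. rd i t w * rd i t' w) - 2 / card Z * bridge_cov t t'\<bar> \<le> ?G (\<lambda>j. C j w) (U w) + (2 * H w + 4 / n)" for w
  proof -
    have bn: "0 < b * n + 2" "0 < b" using b1 by (auto intro: add_nonneg_pos)
    have n1: "0 < real n" using n0 by simp
    define x where "x = ?cv (\<lambda>j. C j w) / n"
    define k where "k = bridge_cov t t'"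
    have "2 * ?cv (\<lambda>j. C j w) / (b * n + 2) - 2 / b * k = (2 * n / (b * n + 2)) * (x - k) - (4 / (b * (b * n + 2))) * k"
    proof -
      have "2 * ?cv (\<lambda>j. C j w) / (b * n + 2) = (2 * n / (b * n + 2)) * x" using n1 unfolding x_def by (simp add: mult.assoc)
      moreover have "2 / b = 2 * n / (b * n + 2) + 4 / (b * (b * n + 2))" using bn by (simp add: divide_simps)
      ultimately show ?thesis unfolding right_diff_distrib by (simp only: distrib_right)
    qed
    then have "\<bar>2 * ?cv (\<lambda>j. C j w) / (b * n + 2) - 2 / b * k\<bar> \<le> \<bar>(2 * n / (b * n + 2)) * (x - k)\<bar> + \<bar>(4 / (b * (b * n + 2))) * k\<bar>"
      by (simp only: abs_triangle_ineq4)
    also have "\<dots> \<le> 2 * \<bar>x - k\<bar> + 4 / n * 1"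
    proof (intro add_mono)
      have nb: "real n \<le> b * n" using mult_right_mono[OF b1, of "real n"] by simp
      then have "2 * n / (b * n + 2) \<le> 2" using bn by (simp add: divide_le_eq)
      then show "\<bar>(2 * n / (b * n + 2)) * (x - k)\<bar> \<le> 2 * \<bar>x - k\<bar>"
        unfolding abs_mult using bn by (intro mult_right_mono) auto
      have "1 * real n \<le> b * (b * n + 2)" using b1 nb by (intro mult_mono) auto
      then have "4 / (b * (b * n + 2)) \<le> 4 / n" using n1 by (intro divide_left_mono) auto
      then show "\<bar>(4 / (b * (b * n + 2))) * k\<bar> \<le> 4 / n * 1"
        unfolding abs_mult k_def using bn bridge_cov_abs_le[OF t t'] by (intro mult_mono) auto
    qed
    finally show ?thesis unfolding H_def x_def k_def b_def by linarith
  qed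
  have "expectation (\<lambda>w. \<bar>(\<Sum>i<n. rd i t w * rd i t' w) - 2 / card Z * bridge_cov t t'\<bar>) \<le> expectation (\<lambda>w. ?G (\<lambda>j. C j w) (U w) + (2 * H w + 4 / n))"
  proof (rule integral_mono')
    show "integrable M (\<lambda>w. ?G (\<lambda>j. C j w) (U w) + (2 * H w + 4 / n))"
      using Gi Hi by (intro Bochner_Integration.integrable_add integrable_mult_right integrable_const)
    show "0 \<le> ?G (\<lambda>j. C j w) (U w) + (2 * H w + 4 / n)" for w by (rule order_trans[OF abs_ge_zero pw])
  qed (rule pw)
  also have "\<dots> = expectation (\<lambda>w. ?G (\<lambda>j. C j w) (U w)) + (2 * expectation H + 4 / n)"
  proof -
    have "expectation (\<lambda>w. 2 * H w + 4 / n) = 2 * expectation H + 4 / n" using Hi by (simp add: prob_space)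
    then show ?thesis using Bochner_Integration.integral_add[OF Gi, of "\<lambda>w. 2 * H w + 4 / n"] Hi by simp
  qed
  also have "\<dots> \<le> 40961 / sqrt n + (2 * (5 / sqrt n + 1 / n) + 4 / n)"
    using 1 2 by (intro add_mono mult_left_mono) auto
  finally show ?thesis by simp
qed

lemma haar_ra2_square:
  assumes t: "t \<in> {0..1}"
  shows "expectation (\<lambda>w. (\<Sum>i<n. (ra i t w)\<^sup>2)\<^sup>2) \<le> 776"
proof -
  have n0: "0 < n" using n8 by simp
  have av: "(u + v)\<^sup>2 \<le> 2 * (u\<^sup>2 + v\<^sup>2)" for u v :: real
    using zero_le_power2[of "u - v"] by (simp add: power2_eq_square algebra_simps)
  have i1: "integrable M (\<lambda>w. (\<Sum>i<n. (rd i t w)\<^sup>2)\<^sup>2)"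
  proof (rule integrable_of_bounded[of _ "(\<Sum>i<n. 2\<^sup>2)\<^sup>2"])
    show "norm ((\<Sum>i<n. (rd i t w)\<^sup>2)\<^sup>2) \<le> (\<Sum>i<n. 2\<^sup>2)\<^sup>2" if "w \<in> space M" for w
    proof -
      have "(rd i t w)\<^sup>2 \<le> 2\<^sup>2" if "i < n" for i
        using power_mono[OF abs_row_deviation_le[OF U_unitary[OF \<open>w \<in> space M\<close>] that t] abs_ge_zero, of _ 2] by simp
      then have "(\<Sum>i<n. (rd i t w)\<^sup>2) \<le> (\<Sum>i<n. 2\<^sup>2)" by (intro sum_mono) auto
      then show ?thesis unfolding real_norm_def abs_power2 by (intro power_mono sum_nonneg) auto
    qed
  qed measurable
  have i2: "integrable M (\<lambda>w. C.empirical t w ^ 4)"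
    using power_mono[OF C.abs_empirical_le[OF t] abs_ge_zero, of _ 4] by (intro integrable_of_bounded[of _ "(sqrt n) ^ 4"]) auto
  have "expectation (\<lambda>w. (\<Sum>i<n. (ra i t w)\<^sup>2)\<^sup>2) \<le> expectation (\<lambda>w. 2 * ((\<Sum>i<n. (rd i t w)\<^sup>2)\<^sup>2 + C.empirical t w ^ 4))"
  proof (rule integral_mono')
    show "integrable M (\<lambda>w. 2 * ((\<Sum>i<n. (rd i t w)\<^sup>2)\<^sup>2 + C.empirical t w ^ 4))" using i1 i2 by simp
    show "(\<Sum>i<n. (ra i t w)\<^sup>2)\<^sup>2 \<le> 2 * ((\<Sum>i<n. (rd i t w)\<^sup>2)\<^sup>2 + C.empirical t w ^ 4)" if "w \<in> space M" for w
      using av[of "\<Sum>i<n. (rd i t w)\<^sup>2" "(C.empirical t w)\<^sup>2"] ra_product_sum[OF n0 that, of t t] by (simp add: power2_eq_square power4_eq_xxxx mult.assoc)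
  qed auto
  also have "\<dots> = 2 * (expectation (\<lambda>w. (\<Sum>i<n. (rd i t w)\<^sup>2)\<^sup>2) + expectation (\<lambda>w. C.empirical t w ^ 4))"
    using i1 i2 by simp
  also have "\<dots> \<le> 2 * (384 + 4)" using haar_rd2_square[OF t] C.empirical_moments(2)[OF t] by simp
  finally show ?thesis by simp
qed

end

section \<open>Finite-dimensional limits\<close>

lemma real_over_sqrt_tendsto: "(\<lambda>n. a / sqrt (real n) + b / real n) \<longlonglongrightarrow> 0"
  by real_asymp

lemma fdd_convergesI:
  fixes M :: "nat \<Rightarrow> 'a measure"
  assumes S: "\<And>n. sample_model n (M n) (U n) (R n) (C n)"
    and Ym: "\<And>p. p \<in> unit_square \<Longrightarrow> (\<lambda>w. Y w p) \<in> borel_measurable N"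
    and lim: "\<And>J f. finite J \<Longrightarrow> J \<subseteq> unit_square \<Longrightarrow> continuous_map (product_topology (\<lambda>_. euclideanreal) J) euclideanreal f \<Longrightarrow>
       bounded (f ` topspace (product_topology (\<lambda>_. euclideanreal) J)) \<Longrightarrow>
       (\<lambda>n. \<integral>w. f (restrict (Z_process n (U n) (R n) (C n) w) J) \<partial>M n) \<longlonglongrightarrow> (\<integral>w. f (restrict (Y w) J) \<partial>N)"
  shows "fdd_converges unit_square M (\<lambda>n. Z_process n (U n) (R n) (C n)) N Y"
  unfolding fdd_converges_def converges_in_distribution_def
proof (intro allI impI conjI)
  fix J :: "(real \<times> real) set" assume J: "finite J \<and> J \<subseteq> unit_square"
  interpret sm: sample_model n "M n" "U n" "R n" "C n" for n by (rule S)
  show "(\<lambda>w. restrict (Z_process n (U n) (R n) (C n) w) J) \<in> M n \<rightarrow>\<^sub>M borel_of (product_topology (\<lambda>_. euclideanreal) J)" for n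
    using J sm.Z_eval_measurable[of _ n] by (intro measurable_borel_of_product) auto
  show "(\<lambda>w. restrict (Y w) J) \<in> N \<rightarrow>\<^sub>M borel_of (product_topology (\<lambda>_. euclideanreal) J)"
    using J Ym by (intro measurable_borel_of_product) auto
qed (use lim in auto)

text \<open>
  For Haar matrices the row deviations form an asymptotically negligible array whose quadratic
  variation converges to a multiple of the bridge covariance; the multiple is the \<open>1 / \<beta>'\<close> of
  the limit.
\<close>

theorem haar_fdd:
  fixes M :: "nat \<Rightarrow> 'a measure" and N :: "'b measure"
  assumes S: "\<And>n. sample_model n (M n) (U n) (R n) (C n)"
    and H: "\<And>n. 8 \<le> n \<Longrightarrow> haar_sample n (M n) (U n) (R n) (C n) (G n) Z"
    and BB: "brownian_bridge N B" "brownian_bridge N B'" "indep_processes N {0..1} B B'"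
    and W: "tied_down_bridge N W" and ind: "indep_processes N unit_square (tensor_process B B') W"
  shows "fdd_converges unit_square M (\<lambda>n. Z_process n (U n) (R n) (C n)) N
     (\<lambda>w p. sqrt (2 / card Z) * W p w + tensor_process B B' p w)"
proof -
  interpret sm: sample_model n "M n" "U n" "R n" "C n" for n by (rule S)
  interpret W: gaussian_family N unit_square W "\<lambda>p q. bridge_cov (fst p) (fst q) * bridge_cov (snd p) (snd q)"
    by (rule tied_family[OF W])
  let ?\<gamma> = "2 / real (card Z)"
  let ?rd = "\<lambda>n i t w. row_deviation n (U n w) (\<lambda>j. C n j w) i t"
  have H1: "(\<lambda>n. \<integral>w. (\<Sum>i<n. ?rd n i t w ^ 4) \<partial>M n) \<longlonglongrightarrow> 0" if t: "t \<in> {0..1}" for t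
  proof (rule tendsto_sandwich[OF _ _ tendsto_const real_over_sqrt_tendsto[of 0 640]])
    show "\<forall>\<^sub>F n in sequentially. 0 \<le> (\<integral>w. (\<Sum>i<n. ?rd n i t w ^ 4) \<partial>M n)"
      by (intro always_eventually allI Bochner_Integration.integral_nonneg sum_nonneg) auto
    show "\<forall>\<^sub>F n in sequentially. (\<integral>w. (\<Sum>i<n. ?rd n i t w ^ 4) \<partial>M n) \<le> 0 / sqrt (real n) + 640 / real n"
      using eventually_ge_at_top[of 8] by eventually_elim (use haar_sample.haar_rd4[OF H t] in simp)
  qed
  have H2: "(\<lambda>n. \<integral>w. \<bar>(\<Sum>i<n. ?rd n i t w * ?rd n i t' w) - ?\<gamma> * bridge_cov t t'\<bar> \<partial>M n) \<longlonglongrightarrow> 0"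
    if t: "t \<in> {0..1}" "t' \<in> {0..1}" for t t'
  proof (rule tendsto_sandwich[OF _ _ tendsto_const real_over_sqrt_tendsto[of 40971 6]])
    show "\<forall>\<^sub>F n in sequentially. 0 \<le> (\<integral>w. \<bar>(\<Sum>i<n. ?rd n i t w * ?rd n i t' w) - ?\<gamma> * bridge_cov t t'\<bar> \<partial>M n)"
      by (intro always_eventually allI Bochner_Integration.integral_nonneg) auto
    show "\<forall>\<^sub>F n in sequentially. (\<integral>w. \<bar>(\<Sum>i<n. ?rd n i t w * ?rd n i t' w) - ?\<gamma> * bridge_cov t t'\<bar> \<partial>M n) \<le> 40971 / sqrt (real n) + 6 / real n"
      using eventually_ge_at_top[of 8] by eventually_elim (rule haar_sample.haar_product[OF H t])
  qed
  have Ym: "(\<lambda>w. sqrt ?\<gamma> * W p w + tensor_process B B' p w) \<in> borel_measurable N" if "p \<in> unit_square" for p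
    using W.X_measurable[OF that] tensor_measurable[OF BB(1,2) that] by measurable
  show ?thesis
  proof (rule fdd_convergesI[OF S Ym])
    fix J :: "(real \<times> real) set" and f
    assume J: "finite J" "J \<subseteq> unit_square"
      and f: "continuous_map (product_topology (\<lambda>_. euclideanreal) J) euclideanreal f"
        "bounded (f ` topspace (product_topology (\<lambda>_. euclideanreal) J))"
    show "(\<lambda>n. \<integral>w. f (restrict (Z_process n (U n) (R n) (C n) w) J) \<partial>M n) \<longlonglongrightarrow>
       (\<integral>w. f (restrict (\<lambda>p. sqrt ?\<gamma> * W p w + tensor_process B B' p w) J) \<partial>N)"
    proof (rule fdd_limit[OF S H1 H2 BB(2) J _ _ tensor_plus_tied_char[OF BB W ind J] _ f])
      fix p assume p: "p \<in> J"
      then have p': "p \<in> unit_square" using J by auto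
      show "(\<lambda>w. sqrt ?\<gamma> * W p w + tensor_process B B' p w) \<in> borel_measurable N" by (rule Ym[OF p'])
      show "integrable N (\<lambda>w. (sqrt ?\<gamma> * W p w + tensor_process B B' p w)\<^sup>2)"
      proof (rule Bochner_Integration.integrable_bound)
        show "integrable N (\<lambda>w. 2 * ?\<gamma> * (W p w)\<^sup>2 + 2 * (tensor_process B B' p w)\<^sup>2)"
          using W.X2_integrable[OF p'] tensor_square_integrable[OF BB p'] by simp
        show "(\<lambda>w. (sqrt ?\<gamma> * W p w + tensor_process B B' p w)\<^sup>2) \<in> borel_measurable N"
          by (intro borel_measurable_power Ym p')
        have "(x + y)\<^sup>2 \<le> 2 * x\<^sup>2 + 2 * y\<^sup>2" for x y :: real
          using zero_le_power2[of "x - y"] by (simp add: power2_eq_square algebra_simps)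
        from this[of "sqrt ?\<gamma> * W p _" "tensor_process B B' p _"]
        show "AE w in N. norm ((sqrt ?\<gamma> * W p w + tensor_process B B' p w)\<^sup>2) \<le> norm (2 * ?\<gamma> * (W p w)\<^sup>2 + 2 * (tensor_process B B' p w)\<^sup>2)"
          by (intro AE_I2) (simp add: power_mult_distrib mult.assoc)
      qed
    next
      fix c :: "real \<times> real \<Rightarrow> real"
      have "0 \<le> (\<Sum>p\<in>J. \<Sum>q\<in>J. c p * c q * (bridge_cov (fst p) (fst q) * bridge_cov (snd p) (snd q)))"
        using W.linear_combination(2)[OF J(1), of "\<lambda>p. p" c] J(2) by auto
      then show "0 \<le> ?\<gamma> * (\<Sum>p\<in>J. \<Sum>q\<in>J. c p * c q * bridge_cov (fst p) (fst q) * bridge_cov (snd p) (snd q))"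
        by (simp add: mult.assoc)
    qed auto
  qed
qed

lemma haar_sample_unitary:
  assumes m: "model n M U R C" and h: "haar_distributed n (unitary_group n) M U" and n: "8 \<le> n"
  shows "haar_sample n M U R C (unitary_group n) {1, \<i>}"
proof -
  interpret sample_model n M U R C by unfold_locales (rule m)
  show ?thesis
  proof (intro haar_sample.intro haar_sample_axioms.intro)
    show "sample_model n M U R C" by unfold_locales
    show "U \<in> M \<rightarrow>\<^sub>M restrict_space (matrix_borel n) (unitary_group n)" using h by (simp add: haar_distributed_def)
    show "haar_moments (distr M (restrict_space (matrix_borel n) (unitary_group n)) U) n (unitary_group n) {1, \<i>}"
      using h by (intro haar_moments_unitary) (simp add: haar_distributed_def)
  qed (rule n)
qed

lemma haar_sample_orthogonal:
  assumes m: "model n M U R C" and h: "haar_distributed n (orthogonal_group n) M U" and n: "8 \<le> n"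
  shows "haar_sample n M U R C (orthogonal_group n) {1}"
proof -
  interpret sample_model n M U R C by unfold_locales (rule m)
  show ?thesis
  proof (intro haar_sample.intro haar_sample_axioms.intro)
    show "sample_model n M U R C" by unfold_locales
    show "U \<in> M \<rightarrow>\<^sub>M restrict_space (matrix_borel n) (orthogonal_group n)" using h by (simp add: haar_distributed_def)
    show "haar_moments (distr M (restrict_space (matrix_borel n) (orthogonal_group n)) U) n (orthogonal_group n) {1}"
      using h by (intro haar_moments_orthogonal) (simp add: haar_distributed_def)
  qed (rule n)
qed

lemma dft_matrix_flat:
  assumes "i < n" "j < n"
  shows "(cmod (dft_matrix n $$ (i, j)))\<^sup>2 = 1 / real n"
proof -
  have "Re (- 2 * \<i> * complex_of_real pi * of_nat i * of_nat j / of_nat n) = 0"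
    by (simp add: Re_divide_of_nat)
  then show ?thesis using assms by (simp add: dft_matrix_def norm_divide power_divide)
qed

lemma flat_row_average:
  assumes "\<And>j. j < n \<Longrightarrow> (cmod (u $$ (i, j)))\<^sup>2 = 1 / real n"
  shows "row_average n u c i t = sample_mean n c t"
  unfolding row_average_def sample_mean_def sum_divide_distrib using assms by (intro sum.cong) auto

text \<open>A matrix with entries of constant modulus averages each row evenly: no deviation is left.\<close>

theorem flat_limit:
  fixes M :: "nat \<Rightarrow> 'a measure" and N :: "'b measure" and f :: "(real \<times> real \<Rightarrow> real) \<Rightarrow> real"
  assumes S: "\<And>n. sample_model n (M n) (U n) (R n) (C n)"
    and flat: "\<And>n. AE w in M n. \<forall>i<n. \<forall>j<n. (cmod (U n w $$ (i, j)))\<^sup>2 = 1 / real n"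
    and BB: "brownian_bridge N B" "brownian_bridge N B'" "indep_processes N {0..1} B B'"
    and J: "finite J" "J \<subseteq> unit_square"
    and f: "continuous_map (product_topology (\<lambda>_. euclideanreal) J) euclideanreal f"
      "bounded (f ` topspace (product_topology (\<lambda>_. euclideanreal) J))"
  shows "(\<lambda>n. \<integral>w. f (restrict (Z_process n (U n) (R n) (C n) w) J) \<partial>M n) \<longlonglongrightarrow>
     (\<integral>w. f (restrict (\<lambda>p. tensor_process B B' p w) J) \<partial>N)"
proof (rule fdd_limit[where \<gamma>=0, OF S _ _ BB(2) J _ _ _ _ f])
  interpret sm: sample_model n "M n" "U n" "R n" "C n" for n by (rule S)
  let ?rd = "\<lambda>n i t w. row_deviation n (U n w) (\<lambda>j. C n j w) i t"
  have z: "AE w in M n. \<forall>i<n. \<forall>t. ?rd n i t w = 0" for n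
    using flat[of n] AE_space
  proof eventually_elim
    case (elim w)
    show ?case
    proof (intro allI impI)
      fix i t assume i: "i < n"
      show "?rd n i t w = 0"
        using row_average_split[OF sm.U_unitary[OF elim(2)] i, of "\<lambda>j. C n j w" t]
          flat_row_average[of n "U n w" i "\<lambda>j. C n j w" t] elim(1) i by simp
    qed
  qed
  show "(\<lambda>n. \<integral>w. (\<Sum>i<n. ?rd n i t w ^ 4) \<partial>M n) \<longlonglongrightarrow> 0" for t
  proof -
    have "(\<integral>w. (\<Sum>i<n. ?rd n i t w ^ 4) \<partial>M n) = 0" for n
      by (rule integral_eq_zero_AE) (use z[of n] in eventually_elim, auto)
    then show ?thesis by simp
  qed
  show "(\<lambda>n. \<integral>w. \<bar>(\<Sum>i<n. ?rd n i t w * ?rd n i t' w) - 0 * bridge_cov t t'\<bar> \<partial>M n) \<longlonglongrightarrow> 0" for t t'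
  proof -
    have "(\<integral>w. \<bar>(\<Sum>i<n. ?rd n i t w * ?rd n i t' w) - 0 * bridge_cov t t'\<bar> \<partial>M n) = 0" for n
      by (rule integral_eq_zero_AE) (use z[of n] in eventually_elim, auto)
    then show ?thesis by simp
  qed
  show "tensor_process B B' p \<in> borel_measurable N" if "p \<in> J" for p
    using that J by (intro tensor_measurable BB) auto
  show "integrable N (\<lambda>w. (tensor_process B B' p w)\<^sup>2)" if "p \<in> J" for p
    using that J by (intro tensor_square_integrable BB) auto
qed (simp_all only: tensor_char[OF BB J] mult_zero_left add_0 order_refl)

section \<open>The modulus of continuity of the empirical process\<close>

text \<open>
  Between consecutive levels the dyadic approximation of a point moves by at most one increment.
\<close>

lemma dyadic_chaining:
  fixes f :: "real \<Rightarrow> real" and D :: "nat \<Rightarrow> real" and s :: real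
  assumes D: "\<And>j i. i < 2 ^ j \<Longrightarrow> \<bar>f (real (Suc i) / 2 ^ j) - f (real i / 2 ^ j)\<bar> \<le> D j"
    and D0: "\<And>j. 0 \<le> D j" and s: "0 \<le> s" "s < 1" and km: "k \<le> m"
  shows "\<bar>f (real (nat \<lfloor>2 ^ m * s\<rfloor>) / 2 ^ m) - f (real (nat \<lfloor>2 ^ k * s\<rfloor>) / 2 ^ k)\<bar> \<le> (\<Sum>j\<in>{k<..m}. D j)"
  using km
proof (induction m rule: dec_induct)
  case base
  then show ?case by simp
next
  case (step m)
  define a where "a = nat \<lfloor>2 ^ m * s\<rfloor>"
  define b where "b = nat \<lfloor>2 ^ Suc m * s\<rfloor>"
  have "2 * \<lfloor>x\<rfloor> \<le> \<lfloor>2 * x\<rfloor>" "\<lfloor>2 * x\<rfloor> \<le> 2 * \<lfloor>x\<rfloor> + 1" for x :: real by linarith+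
  from this[of "2 ^ m * s"] have "\<lfloor>2 * (2 ^ m * s)\<rfloor> = 2 * \<lfloor>2 ^ m * s\<rfloor> \<or> \<lfloor>2 * (2 ^ m * s)\<rfloor> = 2 * \<lfloor>2 ^ m * s\<rfloor> + 1" by arith
  moreover have "0 \<le> \<lfloor>2 ^ m * s\<rfloor>" using s by simp
  ultimately have b: "b = 2 * a \<or> b = Suc (2 * a)" unfolding a_def b_def by (auto simp: mult.assoc nat_mult_distrib nat_add_distrib)
  have "2 ^ m * s < 2 ^ m" using s by simp
  then have "\<lfloor>2 ^ m * s\<rfloor> < 2 ^ m" by (simp add: floor_less_iff)
  then have a: "a < 2 ^ m" unfolding a_def using \<open>0 \<le> \<lfloor>2 ^ m * s\<rfloor>\<close> by (simp add: nat_less_iff)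
  have a2: "real (2 * a) / 2 ^ Suc m = real a / 2 ^ m" by simp
  have "\<bar>f (real b / 2 ^ Suc m) - f (real a / 2 ^ m)\<bar> \<le> D (Suc m)"
    using b
  proof
    assume "b = 2 * a"
    then show ?thesis using D0 a2 by simp
  next
    assume "b = Suc (2 * a)"
    then show ?thesis using D[of "2 * a" "Suc m"] a unfolding a2 by simp
  qed
  moreover have "(\<Sum>j\<in>{k<..Suc m}. D j) = (\<Sum>j\<in>{k<..m}. D j) + D (Suc m)"
  proof -
    have "{k<..Suc m} = insert (Suc m) {k<..m}" using step by auto
    then show ?thesis by simp
  qed
  ultimately show ?case using step.IH unfolding a_def b_def by linarith
qed

text \<open>The dyadic increments at level \<open>j\<close> are of the order of the \<open>j\<close>-th power of this rate.\<close>

definition chaining_rate :: real where "chaining_rate = 2 powr (- 1 / 4)"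

lemma chaining_rate_pos: "0 < chaining_rate" by (simp add: chaining_rate_def)

lemma chaining_rate_power4: "chaining_rate ^ 4 = 1 / 2"
  by (simp add: chaining_rate_def powr_powr flip: powr_realpow)

lemma chaining_rate_le: "chaining_rate \<le> 6 / 7"
proof (rule ccontr)
  assume "\<not> ?thesis"
  then have "(6 / 7) ^ 4 < chaining_rate ^ 4" by (intro power_strict_mono) auto
  then show False unfolding chaining_rate_power4 by (simp add: power4_eq_xxxx)
qed

lemma chaining_rate_sum:
  assumes "k \<le> m" shows "(\<Sum>j\<in>{k..m}. chaining_rate ^ j) + 6 * chaining_rate ^ m \<le> 7 * chaining_rate ^ k"
  using assms
proof (induction m rule: dec_induct)
  case (step m)
  have "7 * chaining_rate ^ Suc m \<le> 6 * chaining_rate ^ m"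
    using mult_right_mono[OF chaining_rate_le, of "chaining_rate ^ m"] chaining_rate_pos by simp
  then show ?case using step by simp
qed simp

lemma abs_le_fourth_power:
  fixes x l :: real
  assumes "0 < l"
  shows "\<bar>x\<bar> \<le> l + x ^ 4 / l ^ 3"
proof (cases "\<bar>x\<bar> \<le> l")
  case True
  then show ?thesis using assms by (intro add_increasing2) auto
next
  case False
  then have "l ^ 3 * \<bar>x\<bar> \<le> \<bar>x\<bar> ^ 3 * \<bar>x\<bar>" using assms by (intro mult_right_mono power_mono) auto
  also have "\<bar>x\<bar> ^ 3 * \<bar>x\<bar> = x ^ 4" by (simp add: power3_eq_cube power4_eq_xxxx abs_mult flip: mult.assoc)
  finally have "\<bar>x\<bar> \<le> x ^ 4 / l ^ 3" using assms by (simp add: field_simps)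
  then show ?thesis using assms by linarith
qed

context uniform_sample
begin

text \<open>
  The distribution function is increasing, so the empirical process decreases only through its linear drift. This
  controls the scales below \<open>1 / n\<close>, where the moment bound is useless.
\<close>

lemma empirical_decrease:
  assumes st: "s \<le> t"
  shows "empirical s w - empirical t w \<le> sqrt n * (t - s)"
proof (cases "n = 0")
  case True then show ?thesis using st unfolding empirical_def by simp
next
  case False
  have "centred_step s r - centred_step t r \<le> t - s" for r
    using st by (auto simp: centred_step_def split: split_indicator)
  then have "(\<Sum>j<n. centred_step s (R j w) - centred_step t (R j w)) \<le> (\<Sum>j<n. t - s)" by (intro sum_mono)
  then have "((\<Sum>j<n. centred_step s (R j w)) - (\<Sum>j<n. centred_step t (R j w))) / sqrt n \<le> n * (t - s) / sqrt n"
    by (intro divide_right_mono) (simp_all add: sum_subtractf)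
  also have "n * (t - s) / sqrt n = sqrt n * (t - s)"
  proof -
    have "n * (t - s) / sqrt n = (n / sqrt n) * (t - s)" by simp
    then show ?thesis using real_div_sqrt[of n] by simp
  qed
  finally show ?thesis by (simp add: empirical_def diff_divide_distrib)
qed

text \<open>
  An integrable majorant of all increments at one level, from \<open>|x| \<le> l + x^4 / l^3\<close>; it replaces their maximum.
\<close>

definition dyadic_oscillation :: "nat \<Rightarrow> 'a \<Rightarrow> real" where
  "dyadic_oscillation j w = chaining_rate ^ j +
     (\<Sum>i<2 ^ j. (empirical (real (Suc i) / 2 ^ j) w - empirical (real i / 2 ^ j) w) ^ 4) / (chaining_rate ^ j) ^ 3"

lemma dyadic_oscillation_nonneg: "0 \<le> dyadic_oscillation j w"
  unfolding dyadic_oscillation_def using chaining_rate_pos by (intro add_nonneg_nonneg divide_nonneg_nonneg sum_nonneg) auto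

lemma dyadic_increment_le:
  assumes "i < 2 ^ j"
  shows "\<bar>empirical (real (Suc i) / 2 ^ j) w - empirical (real i / 2 ^ j) w\<bar> \<le> dyadic_oscillation j w"
proof -
  let ?x = "\<lambda>i. empirical (real (Suc i) / 2 ^ j) w - empirical (real i / 2 ^ j) w"
  have q: "0 < chaining_rate ^ j" using chaining_rate_pos by simp
  have "?x i ^ 4 \<le> (\<Sum>i<2 ^ j. ?x i ^ 4)" using assms by (intro member_le_sum) auto
  then have "?x i ^ 4 / (chaining_rate ^ j) ^ 3 \<le> (\<Sum>i<2 ^ j. ?x i ^ 4) / (chaining_rate ^ j) ^ 3"
    using q by (intro divide_right_mono) auto
  then show ?thesis using abs_le_fourth_power[OF q, of "?x i"] unfolding dyadic_oscillation_def by linarith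
qed

lemma dyadic_oscillation_expectation:
  assumes jn: "2 ^ j \<le> n"
  shows "integrable M (dyadic_oscillation j)" and "expectation (dyadic_oscillation j) \<le> 5 * chaining_rate ^ j"
proof -
  let ?x = "\<lambda>i w. empirical (real (Suc i) / 2 ^ j) w - empirical (real i / 2 ^ j) w"
  let ?q = "chaining_rate ^ j"
  have q: "0 < ?q" using chaining_rate_pos by simp
  have n2: "2 ^ j \<le> real n" using of_nat_mono[OF jn, where 'a=real] by simp
  have n: "0 < real n" by (rule less_le_trans[OF _ n2]) simp
  have grid: "real (Suc i) / 2 ^ j \<in> {0..1}" "real i / 2 ^ j \<in> {0..1}" if "i < 2 ^ j" for i
  proof -
    have "real (Suc i) \<le> real (2 ^ j)" using that by (intro of_nat_mono) simp
    then show "real (Suc i) / 2 ^ j \<in> {0..1}" "real i / 2 ^ j \<in> {0..1}" using that by (auto simp: divide_simps)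
  qed
  have int: "integrable M (\<lambda>w. ?x i w ^ 4)" if i: "i < 2 ^ j" for i
  proof (rule integrable_of_bounded[of _ "(2 * sqrt n) ^ 4"])
    show "norm (?x i w ^ 4) \<le> (2 * sqrt n) ^ 4" for w
      unfolding real_norm_def power_abs
    proof (rule power_mono)
      show "\<bar>?x i w\<bar> \<le> 2 * sqrt n"
        using abs_empirical_le[OF grid(1)[OF i], of w] abs_empirical_le[OF grid(2)[OF i], of w] by linarith
    qed simp
  qed measurable
  have e: "expectation (\<lambda>w. ?x i w ^ 4) \<le> 4 / (2 ^ j)\<^sup>2" if i: "i < 2 ^ j" for i
  proof -
    let ?S = "\<lambda>w. (\<Sum>l<n. centred_step (real (Suc i) / 2 ^ j) (R l w) - centred_step (real i / 2 ^ j) (R l w)) ^ 4"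
    have d: "real (Suc i) / 2 ^ j - real i / 2 ^ j = 1 / 2 ^ j" by (simp add: field_simps)
    have "?x i w ^ 4 = ?S w / (real n)\<^sup>2" for w
    proof -
      have "(sqrt (real n)) ^ 4 = (real n)\<^sup>2" by (simp add: power4_eq_xxxx power2_eq_square mult.assoc)
      then show ?thesis
        unfolding empirical_def diff_divide_distrib[symmetric] sum_subtractf[symmetric] power_divide by simp
    qed
    then have "expectation (\<lambda>w. ?x i w ^ 4) = expectation ?S / (real n)\<^sup>2" by simp
    also have "\<dots> \<le> (3 * (real n * (1 / 2 ^ j))\<^sup>2 + real n * (1 / 2 ^ j)) / (real n)\<^sup>2"
    proof (intro divide_right_mono)
      have "real i / 2 ^ j \<le> real (Suc i) / 2 ^ j" by (intro divide_right_mono) auto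
      from increment_fourth_moment[OF grid(2)[OF i] grid(1)[OF i] this]
      show "expectation ?S \<le> 3 * (real n * (1 / 2 ^ j))\<^sup>2 + real n * (1 / 2 ^ j)" unfolding d .
    qed simp
    also have "\<dots> = 3 / (2 ^ j)\<^sup>2 + (1 / 2 ^ j) / real n" using n by (simp add: add_divide_distrib power2_eq_square)
    also have "(1 / 2 ^ j) / real n \<le> (1 / 2 ^ j) / 2 ^ j" using n n2 by (intro divide_left_mono) auto
    finally show ?thesis by (simp add: power2_eq_square add_divide_distrib[symmetric])
  qed
  have int': "integrable M (\<lambda>w. (\<Sum>i<2 ^ j. ?x i w ^ 4) / ?q ^ 3)"
    by (intro integrable_divide Bochner_Integration.integrable_sum int) auto
  show "integrable M (dyadic_oscillation j)"
    unfolding dyadic_oscillation_def[abs_def] by (intro Bochner_Integration.integrable_add integrable_const int')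
  have "expectation (dyadic_oscillation j) = ?q + expectation (\<lambda>w. (\<Sum>i<2 ^ j. ?x i w ^ 4) / ?q ^ 3)"
    unfolding dyadic_oscillation_def[abs_def] using Bochner_Integration.integral_add[OF integrable_const int', of ?q] by (simp add: prob_space)
  also have "expectation (\<lambda>w. (\<Sum>i<2 ^ j. ?x i w ^ 4) / ?q ^ 3) = (\<Sum>i<2 ^ j. expectation (\<lambda>w. ?x i w ^ 4)) / ?q ^ 3"
  proof -
    have "expectation (\<lambda>w. \<Sum>i<2 ^ j. ?x i w ^ 4) = (\<Sum>i<2 ^ j. expectation (\<lambda>w. ?x i w ^ 4))"
      by (rule Bochner_Integration.integral_sum) (use int in auto)
    then show ?thesis by simp
  qed
  finally have E: "expectation (dyadic_oscillation j) = ?q + (\<Sum>i<2 ^ j. expectation (\<lambda>w. ?x i w ^ 4)) / ?q ^ 3" .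
  have "(\<Sum>i<2 ^ j. expectation (\<lambda>w. ?x i w ^ 4)) \<le> (\<Sum>i<(2::nat) ^ j. 4 / (2 ^ j)\<^sup>2)" by (intro sum_mono e) auto
  also have "\<dots> = 4 * (1 / 2) ^ j" by (simp add: power2_eq_square power_one_over)
  also have "(1 / 2 :: real) ^ j = ?q ^ 4" unfolding chaining_rate_power4[symmetric] by (simp add: mult.commute flip: power_mult)
  finally have "(\<Sum>i<2 ^ j. expectation (\<lambda>w. ?x i w ^ 4)) / ?q ^ 3 \<le> 4 * ?q ^ 4 / ?q ^ 3"
    using q by (intro divide_right_mono) auto
  also have "4 * ?q ^ 4 / ?q ^ 3 = 4 * ?q" using q by (simp add: power3_eq_cube power4_eq_xxxx)
  finally show "expectation (dyadic_oscillation j) \<le> 5 * ?q" unfolding E by linarith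
qed

text \<open>
  Chaining down to the level where the mesh is comparable with \<open>1 / n\<close>, then monotonicity.
\<close>

theorem empirical_modulus:
  assumes kn: "2 ^ k \<le> n"
  obtains W where "integrable M W" "expectation W \<le> 40 * chaining_rate ^ k + 2 / sqrt n"
    "\<And>w i s. i < 2 ^ k \<Longrightarrow> real i / 2 ^ k \<le> s \<Longrightarrow> s \<le> real (Suc i) / 2 ^ k \<Longrightarrow>
       \<bar>empirical s w - empirical (real i / 2 ^ k) w\<bar> \<le> W w"
proof -
  have n: "1 \<le> n" by (rule order_trans[OF _ kn]) simp
  obtain m where m: "2 ^ m \<le> n" "n < 2 ^ (m + 1)" using ex_power_ivl1[of 2 n] n by auto
  have km: "k \<le> m"
  proof (rule ccontr)
    assume "\<not> k \<le> m"
    then have "2 ^ (m + 1) \<le> (2::nat) ^ k" by (intro power_increasing) auto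
    then show False using kn m by linarith
  qed
  define W where "W w = (\<Sum>j\<in>{k..m}. dyadic_oscillation j w) + dyadic_oscillation m w + 2 / sqrt n" for w
  have jn: "2 ^ j \<le> n" if "j \<le> m" for j using power_increasing[OF that, of "2::nat"] m by linarith
  have Di: "integrable M (dyadic_oscillation j)" if "j \<le> m" for j by (rule dyadic_oscillation_expectation(1)[OF jn[OF that]])
  have De: "expectation (dyadic_oscillation j) \<le> 5 * chaining_rate ^ j" if "j \<le> m" for j by (rule dyadic_oscillation_expectation(2)[OF jn[OF that]])
  have Si: "integrable M (\<lambda>w. \<Sum>j\<in>{k..m}. dyadic_oscillation j w)"
    by (intro Bochner_Integration.integrable_sum Di) auto
  have Se: "expectation (\<lambda>w. \<Sum>j\<in>{k..m}. dyadic_oscillation j w) = (\<Sum>j\<in>{k..m}. expectation (dyadic_oscillation j))"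
    by (rule Bochner_Integration.integral_sum) (use Di in auto)
  show ?thesis
  proof (rule that)
    show Wi: "integrable M W" unfolding W_def[abs_def]
      by (intro Bochner_Integration.integrable_add Si Di integrable_const) simp
    have "expectation W = expectation (\<lambda>w. \<Sum>j\<in>{k..m}. dyadic_oscillation j w) + expectation (dyadic_oscillation m) + 2 / sqrt n"
      unfolding W_def[abs_def] using Si Di[of m] by (simp add: prob_space)
    moreover have "(\<Sum>j\<in>{k..m}. expectation (dyadic_oscillation j)) \<le> 5 * (\<Sum>j\<in>{k..m}. chaining_rate ^ j)"
      unfolding sum_distrib_left by (intro sum_mono De) auto
    moreover have "0 \<le> chaining_rate ^ m" using chaining_rate_pos by simp
    moreover have "0 \<le> chaining_rate ^ k" using chaining_rate_pos by simp
    ultimately show "expectation W \<le> 40 * chaining_rate ^ k + 2 / sqrt n"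
      using Se De[of m] chaining_rate_sum[OF km] by linarith
  next
    fix w i s assume i: "i < 2 ^ k" and s: "real i / 2 ^ k \<le> s" "s \<le> real (Suc i) / 2 ^ k"
    have tail: "0 \<le> dyadic_oscillation m w + 2 / sqrt n"
      using dyadic_oscillation_nonneg[of m w] by (intro add_nonneg_nonneg) auto
    show "\<bar>empirical s w - empirical (real i / 2 ^ k) w\<bar> \<le> W w"
    proof (cases "s = real (Suc i) / 2 ^ k")
      case True
      have "dyadic_oscillation k w \<le> (\<Sum>j\<in>{k..m}. dyadic_oscillation j w)"
        using km dyadic_oscillation_nonneg by (intro member_le_sum) auto
      then show ?thesis using dyadic_increment_le[OF i, of w] tail unfolding True W_def by linarith
    next
      case False
      have i1: "real (Suc i) \<le> 2 ^ k" using of_nat_mono[OF Suc_leI[OF i], where 'a=real] by simp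
      have sk: "real i \<le> 2 ^ k * s" "2 ^ k * s < real (Suc i)" using s False by (auto simp: field_simps)
      then have fk: "nat \<lfloor>2 ^ k * s\<rfloor> = i" by linarith
      have s0: "0 \<le> s" by (rule order_trans[OF _ s(1)]) simp
      have "2 ^ k * s < 2 ^ k * 1" using sk i1 by linarith
      then have s1: "s < 1" by simp
      define a where "a = nat \<lfloor>2 ^ m * s\<rfloor>"
      have "0 \<le> 2 ^ m * s" using s0 by simp
      then have am: "real a \<le> 2 ^ m * s" "2 ^ m * s \<le> real (Suc a)" unfolding a_def by linarith+
      have "2 ^ m * s < 2 ^ m" using s1 by simp
      then have "real a < 2 ^ m" using am(1) by linarith
      then have a2: "a < 2 ^ m" using of_nat_less_iff[of a "2 ^ m", where 'a=real] by simp
      have as: "real a / 2 ^ m \<le> s" "s \<le> real (Suc a) / 2 ^ m" using am by (simp_all add: field_simps)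
      have gap: "sqrt n * (y - x) \<le> 2 / sqrt n" if "real a / 2 ^ m \<le> x" "y \<le> real (Suc a) / 2 ^ m" for x y
      proof -
        have "y - x \<le> real (Suc a) / 2 ^ m - real a / 2 ^ m" using that by linarith
        also have "\<dots> = 1 / 2 ^ m" by (simp add: field_simps)
        finally have "sqrt n * (y - x) \<le> sqrt n * (1 / 2 ^ m)" by (intro mult_left_mono) auto
        also have "\<dots> \<le> 2 / sqrt n"
        proof -
          have "real n \<le> 2 * 2 ^ m" using of_nat_mono[OF less_imp_le[OF m(2)], where 'a=real] by simp
          then show ?thesis using n by (simp add: divide_simps)
        qed
        finally show ?thesis .
      qed
      have "empirical (real a / 2 ^ m) w - empirical s w \<le> 2 / sqrt n"
        by (rule order_trans[OF empirical_decrease[OF as(1)] gap]) (use as in auto)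
      moreover have "empirical s w - empirical (real (Suc a) / 2 ^ m) w \<le> 2 / sqrt n"
        by (rule order_trans[OF empirical_decrease[OF as(2)] gap]) (use as in auto)
      moreover note dyadic_increment_le[OF a2, of w]
      ultimately have fine: "\<bar>empirical s w - empirical (real a / 2 ^ m) w\<bar> \<le> dyadic_oscillation m w + 2 / sqrt n"
        unfolding abs_le_iff using dyadic_oscillation_nonneg[of m w] by linarith
      have "\<bar>empirical (real a / 2 ^ m) w - empirical (real i / 2 ^ k) w\<bar> \<le> (\<Sum>j\<in>{k<..m}. dyadic_oscillation j w)"
        using dyadic_chaining[where f="\<lambda>s. empirical s w", OF dyadic_increment_le dyadic_oscillation_nonneg s0 s1 km] unfolding fk a_def .
      also have "\<dots> \<le> (\<Sum>j\<in>{k..m}. dyadic_oscillation j w)"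
        using dyadic_oscillation_nonneg by (intro sum_mono2) auto
      finally show ?thesis using fine unfolding W_def by linarith
    qed
  qed
qed

end

section \<open>Uniform negligibility for Haar matrices\<close>

lemma dyadic_cell:
  fixes s :: real
  assumes "s \<in> {0..1}"
  obtains i :: nat where "i < 2 ^ k" "real i / 2 ^ k \<le> s" "s \<le> real (Suc i) / 2 ^ k"
proof (cases "s = 1")
  case True
  have "real (Suc (2 ^ k - 1)) = 2 ^ k" by (simp add: of_nat_diff)
  then show ?thesis using True by (intro that[of "2 ^ k - 1"]) (auto simp: divide_simps of_nat_diff)
next
  case False
  define i where "i = nat \<lfloor>2 ^ k * s\<rfloor>"
  have "0 \<le> 2 ^ k * s" "2 ^ k * s < 2 ^ k" using assms False by auto
  then have i: "real i \<le> 2 ^ k * s" "2 ^ k * s \<le> real (Suc i)" "real i < 2 ^ k" unfolding i_def by linarith+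
  show ?thesis
  proof (rule that)
    show "i < 2 ^ k" using i(3) of_nat_less_iff[of i "2 ^ k", where 'a=real] by simp
    show "real i / 2 ^ k \<le> s" "s \<le> real (Suc i) / 2 ^ k" using i by (simp_all add: field_simps)
  qed
qed

lemma doubly_stochastic_form:
  fixes a :: "nat \<Rightarrow> nat \<Rightarrow> real" and x y :: "nat \<Rightarrow> real" and s t :: real
  assumes row: "\<And>i. i < n \<Longrightarrow> (\<Sum>j<n. a i j) = 1" and col: "\<And>j. j < n \<Longrightarrow> (\<Sum>i<n. a i j) = 1"
  shows "(\<Sum>i<n. \<Sum>j<n. a i j * (x i - s) * (y j - t)) =
    (\<Sum>i<n. \<Sum>j<n. a i j * (x i * y j)) - t * (\<Sum>i<n. x i) - s * (\<Sum>j<n. y j) + real n * (s * t)"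
proof -
  have "(\<Sum>i<n. \<Sum>j<n. a i j * (x i - s) * (y j - t)) =
     (\<Sum>i<n. \<Sum>j<n. a i j * (x i * y j) - t * x i * a i j - s * (y j * a i j) + s * t * a i j)"
    by (intro sum.cong refl) (simp add: algebra_simps)
  also have "\<dots> = (\<Sum>i<n. \<Sum>j<n. a i j * (x i * y j)) - (\<Sum>i<n. t * x i * (\<Sum>j<n. a i j)) - s * (\<Sum>i<n. \<Sum>j<n. y j * a i j) + s * t * (\<Sum>i<n. \<Sum>j<n. a i j)"
    by (simp only: sum.distrib sum_subtractf sum_distrib_left)
  also have "(\<Sum>i<n. t * x i * (\<Sum>j<n. a i j)) = t * (\<Sum>i<n. x i)"
    by (simp add: row sum_distrib_left)
  also have "(\<Sum>i<n. \<Sum>j<n. y j * a i j) = (\<Sum>j<n. y j * (\<Sum>i<n. a i j))"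
    unfolding sum_distrib_left by (rule sum.swap)
  also have "\<dots> = (\<Sum>j<n. y j)" by (simp add: col)
  also have "(\<Sum>i<n. \<Sum>j<n. a i j) = n" by (simp add: row)
  finally show ?thesis by (simp add: mult.commute)
qed

context sample_model
begin

text \<open>
  The matrix of squared moduli is doubly stochastic, so up to the two empirical processes
  \<open>Z\<close> is the distribution function of a positive measure on the square. Monotonicity of that
  function controls \<open>Z\<close> inside a cell by its values at the corners.
\<close>

lemma Z_corner_comparison:
  fixes s s' t t' d :: real
  assumes s: "0 \<le> s" "s \<le> s'" "s' \<le> 1" "s' - s \<le> d" and t: "0 \<le> t" "t \<le> t'" "t' \<le> 1" "t' - t \<le> d" and w: "w \<in> space M"
  shows "Z_process n U R C w (s, t) - Z_process n U R C w (s', t') \<le>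
    sqrt n * (\<bar>R.empirical s' w - R.empirical s w\<bar> + \<bar>C.empirical t' w - C.empirical t w\<bar>) + 4 * (real n * d)"
proof (cases "n = 0")
  case True
  then show ?thesis using s t by (simp add: Z_process_def unit_square_def)
next
  case False
  let ?a = "\<lambda>i j. (cmod (U w $$ (i, j)))\<^sup>2"
  let ?X = "\<lambda>s i. indicator {..s} (R i w) :: real" and ?Y = "\<lambda>t j. indicator {..t} (C j w) :: real"
  define G where "G s t = (\<Sum>i<n. \<Sum>j<n. ?a i j * (?X s i * ?Y t j))" for s t :: real
  define \<alpha> where "\<alpha> s = R.empirical s w" for s :: real
  define \<alpha>' where "\<alpha>' t = C.empirical t w" for t :: real
  have sn: "sqrt (real n) > 0" using False by simp
  have X: "(\<Sum>i<n. ?X s i) = sqrt n * \<alpha> s + real n * s" and Y: "(\<Sum>j<n. ?Y s j) = sqrt n * \<alpha>' s + real n * s" for s :: real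
    unfolding \<alpha>_def \<alpha>'_def R.empirical_def C.empirical_def centred_step_def using sn by (simp_all add: sum_subtractf)
  have Z: "Z_process n U R C w (s, t) = G s t - sqrt n * (t * \<alpha> s + s * \<alpha>' t) - real n * (s * t)"
    if "0 \<le> s" "s \<le> 1" "0 \<le> t" "t \<le> 1" for s t :: real
  proof -
    have "Z_process n U R C w (s, t) = (\<Sum>i<n. \<Sum>j<n. ?a i j * (?X s i - s) * (?Y t j - t))"
      using that by (simp add: Z_process_def unit_square_def)
    also have "\<dots> = G s t - t * (\<Sum>i<n. ?X s i) - s * (\<Sum>j<n. ?Y t j) + real n * (s * t)"
      unfolding G_def by (rule doubly_stochastic_form) (use unitary_row_sum[OF U_unitary[OF w]] unitary_column_sum[OF U_unitary[OF w]] in auto)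
    finally show ?thesis unfolding X Y by (simp add: algebra_simps)
  qed
  have "G s t \<le> G s' t'"
    unfolding G_def using s t by (intro sum_mono mult_left_mono mult_mono) (auto split: split_indicator)
  then have "Z_process n U R C w (s, t) - Z_process n U R C w (s', t') \<le>
     sqrt n * ((t' * \<alpha> s' - t * \<alpha> s) + (s' * \<alpha>' t' - s * \<alpha>' t)) + real n * (s' * t' - s * t)"
    using s t by (simp add: Z algebra_simps)
  also have "\<dots> \<le> sqrt n * ((\<bar>\<alpha> s' - \<alpha> s\<bar> + d * sqrt n) + (\<bar>\<alpha>' t' - \<alpha>' t\<bar> + d * sqrt n)) + real n * (2 * d)"
  proof -
    have product: "y' * u' - y * u \<le> \<bar>u' - u\<bar> + d * sqrt n" if "0 \<le> y'" "y' \<le> 1" "0 \<le> y' - y" "y' - y \<le> d" "\<bar>u\<bar> \<le> sqrt n" for u u' y y' :: real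
    proof -
      have "y' * (u' - u) \<le> y' * \<bar>u' - u\<bar>" using that by (intro mult_left_mono) auto
      also have "\<dots> \<le> \<bar>u' - u\<bar>" using that by (intro mult_left_le_one_le) auto
      finally have "y' * (u' - u) \<le> \<bar>u' - u\<bar>" .
      moreover have "(y' - y) * u \<le> (y' - y) * \<bar>u\<bar>" using that by (intro mult_left_mono) auto
      moreover have "(y' - y) * \<bar>u\<bar> \<le> d * sqrt n" using that by (intro mult_mono) auto
      moreover have "y' * u' - y * u = y' * (u' - u) + (y' - y) * u" by (simp add: algebra_simps)
      ultimately show ?thesis by linarith
    qed
    have "s' * t' - s * t = s' * (t' - t) + t * (s' - s)" by (simp add: algebra_simps)
    also have "\<dots> \<le> 1 * d + 1 * d" using s t by (intro add_mono mult_mono) auto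
    finally have "s' * t' - s * t \<le> 2 * d" by simp
    moreover have "t' * \<alpha> s' - t * \<alpha> s \<le> \<bar>\<alpha> s' - \<alpha> s\<bar> + d * sqrt n"
      unfolding \<alpha>_def using s t R.abs_empirical_le[of s w] by (intro product) auto
    moreover have "s' * \<alpha>' t' - s * \<alpha>' t \<le> \<bar>\<alpha>' t' - \<alpha>' t\<bar> + d * sqrt n"
      unfolding \<alpha>'_def using s t C.abs_empirical_le[of t w] by (intro product) auto
    ultimately show ?thesis by (intro add_mono mult_left_mono) auto
  qed
  also have "\<dots> = sqrt n * (\<bar>\<alpha> s' - \<alpha> s\<bar> + \<bar>\<alpha>' t' - \<alpha>' t\<bar>) + 2 * d * (sqrt n * sqrt n) + real n * (2 * d)"
    by (simp add: algebra_simps)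
  also have "\<dots> = sqrt n * (\<bar>\<alpha> s' - \<alpha> s\<bar> + \<bar>\<alpha>' t' - \<alpha>' t\<bar>) + 4 * (real n * d)" by simp
  finally show ?thesis unfolding \<alpha>_def \<alpha>'_def .
qed

end

text \<open>
  The corners are controlled by a union bound on fourth moments, which costs the number of corners
  divided by \<open>n\<^sup>2\<close>; the comparison inside the cells costs \<open>\<surd>n\<close> times their width. A width of
  order \<open>n\<close> to the power \<open>- 3 / 4\<close> makes both negligible.
\<close>

lemma (in haar_sample) uniform_bound:
  fixes l :: real
  assumes kn: "2 ^ k \<le> n" and l: "0 < l"
  obtains V where "integrable M V"
    "expectation V \<le> l + 4 * 4 ^ k * 3104 / ((real n)\<^sup>2 * l ^ 3) + 4 * (40 * chaining_rate ^ k + 2 / sqrt n) + 4 * (sqrt n / 2 ^ k)"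
    "\<And>w p. w \<in> space M \<Longrightarrow> p \<in> unit_square \<Longrightarrow> \<bar>Z_process n U R C w p\<bar> / sqrt n \<le> V w"
proof -
  have n0: "0 < real n" using n8 by simp
  then have sn: "0 < sqrt (real n)" by simp
  obtain W where W: "integrable M W" "expectation W \<le> 40 * chaining_rate ^ k + 2 / sqrt n"
    "\<And>w i s. i < 2 ^ k \<Longrightarrow> real i / 2 ^ k \<le> s \<Longrightarrow> s \<le> real (Suc i) / 2 ^ k \<Longrightarrow> \<bar>R.empirical s w - R.empirical (real i / 2 ^ k) w\<bar> \<le> W w"
    by (rule R.empirical_modulus[OF kn]) blast
  obtain W' where W': "integrable M W'" "expectation W' \<le> 40 * chaining_rate ^ k + 2 / sqrt n"
    "\<And>w i s. i < 2 ^ k \<Longrightarrow> real i / 2 ^ k \<le> s \<Longrightarrow> s \<le> real (Suc i) / 2 ^ k \<Longrightarrow> \<bar>C.empirical s w - C.empirical (real i / 2 ^ k) w\<bar> \<le> W' w"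
    by (rule C.empirical_modulus[OF kn]) blast
  let ?Z = "\<lambda>a b w. Z_process n U R C w (real a / 2 ^ k, real b / 2 ^ k)"
  have grid: "real a / 2 ^ k \<in> {0..1}" if "a \<le> 2 ^ k" for a
  proof -
    have "real a \<le> 2 ^ k" using of_nat_mono[OF that, where 'a=real] by simp
    then show ?thesis by (simp add: divide_simps)
  qed
  define T where "T w = (\<Sum>a\<le>2 ^ k. \<Sum>b\<le>2 ^ k. ?Z a b w ^ 4) / ((real n)\<^sup>2 * l ^ 3)" for w
  define V where "V w = l + T w + (2 * W w + 2 * W' w) + 4 * (sqrt n / 2 ^ k)" for w
  have Zi: "integrable M (\<lambda>w. ?Z a b w ^ 4)" if "a \<le> 2 ^ k" "b \<le> 2 ^ k" for a b
    using grid[OF that(1)] grid[OF that(2)] by (intro Z_power_integrable) (auto simp: unit_square_def)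
  have Ze: "expectation (\<lambda>w. ?Z a b w ^ 4) \<le> 3104" if "a \<le> 2 ^ k" "b \<le> 2 ^ k" for a b
  proof -
    have "(real a / 2 ^ k, real b / 2 ^ k) \<in> unit_square" using grid[OF that(1)] grid[OF that(2)] by (auto simp: unit_square_def)
    from Z_moments(2)[OF this] haar_ra2_square[OF grid[OF that(2)]] show ?thesis by linarith
  qed
  have Ti: "integrable M T" unfolding T_def[abs_def]
    by (intro integrable_divide Bochner_Integration.integrable_sum Zi) auto
  have Te: "expectation T \<le> 4 * 4 ^ k * 3104 / ((real n)\<^sup>2 * l ^ 3)"
  proof -
    have "expectation (\<lambda>w. \<Sum>a\<le>2 ^ k. \<Sum>b\<le>2 ^ k. ?Z a b w ^ 4) = (\<Sum>a\<le>2 ^ k. expectation (\<lambda>w. \<Sum>b\<le>2 ^ k. ?Z a b w ^ 4))"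
      by (rule Bochner_Integration.integral_sum) (use Zi in \<open>auto intro!: Bochner_Integration.integrable_sum\<close>)
    also have "\<dots> = (\<Sum>a\<le>2 ^ k. \<Sum>b\<le>2 ^ k. expectation (\<lambda>w. ?Z a b w ^ 4))"
      by (rule sum.cong[OF refl], rule Bochner_Integration.integral_sum) (use Zi in auto)
    also have "\<dots> \<le> (\<Sum>a\<le>(2::nat) ^ k. \<Sum>b\<le>(2::nat) ^ k. 3104)" by (intro sum_mono Ze) auto
    also have "\<dots> = (2 ^ k + 1)\<^sup>2 * (3104 :: real)" by (simp add: power2_eq_square algebra_simps)
    also have "\<dots> \<le> (2 * 2 ^ k)\<^sup>2 * 3104" by (intro mult_right_mono power_mono) auto
    also have "\<dots> = 4 * 4 ^ k * 3104" by (simp add: power2_eq_square flip: power_mult_distrib)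
    finally show ?thesis unfolding T_def[abs_def] using l n0 by (simp add: divide_right_mono)
  qed
  have corner: "\<bar>?Z a b w\<bar> / sqrt n \<le> l + T w" if ab: "a \<le> 2 ^ k" "b \<le> 2 ^ k" for a b w
  proof -
    have "\<bar>?Z a b w\<bar> / sqrt n = \<bar>?Z a b w / sqrt n\<bar>" by (simp add: abs_divide)
    also have "\<dots> \<le> l + (?Z a b w / sqrt n) ^ 4 / l ^ 3" by (rule abs_le_fourth_power[OF l])
    also have "(?Z a b w / sqrt n) ^ 4 / l ^ 3 = ?Z a b w ^ 4 / ((real n)\<^sup>2 * l ^ 3)"
    proof -
      have "(sqrt (real n)) ^ 4 = (real n)\<^sup>2" by (simp add: power4_eq_xxxx power2_eq_square mult.assoc)
      then show ?thesis by (simp add: power_divide)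
    qed
    also have "\<dots> \<le> T w" unfolding T_def
    proof (rule divide_right_mono)
      have "?Z a b w ^ 4 \<le> (\<Sum>b\<le>2 ^ k. ?Z a b w ^ 4)" by (rule member_le_sum) (use ab in auto)
      also have "\<dots> \<le> (\<Sum>a\<le>2 ^ k. \<Sum>b\<le>2 ^ k. ?Z a b w ^ 4)"
        by (rule member_le_sum[where f="\<lambda>a. \<Sum>b\<le>2 ^ k. ?Z a b w ^ 4"]) (use ab in \<open>auto intro!: sum_nonneg\<close>)
      finally show "?Z a b w ^ 4 \<le> (\<Sum>a\<le>2 ^ k. \<Sum>b\<le>2 ^ k. ?Z a b w ^ 4)" .
    qed (use l n0 in auto)
    finally show ?thesis by simp
  qed
  show ?thesis
  proof (rule that)
    show "integrable M V" unfolding V_def[abs_def]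
      by (intro Bochner_Integration.integrable_add integrable_const integrable_mult_right Ti W(1) W'(1)) 
    have "expectation V = l + expectation T + (2 * expectation W + 2 * expectation W') + 4 * (sqrt n / 2 ^ k)"
      unfolding V_def[abs_def] using Ti W(1) W'(1) by (simp add: prob_space)
    moreover have "l + x + (2 * a + 2 * b) + r \<le> l + X + 4 * Y + r" if "x \<le> X" "a \<le> Y" "b \<le> Y" for x X a b Y r :: real
      using that by linarith
    from this[OF Te W(2) W'(2)]
    have "l + expectation T + (2 * expectation W + 2 * expectation W') + 4 * (sqrt n / 2 ^ k) \<le>
      l + 4 * 4 ^ k * 3104 / ((real n)\<^sup>2 * l ^ 3) + 4 * (40 * chaining_rate ^ k + 2 / sqrt n) + 4 * (sqrt n / 2 ^ k)" .
    ultimately show "expectation V \<le> l + 4 * 4 ^ k * 3104 / ((real n)\<^sup>2 * l ^ 3) + 4 * (40 * chaining_rate ^ k + 2 / sqrt n) + 4 * (sqrt n / 2 ^ k)"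
      by (simp only:)
  next
    fix w p assume w: "w \<in> space M" and p: "p \<in> unit_square"
    obtain s t where st: "p = (s, t)" "s \<in> {0..1}" "t \<in> {0..1}" using p by (cases p) (auto simp: unit_square_def)
    obtain i where i: "i < 2 ^ k" "real i / 2 ^ k \<le> s" "s \<le> real (Suc i) / 2 ^ k" by (rule dyadic_cell[OF st(2)])
    obtain j where j: "j < 2 ^ k" "real j / 2 ^ k \<le> t" "t \<le> real (Suc j) / 2 ^ k" by (rule dyadic_cell[OF st(3)])
    have width: "real (Suc i) / 2 ^ k = real i / 2 ^ k + 1 / 2 ^ k" for i by (simp add: field_simps)
    have g: "real i / 2 ^ k \<in> {0..1}" "real (Suc i) / 2 ^ k \<in> {0..1}" "real j / 2 ^ k \<in> {0..1}" "real (Suc j) / 2 ^ k \<in> {0..1}"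
      using grid[of i] grid[of "Suc i"] grid[of j] grid[of "Suc j"] i(1) j(1) by auto
    have g0: "0 \<le> real i / 2 ^ k" "0 \<le> real j / 2 ^ k" "real (Suc i) / 2 ^ k \<le> 1" "real (Suc j) / 2 ^ k \<le> 1" "0 \<le> s" "s \<le> 1" "0 \<le> t" "t \<le> 1"
      using g st by (auto simp del: of_nat_Suc)
    have cs: "real (Suc i) / 2 ^ k - s \<le> 1 / 2 ^ k" "s - real i / 2 ^ k \<le> 1 / 2 ^ k" "real (Suc j) / 2 ^ k - t \<le> 1 / 2 ^ k" "t - real j / 2 ^ k \<le> 1 / 2 ^ k"
      using i j width[of i] width[of j] by linarith+
    note a = W(3)[OF i, of w] W(3)[OF i(1) _ order_refl, of w] W'(3)[OF j, of w] W'(3)[OF j(1) _ order_refl, of w]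
    let ?e = "2 * W w + 2 * W' w"
    have le: "real i / 2 ^ k \<le> real (Suc i) / 2 ^ k" for i by (intro divide_right_mono) auto
    have up_incr: "\<bar>R.empirical (real (Suc i) / 2 ^ k) w - R.empirical s w\<bar> + \<bar>C.empirical (real (Suc j) / 2 ^ k) w - C.empirical t w\<bar> \<le> ?e"
      using a(1) a(2)[OF le] a(3) a(4)[OF le] by linarith
    have lo_incr: "\<bar>R.empirical s w - R.empirical (real i / 2 ^ k) w\<bar> + \<bar>C.empirical t w - C.empirical (real j / 2 ^ k) w\<bar> \<le> ?e"
      using a(1) a(3) by linarith
    have "Z_process n U R C w (s, t) - ?Z (Suc i) (Suc j) w \<le> sqrt n * (\<bar>R.empirical (real (Suc i) / 2 ^ k) w - R.empirical s w\<bar> + \<bar>C.empirical (real (Suc j) / 2 ^ k) w - C.empirical t w\<bar>) + 4 * (real n * (1 / 2 ^ k))"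
      by (rule Z_corner_comparison[OF g0(5) i(3) g0(3) cs(1) g0(7) j(3) g0(4) cs(3) w])
    also have "\<dots> \<le> sqrt n * ?e + 4 * (real n * (1 / 2 ^ k))"
      by (intro add_right_mono mult_left_mono up_incr) simp
    finally have up: "Z_process n U R C w (s, t) - ?Z (Suc i) (Suc j) w \<le> sqrt n * ?e + 4 * (real n * (1 / 2 ^ k))" .
    have "?Z i j w - Z_process n U R C w (s, t) \<le> sqrt n * (\<bar>R.empirical s w - R.empirical (real i / 2 ^ k) w\<bar> + \<bar>C.empirical t w - C.empirical (real j / 2 ^ k) w\<bar>) + 4 * (real n * (1 / 2 ^ k))"
      by (rule Z_corner_comparison[OF g0(1) i(2) g0(6) cs(2) g0(2) j(2) g0(8) cs(4) w])
    also have "\<dots> \<le> sqrt n * ?e + 4 * (real n * (1 / 2 ^ k))"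
      by (intro add_right_mono mult_left_mono lo_incr) simp
    finally have lo: "?Z i j w - Z_process n U R C w (s, t) \<le> sqrt n * ?e + 4 * (real n * (1 / 2 ^ k))" .
    have "\<bar>?Z (Suc i) (Suc j) w\<bar> \<le> sqrt n * (l + T w)" "\<bar>?Z i j w\<bar> \<le> sqrt n * (l + T w)"
      using corner[of "Suc i" "Suc j" w] corner[of i j w] i(1) j(1) sn by (simp_all add: divide_le_eq mult.commute)
    then have "\<bar>Z_process n U R C w (s, t)\<bar> \<le> sqrt n * (l + T w) + (sqrt n * ?e + 4 * (real n * (1 / 2 ^ k)))"
      using up lo by linarith
    also have "\<dots> = sqrt n * V w"
    proof -
      have "real n = sqrt n * sqrt n" by simp
      then have "4 * (real n * (1 / 2 ^ k)) = sqrt n * (4 * (sqrt n / 2 ^ k))" by simp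
      then show ?thesis unfolding V_def by (simp only: distrib_left)
    qed
    finally show "\<bar>Z_process n U R C w p\<bar> / sqrt n \<le> V w" using sn st(1) by (simp add: divide_le_eq mult.commute)
  qed
qed

text \<open>
  With \<open>16^k\<close> of the order of \<open>n^3\<close>, the mesh \<open>2^-k\<close> is of the order of \<open>n\<close> to the power \<open>- 3 / 4\<close>.
\<close>

theorem haar_negligible:
  fixes M :: "nat \<Rightarrow> 'a measure"
  assumes S: "\<And>n. sample_model n (M n) (U n) (R n) (C n)"
    and H: "\<And>n. 8 \<le> n \<Longrightarrow> haar_sample n (M n) (U n) (R n) (C n) (G n) Z"
  shows "skorokhod_converges_in_probability
            M (\<lambda>n w. \<lambda>p\<in>unit_square. real n powr (- 1 / 2) * Z_process n (U n) (R n) (C n) w p)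
            (\<lambda>p\<in>unit_square. 0)"
  unfolding skorokhod_converges_in_probability_def
proof (intro conjI allI impI)
  interpret sm: sample_model n "M n" "U n" "R n" "C n" for n by (rule S)
  show zero: "(\<lambda>p\<in>unit_square. 0) \<in> skorokhod_space" by (rule skorokhod_space_continuous) (rule continuous_on_const)
  let ?X = "\<lambda>n w. \<lambda>p\<in>unit_square. real n powr (- 1 / 2) * Z_process n (U n) (R n) (C n) w p"
  show meas: "?X n \<in> M n \<rightarrow>\<^sub>M borel_of skorokhod_topology" for n by (rule sm.Z_skorokhod_measurable)
  have X: "?X n w \<in> skorokhod_space" if "w \<in> space (M n)" for n w
    using measurable_space[OF meas that] by (simp add: space_borel_of)
  define b where "b n = real n powr (- 1 / 8) + 4 * real n powr (3 / 2) * 3104 / ((real n)\<^sup>2 * (real n powr (- 1 / 8)) ^ 3) +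
     4 * (40 * (real n powr (3 / 4) / 2) powr (- 1 / 4) + 2 / sqrt (real n)) + 4 * (sqrt (real n) / (real n powr (3 / 4) / 2))" for n :: nat
  have b0: "b \<longlonglongrightarrow> 0" unfolding b_def by real_asymp
  fix \<epsilon> :: real assume \<epsilon>: "0 < \<epsilon>"
  have "\<forall>\<^sub>F n in sequentially. measure (M n) {w \<in> space (M n). \<epsilon> < skorokhod_dist (?X n w) (\<lambda>p\<in>unit_square. 0)} \<le> b n / \<epsilon>"
    using eventually_ge_at_top[of 8]
  proof eventually_elim
    case (elim n)
    interpret hs: haar_sample n "M n" "U n" "R n" "C n" "G n" Z by (rule H[OF elim])
    have n0: "0 < real n" using elim by simp
    obtain k where k: "16 ^ k \<le> n ^ 3" "n ^ 3 < 16 ^ (k + 1)"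
    proof -
      have "1 \<le> n ^ 3" using elim by (intro one_le_power) simp
      from ex_power_ivl1[OF _ this, of 16] that show ?thesis by auto
    qed
    have k16: "(16::real) ^ k = (2 ^ k) ^ 4"
      using power_mult[of "2::real" 4 k] power_mult[of "2::real" k 4] by (simp add: mult.commute)
    then have k16': "(16::real) ^ (k + 1) = (2 * 2 ^ k) ^ 4" unfolding power_mult_distrib by simp
    have n34: "(real n powr (3 / 4)) ^ 4 = real n ^ 3"
      using n0 powr_power[of "real n" "3 / 4" 4] by simp
    have up: "2 ^ k \<le> real n powr (3 / 4)"
    proof (rule power_le_imp_le_base[of _ 3])
      show "(2 ^ k) ^ Suc 3 \<le> (real n powr (3 / 4)) ^ Suc 3"
        using of_nat_mono[OF k(1), where 'a=real] k16 n34 by simp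
    qed simp
    have lo: "real n powr (3 / 4) / 2 < 2 ^ k"
    proof -
      have "(real n powr (3 / 4)) ^ 4 < (2 * 2 ^ k) ^ 4"
        using of_nat_less_iff[of "n ^ 3" "16 ^ (k + 1)", where 'a=real] k(2) unfolding n34 k16'[symmetric] by simp
      then have "real n powr (3 / 4) < 2 * 2 ^ k" by (rule power_less_imp_less_base) simp
      then show ?thesis by simp
    qed
    have "real n powr (3 / 4) \<le> real n powr 1" using elim by (intro powr_mono) auto
    then have "real (2 ^ k) \<le> real n" using order_trans[OF up \<open>real n powr (3 / 4) \<le> real n powr 1\<close>] n0 by simp
    then have kn: "2 ^ k \<le> n" by (simp only: of_nat_le_iff)
    have "0 < real n powr (- 1 / 8)" using n0 by simp
    from hs.uniform_bound[OF kn this] obtain V where V: "integrable (M n) V"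
      "(\<integral>w. V w \<partial>M n) \<le> real n powr (- 1 / 8) + 4 * 4 ^ k * 3104 / ((real n)\<^sup>2 * (real n powr (- 1 / 8)) ^ 3) + 4 * (40 * chaining_rate ^ k + 2 / sqrt n) + 4 * (sqrt n / 2 ^ k)"
      "\<And>w p. w \<in> space (M n) \<Longrightarrow> p \<in> unit_square \<Longrightarrow> \<bar>Z_process n (U n) (R n) (C n) w p\<bar> / sqrt n \<le> V w"
      by blast
    have "real n powr (- 1 / 8) + 4 * 4 ^ k * 3104 / ((real n)\<^sup>2 * (real n powr (- 1 / 8)) ^ 3) + 4 * (40 * chaining_rate ^ k + 2 / sqrt n) + 4 * (sqrt n / 2 ^ k) \<le> b n"
      unfolding b_def
    proof (intro add_mono order_refl mult_left_mono mult_right_mono divide_right_mono divide_left_mono)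
      have "(4::real) ^ k = (2 ^ k)\<^sup>2" by (simp add: power2_eq_square flip: power_mult_distrib)
      also have "\<dots> \<le> (real n powr (3 / 4))\<^sup>2" using up by (intro power_mono) auto
      also have "\<dots> = real n powr (3 / 2)" using n0 powr_power[of "real n" "3 / 4" 2] by simp
      finally show "(4::real) ^ k \<le> real n powr (3 / 2)" .
      have "chaining_rate ^ k = (2 ^ k) powr (- 1 / 4)"
        using powr_power[of "2::real" "- 1 / 4" k] powr_powr[of 2 "real k" "- 1 / 4"] by (simp add: chaining_rate_def powr_realpow mult.commute)
      also have "\<dots> \<le> (real n powr (3 / 4) / 2) powr (- 1 / 4)"
        using lo n0 by (intro powr_mono2') auto
      finally show "chaining_rate ^ k \<le> (real n powr (3 / 4) / 2) powr (- 1 / 4)" .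
    qed (use lo n0 in auto)
    with V(2) have Vb: "(\<integral>w. V w \<partial>M n) \<le> b n" by linarith
    have V0: "0 \<le> V w" if "w \<in> space (M n)" for w
    proof -
      have "(0, 0) \<in> unit_square" by (simp add: unit_square_def)
      from V(3)[OF that this] show ?thesis by (rule order_trans[rotated]) simp
    qed
    have "measure (M n) {w \<in> space (M n). \<epsilon> < skorokhod_dist (?X n w) (\<lambda>p\<in>unit_square. 0)} \<le> measure (M n) {w \<in> space (M n). V w \<ge> \<epsilon>}"
    proof (rule sm.finite_measure_mono)
      show "{w \<in> space (M n). \<epsilon> < skorokhod_dist (?X n w) (\<lambda>p\<in>unit_square. 0)} \<subseteq> {w \<in> space (M n). V w \<ge> \<epsilon>}"
      proof (intro subsetI CollectI conjI)
        fix w assume w: "w \<in> {w \<in> space (M n). \<epsilon> < skorokhod_dist (?X n w) (\<lambda>p\<in>unit_square. 0)}"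
        then show ws: "w \<in> space (M n)" by simp
        have "skorokhod_dist (?X n w) (\<lambda>p\<in>unit_square. 0) \<le> V w"
        proof (rule skorokhod_dist_le_uniform[OF X[OF ws] zero V0[OF ws]])
          fix p assume p: "p \<in> unit_square"
          have "real n powr (- 1 / 2) = 1 / sqrt n" using n0 by (simp add: powr_minus_divide powr_half_sqrt)
          then show "\<bar>?X n w p - (\<lambda>p\<in>unit_square. 0) p\<bar> \<le> V w"
            using V(3)[OF ws p] p by (simp add: abs_mult)
        qed
        then show "\<epsilon> \<le> V w" using w by simp
      qed
      show "{w \<in> space (M n). V w \<ge> \<epsilon>} \<in> sets (M n)" using borel_measurable_integrable[OF V(1)] by measurable
    qed
    also have "\<dots> \<le> (\<integral>w. V w \<partial>M n) / \<epsilon>"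
      using V0 by (intro integral_Markov_inequality_measure[OF V(1), where A="space (M n)"] AE_I2 \<epsilon>) auto
    also have "\<dots> \<le> b n / \<epsilon>" using Vb \<epsilon> by (intro divide_right_mono) auto
    finally show ?case .
  qed
  moreover have "(\<lambda>n. b n / \<epsilon>) \<longlonglongrightarrow> 0" using tendsto_divide[OF b0 tendsto_const[of \<epsilon>]] \<epsilon> by simp
  ultimately show "(\<lambda>n. measure (M n) {w \<in> space (M n). \<epsilon> < skorokhod_dist (?X n w) (\<lambda>p\<in>unit_square. 0)}) \<longlonglongrightarrow> 0"
    by (intro tendsto_sandwich[OF always_eventually[OF allI[OF measure_nonneg]] _ tendsto_const])
qed

section \<open>Discretisation of paths\<close>

lemma continuous_map_measurable_borel_of_borel_of:
  assumes g: "continuous_map T T' g"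
  shows "g \<in> borel_of T \<rightarrow>\<^sub>M borel_of T'"
proof (rule measurable_borel_ofI)
  show "g x \<in> topspace T'" if "x \<in> space (borel_of T)" for x
    using continuous_map_funspace[OF g] that by (auto simp: space_borel_of)
  fix V assume "openin T' V"
  then have "openin T {x \<in> topspace T. g x \<in> V}" using g by (simp add: continuous_map)
  then show "{x \<in> space (borel_of T). g x \<in> V} \<in> sets (borel_of T)"
    unfolding space_borel_of by (rule openin_sets_borel_of)
qed

definition dyadic_floor :: "nat \<Rightarrow> real \<Rightarrow> real" where
  "dyadic_floor k s = real_of_int \<lfloor>2 ^ k * s\<rfloor> / 2 ^ k"

definition dyadic_grid :: "nat \<Rightarrow> (real \<times> real) set" where
  "dyadic_grid k = (\<lambda>(a, b). (real a / 2 ^ k, real b / 2 ^ k)) ` ({..2 ^ k} \<times> {..2 ^ k})"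

definition grid_path :: "nat \<Rightarrow> (real \<times> real \<Rightarrow> real) \<Rightarrow> real \<times> real \<Rightarrow> real" where
  "grid_path k v = (\<lambda>p\<in>unit_square. v (dyadic_floor k (fst p), dyadic_floor k (snd p)))"

lemma finite_dyadic_grid: "finite (dyadic_grid k)"
  by (simp add: dyadic_grid_def)

lemma dyadic_grid_subset: "dyadic_grid k \<subseteq> unit_square"
proof -
  have "real a / 2 ^ k \<in> {0..1}" if "a \<le> 2 ^ k" for a
    using of_nat_mono[OF that, where 'a=real] by (simp add: divide_simps)
  then show ?thesis by (auto simp: dyadic_grid_def unit_square_def)
qed

lemma dyadic_floor_cell:
  assumes "s \<in> {0..1}"
  shows "dyadic_floor k s = s \<or> (\<exists>i<2 ^ k. dyadic_floor k s = real i / 2 ^ k \<and> real i / 2 ^ k \<le> s \<and> s \<le> real (Suc i) / 2 ^ k)"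
proof (cases "s = 1")
  case True
  then show ?thesis by (simp add: dyadic_floor_def)
next
  case False
  define i where "i = nat \<lfloor>2 ^ k * s\<rfloor>"
  have "0 \<le> 2 ^ k * s" "2 ^ k * s < 2 ^ k" using assms False by auto
  then have i: "real i \<le> 2 ^ k * s" "2 ^ k * s \<le> real (Suc i)" "real i < 2 ^ k" "real_of_int \<lfloor>2 ^ k * s\<rfloor> = real i"
    unfolding i_def by (linarith, linarith, linarith, simp)
  have "i < 2 ^ k" using i(3) of_nat_less_iff[of i "2 ^ k", where 'a=real] by simp
  moreover have "real i / 2 ^ k \<le> s" "s \<le> real (Suc i) / 2 ^ k" using i by (simp_all add: field_simps)
  ultimately show ?thesis using i(4) unfolding dyadic_floor_def by auto
qed

lemma dyadic_floor_grid:
  assumes "s \<in> {0..1}"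
  shows "\<exists>a\<le>2 ^ k. dyadic_floor k s = real a / 2 ^ k"
proof -
  define a where "a = nat \<lfloor>2 ^ k * s\<rfloor>"
  have "0 \<le> 2 ^ k * s" "2 ^ k * s \<le> 2 ^ k" using assms by auto
  then have a: "real a \<le> 2 ^ k" "real_of_int \<lfloor>2 ^ k * s\<rfloor> = real a" unfolding a_def by (linarith, simp)
  have "a \<le> 2 ^ k" using a(1) of_nat_le_iff[of a "2 ^ k", where 'a=real] by simp
  then show ?thesis using a(2) unfolding dyadic_floor_def by auto
qed

lemma dyadic_floor_near: "\<bar>dyadic_floor k s - s\<bar> \<le> 1 / 2 ^ k"
proof -
  have "dyadic_floor k s - s = (real_of_int \<lfloor>2 ^ k * s\<rfloor> - 2 ^ k * s) / 2 ^ k" by (simp add: dyadic_floor_def diff_divide_distrib)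
  moreover have "\<bar>real_of_int \<lfloor>2 ^ k * s\<rfloor> - 2 ^ k * s\<bar> \<le> 1" by linarith
  ultimately show ?thesis by (simp add: abs_divide divide_right_mono)
qed

lemma dyadic_floor_in_grid: "p \<in> unit_square \<Longrightarrow> (dyadic_floor k (fst p), dyadic_floor k (snd p)) \<in> dyadic_grid k"
proof -
  assume "p \<in> unit_square"
  then have "fst p \<in> {0..1}" "snd p \<in> {0..1}" by (auto simp: unit_square_def)
  then obtain a b where "a \<le> 2 ^ k" "dyadic_floor k (fst p) = real a / 2 ^ k" "b \<le> 2 ^ k" "dyadic_floor k (snd p) = real b / 2 ^ k"
    using dyadic_floor_grid[of "fst p" k] dyadic_floor_grid[of "snd p" k] by auto
  then show ?thesis unfolding dyadic_grid_def by (intro image_eqI[where x="(a, b)"]) auto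
qed

lemma grid_path_cong: "(\<And>p. p \<in> dyadic_grid k \<Longrightarrow> v p = v' p) \<Longrightarrow> grid_path k v = grid_path k v'"
  unfolding grid_path_def using dyadic_floor_in_grid by (intro restrict_ext) auto

lemma grid_path_restrict: "grid_path k (restrict v (dyadic_grid k)) = grid_path k v"
  by (rule grid_path_cong) simp

lemma grid_path_in_skorokhod: "grid_path k v \<in> skorokhod_space"
proof -
  have "grid_path k v = restrict (\<lambda>q. v (real_of_int \<lfloor>2 ^ k * fst q\<rfloor> / 2 ^ k, real_of_int \<lfloor>2 ^ k * snd q\<rfloor> / 2 ^ k)) unit_square"
    by (simp add: grid_path_def dyadic_floor_def)
  also have "\<dots> \<in> skorokhod_space"
    by (rule skorokhod_spaceI[OF locally_step_floor locally_step_floor, of "2 ^ k" "2 ^ k" "\<lambda>a b q. v (real_of_int a / 2 ^ k, real_of_int b / 2 ^ k)"])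
       (auto intro: continuous_on_const)
  finally show ?thesis .
qed

lemma grid_path_continuous:
  "continuous_map (product_topology (\<lambda>_. euclideanreal) (dyadic_grid k)) skorokhod_topology (grid_path k)"
proof (rule skorokhod.continuous_map_to_metric[THEN iffD2], intro ballI allI impI)
  let ?P = "product_topology (\<lambda>_. euclideanreal) (dyadic_grid k)"
  fix v \<epsilon> assume v: "v \<in> topspace ?P" and \<epsilon>: "(0::real) < \<epsilon>"
  let ?V = "PiE (dyadic_grid k) (\<lambda>p. {v p - \<epsilon> / 2 <..< v p + \<epsilon> / 2})"
  have "openin ?P ?V" by (rule openin_PiE[THEN iffD2]) (use finite_dyadic_grid in auto)
  moreover have "v \<in> ?V" using v \<epsilon> by (auto simp: PiE_iff)
  moreover have "grid_path k w \<in> skorokhod.mball (grid_path k v) \<epsilon>" if w: "w \<in> ?V" for w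
  proof -
    have "skorokhod_dist (grid_path k v) (grid_path k w) \<le> \<epsilon> / 2"
    proof (rule skorokhod_dist_le_uniform[OF grid_path_in_skorokhod grid_path_in_skorokhod])
      fix p assume p: "p \<in> unit_square"
      have "w (dyadic_floor k (fst p), dyadic_floor k (snd p)) \<in> {v (dyadic_floor k (fst p), dyadic_floor k (snd p)) - \<epsilon> / 2 <..< v (dyadic_floor k (fst p), dyadic_floor k (snd p)) + \<epsilon> / 2}"
        using w dyadic_floor_in_grid[OF p, of k] by (rule PiE_mem)
      then have "\<bar>v (dyadic_floor k (fst p), dyadic_floor k (snd p)) - w (dyadic_floor k (fst p), dyadic_floor k (snd p))\<bar> \<le> \<epsilon> / 2"
        unfolding abs_le_iff greaterThanLessThan_iff by linarith
      then show "\<bar>grid_path k v p - grid_path k w p\<bar> \<le> \<epsilon> / 2" using p by (simp add: grid_path_def)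
    qed (use \<epsilon> in simp)
    then show ?thesis using \<epsilon> grid_path_in_skorokhod by (simp add: skorokhod.in_mball)
  qed
  ultimately show "\<exists>V. openin ?P V \<and> v \<in> V \<and> (\<forall>w\<in>V. grid_path k w \<in> skorokhod.mball (grid_path k v) \<epsilon>)" by blast
qed

text \<open>
  Uniform continuity on the compact square.
\<close>

lemma grid_path_tendsto:
  assumes f: "continuous_on unit_square f"
  shows "(\<lambda>k. skorokhod_dist (grid_path k f) (restrict f unit_square)) \<longlonglongrightarrow> 0"
proof (rule LIMSEQ_I)
  fix \<epsilon> :: real assume \<epsilon>: "0 < \<epsilon>"
  have "compact unit_square" unfolding unit_square_def by (intro compact_Times compact_Icc)
  then have "uniformly_continuous_on unit_square f" by (rule compact_uniformly_continuous[OF f])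
  then obtain d where d: "0 < d" "\<And>p q. p \<in> unit_square \<Longrightarrow> q \<in> unit_square \<Longrightarrow> dist q p < d \<Longrightarrow> dist (f q) (f p) < \<epsilon> / 2"
    unfolding uniformly_continuous_on_def using \<epsilon> by (elim allE[of _ "\<epsilon> / 2"]) auto
  have "(\<lambda>k. 2 * (1 / 2) ^ k :: real) \<longlonglongrightarrow> 2 * 0" by (intro tendsto_mult tendsto_const LIMSEQ_realpow_zero) auto
  then have "\<forall>\<^sub>F k in sequentially. 2 * (1 / 2) ^ k < d" using d(1) by (intro order_tendstoD(2)) auto
  then have "\<forall>\<^sub>F k in sequentially. norm (skorokhod_dist (grid_path k f) (restrict f unit_square) - 0) < \<epsilon>"
  proof eventually_elim
    case (elim k)
    have "skorokhod_dist (grid_path k f) (restrict f unit_square) \<le> \<epsilon> / 2"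
    proof (rule skorokhod_dist_le_uniform[OF grid_path_in_skorokhod skorokhod_space_continuous[OF f]])
      fix p assume p: "p \<in> unit_square"
      let ?q = "(dyadic_floor k (fst p), dyadic_floor k (snd p))"
      have q: "?q \<in> unit_square" using dyadic_floor_in_grid[OF p] dyadic_grid_subset by blast
      have "dist ?q p \<le> \<bar>fst ?q - fst p\<bar> + \<bar>snd ?q - snd p\<bar>"
        unfolding dist_prod_def dist_real_def by (rule order_trans[OF real_sqrt_le_mono sqrt_sum_squares_le_sum_abs]) simp
      also have "\<dots> \<le> 1 / 2 ^ k + 1 / 2 ^ k" using dyadic_floor_near[of k "fst p"] dyadic_floor_near[of k "snd p"] by (intro add_mono) auto
      also have "\<dots> = 2 * (1 / 2) ^ k" by (simp add: power_one_over)
      finally have "dist (f ?q) (f p) < \<epsilon> / 2" using elim by (intro d(2)[OF p q]) simp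
      then show "\<bar>grid_path k f p - restrict f unit_square p\<bar> \<le> \<epsilon> / 2" using p by (simp add: grid_path_def dist_real_def)
    qed (use \<epsilon> in simp)
    then show ?case using \<epsilon> skorokhod.nonneg[of "grid_path k f" "restrict f unit_square"] by simp
  qed
  then show "\<exists>m. \<forall>k\<ge>m. norm (skorokhod_dist (grid_path k f) (restrict f unit_square) - 0) < \<epsilon>"
    by (simp add: eventually_sequentially)
qed

lemma (in uniform_sample) empirical_grid_approximation:
  assumes kn: "2 ^ k \<le> n"
  obtains W A where "integrable M W" "expectation W \<le> 40 * chaining_rate ^ k + 2 / sqrt n" "\<And>w. 0 \<le> W w"
    "integrable M A" "expectation A \<le> 46" "\<And>w. 0 \<le> A w"
    "\<And>w s. s \<in> {0..1} \<Longrightarrow> \<bar>empirical s w - empirical (dyadic_floor k s) w\<bar> \<le> W w"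
    "\<And>w s. s \<in> {0..1} \<Longrightarrow> \<bar>empirical s w\<bar> \<le> A w"
proof -
  have n1: "1 \<le> n" by (rule order_trans[OF _ kn]) simp
  obtain W where W: "integrable M W" "expectation W \<le> 40 * chaining_rate ^ k + 2 / sqrt n"
    "\<And>w i s. i < 2 ^ k \<Longrightarrow> real i / 2 ^ k \<le> s \<Longrightarrow> s \<le> real (Suc i) / 2 ^ k \<Longrightarrow> \<bar>empirical s w - empirical (real i / 2 ^ k) w\<bar> \<le> W w"
    by (rule empirical_modulus[OF kn]) blast
  have n0: "2 ^ 0 \<le> n" using n1 by simp
  obtain W0 where W0: "integrable M W0" "expectation W0 \<le> 40 * chaining_rate ^ 0 + 2 / sqrt n"
    "\<And>w i s. i < 2 ^ 0 \<Longrightarrow> real i / 2 ^ 0 \<le> s \<Longrightarrow> s \<le> real (Suc i) / 2 ^ 0 \<Longrightarrow> \<bar>empirical s w - empirical (real i / 2 ^ 0) w\<bar> \<le> W0 w"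
    by (rule empirical_modulus[OF n0]) blast
  have W_nonneg: "0 \<le> W w" for w using W(3)[of 0 0 w] by simp
  define A where "A w = W0 w + (1 + (empirical 0 w)\<^sup>2)" for w
  have bound: "\<bar>empirical s w\<bar> \<le> A w" if "s \<in> {0..1}" for s w
  proof -
    have "\<bar>empirical s w - empirical 0 w\<bar> \<le> W0 w" using W0(3)[of 0 s w] that by simp
    moreover have "2 * \<bar>empirical 0 w\<bar> \<le> 1 + (empirical 0 w)\<^sup>2"
      using zero_le_power2[of "\<bar>empirical 0 w\<bar> - 1"] unfolding power2_diff by simp
    ultimately show ?thesis unfolding A_def by linarith
  qed
  have E0: "integrable M (\<lambda>w. (empirical 0 w)\<^sup>2)" by (rule empirical_square_integrable) simp
  show ?thesis
  proof (rule that[OF W(1,2) W_nonneg])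
    show "integrable M A" unfolding A_def[abs_def] by (intro Bochner_Integration.integrable_add W0(1) integrable_const E0)
    have "expectation A = expectation W0 + (1 + expectation (\<lambda>w. (empirical 0 w)\<^sup>2))"
    proof -
      have i: "integrable M (\<lambda>w. 1 + (empirical 0 w)\<^sup>2)" by (intro Bochner_Integration.integrable_add integrable_const E0)
      have e: "expectation (\<lambda>w. 1 + (empirical 0 w)\<^sup>2) = 1 + expectation (\<lambda>w. (empirical 0 w)\<^sup>2)"
        using Bochner_Integration.integral_add[OF integrable_const E0, of 1] by (simp add: prob_space)
      show ?thesis unfolding A_def[abs_def] Bochner_Integration.integral_add[OF W0(1) i] e ..
    qed
    moreover have "2 / sqrt n \<le> 2" using divide_left_mono[of 1 "sqrt n" 2] n1 by simp
    moreover have "expectation (\<lambda>w. (empirical 0 w)\<^sup>2) \<le> 1" by (rule empirical_moments(1)) simp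
    ultimately show "expectation A \<le> 46" using W0(2) unfolding power_0 by linarith
    show "0 \<le> A w" for w by (rule order_trans[OF abs_ge_zero bound[of 0]]) simp
    show "\<bar>empirical s w\<bar> \<le> A w" if "s \<in> {0..1}" for s w by (rule bound[OF that])
    show "\<bar>empirical s w - empirical (dyadic_floor k s) w\<bar> \<le> W w" if "s \<in> {0..1}" for s w
      using dyadic_floor_cell[OF that, of k]
    proof
      assume "dyadic_floor k s = s"
      then show ?thesis using W_nonneg[of w] by simp
    next
      assume "\<exists>i<2 ^ k. dyadic_floor k s = real i / 2 ^ k \<and> real i / 2 ^ k \<le> s \<and> s \<le> real (Suc i) / 2 ^ k"
      then obtain i where i: "i < 2 ^ k" "dyadic_floor k s = real i / 2 ^ k" "real i / 2 ^ k \<le> s" "s \<le> real (Suc i) / 2 ^ k" by blast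
      show ?thesis unfolding i(2) by (rule W(3)[OF i(1,3,4)])
    qed
  qed
qed

section \<open>Functional convergence for flat matrices\<close>

context sample_model
begin

lemma flat_Z:
  assumes flat: "\<forall>i<n. \<forall>j<n. (cmod (U w $$ (i, j)))\<^sup>2 = 1 / real n" and n: "0 < n" and st: "s \<in> {0..1}" "t \<in> {0..1}"
  shows "Z_process n U R C w (s, t) = R.empirical s w * C.empirical t w"
proof -
  have "Z_process n U R C w (s, t) = (\<Sum>i<n. row_average n (U w) (\<lambda>j. C j w) i t * centred_step s (R i w))"
    using st by (intro Z_process_eq) (simp add: unit_square_def)
  also have "\<dots> = (\<Sum>i<n. sm t w * centred_step s (R i w))"
    using flat by (intro sum.cong refl) (simp add: flat_row_average)
  also have "\<dots> = (C.empirical t w / sqrt n) * (sqrt n * R.empirical s w)"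
    unfolding sum_distrib_left[symmetric] sm_empirical[OF n] using n by (simp add: R.empirical_def)
  also have "\<dots> = R.empirical s w * C.empirical t w" using n by simp
  finally show ?thesis .
qed

lemma Z_measurable: "Z_process n U R C \<in> M \<rightarrow>\<^sub>M borel_of skorokhod_topology"
proof -
  have "(\<lambda>w. \<lambda>p\<in>unit_square. 1 * Z_process n U R C w p) = Z_process n U R C"
    by (intro ext) (simp add: Z_process_def split: prod.split)
  then show ?thesis using Z_skorokhod_measurable[of 1] by simp
qed

lemma Z_in_skorokhod: "Z_process n U R C w \<in> skorokhod_space"
  unfolding Z_process_bilinear_path by (rule bilinear_path_in_skorokhod)

lemma grid_Z_measurable:
  assumes h: "continuous_map skorokhod_topology euclideanreal h"
  shows "(\<lambda>w. h (grid_path k (Z_process n U R C w))) \<in> borel_measurable M"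
proof -
  have "(\<lambda>w. restrict (Z_process n U R C w) (dyadic_grid k)) \<in> M \<rightarrow>\<^sub>M borel_of (product_topology (\<lambda>_. euclideanreal) (dyadic_grid k))"
    using Z_eval_measurable dyadic_grid_subset by (intro measurable_borel_of_product finite_dyadic_grid) blast
  from measurable_compose[OF this continuous_map_measurable_borel_of[OF continuous_map_compose[OF grid_path_continuous h]]]
  show ?thesis by (simp add: grid_path_restrict o_def)
qed

text \<open>
  The difference between the path and its discretisation is a product of an oscillation, small by
  chaining, and a supremum, only bounded in mean; cutting the supremum at a level \<open>\<kappa>\<close> avoids
  any moment of the product.
\<close>

lemma flat_grid_approximation:
  assumes flat: "AE w in M. \<forall>i<n. \<forall>j<n. (cmod (U w $$ (i, j)))\<^sup>2 = 1 / real n"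
    and kn: "2 ^ k \<le> n" and \<kappa>: "0 < \<kappa>"
    and lip: "\<And>x y. x \<in> skorokhod_space \<Longrightarrow> y \<in> skorokhod_space \<Longrightarrow> \<bar>h x - h y\<bar> \<le> L * skorokhod_dist x y"
    and hB: "\<And>x. x \<in> skorokhod_space \<Longrightarrow> \<bar>h x\<bar> \<le> B"
    and h: "continuous_map skorokhod_topology euclideanreal h" and LB: "0 < L" "0 < B"
  shows "\<bar>expectation (\<lambda>w. h (Z_process n U R C w)) - expectation (\<lambda>w. h (grid_path k (Z_process n U R C w)))\<bar>
    \<le> (2 * B + L) * (\<kappa> * (80 * chaining_rate ^ k + 4 / sqrt n) + 92 / \<kappa>)"
proof -
  have n0: "0 < n" by (rule less_le_trans[OF _ kn]) simp
  obtain W A where W: "integrable M W" "expectation W \<le> 40 * chaining_rate ^ k + 2 / sqrt n" "\<And>w. 0 \<le> W w"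
    and A: "integrable M A" "expectation A \<le> 46" "\<And>w. 0 \<le> A w"
    and WA: "\<And>w s. s \<in> {0..1} \<Longrightarrow> \<bar>R.empirical s w - R.empirical (dyadic_floor k s) w\<bar> \<le> W w"
      "\<And>w s. s \<in> {0..1} \<Longrightarrow> \<bar>R.empirical s w\<bar> \<le> A w"
    by (rule R.empirical_grid_approximation[OF kn]) blast
  obtain W' A' where W': "integrable M W'" "expectation W' \<le> 40 * chaining_rate ^ k + 2 / sqrt n" "\<And>w. 0 \<le> W' w"
    and A': "integrable M A'" "expectation A' \<le> 46" "\<And>w. 0 \<le> A' w"
    and WA': "\<And>w s. s \<in> {0..1} \<Longrightarrow> \<bar>C.empirical s w - C.empirical (dyadic_floor k s) w\<bar> \<le> W' w"
      "\<And>w s. s \<in> {0..1} \<Longrightarrow> \<bar>C.empirical s w\<bar> \<le> A' w"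
    by (rule C.empirical_grid_approximation[OF kn]) blast
  let ?X = "\<lambda>w. h (Z_process n U R C w)" and ?Y = "\<lambda>w. h (grid_path k (Z_process n U R C w))"
  have Xi: "integrable M ?X"
    using measurable_compose[OF Z_measurable continuous_map_measurable_borel_of[OF h]] hB[OF Z_in_skorokhod]
    by (intro integrable_of_bounded[of _ B]) auto
  have Yi: "integrable M ?Y"
    using grid_Z_measurable[OF h] hB[OF grid_path_in_skorokhod] by (intro integrable_of_bounded[of _ B]) auto
  let ?V = "\<lambda>w. (2 * B + L) * (\<kappa> * (W w + W' w) + (A w + A' w) / \<kappa>)"
  have Vi: "integrable M ?V"
    by (intro integrable_mult_right Bochner_Integration.integrable_add integrable_divide W(1) W'(1) A(1) A'(1))
  have pw: "AE w in M. \<bar>?X w - ?Y w\<bar> \<le> ?V w"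
    using flat
  proof eventually_elim
    case (elim w)
    note nn = W(3)[of w] W'(3)[of w] A(3)[of w] A'(3)[of w]
    show ?case
    proof (cases "A w \<le> \<kappa> \<and> A' w \<le> \<kappa>")
      case True
      have "skorokhod_dist (Z_process n U R C w) (grid_path k (Z_process n U R C w)) \<le> \<kappa> * (W w + W' w)"
      proof (rule skorokhod_dist_le_uniform[OF Z_in_skorokhod grid_path_in_skorokhod])
        show "0 \<le> \<kappa> * (W w + W' w)" using \<kappa> nn by simp
        fix p assume p: "p \<in> unit_square"
        obtain s t where st: "p = (s, t)" "s \<in> {0..1}" "t \<in> {0..1}" using p by (cases p) (auto simp: unit_square_def)
        let ?s = "dyadic_floor k s" and ?t = "dyadic_floor k t"
        have "(?s, ?t) \<in> unit_square" using dyadic_floor_in_grid[OF p, of k] dyadic_grid_subset[of k] st(1) by auto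
        then have q: "?s \<in> {0..1}" "?t \<in> {0..1}" by (simp_all add: unit_square_def)
        have "Z_process n U R C w p - grid_path k (Z_process n U R C w) p = R.empirical s w * C.empirical t w - R.empirical ?s w * C.empirical ?t w"
          using p unfolding grid_path_def st(1) by (simp add: flat_Z[OF elim n0 st(2,3)] flat_Z[OF elim n0 q])
        also have "\<dots> = (R.empirical s w - R.empirical ?s w) * C.empirical t w + R.empirical ?s w * (C.empirical t w - C.empirical ?t w)"
          by (simp add: algebra_simps)
        finally have "\<bar>Z_process n U R C w p - grid_path k (Z_process n U R C w) p\<bar> \<le>
           \<bar>R.empirical s w - R.empirical ?s w\<bar> * \<bar>C.empirical t w\<bar> + \<bar>R.empirical ?s w\<bar> * \<bar>C.empirical t w - C.empirical ?t w\<bar>"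
          unfolding abs_mult[symmetric] by (simp only: abs_triangle_ineq)
        moreover have "\<bar>R.empirical s w - R.empirical ?s w\<bar> * \<bar>C.empirical t w\<bar> \<le> W w * \<kappa>"
          by (rule mult_mono[OF WA(1)[OF st(2)] order_trans[OF WA'(2)[OF st(3)]] nn(1) abs_ge_zero]) (use True in simp)
        moreover have "\<bar>R.empirical ?s w\<bar> * \<bar>C.empirical t w - C.empirical ?t w\<bar> \<le> \<kappa> * W' w"
          by (rule mult_mono[OF order_trans[OF WA(2)[OF q(1)]] WA'(1)[OF st(3)] less_imp_le[OF \<kappa>] abs_ge_zero]) (use True in simp)
        ultimately show "\<bar>Z_process n U R C w p - grid_path k (Z_process n U R C w) p\<bar> \<le> \<kappa> * (W w + W' w)"
          by (simp add: distrib_left mult.commute)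
      qed
      then have "L * skorokhod_dist (Z_process n U R C w) (grid_path k (Z_process n U R C w)) \<le> L * (\<kappa> * (W w + W' w))"
        using LB by (intro mult_left_mono) auto
      also have "\<dots> \<le> ?V w"
      proof (rule mult_mono)
        have "0 \<le> (A w + A' w) / \<kappa>" using \<kappa> nn by (intro divide_nonneg_pos add_nonneg_nonneg)
        then show "\<kappa> * (W w + W' w) \<le> \<kappa> * (W w + W' w) + (A w + A' w) / \<kappa>" by linarith
        show "0 \<le> \<kappa> * (W w + W' w)" using \<kappa> nn by (intro mult_nonneg_nonneg add_nonneg_nonneg) auto
      qed (use LB in linarith)+
      finally show ?thesis using lip[OF Z_in_skorokhod grid_path_in_skorokhod, of w k "Z_process n U R C w"] by linarith
    next
      case False
      then have "\<kappa> \<le> A w + A' w" using nn by auto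
      then have "1 \<le> (A w + A' w) / \<kappa>" using \<kappa> by simp
      moreover have "0 \<le> \<kappa> * (W w + W' w)" using \<kappa> nn by (intro mult_nonneg_nonneg add_nonneg_nonneg) auto
      ultimately have "1 \<le> \<kappa> * (W w + W' w) + (A w + A' w) / \<kappa>" by linarith
      then have "2 * B * 1 \<le> ?V w" by (rule mult_mono[rotated]) (use LB in linarith)+
      then show ?thesis using hB[OF Z_in_skorokhod, of w] hB[OF grid_path_in_skorokhod, of k "Z_process n U R C w"] by linarith
    qed
  qed
  have "expectation ?X - expectation ?Y = expectation (\<lambda>w. ?X w - ?Y w)" by (rule Bochner_Integration.integral_diff[OF Xi Yi, symmetric])
  then have "\<bar>expectation ?X - expectation ?Y\<bar> \<le> expectation (\<lambda>w. \<bar>?X w - ?Y w\<bar>)"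
    by (simp only: integral_abs_bound)
  also have "\<dots> \<le> expectation ?V"
    by (rule integral_mono_AE[OF Bochner_Integration.integrable_abs[OF Bochner_Integration.integrable_diff[OF Xi Yi]] Vi pw])
  also have "\<dots> = (2 * B + L) * (\<kappa> * (expectation W + expectation W') + (expectation A + expectation A') / \<kappa>)"
    using W(1) W'(1) A(1) A'(1) by simp
  finally have E: "\<bar>expectation ?X - expectation ?Y\<bar> \<le> (2 * B + L) * (\<kappa> * (expectation W + expectation W') + (expectation A + expectation A') / \<kappa>)" .
  have w: "expectation W + expectation W' \<le> 80 * chaining_rate ^ k + 4 / sqrt n"
    using add_mono[OF W(2) W'(2)] by simp
  have a: "expectation A + expectation A' \<le> 92" using A(2) A'(2) by simp
  show ?thesis
    by (rule order_trans[OF E mult_left_mono[OF add_mono[OF mult_left_mono[OF w] divide_right_mono[OF a]]]]) (use LB \<kappa> in auto)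
qed

end

text \<open>
  The grid error is small uniformly in \<open>n\<close>, the grid values converge by the finite-dimensional limit,
  and the discretised limit paths converge because they are continuous.
\<close>

theorem flat_functional_convergence:
  fixes M :: "nat \<Rightarrow> 'a measure" and N :: "'b measure"
  assumes S: "\<And>n. sample_model n (M n) (U n) (R n) (C n)"
    and flat: "\<And>n. AE w in M n. \<forall>i<n. \<forall>j<n. (cmod (U n w $$ (i, j)))\<^sup>2 = 1 / real n"
    and BB: "brownian_bridge N B" "brownian_bridge N B'" "indep_processes N {0..1} B B'"
  shows "converges_in_distribution skorokhod_topology
            M (\<lambda>n. Z_process n (U n) (R n) (C n))
            N (\<lambda>w. \<lambda>p\<in>unit_square. tensor_process B B' p w)"
proof -
  interpret sm: sample_model n "M n" "U n" "R n" "C n" for n by (rule S)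
  interpret B: gaussian_family N "{0..1}" B bridge_cov by (rule bridge_family[OF BB(1)])
  let ?Z = "\<lambda>n. Z_process n (U n) (R n) (C n)"
  let ?T = "\<lambda>w p. tensor_process B B' p w"
  have cont: "continuous_on unit_square (?T w)" if "w \<in> space N" for w
  proof -
    have c: "continuous_on {0..1} (\<lambda>s. B s w)" "continuous_on {0..1} (\<lambda>s. B' s w)"
      using BB(1,2) that by (auto simp: brownian_bridge_def)
    have "continuous_on unit_square (\<lambda>p. B (fst p) w)"
      by (rule continuous_on_compose2[OF c(1) continuous_on_fst[OF continuous_on_id]]) (auto simp: unit_square_def)
    moreover have "continuous_on unit_square (\<lambda>p. B' (snd p) w)"
      by (rule continuous_on_compose2[OF c(2) continuous_on_snd[OF continuous_on_id]]) (auto simp: unit_square_def)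
    ultimately show ?thesis unfolding tensor_process_def split_beta by (rule continuous_on_mult)
  qed
  have grid_meas: "(\<lambda>w. grid_path k (?T w)) \<in> N \<rightarrow>\<^sub>M borel_of skorokhod_topology" for k
  proof -
    have "(\<lambda>w. restrict (?T w) (dyadic_grid k)) \<in> N \<rightarrow>\<^sub>M borel_of (product_topology (\<lambda>_. euclideanreal) (dyadic_grid k))"
      using tensor_measurable[OF BB(1,2)] dyadic_grid_subset by (intro measurable_borel_of_product finite_dyadic_grid) blast
    from measurable_compose[OF this continuous_map_measurable_borel_of_borel_of[OF grid_path_continuous]]
    show ?thesis by (simp add: grid_path_restrict)
  qed
  have T_in: "restrict (?T w) unit_square \<in> skorokhod_space" if "w \<in> space N" for w
    by (rule skorokhod_space_continuous[OF cont[OF that]])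
  have T_lim: "(\<lambda>k. skorokhod_dist (grid_path k (?T w)) (restrict (?T w) unit_square)) \<longlonglongrightarrow> 0" if "w \<in> space N" for w
    by (rule grid_path_tendsto[OF cont[OF that]])
  have T_meas: "(\<lambda>w. restrict (?T w) unit_square) \<in> N \<rightarrow>\<^sub>M borel_of skorokhod_topology"
    by (rule skorokhod.measurable_limit[OF grid_meas T_in T_lim])
  show ?thesis
  proof (rule skorokhod.converges_in_distribution_Lipschitz)
    show "prob_space (M n)" for n by (rule sm.prob_space_axioms)
    show "prob_space N" by (rule B.prob_space_axioms)
    show "?Z n \<in> M n \<rightarrow>\<^sub>M borel_of skorokhod_topology" for n by (rule sm.Z_measurable)
    show "(\<lambda>w. restrict (?T w) unit_square) \<in> N \<rightarrow>\<^sub>M borel_of skorokhod_topology" by (rule T_meas)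
    fix h :: "(real \<times> real \<Rightarrow> real) \<Rightarrow> real" and L K :: real
    assume lip: "\<And>x y. x \<in> skorokhod_space \<Longrightarrow> y \<in> skorokhod_space \<Longrightarrow> \<bar>h x - h y\<bar> \<le> L * skorokhod_dist x y"
      and hB: "\<And>x. x \<in> skorokhod_space \<Longrightarrow> \<bar>h x\<bar> \<le> K"
      and h: "continuous_map skorokhod_topology euclideanreal h" and LK: "0 < L" "0 < K"
    define D where "D = 2 * K + L"
    have D0: "0 < D" using LK by (simp add: D_def)
    have grid_lim: "(\<lambda>n. \<integral>w. h (grid_path k (?Z n w)) \<partial>M n) \<longlonglongrightarrow> (\<integral>w. h (grid_path k (?T w)) \<partial>N)" for k
    proof -
      let ?P = "product_topology (\<lambda>_. euclideanreal) (dyadic_grid k)"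
      have "continuous_map ?P euclideanreal (h \<circ> grid_path k)" by (rule continuous_map_compose[OF grid_path_continuous h])
      moreover have "bounded ((h \<circ> grid_path k) ` topspace ?P)"
        using hB[OF grid_path_in_skorokhod] by (intro boundedI[of _ K]) auto
      ultimately have "(\<lambda>n. \<integral>w. (h \<circ> grid_path k) (restrict (?Z n w) (dyadic_grid k)) \<partial>M n) \<longlonglongrightarrow> (\<integral>w. (h \<circ> grid_path k) (restrict (?T w) (dyadic_grid k)) \<partial>N)"
        by (rule flat_limit[OF S flat BB finite_dyadic_grid dyadic_grid_subset])
      then show ?thesis by (simp add: grid_path_restrict)
    qed
    have limit_grid: "(\<lambda>k. \<integral>w. h (grid_path k (?T w)) \<partial>N) \<longlonglongrightarrow> (\<integral>w. h (restrict (?T w) unit_square) \<partial>N)"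
    proof (rule integral_dominated_convergence[where w="\<lambda>_. K"])
      show "(\<lambda>w. h (restrict (?T w) unit_square)) \<in> borel_measurable N"
        using measurable_compose[OF T_meas continuous_map_measurable_borel_of[OF h]] .
      show "(\<lambda>w. h (grid_path k (?T w))) \<in> borel_measurable N" for k
        using measurable_compose[OF grid_meas continuous_map_measurable_borel_of[OF h]] .
      show "AE w in N. norm (h (grid_path k (?T w))) \<le> K" for k using hB[OF grid_path_in_skorokhod] by (intro AE_I2) simp
      show "AE w in N. (\<lambda>k. h (grid_path k (?T w))) \<longlonglongrightarrow> h (restrict (?T w) unit_square)"
      proof (rule AE_I2)
        fix w assume w: "w \<in> space N"
        have "(\<lambda>k. L * skorokhod_dist (grid_path k (?T w)) (restrict (?T w) unit_square)) \<longlonglongrightarrow> 0"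
          by (rule tendsto_mult_right_zero[OF T_lim[OF w]])
        moreover have "\<forall>\<^sub>F k in sequentially. norm (h (grid_path k (?T w)) - h (restrict (?T w) unit_square)) \<le> L * skorokhod_dist (grid_path k (?T w)) (restrict (?T w) unit_square)"
          unfolding real_norm_def by (rule always_eventually[OF allI[OF lip[OF grid_path_in_skorokhod T_in[OF w]]]])
        ultimately have "(\<lambda>k. h (grid_path k (?T w)) - h (restrict (?T w) unit_square)) \<longlonglongrightarrow> 0"
          by (rule Lim_null_comparison[rotated])
        then show "(\<lambda>k. h (grid_path k (?T w))) \<longlonglongrightarrow> h (restrict (?T w) unit_square)" by (rule LIM_zero_cancel)
      qed
      show "integrable N (\<lambda>_. K)" by (rule B.integrable_const)
    qed
    show "(\<lambda>n. \<integral>w. h (?Z n w) \<partial>M n) \<longlonglongrightarrow> (\<integral>w. h (restrict (?T w) unit_square) \<partial>N)"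
    proof (rule tendstoI)
      fix \<epsilon> :: real assume \<epsilon>: "0 < \<epsilon>"
      define \<kappa> where "\<kappa> = 92 * D / (\<epsilon> / 5)"
      have \<kappa>: "0 < \<kappa>" using D0 \<epsilon> by (simp add: \<kappa>_def)
      have c1: "D * (92 / \<kappa>) = \<epsilon> / 5" using D0 \<epsilon> by (simp add: \<kappa>_def)
      have "(\<lambda>k. D * (\<kappa> * (80 * chaining_rate ^ k))) \<longlonglongrightarrow> D * (\<kappa> * (80 * 0))"
        using chaining_rate_pos chaining_rate_le by (intro tendsto_mult tendsto_const LIMSEQ_realpow_zero) auto
      then have "\<forall>\<^sub>F k in sequentially. D * (\<kappa> * (80 * chaining_rate ^ k)) < \<epsilon> / 5"
        using \<epsilon> by (intro order_tendstoD(2)) auto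
      moreover have "\<forall>\<^sub>F k in sequentially. dist (\<integral>w. h (grid_path k (?T w)) \<partial>N) (\<integral>w. h (restrict (?T w) unit_square) \<partial>N) < \<epsilon> / 5"
        using limit_grid \<epsilon> by (intro tendstoD) auto
      ultimately have "\<forall>\<^sub>F k in sequentially. D * (\<kappa> * (80 * chaining_rate ^ k)) < \<epsilon> / 5 \<and>
          dist (\<integral>w. h (grid_path k (?T w)) \<partial>N) (\<integral>w. h (restrict (?T w) unit_square) \<partial>N) < \<epsilon> / 5"
        by (rule eventually_conj)
      then obtain k where k: "D * (\<kappa> * (80 * chaining_rate ^ k)) < \<epsilon> / 5"
        "dist (\<integral>w. h (grid_path k (?T w)) \<partial>N) (\<integral>w. h (restrict (?T w) unit_square) \<partial>N) < \<epsilon> / 5"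
        using eventually_happens'[OF sequentially_bot] by blast
      have "(\<lambda>n. D * (\<kappa> * (4 / sqrt (real n) + 0 / real n))) \<longlonglongrightarrow> D * (\<kappa> * 0)"
        by (intro tendsto_mult tendsto_const real_over_sqrt_tendsto)
      then have "\<forall>\<^sub>F n in sequentially. D * (\<kappa> * (4 / sqrt (real n) + 0 / real n)) < \<epsilon> / 5"
        using \<epsilon> by (intro order_tendstoD(2)) auto
      moreover have "\<forall>\<^sub>F n in sequentially. dist (\<integral>w. h (grid_path k (?Z n w)) \<partial>M n) (\<integral>w. h (grid_path k (?T w)) \<partial>N) < \<epsilon> / 5"
        using grid_lim[of k] \<epsilon> by (intro tendstoD) auto
      moreover have "\<forall>\<^sub>F n in sequentially. 2 ^ k \<le> n" by (rule eventually_ge_at_top)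
      ultimately show "\<forall>\<^sub>F n in sequentially. dist (\<integral>w. h (?Z n w) \<partial>M n) (\<integral>w. h (restrict (?T w) unit_square) \<partial>N) < \<epsilon>"
      proof eventually_elim
        case (elim n)
        have "\<bar>(\<integral>w. h (?Z n w) \<partial>M n) - (\<integral>w. h (grid_path k (?Z n w)) \<partial>M n)\<bar> \<le> D * (\<kappa> * (80 * chaining_rate ^ k + 4 / sqrt n) + 92 / \<kappa>)"
          unfolding D_def by (rule sm.flat_grid_approximation[OF flat elim(3) \<kappa> lip hB h LK])
        also have "\<dots> = D * (\<kappa> * (80 * chaining_rate ^ k)) + D * (\<kappa> * (4 / sqrt (real n) + 0 / real n)) + D * (92 / \<kappa>)"
          by (simp only: distrib_left div_0 add_0_right add.assoc)
        also have "\<dots> < \<epsilon> / 5 + \<epsilon> / 5 + \<epsilon> / 5" unfolding c1 using k(1) elim(1) by linarith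
        finally show ?case using k(2) elim(2) unfolding dist_real_def by linarith
      qed
    qed
  qed
qed

section \<open>The limit theorems\<close>

theorem proposition3p5:
  fixes M :: "nat \<Rightarrow> 'a measure"
    and U :: "nat \<Rightarrow> 'a \<Rightarrow> complex mat"
    and R C :: "nat \<Rightarrow> nat \<Rightarrow> 'a \<Rightarrow> real"
    and N :: "'b measure"
    and B B' :: "real \<Rightarrow> 'b \<Rightarrow> real"
    and W :: "real \<times> real \<Rightarrow> 'b \<Rightarrow> real"
    and \<beta>' :: real
  assumes model: "\<And>n. model n (M n) (U n) (R n) (C n)"
  shows
    "((\<forall>n. \<forall>\<omega>\<in>space (M n). U n \<omega> = dft_matrix n) \<or>
      (\<forall>n. AE \<omega> in M n. \<forall>i<n. \<forall>j<n. (cmod (U n \<omega> $$ (i, j)))\<^sup>2 = 1 / real n)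
      \<longrightarrow> brownian_bridge N B \<and> brownian_bridge N B' \<and> indep_processes N {0..1} B B'
      \<longrightarrow> converges_in_distribution skorokhod_topology
            M (\<lambda>n. Z_process n (U n) (R n) (C n))
            N (\<lambda>\<omega>. \<lambda>p\<in>unit_square. tensor_process B B' p \<omega>)) \<and>
     ((\<forall>n. haar_distributed n (unitary_group n) (M n) (U n)) \<and> \<beta>' = 1 \<or>
      (\<forall>n. haar_distributed n (orthogonal_group n) (M n) (U n)) \<and> \<beta>' = 1 / 2
      \<longrightarrow> (brownian_bridge N B \<and> brownian_bridge N B' \<and> indep_processes N {0..1} B B' \<and>
            tied_down_bridge N W \<and> indep_processes N unit_square (tensor_process B B') W
            \<longrightarrow> fdd_converges unit_square
                  M (\<lambda>n. Z_process n (U n) (R n) (C n))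
                  N (\<lambda>\<omega> p. sqrt (1 / \<beta>') * W p \<omega> + tensor_process B B' p \<omega>)) \<and>
          skorokhod_converges_in_probability
            M (\<lambda>n \<omega>. \<lambda>p\<in>unit_square. real n powr (- 1 / 2) * Z_process n (U n) (R n) (C n) \<omega> p)
            (\<lambda>p\<in>unit_square. 0))"
proof (intro conjI impI)
  have S: "sample_model n (M n) (U n) (R n) (C n)" for n by (rule sample_model.intro[OF model])
  {
    assume cases: "(\<forall>n. \<forall>\<omega>\<in>space (M n). U n \<omega> = dft_matrix n) \<or>
      (\<forall>n. AE \<omega> in M n. \<forall>i<n. \<forall>j<n. (cmod (U n \<omega> $$ (i, j)))\<^sup>2 = 1 / real n)"
    have flat: "AE \<omega> in M n. \<forall>i<n. \<forall>j<n. (cmod (U n \<omega> $$ (i, j)))\<^sup>2 = 1 / real n" for n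
      using cases
    proof
      assume "\<forall>n. \<forall>\<omega>\<in>space (M n). U n \<omega> = dft_matrix n"
      then show ?thesis by (intro AE_I2) (simp add: dft_matrix_flat)
    qed blast
    assume "brownian_bridge N B \<and> brownian_bridge N B' \<and> indep_processes N {0..1} B B'"
    then show "converges_in_distribution skorokhod_topology M (\<lambda>n. Z_process n (U n) (R n) (C n))
        N (\<lambda>\<omega>. \<lambda>p\<in>unit_square. tensor_process B B' p \<omega>)"
      by (intro flat_functional_convergence[OF S flat]) auto
  next
    assume cases: "(\<forall>n. haar_distributed n (unitary_group n) (M n) (U n)) \<and> \<beta>' = 1 \<or>
      (\<forall>n. haar_distributed n (orthogonal_group n) (M n) (U n)) \<and> \<beta>' = 1 / 2"
    obtain G Z where H: "\<And>n. 8 \<le> n \<Longrightarrow> haar_sample n (M n) (U n) (R n) (C n) (G n) Z"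
      and \<beta>: "2 / real (card Z) = 1 / \<beta>'"
      using cases
    proof
      assume "(\<forall>n. haar_distributed n (unitary_group n) (M n) (U n)) \<and> \<beta>' = 1"
      then show thesis
        by (intro that[of unitary_group "{1, \<i>}"] haar_sample_unitary model) (auto simp: complex_eq_iff)
    next
      assume "(\<forall>n. haar_distributed n (orthogonal_group n) (M n) (U n)) \<and> \<beta>' = 1 / 2"
      then have b: "\<beta>' = 1 / 2" and h: "haar_distributed n (orthogonal_group n) (M n) (U n)" for n by auto
      show thesis
      proof (rule that)
        show "haar_sample n (M n) (U n) (R n) (C n) (orthogonal_group n) {1}" if "8 \<le> n" for n
          by (rule haar_sample_orthogonal[OF model h that])
        show "2 / real (card {1 :: complex}) = 1 / \<beta>'" unfolding b by simp
      qed
    qed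
    show "skorokhod_converges_in_probability M
        (\<lambda>n \<omega>. \<lambda>p\<in>unit_square. real n powr (- 1 / 2) * Z_process n (U n) (R n) (C n) \<omega> p)
        (\<lambda>p\<in>unit_square. 0)"
      by (rule haar_negligible[OF S H])
    assume "brownian_bridge N B \<and> brownian_bridge N B' \<and> indep_processes N {0..1} B B' \<and>
      tied_down_bridge N W \<and> indep_processes N unit_square (tensor_process B B') W"
    then show "fdd_converges unit_square M (\<lambda>n. Z_process n (U n) (R n) (C n))
        N (\<lambda>\<omega> p. sqrt (1 / \<beta>') * W p \<omega> + tensor_process B B' p \<omega>)"
      unfolding \<beta>[symmetric] by (intro haar_fdd[OF S H]) auto
  }
qed

end
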